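(* Let $J$ be an almost complex structure on $W=\mathbb{R}^+\times V$ which is asymptotically cylindrical at $+\infty$ and of Morse-Bott type, and let $\tilde u:\mathbb{C}\to W$ be a $J$-holomorphic map with $E(\tilde u)<+\infty$. Then $\|\nabla\tilde u\|:=\sup_{z\in\mathbb{C}}|\nabla\tilde u(z)|<+\infty$, where the norm is computed with respect to the standard metric $ds^2+dt^2$ on $\mathbb{C}$ and a translationally invariant metric $g_W$ on $W$ (for example $g_W=dr^2+g_V$).
   Context: Conventions: $V$ is a smooth closed oriented manifold of dimension $2n+1$; $\mathbb{R}^+=[0,\infty)$; $W=\mathbb{R}^+\times V$ has first coordinate $r$; $J$ is a smooth almost complex structure on $W$ inducing the product orientation. Put $\mathbf{R}=J(\partial/\partial r)$ and $\xi_{(r,v)}=(0\times T_vV)\cap J(0\times T_vV)$, so $TW=\mathbb{R}\frac{\partial}{\partial r}\oplus\mathbb{R}\mathbf{R}\oplus\xi$; let $\pi_\xi$ be the projection to $\xi$. Define 1-forms by $\lambda(\xi)=0,\ \lambda(\partial_r)=0,\ \lambda(\mathbf{R})=1$ and $\sigma(\xi)=0,\ \sigma(\partial_r)=1,\ \sigma(\mathbf{R})=0$. Let $f_s(r,v)=(r+s,v)$. A tensor is translationally invariant if it is independent of $r$. Asymptotically cylindrical at $+\infty$ means: (AC1) there is a smooth translationally invariant almost complex structure $J_\infty$ on $W$ and, for every integer $l\ge0$, constants $K_l^+,\delta_l>0$ with $\|\nabla^l(J-J_\infty)|_{[r,\infty)\times V}\|_{C^0}\le K_l^+e^{-\delta_l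 r}$ for all $r\ge 0$ (norm and Levi-Civita connection of a translationally invariant metric such as $dr^2+g_V$); (AC2) $i(\mathbf{R}_\infty)d\lambda_\infty=0$, where $\mathbf{R}_\infty=\lim_{s\to\infty}f_s^*\mathbf{R}$, $\lambda_\infty=\lim_{s\to\infty}f_s^*\lambda$; (AC3) $\mathbf{R}_\infty=J_\infty(\partial_r)$ is tangent to $0\times TV$ (so $\mathbf{R}_\infty$ is regarded as a vector field on $V$); and there is a closed 2-form $\omega_\infty$ on $V$ (fixed from now on) with (AC4) $i(\mathbf{R}_\infty)\omega_\infty=0$ and (AC5) $\omega_\infty(\cdot,J_\infty\cdot)$ is a metric on $\xi_\infty=\lim_{s\to\infty}f_s^*\xi$. Moreover the $K_l^+$ are required to be small enough that the 2-form on $W$ $$\omega(x,y)=\tfrac12\left[\omega_\infty(\pi_\xi x,\pi_\xi y)+\omega_\infty(J\pi_\xi x,J\pi_\xi y)\right]$$ satisfies: $\omega|_\xi(\cdot,J\cdot)$ is a metric on $\xi$, and for each $l$ there are $\epsilon_l,\delta_l>0$ with $\|(\omega-\omega_\infty)|_{[r,\infty)\times V}\|_{C^l}\le\epsilon_le^{-\delta_lr}$ for all $r\ge0$. Morse-Bott type: let $\phi^t$ be the flow of $\mathbf{R}_{\infty}$ on $V$. For every $T>0$ the set $N_T\subset V$ formed by the closed trajectories of period $T$ (multiple covers being counted) is a smooth closed submanifold of $V$, the rank of $\omega_{\infty}|_{N_T}$ is locally constant, and $T_pN_T=\ker(d\phi^T-\mathrm{Id})_p$ for $p\in N_T$. Energy: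 a $J$-holomorphic map satisfies $T\tilde u\circ i=J(\tilde u)\circ T\tilde u$. For $\tilde u:\Sigma\to W$, $$E_\omega(\tilde u)=\int_\Sigma\tilde u^*\omega,\quad E_\lambda(\tilde u)=\sup_{\phi\in\mathcal{C}}\int_\Sigma\tilde u^*(\phi(r)\,\sigma\wedge\lambda),\quad E(\tilde u)=E_\omega(\tilde u)+E_\lambda(\tilde u),$$ with $\mathcal{C}=\{\phi\in C_c^\infty(\mathbb{R},[0,1]):\int_{\mathbb{R}}\phi=1\}$. *)

theory Defs
  imports "HOL-Analysis.Analysis" "HOL-Combinatorics.Permutations"
begin

section \<open>Smooth maps\<close>

primrec Ck_on :: "nat \<Rightarrow> 'a::real_normed_vector set \<Rightarrow> ('a \<Rightarrow> 'b::real_normed_vector) \<Rightarrow> bool" where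
  "Ck_on 0 S f \<longleftrightarrow> continuous_on S f"
| "Ck_on (Suc k) S f \<longleftrightarrow>
     (\<forall>x\<in>S. f differentiable (at x)) \<and> (\<forall>v. Ck_on k S (\<lambda>x. frechet_derivative f (at x) v))"

text \<open>Smoothness on a set that need not be open (a half-space, say) means existence of local smooth
  extensions. \<open>Ck_on\<close> is only meant for open sets.\<close>

definition smooth_on :: "'a::real_normed_vector set \<Rightarrow> ('a \<Rightarrow> 'b::real_normed_vector) \<Rightarrow> bool" where
  "smooth_on S f \<longleftrightarrow>
     (\<forall>x\<in>S. \<exists>O' h. open O' \<and> x \<in> O' \<and> (\<forall>k. Ck_on k O' h) \<and> (\<forall>y\<in>O' \<inter> S. h y = f y))"


section \<open>Manifolds and tensor fields in charts\<close>

text \<open>A chart is a pair of a domain and a coordinate map; an atlas is a family of charts \<open>C i\<close>,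
  \<open>i \<in> I\<close>. A tensor field is given by its components: for every chart \<open>i\<close> and every point \<open>x\<close> of the
  chart's range a tensor on the model space, subject to the usual transformation law.
  All values outside the chart ranges are irrelevant.\<close>

type_synonym ('p, 'k) chart = "'p set \<times> ('p \<Rightarrow> 'k)"

definition chart_range :: "('p, 'k) chart \<Rightarrow> 'k set" where
  "chart_range c = snd c ` fst c"

definition chart_inv :: "('p, 'k) chart \<Rightarrow> 'k \<Rightarrow> 'p" where
  "chart_inv c = inv_into (fst c) (snd c)"

definition transition :: "('p, 'k) chart \<Rightarrow> ('p, 'k) chart \<Rightarrow> 'k \<Rightarrow> 'k" where
  "transition c d = snd d \<circ> chart_inv c"

definition transition_deriv ::
  "('p, 'k::real_normed_vector) chart \<Rightarrow> ('p, 'k) chart \<Rightarrow> 'p \<Rightarrow> 'k \<Rightarrow> 'k" where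
  "transition_deriv c d p =
     frechet_derivative (transition c d) (at (snd c p) within snd c ` (fst c \<inter> fst d))"

text \<open>Leibniz determinant of the list of vectors \<open>F\<close> with respect to the ordered orthonormal basis \<open>B\<close>.\<close>

definition frame_det :: "'k::euclidean_space list \<Rightarrow> 'k list \<Rightarrow> real" where
  "frame_det B F =
     (\<Sum>p | p permutes {..<length B}. of_int (sign p) * (\<Prod>k<length B. (F ! k) \<bullet> (B ! p k)))"

text \<open>The list \<open>B\<close> is the standard basis of the model space in a fixed order; it orients the model space.
  Second countability follows from compactness.\<close>

definition closed_oriented_manifold ::
  "nat \<Rightarrow> 'e::euclidean_space list \<Rightarrow> 'i set \<Rightarrow> ('i \<Rightarrow> ('v::t2_space, 'e) chart) \<Rightarrow> bool" where
  "closed_oriented_manifold d B I C \<longleftrightarrow>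
     length B = d \<and> distinct B \<and> set B = Basis \<and>
     compact (UNIV :: 'v set) \<and>
     (\<Union>i\<in>I. fst (C i)) = UNIV \<and>
     (\<forall>i\<in>I. open (fst (C i)) \<and> open (chart_range (C i)) \<and>
        homeomorphism (fst (C i)) (chart_range (C i)) (snd (C i)) (chart_inv (C i))) \<and>
     (\<forall>i\<in>I. \<forall>j\<in>I. smooth_on (snd (C i) ` (fst (C i) \<inter> fst (C j))) (transition (C i) (C j))) \<and>
     (\<forall>i\<in>I. \<forall>j\<in>I. \<forall>p\<in>fst (C i) \<inter> fst (C j).
        frame_det B (map (transition_deriv (C i) (C j) p) B) > 0)"

definition endo_field ::
  "'i set \<Rightarrow> ('i \<Rightarrow> ('p, 'k::real_normed_vector) chart) \<Rightarrow> ('i \<Rightarrow> 'k \<Rightarrow> 'k \<Rightarrow> 'k) \<Rightarrow> bool" where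
  "endo_field I C A \<longleftrightarrow>
     (\<forall>i\<in>I. (\<forall>x\<in>chart_range (C i). linear (A i x)) \<and>
            (\<forall>v. smooth_on (chart_range (C i)) (\<lambda>x. A i x v))) \<and>
     (\<forall>i\<in>I. \<forall>j\<in>I. \<forall>p\<in>fst (C i) \<inter> fst (C j). \<forall>v.
        A j (snd (C j) p) (transition_deriv (C i) (C j) p v) =
        transition_deriv (C i) (C j) p (A i (snd (C i) p) v))"

definition bilinear_field ::
  "'i set \<Rightarrow> ('i \<Rightarrow> ('p, 'k::real_normed_vector) chart) \<Rightarrow> ('i \<Rightarrow> 'k \<Rightarrow> 'k \<Rightarrow> 'k \<Rightarrow> real) \<Rightarrow> bool" where
  "bilinear_field I C b \<longleftrightarrow>
     (\<forall>i\<in>I. (\<forall>x\<in>chart_range (C i). bilinear (b i x)) \<and>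
            (\<forall>v w. smooth_on (chart_range (C i)) (\<lambda>x. b i x v w))) \<and>
     (\<forall>i\<in>I. \<forall>j\<in>I. \<forall>p\<in>fst (C i) \<inter> fst (C j). \<forall>v w.
        b j (snd (C j) p) (transition_deriv (C i) (C j) p v) (transition_deriv (C i) (C j) p w) =
        b i (snd (C i) p) v w)"

definition riemannian_metric ::
  "'i set \<Rightarrow> ('i \<Rightarrow> ('p, 'k::real_normed_vector) chart) \<Rightarrow> ('i \<Rightarrow> 'k \<Rightarrow> 'k \<Rightarrow> 'k \<Rightarrow> real) \<Rightarrow> bool" where
  "riemannian_metric I C g \<longleftrightarrow> bilinear_field I C g \<and>
     (\<forall>i\<in>I. \<forall>x\<in>chart_range (C i). (\<forall>v w. g i x v w = g i x w v) \<and> (\<forall>v. v \<noteq> 0 \<longrightarrow> g i x v v > 0))"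

definition closed_two_form ::
  "'i set \<Rightarrow> ('i \<Rightarrow> ('p, 'k::real_normed_vector) chart) \<Rightarrow> ('i \<Rightarrow> 'k \<Rightarrow> 'k \<Rightarrow> 'k \<Rightarrow> real) \<Rightarrow> bool" where
  "closed_two_form I C w \<longleftrightarrow> bilinear_field I C w \<and>
     (\<forall>i\<in>I. \<forall>x\<in>chart_range (C i). \<forall>a b. w i x a b = - w i x b a) \<and>
     (\<forall>i\<in>I. \<forall>x\<in>chart_range (C i). \<forall>a b c.
        frechet_derivative (\<lambda>y. w i y b c) (at x within chart_range (C i)) a
      - frechet_derivative (\<lambda>y. w i y a c) (at x within chart_range (C i)) b
      + frechet_derivative (\<lambda>y. w i y a b) (at x within chart_range (C i)) c = 0)"

definition almost_complex_structure ::
  "'i set \<Rightarrow> ('i \<Rightarrow> ('p, 'k::real_normed_vector) chart) \<Rightarrow> ('i \<Rightarrow> 'k \<Rightarrow> 'k \<Rightarrow> 'k) \<Rightarrow> bool" where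
  "almost_complex_structure I C J \<longleftrightarrow> endo_field I C J \<and>
     (\<forall>i\<in>I. \<forall>x\<in>chart_range (C i). \<forall>v. J i x (J i x v) = - v)"

definition d_one_form ::
  "'k::real_normed_vector set \<Rightarrow> ('k \<Rightarrow> 'k \<Rightarrow> real) \<Rightarrow> 'k \<Rightarrow> 'k \<Rightarrow> 'k \<Rightarrow> real" where
  "d_one_form S a x v w =
     frechet_derivative (\<lambda>y. a y w) (at x within S) v - frechet_derivative (\<lambda>y. a y v) (at x within S) w"

text \<open>Christoffel symbols of the Levi-Civita connection: Koszul's formula for constant vector fields.\<close>

definition christoffel ::
  "'k::real_normed_vector set \<Rightarrow> ('k \<Rightarrow> 'k \<Rightarrow> 'k \<Rightarrow> real) \<Rightarrow> 'k \<Rightarrow> 'k \<Rightarrow> 'k \<Rightarrow> 'k" where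
  "christoffel S g x v w = (THE y. \<forall>z. g x y z =
     (frechet_derivative (\<lambda>x. g x w z) (at x within S) v
    + frechet_derivative (\<lambda>x. g x v z) (at x within S) w
    - frechet_derivative (\<lambda>x. g x v w) (at x within S) z) / 2)"

text \<open>A covariant tensor with values in \<open>'b\<close> takes a list of vectors. The new slot of the covariant
  derivative comes first. The argument \<open>con\<close> is the connection term of the value bundle: the Christoffel
  symbols for tangent-vector values, 0 for scalar values.\<close>

definition cov_deriv ::
  "'k::real_normed_vector set \<Rightarrow> ('k \<Rightarrow> 'k \<Rightarrow> 'k \<Rightarrow> real) \<Rightarrow> ('k \<Rightarrow> 'k \<Rightarrow> 'b \<Rightarrow> 'b) \<Rightarrow>
   ('k \<Rightarrow> 'k list \<Rightarrow> 'b::real_normed_vector) \<Rightarrow> 'k \<Rightarrow> 'k list \<Rightarrow> 'b" where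
  "cov_deriv S g con T x Xs = (case Xs of [] \<Rightarrow> 0 | X # Ys \<Rightarrow>
     frechet_derivative (\<lambda>y. T y Ys) (at x within S) X + con x X (T x Ys)
     - (\<Sum>m<length Ys. T x (Ys[m := christoffel S g x X (Ys ! m)])))"

text \<open>Operator norm of a \<open>k\<close>-linear map with respect to the inner product \<open>h\<close> and the norm \<open>nrm\<close> of
  the values.\<close>

definition tensor_norm ::
  "('b \<Rightarrow> real) \<Rightarrow> ('k \<Rightarrow> 'k \<Rightarrow> real) \<Rightarrow> nat \<Rightarrow> ('k list \<Rightarrow> 'b) \<Rightarrow> real" where
  "tensor_norm nrm h k T =
     (SUP Xs\<in>{Xs. length Xs = k \<and> (\<forall>X\<in>set Xs. h X X \<le> 1)}. nrm (T Xs))"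


section \<open>The half-cylinder and its almost complex structures\<close>

definition wchart :: "('v, 'e) chart \<Rightarrow> (real \<times> 'v, real \<times> 'e) chart" where
  "wchart c = ({0..} \<times> fst c, map_prod id (snd c))"

definition watlas :: "('i \<Rightarrow> ('v, 'e) chart) \<Rightarrow> 'i \<Rightarrow> (real \<times> 'v, real \<times> 'e) chart" where
  "watlas C i = wchart (C i)"

definition shift :: "real \<Rightarrow> real \<times> 'e \<Rightarrow> real \<times> 'e" where
  "shift s x = (fst x + s, snd x)"

text \<open>In the product charts the flow of \<open>\<partial>\<^sub>r\<close> acts by \<open>shift\<close> and has derivative the identity, so
  pullback by it only changes the base point of the components.\<close>

definition translation_invariant ::
  "'i set \<Rightarrow> ('i \<Rightarrow> ('v, 'e) chart) \<Rightarrow> ('i \<Rightarrow> real \<times> 'e \<Rightarrow> 't) \<Rightarrow> bool" where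
  "translation_invariant I C T \<longleftrightarrow> (\<forall>i\<in>I. \<forall>r\<ge>0. \<forall>y\<in>chart_range (C i). T i (r, y) = T i (0, y))"

text \<open>The product orientation has \<open>\<partial>\<^sub>r\<close> first; an almost complex structure induces the orientation
  of the frames \<open>X\<^sub>0, J X\<^sub>0, \<dots>, X\<^sub>n, J X\<^sub>n\<close>.\<close>

definition induces_product_orientation ::
  "nat \<Rightarrow> 'e::euclidean_space list \<Rightarrow> 'i set \<Rightarrow> ('i \<Rightarrow> ('v, 'e) chart) \<Rightarrow>
   ('i \<Rightarrow> real \<times> 'e \<Rightarrow> real \<times> 'e \<Rightarrow> real \<times> 'e) \<Rightarrow> bool" where
  "induces_product_orientation n B I C J \<longleftrightarrow>
     (\<forall>i\<in>I. \<forall>x\<in>chart_range (watlas C i). \<forall>Xs. length Xs = n + 1 \<longrightarrow>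
       (let WB = (1, 0) # map (Pair 0) B; F = concat (map (\<lambda>X. [X, J i x X]) Xs)
        in frame_det WB F \<noteq> 0 \<longrightarrow> frame_det WB F > 0))"

text \<open>Pointwise data determined by a complex structure \<open>j\<close> on \<open>\<real> \<times> T\<^sub>vV\<close>.\<close>

definition dr :: "real \<times> 'e::real_normed_vector" where
  "dr = (1, 0)"

definition reeb :: "(real \<times> 'e::real_normed_vector \<Rightarrow> real \<times> 'e) \<Rightarrow> real \<times> 'e" where
  "reeb j = j dr"

definition xi :: "(real \<times> 'e::real_normed_vector \<Rightarrow> real \<times> 'e) \<Rightarrow> (real \<times> 'e) set" where
  "xi j = ({0} \<times> UNIV) \<inter> j ` ({0} \<times> UNIV)"

definition split_vec ::
  "(real \<times> 'e::real_normed_vector \<Rightarrow> real \<times> 'e) \<Rightarrow> real \<times> 'e \<Rightarrow> real \<times> real \<times> (real \<times> 'e)" where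
  "split_vec j w = (THE (a, b, y). y \<in> xi j \<and> w = a *\<^sub>R dr + b *\<^sub>R reeb j + y)"

definition sigma_form :: "(real \<times> 'e::real_normed_vector \<Rightarrow> real \<times> 'e) \<Rightarrow> real \<times> 'e \<Rightarrow> real" where
  "sigma_form j w = fst (split_vec j w)"

definition lambda_form :: "(real \<times> 'e::real_normed_vector \<Rightarrow> real \<times> 'e) \<Rightarrow> real \<times> 'e \<Rightarrow> real" where
  "lambda_form j w = fst (snd (split_vec j w))"

definition proj_xi :: "(real \<times> 'e::real_normed_vector \<Rightarrow> real \<times> 'e) \<Rightarrow> real \<times> 'e \<Rightarrow> real \<times> 'e" where
  "proj_xi j w = snd (snd (split_vec j w))"

definition reeb_inf ::
  "('i \<Rightarrow> real \<times> 'e \<Rightarrow> real \<times> 'e \<Rightarrow> real \<times> 'e) \<Rightarrow> 'i \<Rightarrow> real \<times> 'e \<Rightarrow> real \<times> 'e::real_normed_vector" where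
  "reeb_inf J i x = Lim at_top (\<lambda>s. reeb (J i (shift s x)))"

definition lambda_inf ::
  "('i \<Rightarrow> real \<times> 'e::real_normed_vector \<Rightarrow> real \<times> 'e \<Rightarrow> real \<times> 'e) \<Rightarrow> 'i \<Rightarrow> real \<times> 'e \<Rightarrow> real \<times> 'e \<Rightarrow> real" where
  "lambda_inf J i x v = Lim at_top (\<lambda>s. lambda_form (J i (shift s x)) v)"

text \<open>The limit of the subspaces \<open>xi\<close>, as the set of limits of their elements.\<close>

definition xi_inf ::
  "('i \<Rightarrow> real \<times> 'e::real_normed_vector \<Rightarrow> real \<times> 'e \<Rightarrow> real \<times> 'e) \<Rightarrow> 'i \<Rightarrow> real \<times> 'e \<Rightarrow> (real \<times> 'e) set" where
  "xi_inf J i x = {y. \<exists>Y. (\<forall>s\<ge>0. Y s \<in> xi (J i (shift s x))) \<and> (Y \<longlongrightarrow> y) (at_top :: real filter)}"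

definition pull_V ::
  "('i \<Rightarrow> 'e \<Rightarrow> 'e \<Rightarrow> 'e \<Rightarrow> real) \<Rightarrow> 'i \<Rightarrow> real \<times> 'e \<Rightarrow> real \<times> 'e \<Rightarrow> real \<times> 'e \<Rightarrow> real" where
  "pull_V w i x a b = w i (snd x) (snd a) (snd b)"

definition omega_form ::
  "('i \<Rightarrow> real \<times> 'e \<Rightarrow> real \<times> 'e \<Rightarrow> real \<times> 'e) \<Rightarrow> ('i \<Rightarrow> 'e \<Rightarrow> 'e \<Rightarrow> 'e \<Rightarrow> real) \<Rightarrow>
   'i \<Rightarrow> real \<times> 'e \<Rightarrow> real \<times> 'e \<Rightarrow> real \<times> 'e::real_normed_vector \<Rightarrow> real" where
  "omega_form J w i x a b =
     (pull_V w i x (proj_xi (J i x) a) (proj_xi (J i x) b)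
    + pull_V w i x (J i x (proj_xi (J i x) a)) (J i x (proj_xi (J i x) b))) / 2"

definition inner_product_on :: "'k::real_vector set \<Rightarrow> ('k \<Rightarrow> 'k \<Rightarrow> real) \<Rightarrow> bool" where
  "inner_product_on S b \<longleftrightarrow>
     (\<forall>x\<in>S. \<forall>y\<in>S. \<forall>z\<in>S. \<forall>p q. b (p *\<^sub>R x + q *\<^sub>R y) z = p * b x z + q * b y z) \<and>
     (\<forall>x\<in>S. \<forall>y\<in>S. b x y = b y x) \<and>
     (\<forall>x\<in>S. x \<noteq> 0 \<longrightarrow> b x x > 0)"


section \<open>Asymptotically cylindrical structures\<close>

definition tail_norm_le ::
  "'i set \<Rightarrow> ('i \<Rightarrow> ('v, 'e) chart) \<Rightarrow> ('i \<Rightarrow> real \<times> 'e \<Rightarrow> 'b \<Rightarrow> real) \<Rightarrow>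
   ('i \<Rightarrow> real \<times> 'e \<Rightarrow> real \<times> 'e \<Rightarrow> real \<times> 'e \<Rightarrow> real) \<Rightarrow> nat \<Rightarrow>
   ('i \<Rightarrow> real \<times> 'e \<Rightarrow> (real \<times> 'e) list \<Rightarrow> 'b) \<Rightarrow> real \<Rightarrow> real \<Rightarrow> bool" where
  "tail_norm_le I C nrm g k T r c \<longleftrightarrow>
     (\<forall>i\<in>I. \<forall>x\<in>chart_range (watlas C i). r \<le> fst x \<longrightarrow> tensor_norm (nrm i x) (g i x) k (T i x) \<le> c)"

definition nabla_endo ::
  "('i \<Rightarrow> ('v, 'e::real_normed_vector) chart) \<Rightarrow> ('i \<Rightarrow> real \<times> 'e \<Rightarrow> real \<times> 'e \<Rightarrow> real \<times> 'e \<Rightarrow> real) \<Rightarrow> nat \<Rightarrow>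
   ('i \<Rightarrow> real \<times> 'e \<Rightarrow> real \<times> 'e \<Rightarrow> real \<times> 'e) \<Rightarrow> 'i \<Rightarrow> real \<times> 'e \<Rightarrow> (real \<times> 'e) list \<Rightarrow> real \<times> 'e" where
  "nabla_endo C g l A i =
     (let S = chart_range (watlas C i)
      in (cov_deriv S (g i) (christoffel S (g i)) ^^ l) (\<lambda>x Xs. A i x (Xs ! 0)))"

definition nabla_bilinear ::
  "('i \<Rightarrow> ('v, 'e::real_normed_vector) chart) \<Rightarrow> ('i \<Rightarrow> real \<times> 'e \<Rightarrow> real \<times> 'e \<Rightarrow> real \<times> 'e \<Rightarrow> real) \<Rightarrow> nat \<Rightarrow>
   ('i \<Rightarrow> real \<times> 'e \<Rightarrow> real \<times> 'e \<Rightarrow> real \<times> 'e \<Rightarrow> real) \<Rightarrow> 'i \<Rightarrow> real \<times> 'e \<Rightarrow> (real \<times> 'e) list \<Rightarrow> real" where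
  "nabla_bilinear C g l b i =
     (cov_deriv (chart_range (watlas C i)) (g i) (\<lambda>_ _ _. 0) ^^ l) (\<lambda>x Xs. b i x (Xs ! 0) (Xs ! 1))"

text \<open>The \<open>C\<^sup>l\<close> norm is the maximum of the \<open>C\<^sup>0\<close> norms of the covariant derivatives up to order \<open>l\<close>.\<close>

definition asymptotically_cylindrical ::
  "'i set \<Rightarrow> ('i \<Rightarrow> ('v, 'e::real_normed_vector) chart) \<Rightarrow>
   ('i \<Rightarrow> real \<times> 'e \<Rightarrow> real \<times> 'e \<Rightarrow> real \<times> 'e \<Rightarrow> real) \<Rightarrow>
   ('i \<Rightarrow> real \<times> 'e \<Rightarrow> real \<times> 'e \<Rightarrow> real \<times> 'e) \<Rightarrow> ('i \<Rightarrow> real \<times> 'e \<Rightarrow> real \<times> 'e \<Rightarrow> real \<times> 'e) \<Rightarrow>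
   ('i \<Rightarrow> 'e \<Rightarrow> 'e \<Rightarrow> 'e \<Rightarrow> real) \<Rightarrow> bool" where
  "asymptotically_cylindrical I C g J Jinf winf \<longleftrightarrow>
     almost_complex_structure I (watlas C) Jinf \<and> translation_invariant I C Jinf \<and>
     (\<forall>l. \<exists>K>0. \<exists>\<delta>>0. \<forall>r\<ge>0.
        tail_norm_le I C (\<lambda>i x y. sqrt (g i x y y)) g (l + 1)
          (nabla_endo C g l (\<lambda>i x v. J i x v - Jinf i x v)) r (K * exp (- \<delta> * r))) \<and>
     (\<forall>i\<in>I. \<forall>x\<in>chart_range (watlas C i). \<forall>v.
        d_one_form (chart_range (watlas C i)) (lambda_inf J i) x (reeb_inf J i x) v = 0) \<and>
     (\<forall>i\<in>I. \<forall>x\<in>chart_range (watlas C i). reeb_inf J i x = Jinf i x dr \<and> fst (reeb_inf J i x) = 0) \<and>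
     closed_two_form I C winf \<and>
     (\<forall>i\<in>I. \<forall>x\<in>chart_range (watlas C i). \<forall>v. winf i (snd x) (snd (reeb_inf J i x)) v = 0) \<and>
     (\<forall>i\<in>I. \<forall>x\<in>chart_range (watlas C i).
        inner_product_on (xi_inf J i x) (\<lambda>a b. pull_V winf i x a (Jinf i x b))) \<and>
     (\<forall>i\<in>I. \<forall>x\<in>chart_range (watlas C i).
        inner_product_on (xi (J i x)) (\<lambda>a b. omega_form J winf i x a (J i x b))) \<and>
     (\<forall>l. \<exists>\<epsilon>>0. \<exists>\<delta>>0. \<forall>r\<ge>0. \<forall>k\<le>l.
        tail_norm_le I C (\<lambda>i x y. \<bar>y\<bar>) g (k + 2)
          (nabla_bilinear C g k (\<lambda>i x a b. omega_form J winf i x a b - pull_V winf i x a b))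
          r (\<epsilon> * exp (- \<delta> * r)))"


section \<open>Morse-Bott type\<close>

definition is_flow ::
  "'i set \<Rightarrow> ('i \<Rightarrow> ('v::topological_space, 'e::real_normed_vector) chart) \<Rightarrow> ('i \<Rightarrow> 'e \<Rightarrow> 'e) \<Rightarrow>
   (real \<Rightarrow> 'v \<Rightarrow> 'v) \<Rightarrow> bool" where
  "is_flow I C X fl \<longleftrightarrow>
     (\<forall>p. fl 0 p = p) \<and> (\<forall>p. continuous_on UNIV (\<lambda>t. fl t p)) \<and>
     (\<forall>i\<in>I. \<forall>p t. fl t p \<in> fst (C i) \<longrightarrow>
        ((\<lambda>s. snd (C i) (fl s p)) has_vector_derivative X i (snd (C i) (fl t p))) (at t))"

text \<open>Closed subsets with slice charts. The dimension may depend on the connected component.\<close>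

definition closed_submanifold ::
  "'i set \<Rightarrow> ('i \<Rightarrow> ('v::topological_space, 'e::real_normed_vector) chart) \<Rightarrow> 'v set \<Rightarrow> bool" where
  "closed_submanifold I C N \<longleftrightarrow> closed N \<and>
     (\<forall>p\<in>N. \<exists>i\<in>I. p \<in> fst (C i) \<and>
       (\<exists>Q \<psi> \<psi>' L. open Q \<and> snd (C i) p \<in> Q \<and> Q \<subseteq> chart_range (C i) \<and> open (\<psi> ` Q) \<and>
          homeomorphism Q (\<psi> ` Q) \<psi> \<psi>' \<and> smooth_on Q \<psi> \<and> smooth_on (\<psi> ` Q) \<psi>' \<and>
          subspace (L :: 'e set) \<and> \<psi> ` (Q \<inter> snd (C i) ` (N \<inter> fst (C i))) = \<psi> ` Q \<inter> L))"

text \<open>Velocities of smooth curves in the subset \<open>S\<close>; for a submanifold this is its tangent space.\<close>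

definition tangent_space_of :: "'k::real_normed_vector set \<Rightarrow> 'k \<Rightarrow> 'k set" where
  "tangent_space_of S x =
     {v. \<exists>\<gamma> e. e > 0 \<and> smooth_on {- e<..<e} \<gamma> \<and> (\<forall>t\<in>{- e<..<e}. \<gamma> t \<in> S) \<and> \<gamma> 0 = x \<and>
         (\<gamma> has_vector_derivative v) (at (0::real))}"

definition tangent_in_chart :: "('v, 'e::real_normed_vector) chart \<Rightarrow> 'v set \<Rightarrow> 'v \<Rightarrow> 'e set" where
  "tangent_in_chart c N p = tangent_space_of (snd c ` (N \<inter> fst c)) (snd c p)"

definition form_rank :: "'k::euclidean_space set \<Rightarrow> ('k \<Rightarrow> 'k \<Rightarrow> real) \<Rightarrow> nat" where
  "form_rank L w = dim L - dim {a \<in> L. \<forall>b\<in>L. w a b = 0}"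

text \<open>\<open>reeb_inf\<close> as a vector field on \<open>V\<close>.\<close>

definition reeb_V ::
  "('i \<Rightarrow> real \<times> 'e \<Rightarrow> real \<times> 'e \<Rightarrow> real \<times> 'e) \<Rightarrow> 'i \<Rightarrow> 'e::real_normed_vector \<Rightarrow> 'e" where
  "reeb_V J i y = snd (reeb_inf J i (0, y))"

definition periodic_points :: "(real \<Rightarrow> 'v \<Rightarrow> 'v) \<Rightarrow> real \<Rightarrow> 'v set" where
  "periodic_points fl T = {p. fl T p = p}"

definition morse_bott ::
  "'i set \<Rightarrow> ('i \<Rightarrow> ('v::topological_space, 'e::euclidean_space) chart) \<Rightarrow>
   ('i \<Rightarrow> real \<times> 'e \<Rightarrow> real \<times> 'e \<Rightarrow> real \<times> 'e) \<Rightarrow> ('i \<Rightarrow> 'e \<Rightarrow> 'e \<Rightarrow> 'e \<Rightarrow> real) \<Rightarrow> bool" where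
  "morse_bott I C J winf \<longleftrightarrow> (\<exists>fl. is_flow I C (reeb_V J) fl \<and>
     (\<forall>T>0. let N = periodic_points fl T in
        closed_submanifold I C N \<and>
        (\<forall>p\<in>N. \<exists>Q k. open Q \<and> p \<in> Q \<and>
           (\<forall>q\<in>Q \<inter> N. \<forall>i\<in>I. q \<in> fst (C i) \<longrightarrow>
              form_rank (tangent_in_chart (C i) N q) (winf i (snd (C i) q)) = k)) \<and>
        (\<forall>p\<in>N. \<forall>i\<in>I. p \<in> fst (C i) \<longrightarrow>
           tangent_in_chart (C i) N p =
           {v. frechet_derivative (snd (C i) \<circ> fl T \<circ> chart_inv (C i)) (at (snd (C i) p)) v = v})))"


section \<open>Holomorphic planes and their energy\<close>

definition map_deriv ::
  "(real \<times> 'v, real \<times> 'e::real_normed_vector) chart \<Rightarrow> (complex \<Rightarrow> real \<times> 'v) \<Rightarrow> complex \<Rightarrow> complex \<Rightarrow> real \<times> 'e" where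
  "map_deriv c u z = frechet_derivative (\<lambda>y. snd c (u y)) (at z)"

definition J_holomorphic ::
  "'i set \<Rightarrow> ('i \<Rightarrow> ('v::topological_space, 'e::real_normed_vector) chart) \<Rightarrow>
   ('i \<Rightarrow> real \<times> 'e \<Rightarrow> real \<times> 'e \<Rightarrow> real \<times> 'e) \<Rightarrow> (complex \<Rightarrow> real \<times> 'v) \<Rightarrow> bool" where
  "J_holomorphic I C J u \<longleftrightarrow>
     (\<forall>z. fst (u z) \<ge> 0) \<and> continuous_on UNIV u \<and>
     (\<forall>i\<in>I. smooth_on {z. u z \<in> fst (watlas C i)} (\<lambda>z. snd (watlas C i) (u z))) \<and>
     (\<forall>i\<in>I. \<forall>z h. u z \<in> fst (watlas C i) \<longrightarrow>
        map_deriv (watlas C i) u z (\<i> * h) =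
        J i (snd (watlas C i) (u z)) (map_deriv (watlas C i) u z h))"

text \<open>Expressions at the point \<open>u z\<close> that do not depend on the chart are evaluated in an arbitrary one.\<close>

definition chart_at :: "'i set \<Rightarrow> ('i \<Rightarrow> ('v, 'e) chart) \<Rightarrow> real \<times> 'v \<Rightarrow> 'i" where
  "chart_at I C p = (SOME i. i \<in> I \<and> p \<in> fst (watlas C i))"

text \<open>The coefficient of \<open>ds \<and> dt\<close> in the pullback of a 2-form.\<close>

definition pullback_density ::
  "'i set \<Rightarrow> ('i \<Rightarrow> ('v, 'e::real_normed_vector) chart) \<Rightarrow>
   ('i \<Rightarrow> real \<times> 'e \<Rightarrow> real \<times> 'e \<Rightarrow> real \<times> 'e \<Rightarrow> real) \<Rightarrow> (complex \<Rightarrow> real \<times> 'v) \<Rightarrow> complex \<Rightarrow> real" where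
  "pullback_density I C b u z = (let i = chart_at I C (u z) in
     b i (snd (watlas C i) (u z)) (map_deriv (watlas C i) u z 1) (map_deriv (watlas C i) u z \<i>))"

definition ext_integral :: "(complex \<Rightarrow> real) \<Rightarrow> ereal" where
  "ext_integral f =
     enn2ereal (\<integral>\<^sup>+z. ennreal (f z) \<partial>lborel) - enn2ereal (\<integral>\<^sup>+z. ennreal (- f z) \<partial>lborel)"

definition energy_cutoffs :: "(real \<Rightarrow> real) set" where
  "energy_cutoffs = {\<phi>. smooth_on UNIV \<phi> \<and> compact (closure {r. \<phi> r \<noteq> 0}) \<and>
     (\<forall>r. \<phi> r \<in> {0..1}) \<and> (\<phi> has_integral 1) UNIV}"

definition energy_omega ::
  "'i set \<Rightarrow> ('i \<Rightarrow> ('v, 'e::real_normed_vector) chart) \<Rightarrow>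
   ('i \<Rightarrow> real \<times> 'e \<Rightarrow> real \<times> 'e \<Rightarrow> real \<times> 'e) \<Rightarrow> ('i \<Rightarrow> 'e \<Rightarrow> 'e \<Rightarrow> 'e \<Rightarrow> real) \<Rightarrow>
   (complex \<Rightarrow> real \<times> 'v) \<Rightarrow> ereal" where
  "energy_omega I C J winf u = ext_integral (pullback_density I C (omega_form J winf) u)"

definition energy_lambda ::
  "'i set \<Rightarrow> ('i \<Rightarrow> ('v, 'e::real_normed_vector) chart) \<Rightarrow>
   ('i \<Rightarrow> real \<times> 'e \<Rightarrow> real \<times> 'e \<Rightarrow> real \<times> 'e) \<Rightarrow> (complex \<Rightarrow> real \<times> 'v) \<Rightarrow> ereal" where
  "energy_lambda I C J u = (SUP \<phi>\<in>energy_cutoffs. ext_integral (pullback_density I C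
     (\<lambda>i x a b. \<phi> (fst x) * (sigma_form (J i x) a * lambda_form (J i x) b
                            - sigma_form (J i x) b * lambda_form (J i x) a)) u))"

definition energy ::
  "'i set \<Rightarrow> ('i \<Rightarrow> ('v, 'e::real_normed_vector) chart) \<Rightarrow>
   ('i \<Rightarrow> real \<times> 'e \<Rightarrow> real \<times> 'e \<Rightarrow> real \<times> 'e) \<Rightarrow> ('i \<Rightarrow> 'e \<Rightarrow> 'e \<Rightarrow> 'e \<Rightarrow> real) \<Rightarrow>
   (complex \<Rightarrow> real \<times> 'v) \<Rightarrow> ereal" where
  "energy I C J winf u = energy_omega I C J winf u + energy_lambda I C J u"

definition gradient_norm ::
  "'i set \<Rightarrow> ('i \<Rightarrow> ('v, 'e::real_normed_vector) chart) \<Rightarrow>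
   ('i \<Rightarrow> real \<times> 'e \<Rightarrow> real \<times> 'e \<Rightarrow> real \<times> 'e \<Rightarrow> real) \<Rightarrow> (complex \<Rightarrow> real \<times> 'v) \<Rightarrow> complex \<Rightarrow> real" where
  "gradient_norm I C g u z =
     (let i = chart_at I C (u z); x = snd (watlas C i) (u z); D = map_deriv (watlas C i) u z
      in SUP h\<in>{h. norm h \<le> 1}. sqrt (g i x (D h) (D h)))"

end

theory Submission
  imports Defs
begin

text \<open>
  No compactness theorem for holomorphic curves is needed. Let \<open>a\<close> be the \<open>\<real>\<close>-component of \<open>u\<close>, let \<open>e\<close> be
  the density of \<open>u\<^sup>*\<omega>\<close> and \<open>F = e + \<bar>\<nabla>a\<bar>\<^sup>2\<close>, which is comparable with \<open>\<bar>\<nabla>u\<bar>\<^sup>2\<close>. If \<open>F\<close> is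
  unbounded, Hofer's point picking and rescaling give holomorphic maps \<open>v\<close> on large discs with \<open>F(0) = 1\<close>,
  \<open>F \<le> 16\<close>, and with arbitrarily small \<open>\<omega>\<close>-energy, since the discs lie far out in the plane. An
  \<open>\<epsilon>\<close>-regularity estimate (from the fundamental theorem of calculus applied to averages of \<open>v\<close> in a chart)
  shows \<open>F(0) < 1\<close> as soon as \<open>F\<close> has small integral over the unit disc, so it suffices to make the integral of
  \<open>\<bar>\<nabla>a\<bar>\<^sup>2\<close> small. If \<open>a(0)\<close> is bounded, one fixed cutoff dominates \<open>\<bar>\<nabla>a\<bar>\<^sup>2\<close> and its energy has
  small tails. If \<open>a(0)\<close> is large, the 1-form \<open>u\<^sup>*\<lambda>\<^sub>\<infinity>\<close> is nearly conjugate to \<open>da\<close> and nearly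
  closed, so \<open>a\<close> is nearly harmonic on the disc; it is then nearly affine at unit scale, and a slope bounded
  below would contradict the bound on the \<open>\<lambda>\<close>-energy, because a cutoff spread over the range of \<open>a\<close> on a disc
  of radius \<open>L\<close> sees energy of order \<open>L\<close>.
\<close>

section \<open>Continuously differentiable functions on the plane\<close>

text \<open>The obstacle is the case of large \<open>a(0)\<close>: no fixed cutoff reaches that
  height, so the bound on the \<lambda>-energy alone yields no smallness, and the usual way out is
  to pass to a limit plane or cylinder. Here the limit is replaced by inequalities whose constants
  depend only on the energy and the geometry and are fixed before the rescaling point is chosen.
  Near closedness of the pullback of \<open>lambda_inf\<close> rests on (AC2): its differential
  annihilates both \<partial>_r and the limit Reeb field, so it is quadratic in the \<xi>-part of
  du, which \<open>e\<close> controls, up to exponentially small terms. The form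
  \<open>lambda_inf\<close> is preferred to \<open>lambda_form\<close> because it is translationally
  invariant: comparing it with da takes only the C^0 decay of J - Jinf. All averages are taken
  against powers of 1 - |z|^2, whose gradients are multiples of lower powers; mean values, slopes
  and gradient bounds thus come from integration by parts, with control of first derivatives
  only.\<close>

definition C1_on ::
  "complex set \<Rightarrow> (complex \<Rightarrow> 'b::real_normed_vector) \<Rightarrow> (complex \<Rightarrow> 'b) \<Rightarrow> (complex \<Rightarrow> 'b) \<Rightarrow> bool" where
  "C1_on S f fs ft \<longleftrightarrow> continuous_on S fs \<and> continuous_on S ft \<and>
     (\<forall>z\<in>S. (f has_derivative (\<lambda>h. Re h *\<^sub>R fs z + Im h *\<^sub>R ft z)) (at z))"

lemma C1_onD:
  assumes "C1_on S f fs ft"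
  shows "continuous_on S fs" "continuous_on S ft" "continuous_on S f"
    and "z \<in> S \<Longrightarrow> (f has_derivative (\<lambda>h. Re h *\<^sub>R fs z + Im h *\<^sub>R ft z)) (at z)"
  using assms unfolding C1_on_def
  by (auto intro!: continuous_at_imp_continuous_on has_derivative_continuous)

lemma C1_on_subset: "C1_on S f fs ft \<Longrightarrow> T \<subseteq> S \<Longrightarrow> C1_on T f fs ft"
  unfolding C1_on_def by (meson continuous_on_subset subsetD)

lemma C1_on_cong:
  assumes "C1_on S f fs ft" "\<And>z. z \<in> S \<Longrightarrow> fs z = fs' z" "\<And>z. z \<in> S \<Longrightarrow> ft z = ft' z"
  shows "C1_on S f fs' ft'"
  using assms unfolding C1_on_def by (auto cong: continuous_on_cong)

lemma C1_on_scaleR: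
  assumes "C1_on S k ks kt" "C1_on S f fs ft"
  shows "C1_on S (\<lambda>z. k z *\<^sub>R f z) (\<lambda>z. ks z *\<^sub>R f z + k z *\<^sub>R fs z) (\<lambda>z. kt z *\<^sub>R f z + k z *\<^sub>R ft z)"
  using C1_onD[OF assms(1)] C1_onD[OF assms(2)] unfolding C1_on_def
  by (auto intro!: continuous_intros derivative_eq_intros simp: algebra_simps)

lemma C1_on_mult:
  fixes f k :: "complex \<Rightarrow> real"
  assumes "C1_on S k ks kt" "C1_on S f fs ft"
  shows "C1_on S (\<lambda>z. k z * f z) (\<lambda>z. ks z * f z + k z * fs z) (\<lambda>z. kt z * f z + k z * ft z)"
  using C1_on_scaleR[OF assms] by simp

lemma C1_on_add:
  assumes "C1_on S k ks kt" "C1_on S f fs ft"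
  shows "C1_on S (\<lambda>z. k z + f z) (\<lambda>z. ks z + fs z) (\<lambda>z. kt z + ft z)"
  using C1_onD[OF assms(1)] C1_onD[OF assms(2)] unfolding C1_on_def
  by (auto intro!: continuous_intros derivative_eq_intros simp: algebra_simps)

lemma C1_on_diff_const:
  assumes "C1_on S f fs ft"
  shows "C1_on S (\<lambda>z. f z - c) fs ft"
  using C1_onD[OF assms] unfolding C1_on_def
  by (auto intro!: derivative_eq_intros)

lemma C1_on_linear:
  assumes "C1_on S f fs ft" "bounded_linear L"
  shows "C1_on S (\<lambda>z. L (f z)) (\<lambda>z. L (fs z)) (\<lambda>z. L (ft z))"
proof -
  interpret bounded_linear L by fact
  have "((\<lambda>z. L (f z)) has_derivative (\<lambda>h. Re h *\<^sub>R L (fs z) + Im h *\<^sub>R L (ft z))) (at z)" if "z \<in> S" for z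
    using has_derivative[OF C1_onD(4)[OF assms(1) that]] by (simp add: add scaleR)
  then show ?thesis
    using C1_onD[OF assms(1)] unfolding C1_on_def by (auto intro!: continuous_on)
qed

lemma C1_on_affine:
  assumes "C1_on S f fs ft" "\<And>z. z \<in> S' \<Longrightarrow> c + m *\<^sub>R z \<in> S"
  shows "C1_on S' (\<lambda>z. f (c + m *\<^sub>R z)) (\<lambda>z. m *\<^sub>R fs (c + m *\<^sub>R z)) (\<lambda>z. m *\<^sub>R ft (c + m *\<^sub>R z))"
proof -
  have "((\<lambda>z. f (c + m *\<^sub>R z)) has_derivative
      (\<lambda>h. Re h *\<^sub>R m *\<^sub>R fs (c + m *\<^sub>R z) + Im h *\<^sub>R m *\<^sub>R ft (c + m *\<^sub>R z))) (at z)" if "z \<in> S'" for z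
  proof -
    have "((\<lambda>z. c + m *\<^sub>R z) has_derivative (\<lambda>h. m *\<^sub>R h)) (at z)"
      by (auto intro!: derivative_eq_intros)
    from has_derivative_compose[OF this C1_onD(4)[OF assms(1) assms(2)[OF that]]]
    show ?thesis by (simp add: mult.commute)
  qed
  then show ?thesis
    using C1_onD[OF assms(1)] assms(2) unfolding C1_on_def
    by (auto intro!: continuous_intros continuous_on_compose2[where f="\<lambda>z. c + m *\<^sub>R z" and t=S])
qed

lemma C1_on_real_compose:
  assumes f: "C1_on S f fs ft" and g: "\<And>x. (g has_real_derivative g' x) (at x)" "continuous_on UNIV g'"
  shows "C1_on S (\<lambda>z. g (f z)) (\<lambda>z. g' (f z) * fs z) (\<lambda>z. g' (f z) * ft z)"
proof -
  have "((\<lambda>z. g (f z)) has_derivative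
      (\<lambda>h. Re h *\<^sub>R (g' (f z) * fs z) + Im h *\<^sub>R (g' (f z) * ft z))) (at z)" if "z \<in> S" for z
    using has_derivative_compose[OF C1_onD(4)[OF f that] g(1)[unfolded has_field_derivative_def]]
    by (simp add: algebra_simps)
  then show ?thesis
    using C1_onD[OF f] g(2) unfolding C1_on_def
    by (auto intro!: continuous_intros continuous_on_compose2[OF g(2)])
qed

lemma C1_on_Re_Im: "C1_on S Re (\<lambda>_. 1) (\<lambda>_. 0)" "C1_on S Im (\<lambda>_. 0) (\<lambda>_. 1)"
  unfolding C1_on_def by (auto intro!: derivative_eq_intros continuous_intros)

lemma C1_on_has_derivative_along:
  assumes "C1_on S f fs ft" "c + t *\<^sub>R d \<in> S"
  shows "((\<lambda>t. f (c + t *\<^sub>R d)) has_vector_derivative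
    Re d *\<^sub>R fs (c + t *\<^sub>R d) + Im d *\<^sub>R ft (c + t *\<^sub>R d)) (at t within X)"
proof -
  have "((\<lambda>t. c + t *\<^sub>R d) has_derivative (\<lambda>h. h *\<^sub>R d)) (at t)"
    by (auto intro!: derivative_eq_intros)
  from has_derivative_compose[OF this C1_onD(4)[OF assms]]
  have "((\<lambda>t. f (c + t *\<^sub>R d)) has_vector_derivative
    Re d *\<^sub>R fs (c + t *\<^sub>R d) + Im d *\<^sub>R ft (c + t *\<^sub>R d)) (at t)"
    by (simp add: has_vector_derivative_def algebra_simps)
  then show ?thesis by (rule has_vector_derivative_at_within)
qed

section \<open>Integrals of compactly supported functions on the plane\<close>

definition qbox :: "real \<Rightarrow> complex set" where "qbox r = cbox (Complex (- r) (- r)) (Complex r r)"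

lemma cball_subset_qbox: "cball 0 r \<subseteq> qbox r"
  by (auto simp: qbox_def in_cbox_complex_iff)
     (smt (verit) abs_Re_le_cmod abs_Im_le_cmod)+

lemma mem_qbox: "norm z \<le> r \<Longrightarrow> z \<in> qbox r"
  using cball_subset_qbox[of r] by auto

lemma content_qbox: "r \<ge> 0 \<Longrightarrow> measure lborel (qbox r) = (2 * r)^2"
  unfolding qbox_def
  by (subst content_cbox) (auto simp: Basis_complex_def complex_inner_1_right complex_inner_i_right power2_eq_square)

text \<open>Squares stand in for discs: differentiation under the integral sign and affine
  substitution are applied on boxes, and a compactly supported integrand does not see the
  difference.\<close>

lemma has_integral_UNIV_qbox:
  fixes f :: "complex \<Rightarrow> 'b::banach"
  assumes "continuous_on UNIV f" "\<And>z. norm z > r \<Longrightarrow> f z = 0" "r \<le> R"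
  shows "(f has_integral integral (qbox R) f) UNIV"
proof (rule has_integral_on_superset)
  show "(f has_integral integral (qbox R) f) (qbox R)"
    unfolding qbox_def
    by (intro integrable_integral integrable_continuous continuous_on_subset[OF assms(1)]) auto
  show "f x = 0" if "x \<notin> qbox R" for x
    using assms(2,3) mem_qbox[of x R] that by force
qed auto

lemma compact_support_integrable:
  fixes f :: "complex \<Rightarrow> 'b::banach"
  assumes "continuous_on UNIV f" "\<And>z. norm z > r \<Longrightarrow> f z = 0"
  shows "f integrable_on UNIV" "r \<le> R \<Longrightarrow> integral UNIV f = integral (qbox R) f"
  using has_integral_UNIV_qbox[OF assms order_refl] has_integral_UNIV_qbox[OF assms]
  by (auto simp: integrable_on_def integral_unique)

lemma integral_compact_support_bound:
  fixes f :: "complex \<Rightarrow> 'b::banach"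
  assumes "continuous_on UNIV f" "\<And>z. norm z > r \<Longrightarrow> f z = 0" "\<And>z. norm (f z) \<le> B" "r \<ge> 0"
  shows "norm (integral UNIV f) \<le> B * (4 * r^2)"
proof -
  have "B \<ge> 0" using assms(3)[of 0] norm_ge_zero[of "f 0"] by linarith
  have "norm (integral (qbox r) f) \<le> B * measure lborel (qbox r)"
    unfolding qbox_def
    by (rule integrable_bound)
       (use \<open>B \<ge> 0\<close> assms in \<open>auto intro!: integrable_continuous continuous_on_subset[OF assms(1)]\<close>)
  then show ?thesis
    using compact_support_integrable(2)[OF assms(1,2), where R=r] content_qbox[OF assms(4)]
    by (simp add: power2_eq_square)
qed

lemma continuous_on_UNIV_extend:
  assumes "open S" "cball 0 r \<subseteq> S" "continuous_on S f" "\<And>z. norm z > r \<Longrightarrow> f z = 0"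
  shows "continuous_on UNIV f"
proof -
  have "open {z::'a. norm z > r}"
    by (intro open_Collect_less continuous_intros)
  moreover have "continuous_on {z. norm z > r} f"
    using continuous_on_cong[of "{z. norm z > r}" "{z. norm z > r}" f "\<lambda>_. 0"] assms(4) by auto
  ultimately have "continuous_on (S \<union> {z. norm z > r}) f"
    using continuous_on_open_Un assms by blast
  moreover have "S \<union> {z. norm z > r} = UNIV"
    using assms(2) by force
  ultimately show ?thesis by simp
qed

lemma has_derivative_zero_outside:
  assumes "\<And>z. norm z > r \<Longrightarrow> f z = (0::'b::real_normed_vector)" "norm z > r"
  shows "(f has_derivative (\<lambda>h. 0)) (at (z::'a::real_normed_vector))"
proof -
  have "((\<lambda>z. 0::'b) has_derivative (\<lambda>h. 0)) (at z)" by simp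
  moreover have "open {z::'a. norm z > r}"
    by (intro open_Collect_less continuous_intros)
  ultimately show ?thesis
    using assms has_derivative_transform_within_open[of "\<lambda>z. 0" "\<lambda>h. 0" z UNIV "{z. norm z > r}" f]
    by auto
qed

text \<open>Translation invariance makes t \<mapsto> \<integral> F(z + t d) constant; its derivative
  at 0, taken under the integral, is the left side. \<open>F\<close> is C^1 only near the disc and
  vanishes beyond it, so everything is first extended to the whole plane.\<close>

lemma integral_C1_compact_support:
  fixes F :: "complex \<Rightarrow> 'b::banach"
  assumes S: "open S" "cball 0 r \<subseteq> S" and C: "C1_on S F Fs Ft"
    and F0: "\<And>z. norm z > r \<Longrightarrow> F z = 0" "\<And>z. norm z > r \<Longrightarrow> Fs z = 0" "\<And>z. norm z > r \<Longrightarrow> Ft z = 0"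
    and r: "r \<ge> 0"
  shows "integral UNIV (\<lambda>z. Re d *\<^sub>R Fs z + Im d *\<^sub>R Ft z) = 0"
proof -
  define D where "D z = Re d *\<^sub>R Fs z + Im d *\<^sub>R Ft z" for z
  have cF: "continuous_on UNIV F" "continuous_on UNIV Fs" "continuous_on UNIV Ft"
    using continuous_on_UNIV_extend[OF S] C1_onD[OF C] F0 by blast+
  then have cD: "continuous_on UNIV D"
    unfolding D_def by (intro continuous_intros) auto
  have der: "(F has_derivative (\<lambda>h. Re h *\<^sub>R Fs z + Im h *\<^sub>R Ft z)) (at z)" for z
  proof (cases "norm z > r")
    case True
    then show ?thesis using has_derivative_zero_outside[of r F z] F0 by simp
  next
    case False
    then have "z \<in> S" using S(2) by auto
    then show ?thesis by (rule C1_onD(4)[OF C])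
  qed
  then have CU: "C1_on UNIV F Fs Ft"
    using cF unfolding C1_on_def by auto
  \<comment> \<open>For |t| \<le> 1 the support of the translate by t d stays in this
    square.\<close>
  define R where "R = r + norm d"
  define U where "U = {-1..1::real}"
  have D0: "D z = 0" if "norm z > r" for z using that F0 by (simp add: D_def)
  have "((\<lambda>t. integral (qbox R) (\<lambda>z. F (z + t *\<^sub>R d))) has_vector_derivative
      integral (qbox R) (\<lambda>z. D (z + 0 *\<^sub>R d))) (at 0 within U)"
    unfolding qbox_def
  proof (rule leibniz_rule_vector_derivative)
    show "((\<lambda>t. F (z + t *\<^sub>R d)) has_vector_derivative D (z + x *\<^sub>R d)) (at x within U)" for x z
      unfolding D_def by (rule C1_on_has_derivative_along[OF CU]) simp
    show "(\<lambda>z. F (z + x *\<^sub>R d)) integrable_on cbox (Complex (- R) (- R)) (Complex R R)" for x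
      by (intro integrable_continuous continuous_on_compose2[OF cF(1)] continuous_intros) auto
    show "continuous_on (U \<times> cbox (Complex (- R) (- R)) (Complex R R)) (\<lambda>(x, t). D (t + x *\<^sub>R d))"
      unfolding split_beta by (intro continuous_on_compose2[OF cD] continuous_intros) auto
  qed (auto simp: U_def)
  then have vd: "((\<lambda>t. integral (qbox R) (\<lambda>z. F (z + t *\<^sub>R d))) has_vector_derivative
      integral (qbox R) D) (at 0 within U)" by simp
  have "integral (qbox R) (\<lambda>z. F (z + t *\<^sub>R d)) = integral UNIV F" if "t \<in> U" for t
  proof -
    have "((\<lambda>z. F (1 *\<^sub>R z + t *\<^sub>R d)) has_integral (integral UNIV F /\<^sub>R 1 ^ DIM(complex)))
      (cbox ((Complex (-(R + norm d)) (-(R + norm d)) - t *\<^sub>R d) /\<^sub>R 1) ((Complex (R + norm d) (R + norm d) - t *\<^sub>R d) /\<^sub>R 1))"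
      (is "(?f has_integral ?i) ?c")
    proof (rule has_integral_affinity')
      have "integral UNIV F = integral (qbox (R + norm d)) F"
        by (rule compact_support_integrable(2)[OF cF(1) F0(1)]) (auto simp: R_def)
      moreover have "F integrable_on (qbox (R + norm d))"
        unfolding qbox_def by (intro integrable_continuous continuous_on_subset[OF cF(1)]) auto
      ultimately show "(F has_integral integral UNIV F) (cbox (Complex (- (R + norm d)) (- (R + norm d))) (Complex (R + norm d) (R + norm d)))"
        by (simp add: qbox_def has_integral_integral)
    qed simp
    then have "(?f has_integral ?i) UNIV"
    proof (rule has_integral_on_superset)
      fix z assume "z \<notin> ?c"
      have "norm (z + t *\<^sub>R d) > r"
      proof (rule ccontr)
        assume "\<not> ?thesis"
        then have "norm (z + t *\<^sub>R d) \<le> R + norm d" by (simp add: R_def) (smt (verit) norm_ge_zero)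
        then have "z + t *\<^sub>R d \<in> qbox (R + norm d)" by (rule mem_qbox)
        then have "z \<in> ?c" unfolding qbox_def in_cbox_complex_iff by simp
        with \<open>z \<notin> ?c\<close> show False by simp
      qed
      then show "F (1 *\<^sub>R z + t *\<^sub>R d) = 0" using F0(1) by simp
    qed auto
    then have 1: "integral UNIV (\<lambda>z. F (z + t *\<^sub>R d)) = integral UNIV F"
      by (simp add: integral_unique)
    have "integral UNIV (\<lambda>z. F (z + t *\<^sub>R d)) = integral (qbox R) (\<lambda>z. F (z + t *\<^sub>R d))"
    proof (rule compact_support_integrable(2)[where r=R])
      show "continuous_on UNIV (\<lambda>z. F (z + t *\<^sub>R d))"
        by (intro continuous_on_compose2[OF cF(1)] continuous_intros) auto
      show "F (z + t *\<^sub>R d) = 0" if "R < norm z" for z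
      proof (rule F0)
        have "norm z \<le> norm (z + t *\<^sub>R d) + norm (t *\<^sub>R d)"
          by (metis add_diff_cancel_right' norm_triangle_ineq4)
        moreover have "norm (t *\<^sub>R d) \<le> norm d"
          using \<open>t \<in> U\<close> by (auto simp: U_def intro!: mult_left_le_one_le)
        ultimately show "r < norm (z + t *\<^sub>R d)" using that by (simp add: R_def)
      qed
    qed simp
    with 1 show ?thesis by simp
  qed
  then have "((\<lambda>t. integral UNIV F) has_vector_derivative integral (qbox R) D) (at 0 within U)"
    using has_vector_derivative_transform_within[OF vd, of 1 "\<lambda>t. integral UNIV F"]
    by (simp add: U_def)
  moreover have "((\<lambda>t. integral UNIV F) has_vector_derivative 0) (at 0 within U)"
    by (rule has_vector_derivative_const)
  ultimately have "integral (qbox R) D = 0"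
    using vector_derivative_unique_within[of 0 U "\<lambda>t. integral UNIV F"]
      at_within_interior[of 0 U]
    by (simp add: U_def)
  then have "integral UNIV D = 0"
    using compact_support_integrable(2)[OF cD D0, where r=r and R=R] by (simp add: R_def)
  then show ?thesis by (simp add: D_def[abs_def])
qed

text \<open>The hypothesis bounds a Lebesgue integral of a function that need not be measurable.\<close>

lemma integral_le_nn_integral_bound:
  fixes f m :: "complex \<Rightarrow> real"
  assumes "continuous_on UNIV f" "\<And>z. norm z > r \<Longrightarrow> f z = 0" "\<And>z. f z \<ge> 0"
    and "\<And>z. z \<in> S \<Longrightarrow> f z \<le> c * m z" "\<And>z. z \<notin> S \<Longrightarrow> f z = 0"
    and "(\<integral>\<^sup>+z\<in>S. ennreal (m z) \<partial>lborel) \<le> ennreal \<eta>" "c > 0" "\<eta> \<ge> 0"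
  shows "integral UNIV f \<le> c * \<eta>"
proof -
  define I where "I = integral UNIV (\<lambda>z. f z / c)"
  have "(\<lambda>z. f z / c) integrable_on UNIV"
    by (rule compact_support_integrable(1)[where r=r]) (use assms in \<open>auto intro!: continuous_intros\<close>)
  then have hi: "((\<lambda>z. f z / c) has_integral I) UNIV"
    by (simp add: I_def has_integral_integral)
  have "integral\<^sup>N lborel (\<lambda>z. ennreal (f z / c)) = ennreal I"
    by (rule nn_integral_has_integral_lborel[OF _ _ hi])
       (use assms in \<open>auto intro!: borel_measurable_continuous_onI continuous_intros\<close>)
  moreover have "integral\<^sup>N lborel (\<lambda>z. ennreal (f z / c)) \<le> (\<integral>\<^sup>+z\<in>S. ennreal (m z) \<partial>lborel)"
  proof (rule nn_integral_mono)
    fix z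
    show "ennreal (f z / c) \<le> ennreal (m z) * indicator S z"
      using assms(4,5,7) by (cases "z \<in> S") (auto intro!: ennreal_leI simp: field_simps)
  qed
  ultimately have "ennreal I \<le> ennreal \<eta>" using assms(6) by simp
  then have "I \<le> \<eta>" using assms(8) by simp
  moreover have "I = integral UNIV f / c" by (simp add: I_def)
  ultimately show ?thesis using assms(7) by (simp add: field_simps)
qed

section \<open>Polynomial bump functions on the unit disc\<close>

definition bmp :: "nat \<Rightarrow> complex \<Rightarrow> real" where "bmp n z = (max 0 (1 - (norm z)^2))^n"

lemma bmp_nonneg [simp]: "bmp n z \<ge> 0" and bmp_le_1: "bmp n z \<le> 1"
  by (auto simp: bmp_def power_le_one)

lemma bmp_eq_0: "norm z \<ge> 1 \<Longrightarrow> n > 0 \<Longrightarrow> bmp n z = 0"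
proof -
  assume "norm z \<ge> 1" "n > 0"
  then have "max 0 (1 - (norm z)^2) = 0" using one_le_power[of "norm z" 2] by linarith
  with \<open>n > 0\<close> show ?thesis by (simp add: bmp_def)
qed

lemma continuous_on_bmp [continuous_intros]: "continuous_on S f \<Longrightarrow> continuous_on S (\<lambda>z. bmp n (f z))"
  unfolding bmp_def by (intro continuous_intros)

text \<open>The power is at least 2, so at 0 the two halves fit together with derivative 0; this
  makes \<open>bmp n\<close> continuously differentiable from n = 2 on.\<close>

lemma has_real_derivative_max_power:
  "((\<lambda>t. (max 0 t) ^ (n + 2)) has_real_derivative (real n + 2) * (max 0 t) ^ (n + 1)) (at t)"
proof (cases "t = 0")
  case False
  show ?thesis
  proof (cases "t > 0")
    case True
    have "((\<lambda>t. t ^ (n + 2)) has_real_derivative (real n + 2) * (max 0 t) ^ (n + 1)) (at t)"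
      using True by (auto intro!: derivative_eq_intros simp: max_def algebra_simps simp flip: power_Suc)
    then show ?thesis
      using has_field_derivative_transform_within_open[of "\<lambda>t. t ^ (n + 2)" _ t "{0<..}"] True by force
  next
    case f: False
    have "((\<lambda>t. 0::real) has_real_derivative (real n + 2) * (max 0 t) ^ (n + 1)) (at t)"
      using f by (auto intro!: derivative_eq_intros simp: max_def)
    then show ?thesis
      using has_field_derivative_transform_within_open[of "\<lambda>t. 0::real" _ t "{..<0}"] f False by force
  qed
next
  case True
  have "((\<lambda>t. (max 0 t) ^ (n + 2)) has_derivative (\<lambda>h. 0)) (at (0::real))"
  proof (rule has_derivativeI)
    have "((\<lambda>y. (max 0 y)^(n+2) /\<^sub>R \<bar>y\<bar>) \<longlongrightarrow> 0) (at (0::real))"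
    proof (rule tendsto_rabs_zero_cancel, rule tendsto_sandwich)
      show "\<forall>\<^sub>F y in at (0::real). 0 \<le> \<bar>(max 0 y)^(n+2) /\<^sub>R \<bar>y\<bar>\<bar>" by simp
      show "\<forall>\<^sub>F y in at (0::real). \<bar>(max 0 y)^(n+2) /\<^sub>R \<bar>y\<bar>\<bar> \<le> \<bar>y\<bar>^(n+1)"
        by (rule always_eventually) (auto simp: max_def field_simps mult_nonpos_nonneg)
      show "((\<lambda>y. \<bar>y\<bar>^(n+1)) \<longlongrightarrow> 0) (at (0::real))" by
        (auto intro!: tendsto_eq_intros)
      show "((\<lambda>y. 0) \<longlongrightarrow> 0) (at (0::real))" by simp
    qed
    then show "((\<lambda>y. ((max 0 y)^(n+2) - (max 0 0)^(n+2) - 0) /\<^sub>R norm (y - 0)) \<longlongrightarrow> 0) (at (0::real))"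
      by simp
  qed auto
  then show ?thesis using True by (simp add: has_field_derivative_def lambda_zero)
qed

text \<open>Differentiation lowers the exponent by one and brings out the factor -2 n z. Hence
  integrating \<open>bmp n\<close> against a derivative gives first moments against
  \<open>bmp (n - 1)\<close>, the form in which the averages below are computed.\<close>

lemma C1_on_bmp:
  assumes "n \<ge> 2"
  shows "C1_on S (bmp n) (\<lambda>z. - 2 * real n * Re z * bmp (n - 1) z) (\<lambda>z. - 2 * real n * Im z * bmp (n - 1) z)"
proof -
  obtain k where n: "n = k + 2" using assms by (metis add.commute le_Suc_ex)
  have 1: "C1_on S (\<lambda>z. 1 - (norm z)^2) (\<lambda>z. - 2 * Re z) (\<lambda>z. - 2 * Im z)"
    unfolding C1_on_def cmod_power2
    by (auto intro!: continuous_intros derivative_eq_intros simp: algebra_simps)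
  have "C1_on S (\<lambda>z. (max 0 (1 - (norm z)^2))^(k + 2))
     (\<lambda>z. (real k + 2) * (max 0 (1 - (norm z)^2)) ^ (k + 1) * (- 2 * Re z))
     (\<lambda>z. (real k + 2) * (max 0 (1 - (norm z)^2)) ^ (k + 1) * (- 2 * Im z))"
    by (rule C1_on_real_compose[OF 1 has_real_derivative_max_power]) (auto intro!: continuous_intros)
  then have "C1_on S (bmp n)
     (\<lambda>z. (real k + 2) * (max 0 (1 - (norm z)^2)) ^ (k + 1) * (- 2 * Re z))
     (\<lambda>z. (real k + 2) * (max 0 (1 - (norm z)^2)) ^ (k + 1) * (- 2 * Im z))"
    by (simp add: bmp_def[abs_def] n)
  then show ?thesis
    by (rule C1_on_cong) (auto simp: n bmp_def algebra_simps)
qed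

section \<open>A gradient estimate for approximately holomorphic maps\<close>

lemma integral_compact_support_affine:
  fixes f :: "complex \<Rightarrow> 'b::banach"
  assumes "continuous_on UNIV f" "\<And>z. norm z > r \<Longrightarrow> f z = 0" "m > 0"
  shows "integral UNIV (\<lambda>z. f (c + m *\<^sub>R z)) = integral UNIV f /\<^sub>R m^2"
proof -
  have "((\<lambda>z. f (m *\<^sub>R z + c)) has_integral (integral UNIV f /\<^sub>R m ^ DIM(complex)))
      (cbox ((Complex (- r) (- r) - c) /\<^sub>R m) ((Complex r r - c) /\<^sub>R m))" (is "(?f has_integral ?i) ?c")
  proof (rule has_integral_affinity')
    show "(f has_integral integral UNIV f) (cbox (Complex (- r) (- r)) (Complex r r))"
      using compact_support_integrable(2)[OF assms(1,2), where r=r and R=r] integrable_continuous[OF continuous_on_subset[OF assms(1)]]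
      by (simp add: qbox_def has_integral_integral)
  qed fact
  then have "(?f has_integral ?i) UNIV"
  proof (rule has_integral_on_superset)
    fix z assume "z \<notin> ?c"
    have "norm (m *\<^sub>R z + c) > r"
    proof (rule ccontr)
      assume "\<not> ?thesis"
      then have "m *\<^sub>R z + c \<in> qbox r" by (intro mem_qbox) simp
      then have "z \<in> ?c" using \<open>m > 0\<close> unfolding qbox_def in_cbox_complex_iff
        by (simp add: field_simps)
      with \<open>z \<notin> ?c\<close> show False by simp
    qed
    then show "f (m *\<^sub>R z + c) = 0" using assms(2) by simp
  qed auto
  then show ?thesis by (simp add: integral_unique add.commute)
qed

text \<open>The partials are parameters, so that products of bumps with coordinate monomials can be
  interpreted with explicit derivatives. The kernel is C^1 on the whole plane, whereas the functions
  averaged against it need only be given near the closed unit disc.\<close>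

locale kernel =
  fixes k ks kt :: "complex \<Rightarrow> real"
  assumes C1: "C1_on UNIV k ks kt"
    and zero: "norm z \<ge> 1 \<Longrightarrow> k z = 0" "norm z \<ge> 1 \<Longrightarrow> ks z = 0" "norm z \<ge> 1 \<Longrightarrow> kt z = 0"

lemma kernel_continuous:
  fixes f :: "complex \<Rightarrow> 'b::banach"
  assumes "continuous_on UNIV k" "\<And>z. norm z \<ge> 1 \<Longrightarrow> k z = 0"
    and "open S" "cball 0 1 \<subseteq> S" "continuous_on S f"
  shows "continuous_on UNIV (\<lambda>z. k z *\<^sub>R f z)" "(\<lambda>z. k z *\<^sub>R f z) integrable_on UNIV"
proof -
  show 1: "continuous_on UNIV (\<lambda>z. k z *\<^sub>R f z)"
    by (rule continuous_on_UNIV_extend[OF assms(3,4)])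
       (use assms in \<open>auto intro!: continuous_intros continuous_on_subset[OF assms(1)]\<close>)
  show "(\<lambda>z. k z *\<^sub>R f z) integrable_on UNIV"
    by (rule compact_support_integrable(1)[OF 1, where r=1]) (use assms in auto)
qed

context kernel
begin

lemma cont: "continuous_on UNIV k" "continuous_on UNIV ks" "continuous_on UNIV kt"
  using C1_onD[OF C1] by auto

lemma ibp:
  fixes f :: "complex \<Rightarrow> 'b::banach"
  assumes S: "open S" "cball 0 1 \<subseteq> S" and f: "C1_on S f fs ft"
  shows "integral UNIV (\<lambda>z. k z *\<^sub>R fs z) = - integral UNIV (\<lambda>z. ks z *\<^sub>R f z)"
    and "integral UNIV (\<lambda>z. k z *\<^sub>R ft z) = - integral UNIV (\<lambda>z. kt z *\<^sub>R f z)"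
proof -
  note I = kernel_continuous(2)[OF cont(1) zero(1) S] kernel_continuous(2)[OF cont(2) zero(2) S]
    kernel_continuous(2)[OF cont(3) zero(3) S]
  note z = integral_C1_compact_support[OF S C1_on_scaleR[OF C1_on_subset[OF C1] f]]
  have "integral UNIV (\<lambda>z. ks z *\<^sub>R f z + k z *\<^sub>R fs z) = 0"
    using z[of 1] zero by simp
  then show "integral UNIV (\<lambda>z. k z *\<^sub>R fs z) = - integral UNIV (\<lambda>z. ks z *\<^sub>R f z)"
    by (subst (asm) integral_add) (auto intro!: I C1_onD[OF f] simp: eq_neg_iff_add_eq_0 add.commute)
  have "integral UNIV (\<lambda>z. kt z *\<^sub>R f z + k z *\<^sub>R ft z) = 0"
    using z[of \<i>] zero by simp
  then show "integral UNIV (\<lambda>z. k z *\<^sub>R ft z) = - integral UNIV (\<lambda>z. kt z *\<^sub>R f z)"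
    by (subst (asm) integral_add) (auto intro!: I C1_onD[OF f] simp: eq_neg_iff_add_eq_0 add.commute)
qed

end

lemma kernel_bmp:
  assumes "n \<ge> 2"
  shows "kernel (bmp n) (\<lambda>z. - 2 * real n * Re z * bmp (n - 1) z) (\<lambda>z. - 2 * real n * Im z * bmp (n - 1) z)"
  by unfold_locales (use C1_on_bmp[OF assms] assms in \<open>auto simp: bmp_eq_0\<close>)

lemma kernel_mult:
  assumes "kernel k ks kt" "C1_on UNIV f fs ft"
  shows "kernel (\<lambda>z. k z * f z) (\<lambda>z. ks z * f z + k z * fs z) (\<lambda>z. kt z * f z + k z * ft z)"
proof -
  interpret kernel k ks kt by fact
  show ?thesis by unfold_locales (auto intro!: C1_on_mult C1 assms zero simp: zero)
qed

text \<open>The factor 4 is the area of the square around the unit disc; it recurs below as the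
  crude mass of any kernel bounded by 1.\<close>

lemma kernel_integral_bound:
  fixes f :: "complex \<Rightarrow> 'b::banach"
  assumes "continuous_on UNIV k" "\<And>z. norm z \<ge> 1 \<Longrightarrow> k z = 0" "\<And>z. \<bar>k z\<bar> \<le> 1"
    and "open S" "cball 0 1 \<subseteq> S" "continuous_on S f" "\<And>z. norm z < 1 \<Longrightarrow> norm (f z) \<le> B" "B \<ge> 0"
  shows "norm (integral UNIV (\<lambda>z. k z *\<^sub>R f z)) \<le> 4 * B"
proof -
  have "norm (integral UNIV (\<lambda>z. k z *\<^sub>R f z)) \<le> B * (4 * 1^2)"
  proof (rule integral_compact_support_bound)
    show "norm (k z *\<^sub>R f z) \<le> B" for z
      using assms(2,3,7)[of z] \<open>B \<ge> 0\<close> mult_mono[of "\<bar>k z\<bar>" 1 "norm (f z)" B]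
      by (cases "norm z < 1") auto
  qed (use assms kernel_continuous[OF assms(1,2,4,5,6)] in auto)
  then show ?thesis by simp
qed

text \<open>A dilated average is differentiated under the integral. For |z| > 1 the argument c + t z
  may leave \<open>S\<close>, but there the kernel vanishes.\<close>

lemma kernel_param_derivative:
  fixes f :: "complex \<Rightarrow> 'b::banach"
  assumes k: "continuous_on UNIV k" "\<And>z. norm z \<ge> 1 \<Longrightarrow> k z = 0"
    and S: "open S" and f: "C1_on S f fs ft"
    and U: "open U" "convex U" "\<And>t z. t \<in> U \<Longrightarrow> norm z \<le> 1 \<Longrightarrow> c + t *\<^sub>R z \<in> S" "T \<in> U"
  shows "((\<lambda>t. integral UNIV (\<lambda>z. k z *\<^sub>R f (c + t *\<^sub>R z))) has_vector_derivative
     integral UNIV (\<lambda>z. k z *\<^sub>R (Re z *\<^sub>R fs (c + T *\<^sub>R z) + Im z *\<^sub>R ft (c + T *\<^sub>R z)))) (at T)"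
proof -
  have c: "continuous_on (U \<times> UNIV) (\<lambda>(t, z). k z *\<^sub>R g z (c + t *\<^sub>R z))"
    if g: "continuous_on (UNIV \<times> S) (\<lambda>(z, w). g z w)" for g :: "complex \<Rightarrow> complex \<Rightarrow> 'b"
  proof -
    \<comment> \<open>Joint continuity is glued from two open sets: on \<open>A\<close> the formula
      is continuous, on \<open>B\<close> the kernel is zero.\<close>
    define A where "A = {x \<in> U \<times> UNIV. c + fst x *\<^sub>R snd x \<in> S}"
    define B where "B = U \<times> {z::complex. norm z > 1}"
    have "A = (U \<times> UNIV) \<inter> (\<lambda>x. c + fst x *\<^sub>R snd x) -` S" by (auto simp: A_def)
    then have "open A"
      using continuous_open_preimage[of "U \<times> UNIV" "\<lambda>x. c + fst x *\<^sub>R snd x" S] S U(1)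
      by (auto intro!: open_Times continuous_intros)
    moreover have "open B"
      unfolding B_def by (intro open_Times open_Collect_less continuous_intros U)
    moreover have "continuous_on A (\<lambda>(t, z). k z *\<^sub>R g z (c + t *\<^sub>R z))"
      unfolding split_beta A_def
      by (intro continuous_on_scaleR continuous_on_compose2[OF k(1)] continuous_intros
          continuous_on_compose2[OF g, of _ "\<lambda>x. (snd x, c + fst x *\<^sub>R snd x)", unfolded split_beta fst_conv snd_conv]) auto
    moreover have "continuous_on B (\<lambda>(t, z). k z *\<^sub>R g z (c + t *\<^sub>R z))"
      by (rule continuous_on_eq[of _ "\<lambda>x. 0"]) (use k(2) in \<open>auto simp: B_def\<close>)
    ultimately have "continuous_on (A \<union> B) (\<lambda>(t, z). k z *\<^sub>R g z (c + t *\<^sub>R z))"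
      by (intro continuous_on_open_Un)
    moreover have "U \<times> UNIV = A \<union> B"
      using U(3) by (force simp: A_def B_def)
    ultimately show ?thesis by simp
  qed
  note [continuous_intros] = continuous_on_compose2[OF C1_onD(1)[OF f], of _ snd]
    continuous_on_compose2[OF C1_onD(2)[OF f], of _ snd] continuous_on_compose2[OF C1_onD(3)[OF f], of _ snd]
  have cd: "continuous_on (U \<times> UNIV) (\<lambda>(t, z). k z *\<^sub>R (Re z *\<^sub>R fs (c + t *\<^sub>R z) + Im z *\<^sub>R ft (c + t *\<^sub>R z)))"
    by (rule c[where g="\<lambda>z w. Re z *\<^sub>R fs w + Im z *\<^sub>R ft w"]) (auto simp: split_beta intro!: continuous_intros)
  have cf: "continuous_on (U \<times> UNIV) (\<lambda>(t, z). k z *\<^sub>R f (c + t *\<^sub>R z))"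
    by (rule c[where g="\<lambda>z w. f w"]) (auto simp: split_beta intro!: continuous_intros)
  have int: "integral UNIV (\<lambda>z. k z *\<^sub>R g t z) = integral (qbox 1) (\<lambda>z. k z *\<^sub>R g t z)"
     if "continuous_on (U \<times> UNIV) (\<lambda>(t, z). k z *\<^sub>R g t z)" "t \<in> U" for g :: "real \<Rightarrow> complex \<Rightarrow> 'b" and t
  proof (rule compact_support_integrable(2)[where r=1])
    have "continuous_on UNIV (Pair t)" by (intro continuous_intros)
    then show "continuous_on UNIV (\<lambda>z. k z *\<^sub>R g t z)"
      using continuous_on_compose2[OF that(1), of UNIV "Pair t"] that(2) by auto
  qed (use k(2) in auto)
  have "((\<lambda>t. integral (qbox 1) (\<lambda>z. k z *\<^sub>R f (c + t *\<^sub>R z))) has_vector_derivative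
     integral (qbox 1) (\<lambda>z. k z *\<^sub>R (Re z *\<^sub>R fs (c + T *\<^sub>R z) + Im z *\<^sub>R ft (c + T *\<^sub>R z)))) (at T within U)"
    unfolding qbox_def
  proof (rule leibniz_rule_vector_derivative)
    show "((\<lambda>t. k z *\<^sub>R f (c + t *\<^sub>R z)) has_vector_derivative
      k z *\<^sub>R (Re z *\<^sub>R fs (c + x *\<^sub>R z) + Im z *\<^sub>R ft (c + x *\<^sub>R z))) (at x within U)" if "x \<in> U" for x z
    proof (cases "norm z \<le> 1")
      case True
      have "((\<lambda>t. f (c + t *\<^sub>R z)) has_vector_derivative
         (Re z *\<^sub>R fs (c + x *\<^sub>R z) + Im z *\<^sub>R ft (c + x *\<^sub>R z))) (at x within U)"
        by (rule C1_on_has_derivative_along[OF f]) (use True that U in auto)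
      then show ?thesis by (auto intro!: derivative_eq_intros)
    qed (use k(2)[of z] in auto)
    show "(\<lambda>z. k z *\<^sub>R f (c + x *\<^sub>R z)) integrable_on cbox (Complex (- 1) (- 1)) (Complex 1 1)" if "x \<in> U" for x
      using that by (intro integrable_continuous continuous_on_compose2[OF cf, where f="\<lambda>z. (x, z)", simplified split_conv])
         (auto intro!: continuous_intros)
    show "continuous_on (U \<times> cbox (Complex (- 1) (- 1)) (Complex 1 1))
       (\<lambda>(t, z). k z *\<^sub>R (Re z *\<^sub>R fs (c + t *\<^sub>R z) + Im z *\<^sub>R ft (c + t *\<^sub>R z)))"
      by (rule continuous_on_subset[OF cd]) auto
  qed (use U in auto)
  then have "((\<lambda>t. integral (qbox 1) (\<lambda>z. k z *\<^sub>R f (c + t *\<^sub>R z))) has_vector_derivative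
     integral UNIV (\<lambda>z. k z *\<^sub>R (Re z *\<^sub>R fs (c + T *\<^sub>R z) + Im z *\<^sub>R ft (c + T *\<^sub>R z)))) (at T)"
    unfolding int[OF cd U(4)] at_within_open[OF U(4,1)] .
  then show ?thesis
    by (rule has_vector_derivative_transform_within_open[OF _ U(1) U(4)]) (rule int[OF cf, symmetric])
qed

text \<open>Write \<partial>v = vs - J0 vt and dbar v = vs + J0 vt. A first moment of v at scale t,
  divided by t, is the average of \<partial>v against bmp 3 / 6. Its derivative in t contains only
  dbar v, which is O(t) by assumption, so the value of \<partial>v at 0, equal to 2 vs(0), differs
  from the average at scale T by O(T). This is the mean value property for the derivative of a
  holomorphic map, with an error from freezing the complex structure.\<close>

lemma J_linear_gradient_estimate:
  fixes v :: "complex \<Rightarrow> 'b::euclidean_space"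
  assumes v: "C1_on (ball 0 \<rho>) v vs vt"
    and J: "linear J0" "\<And>x. J0 (J0 x) = - x" "\<And>x. norm (J0 x) \<le> \<Lambda> * norm x"
    and v0: "vt 0 = J0 (vs 0)"
    and g: "\<And>z. norm z < \<rho> \<Longrightarrow> norm (vs z + J0 (vt z)) \<le> M * norm z"
    and T: "0 < T" "T < \<rho>" and "M \<ge> 0" "\<Lambda> \<ge> 0"
  shows "norm (vs 0) * (integral UNIV (bmp 3) / 3) \<le>
    integral UNIV (\<lambda>z. bmp 3 z / 6 * norm (vs (T *\<^sub>R z) - J0 (vt (T *\<^sub>R z)))) + 8 * (1 + \<Lambda>) * M * T"
proof -
  interpret J0: bounded_linear J0 using J(1) by (rule linear_conv_bounded_linear[THEN iffD1])
  have sub: "t *\<^sub>R z \<in> ball 0 \<rho>" if "t \<in> {0<..<\<rho>}" "norm z \<le> 1" for t z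
  proof -
    have "t * norm z \<le> t * 1" using that by (intro mult_left_mono) auto
    then have "t * norm z < \<rho>" using that unfolding greaterThanLessThan_iff by linarith
    then show ?thesis using that by auto
  qed
  define S where "S t = (\<lambda>z::complex. t *\<^sub>R z) -` ball 0 \<rho>" for t
  have S: "open (S t)" for t unfolding S_def by (intro open_vimage continuous_intros) auto
  have S1: "cball 0 1 \<subseteq> S t" if "t \<in> {0<..<\<rho>}" for t using sub[OF that] by (auto simp: S_def)
  have vt': "C1_on (S t) (\<lambda>z. v (t *\<^sub>R z)) (\<lambda>z. t *\<^sub>R vs (t *\<^sub>R z)) (\<lambda>z. t *\<^sub>R vt (t *\<^sub>R z))" for t
    using C1_on_affine[OF v, where c=0 and m=t and S'="S t"] by (simp add: S_def)
  have cS: "continuous_on (S t) (\<lambda>z. f (t *\<^sub>R z))" if "continuous_on (ball 0 \<rho>) f" for t and f :: "complex \<Rightarrow> 'b"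
    by (rule continuous_on_compose2[OF that]) (auto simp: S_def intro!: continuous_intros)
  note cv = C1_onD[OF v]
  have cJ: "continuous_on (ball 0 \<rho>) (\<lambda>z. J0 (f z))" if "continuous_on (ball 0 \<rho>) f" for f
    by (rule J0.continuous_on[OF that])
  interpret b3: kernel "bmp 3" "\<lambda>z. - 6 * Re z * bmp 2 z" "\<lambda>z. - 6 * Im z * bmp 2 z"
    using kernel_bmp[of 3] by simp
  interpret b2: kernel "bmp 2" "\<lambda>z. - 4 * Re z * bmp 1 z" "\<lambda>z. - 4 * Im z * bmp 1 z"
    using kernel_bmp[of 2] by simp
  define \<psi> where "\<psi> = bmp 2"
  have \<psi>c: "continuous_on UNIV \<psi>" "\<And>z. norm z \<ge> 1 \<Longrightarrow> \<psi> z = 0" "\<And>z. \<bar>\<psi> z\<bar> \<le> 1"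
    using bmp_le_1 by (auto simp: \<psi>_def bmp_eq_0 intro!: continuous_intros)
  have int: "(\<lambda>z. (\<psi> z * q z) *\<^sub>R f (t *\<^sub>R z)) integrable_on UNIV"
    if "continuous_on UNIV q" "continuous_on (ball 0 \<rho>) f" "t \<in> {0<..<\<rho>}" for q t and f :: "complex \<Rightarrow> 'b"
    by (rule kernel_continuous(2)[OF _ _ S S1[OF that(3)] cS[OF that(2)]])
       (use \<psi>c that in \<open>auto intro!: continuous_intros\<close>)
  \<comment> \<open>Moments of f(t z) with weight psi times q; the monomials q that occur have
    degree 1 or 2.\<close>
  define I where "I q f t = integral UNIV (\<lambda>z. (\<psi> z * q z) *\<^sub>R (f (t *\<^sub>R z) :: 'b))" for q f t
  define M1 where "M1 = I Re v"
  define M2 where "M2 = I Im v"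
  \<comment> \<open>The first moment against the conjugate coordinate x - J0 y.\<close>
  define P where "P t = M1 t - J0 (M2 t)" for t
  \<comment> \<open>Integration by parts against bmp 3, whose gradient is -6 z bmp 2, turns this
    moment into an average of vs - J0 vt.\<close>
  have N: "P t = t *\<^sub>R integral UNIV (\<lambda>z. (bmp 3 z / 6) *\<^sub>R (vs (t *\<^sub>R z) - J0 (vt (t *\<^sub>R z))))"
    if t: "t \<in> {0<..<\<rho>}" for t
  proof -
    note ib = b3.ibp[OF S S1[OF t] vt']
    have i3: "(\<lambda>z. bmp 3 z *\<^sub>R f (t *\<^sub>R z)) integrable_on UNIV" if "continuous_on (ball 0 \<rho>) f" for f :: "complex \<Rightarrow> 'b"
      by (rule kernel_continuous(2)[OF b3.cont(1) b3.zero(1) S S1[OF t] cS[OF that]])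
    have "t *\<^sub>R integral UNIV (\<lambda>z. bmp 3 z *\<^sub>R vs (t *\<^sub>R z)) = 6 *\<^sub>R M1 t"
      using ib(1) by (simp add: M1_def I_def \<psi>_def algebra_simps flip: integral_cmul)
    moreover have "t *\<^sub>R integral UNIV (\<lambda>z. bmp 3 z *\<^sub>R vt (t *\<^sub>R z)) = 6 *\<^sub>R M2 t"
      using ib(2) by (simp add: M2_def I_def \<psi>_def algebra_simps flip: integral_cmul)
    moreover have "integral UNIV (\<lambda>z. bmp 3 z *\<^sub>R J0 (vt (t *\<^sub>R z))) = J0 (integral UNIV (\<lambda>z. bmp 3 z *\<^sub>R vt (t *\<^sub>R z)))"
      using integral_linear[OF i3[OF cv(2)] J0.bounded_linear] by (simp add: o_def J0.scaleR)
    moreover have "integral UNIV (\<lambda>z. (bmp 3 z / 6) *\<^sub>R (vs (t *\<^sub>R z) - J0 (vt (t *\<^sub>R z))))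
      = (1/6) *\<^sub>R (integral UNIV (\<lambda>z. bmp 3 z *\<^sub>R vs (t *\<^sub>R z)) - integral UNIV (\<lambda>z. bmp 3 z *\<^sub>R J0 (vt (t *\<^sub>R z))))"
      by (subst integral_diff[symmetric])
         (auto intro!: i3 cv cJ simp: scaleR_diff_right simp flip: integral_cmul)
    moreover have "m = (t/6) *\<^sub>R a" if "t *\<^sub>R a = 6 *\<^sub>R m" for a m :: 'b
      using arg_cong[OF that, of "\<lambda>x. (1/6) *\<^sub>R x"] by simp
    ultimately have "M1 t = (t/6) *\<^sub>R integral UNIV (\<lambda>z. bmp 3 z *\<^sub>R vs (t *\<^sub>R z))"
      "M2 t = (t/6) *\<^sub>R integral UNIV (\<lambda>z. bmp 3 z *\<^sub>R vt (t *\<^sub>R z))"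
      "integral UNIV (\<lambda>z. bmp 3 z *\<^sub>R J0 (vt (t *\<^sub>R z))) = J0 (integral UNIV (\<lambda>z. bmp 3 z *\<^sub>R vt (t *\<^sub>R z)))"
      and "integral UNIV (\<lambda>z. (bmp 3 z / 6) *\<^sub>R (vs (t *\<^sub>R z) - J0 (vt (t *\<^sub>R z))))
      = (1/6) *\<^sub>R (integral UNIV (\<lambda>z. bmp 3 z *\<^sub>R vs (t *\<^sub>R z)) - integral UNIV (\<lambda>z. bmp 3 z *\<^sub>R J0 (vt (t *\<^sub>R z))))"
      by blast+
    then show ?thesis
      by (simp add: P_def J0.scaleR scaleR_diff_right)
  qed
  define g' where "g' z = vs z + J0 (vt z)" for z
  have cg: "continuous_on (ball 0 \<rho>) g'" unfolding g'_def by (intro continuous_intros cv cJ)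
  \<comment> \<open>Since J0 squares to -1, this is the moment of dbar v against (x - J0
    y)^2.\<close>
  define G where "G t = I (\<lambda>z. Re z * Re z) g' t - 2 *\<^sub>R J0 (I (\<lambda>z. Re z * Im z) g' t) - I (\<lambda>z. Im z * Im z) g' t" for t
  have dP: "(P has_vector_derivative ((1/t) *\<^sub>R P t + G t)) (at t)" if t: "t \<in> {0<..<\<rho>}" for t
  proof -
    have dI: "(I q v has_vector_derivative
        I (\<lambda>z. q z * Re z) vs t + I (\<lambda>z. q z * Im z) vt t) (at t)" if q: "continuous_on UNIV q" for q
    proof -
      have "(I q v has_vector_derivative integral UNIV (\<lambda>z. (\<psi> z * q z) *\<^sub>R (Re z *\<^sub>R vs (0 + t *\<^sub>R z) + Im z *\<^sub>R vt (0 + t *\<^sub>R z)))) (at t)"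
        using kernel_param_derivative[OF _ _ open_ball v, where k="\<lambda>z. \<psi> z * q z" and U="{0<..<\<rho>}" and c=0 and T=t]
          \<psi>c q sub t by (auto simp: I_def[abs_def] intro!: continuous_intros)
      moreover have "integral UNIV (\<lambda>z. (\<psi> z * q z) *\<^sub>R (Re z *\<^sub>R vs (0 + t *\<^sub>R z) + Im z *\<^sub>R vt (0 + t *\<^sub>R z)))
         = I (\<lambda>z. q z * Re z) vs t + I (\<lambda>z. q z * Im z) vt t"
        unfolding I_def
        by (subst integral_add[symmetric])
           (auto intro!: int cv t q continuous_intros simp: scaleR_add_right mult.assoc)
      ultimately show ?thesis by simp
    qed
    have kq: "kernel (\<lambda>z. \<psi> z * (f z * f' z)) 
      (\<lambda>z. - 4 * Re z * bmp 1 z * (f z * f' z) + \<psi> z * (fs z * f' z + f z * fs' z))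
      (\<lambda>z. - 4 * Im z * bmp 1 z * (f z * f' z) + \<psi> z * (ft z * f' z + f z * ft' z))"
      if "C1_on UNIV f fs ft" "C1_on UNIV f' fs' ft'" for f f' fs ft fs' ft'
      unfolding \<psi>_def by (intro kernel_mult b2.kernel_axioms C1_on_mult that)
    interpret xx: kernel "\<lambda>z. \<psi> z * (Re z * Re z)" "\<lambda>z. - 4 * Re z * bmp 1 z * (Re z * Re z) + \<psi> z * (2 * Re z)"
       "\<lambda>z. - 4 * Im z * bmp 1 z * (Re z * Re z)" using kq[OF C1_on_Re_Im(1) C1_on_Re_Im(1)] by simp
    interpret xy: kernel "\<lambda>z. \<psi> z * (Re z * Im z)" "\<lambda>z. - 4 * Re z * bmp 1 z * (Re z * Im z) + \<psi> z * Im z"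
       "\<lambda>z. - 4 * Im z * bmp 1 z * (Re z * Im z) + \<psi> z * Re z" using kq[OF C1_on_Re_Im(1) C1_on_Re_Im(2)] by simp
    interpret yy: kernel "\<lambda>z. \<psi> z * (Im z * Im z)" "\<lambda>z. - 4 * Re z * bmp 1 z * (Im z * Im z)"
       "\<lambda>z. - 4 * Im z * bmp 1 z * (Im z * Im z) + \<psi> z * (2 * Im z)" using kq[OF C1_on_Re_Im(2) C1_on_Re_Im(2)] by simp
    have kint: "(\<lambda>z. k z *\<^sub>R v (t *\<^sub>R z)) integrable_on UNIV" if "continuous_on UNIV k" "\<And>z. norm z \<ge> 1 \<Longrightarrow> k z = 0" for k
      by (rule kernel_continuous(2)[OF that S S1[OF t] cS[OF cv(3)]])
    \<comment> \<open>Moments of the angular derivative Re z vt - Im z vs. Because psi is radial,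
      integration by parts only rotates the monomial: weight \<open>Re z\<close> yields
      \<open>M2 t\<close>, weight \<open>Im z\<close> yields \<open>- M1 t\<close>.\<close>
    define x y where "x = I (\<lambda>z. Re z * Re z) vt t - I (\<lambda>z. Re z * Im z) vs t"
      and "y = I (\<lambda>z. Re z * Im z) vt t - I (\<lambda>z. Im z * Im z) vs t"
    have sc: "integral UNIV (\<lambda>z. k z *\<^sub>R t *\<^sub>R f z) = t *\<^sub>R integral UNIV (\<lambda>z. k z *\<^sub>R f z)" for k and f :: "complex \<Rightarrow> 'b"
      by (simp add: mult.commute flip: integral_cmul)
    have neg: "- b - - a = a - b" for a b :: 'b by simp
    have "t *\<^sub>R x = M2 t"
    proof -
      have "t *\<^sub>R x = integral UNIV (\<lambda>z. (- 4 * Re z * bmp 1 z * (Re z * Im z) + \<psi> z * Im z) *\<^sub>R v (t *\<^sub>R z))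
         - integral UNIV (\<lambda>z. (- 4 * Im z * bmp 1 z * (Re z * Re z)) *\<^sub>R v (t *\<^sub>R z))"
        using xx.ibp(2)[OF S S1[OF t] vt', unfolded sc] xy.ibp(1)[OF S S1[OF t] vt', unfolded sc]
        unfolding x_def I_def scaleR_diff_right by (simp only: neg)
      also have "\<dots> = integral UNIV (\<lambda>z. (\<psi> z * Im z) *\<^sub>R v (t *\<^sub>R z))"
        by (subst integral_diff[symmetric], rule kint[OF xy.cont(2)], erule xy.zero(2),
            rule kint[OF xx.cont(3)], erule xx.zero(3), rule integral_cong, simp add: algebra_simps)
      finally show ?thesis by (simp add: M2_def I_def)
    qed
    moreover have "x = (1/t) *\<^sub>R (t *\<^sub>R x)" using t by simp
    ultimately have x: "x = (1/t) *\<^sub>R M2 t" by simp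
    have "t *\<^sub>R y = - M1 t"
    proof -
      have "t *\<^sub>R y = integral UNIV (\<lambda>z. (- 4 * Re z * bmp 1 z * (Im z * Im z)) *\<^sub>R v (t *\<^sub>R z))
        - integral UNIV (\<lambda>z. (- 4 * Im z * bmp 1 z * (Re z * Im z) + \<psi> z * Re z) *\<^sub>R v (t *\<^sub>R z))"
        using xy.ibp(2)[OF S S1[OF t] vt', unfolded sc] yy.ibp(1)[OF S S1[OF t] vt', unfolded sc]
        unfolding y_def I_def scaleR_diff_right by (simp only: neg)
      also have "\<dots> = integral UNIV (\<lambda>z. - ((\<psi> z * Re z) *\<^sub>R v (t *\<^sub>R z)))"
        by (subst integral_diff[symmetric], rule kint[OF yy.cont(2)], erule yy.zero(2),
            rule kint[OF xy.cont(3)], erule xy.zero(3), rule integral_cong, simp add: algebra_simps)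
      finally show ?thesis by (simp add: M1_def I_def)
    qed
    moreover have "y = (1/t) *\<^sub>R (t *\<^sub>R y)" using t by simp
    ultimately have y: "y = - ((1/t) *\<^sub>R M1 t)" by simp
    have "(P has_vector_derivative
       (I (\<lambda>z. Re z * Re z) vs t + I (\<lambda>z. Re z * Im z) vt t)
       - J0 (I (\<lambda>z. Im z * Re z) vs t + I (\<lambda>z. Im z * Im z) vt t)) (at t)"
      unfolding P_def[abs_def] M1_def M2_def
      by (intro has_vector_derivative_diff bounded_linear.has_vector_derivative[OF J0.bounded_linear] dI continuous_intros)
    moreover have "(I (\<lambda>z. Re z * Re z) vs t + I (\<lambda>z. Re z * Im z) vt t)
       - J0 (I (\<lambda>z. Im z * Re z) vs t + I (\<lambda>z. Im z * Im z) vt t) = (1/t) *\<^sub>R P t + G t"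
    proof -
      have Ig: "I q g' t = I q vs t + J0 (I q vt t)" if q: "continuous_on UNIV q" for q
      proof -
        have "J0 (I q vt t) = integral UNIV (\<lambda>z. (\<psi> z * q z) *\<^sub>R J0 (vt (t *\<^sub>R z)))"
          using integral_linear[OF int[OF q cv(2) t] J0.bounded_linear] by (simp add: o_def I_def J0.scaleR)
        then show ?thesis
          unfolding I_def g'_def scaleR_add_right
          using int[OF q cv(1) t] int[OF q cJ[OF cv(2)] t] by (simp add: integral_add)
      qed
      have c: "continuous_on UNIV (\<lambda>z. Re z * Re z)" "continuous_on UNIV (\<lambda>z. Re z * Im z)" "continuous_on UNIV (\<lambda>z. Im z * Im z)"
        by (intro continuous_intros)+
      have "(1/t) *\<^sub>R P t = - y - J0 x"
        unfolding x y P_def by (simp add: J0.scaleR algebra_simps)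
      moreover have "I (\<lambda>z. Im z * Re z) vs t = I (\<lambda>z. Re z * Im z) vs t"
        by (simp add: mult.commute)
      \<comment> \<open>Pure algebra in the six second moments of vs and vt: the radial derivative
        is the angular one rotated by J0, plus terms in dbar v.\<close>
      moreover have "(a + b) - J0 (c + d) = (- (b - e) - J0 (f - c)) + ((a + J0 f) - 2 *\<^sub>R J0 (c + J0 b) - (e + J0 d))"
        for a b c d e f by (simp add: J0.add J0.diff J(2) scaleR_2)
      ultimately show ?thesis
        unfolding G_def Ig[OF c(1)] Ig[OF c(2)] Ig[OF c(3)] x_def y_def by (simp only:)
    qed
    ultimately show ?thesis by simp
  qed
  \<comment> \<open>Three second moments of dbar v, each at most 4 M t, the middle one doubled and
    multiplied by J0: this gives 4 + 8 \<Lambda> + 4.\<close>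
  define c where "c = 8 * (1 + \<Lambda>) * M"
  have Gb: "norm (G t) \<le> c * t" if t: "t \<in> {0<..<\<rho>}" for t
  proof -
    have Ib: "norm (I q g' t) \<le> 4 * (M * t)" if q: "continuous_on UNIV q" "\<And>z. norm z < 1 \<Longrightarrow> \<bar>q z\<bar> \<le> 1" for q
      unfolding I_def
    proof (rule kernel_integral_bound[OF _ _ _ S S1[OF t] cS[OF cg]])
      show "\<bar>\<psi> z * q z\<bar> \<le> 1" for z
        using \<psi>c(2,3)[of z] q(2)[of z] by (cases "norm z < 1") (auto simp: abs_mult mult_le_one)
      show "norm (g' (t *\<^sub>R z)) \<le> M * t" if "norm z < 1" for z
      proof -
        have "norm (g' (t *\<^sub>R z)) \<le> M * (t * norm z)"
          using g[of "t *\<^sub>R z"] sub[of t z] that t by (auto simp: g'_def)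
        also have "\<dots> \<le> M * (t * 1)"
          using that t \<open>M \<ge> 0\<close> by (intro mult_left_mono) auto
        finally show ?thesis by simp
      qed
    qed (use \<psi>c q t \<open>M \<ge> 0\<close> in \<open>auto intro!: continuous_intros\<close>)
    have q: "\<bar>Re z * Re z\<bar> \<le> 1" "\<bar>Re z * Im z\<bar> \<le> 1" "\<bar>Im z * Im z\<bar> \<le> 1" if "norm z < 1" for z
      using abs_Re_le_cmod[of z] abs_Im_le_cmod[of z] that by (auto simp: abs_mult intro!: mult_le_one simp del: abs_mult_self_eq)
    have b: "norm (I (\<lambda>z. Re z * Re z) g' t) \<le> 4 * (M * t)" "norm (I (\<lambda>z. Re z * Im z) g' t) \<le> 4 * (M * t)"
       "norm (I (\<lambda>z. Im z * Im z) g' t) \<le> 4 * (M * t)"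
      by (rule Ib, intro continuous_intros, erule q)+
    have "norm (G t) \<le> norm (I (\<lambda>z. Re z * Re z) g' t) + 2 * norm (J0 (I (\<lambda>z. Re z * Im z) g' t)) + norm (I (\<lambda>z. Im z * Im z) g' t)"
    proof -
      have "norm (a - 2 *\<^sub>R j - e) \<le> norm a + 2 * norm j + norm e" for a j e :: 'b
        using norm_triangle_ineq4[of "a - 2 *\<^sub>R j" e] norm_triangle_ineq4[of a "2 *\<^sub>R j"] by simp
      then show ?thesis unfolding G_def .
    qed
    also have "\<dots> \<le> 4 * (M * t) + 2 * (\<Lambda> * (4 * (M * t))) + 4 * (M * t)"
      using b J(3)[of "I (\<lambda>z. Re z * Im z) g' t"] mult_left_mono[OF b(2) \<open>\<Lambda> \<ge> 0\<close>] by linarith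
    also have "\<dots> = c * t" by (simp add: c_def algebra_simps)
    finally show ?thesis .
  qed
  define N where "N t = (1/t) *\<^sub>R P t" for t
  have Neq: "N t = integral UNIV (\<lambda>z. (bmp 3 z / 6) *\<^sub>R (vs (t *\<^sub>R z) - J0 (vt (t *\<^sub>R z))))"
    if t: "t \<in> {0<..<\<rho>}" for t
    using N[OF t] t by (simp add: N_def)
  \<comment> \<open>The term P / t in the derivative of P is exactly what division by t
    removes.\<close>
  have dN: "(N has_vector_derivative ((1/t) *\<^sub>R G t)) (at t)" if t: "t \<in> {0<..<\<rho>}" for t
  proof -
    have "((\<lambda>t. 1/t) has_real_derivative (- 1/t^2)) (at t)"
      using t by (auto intro!: derivative_eq_intros simp: power2_eq_square)
    from has_vector_derivative_scaleR[OF this dP[OF t]]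
    show ?thesis by (simp add: N_def[abs_def] algebra_simps power2_eq_square)
  qed
  have Ndiff: "norm (N T - N t) \<le> c * T" if t: "0 < t" "t \<le> T" for t
  proof -
    have "norm (N T - N t) \<le> c * norm (T - t)"
    proof (rule differentiable_bound[where S="{t..T}" and f=N and f'="\<lambda>s h. h *\<^sub>R ((1/s) *\<^sub>R G s)"])
      fix s assume s: "s \<in> {t..T}"
      then have s': "s \<in> {0<..<\<rho>}" using t T by auto
      show "(N has_derivative (\<lambda>h. h *\<^sub>R ((1/s) *\<^sub>R G s))) (at s within {t..T})"
        using dN[OF s'] by (auto simp: has_vector_derivative_def intro: has_derivative_at_withinI)
      have "norm ((1/s) *\<^sub>R G s) \<le> c" using Gb[OF s'] s' by (simp add: field_simps)
      then show "onorm (\<lambda>h. h *\<^sub>R ((1/s) *\<^sub>R G s)) \<le> c"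
        by (intro onorm_le) (metis mult.commute mult_right_mono norm_ge_zero norm_scaleR real_norm_def)
    qed (use t in auto)
    also have "\<dots> \<le> c * T"
      using t \<open>M \<ge> 0\<close> \<open>\<Lambda> \<ge> 0\<close> by (intro mult_left_mono) (auto simp: c_def)
    finally show ?thesis .
  qed
  define w where "w z = vs z - J0 (vt z)" for z
  have cw: "continuous_on (ball 0 \<rho>) w" unfolding w_def by (intro continuous_intros cv cJ)
  have w0: "w 0 = 2 *\<^sub>R vs 0" by (simp add: w_def v0 J(2) scaleR_2)
  define \<kappa> where "\<kappa> = integral UNIV (bmp 3) / 6"
  have b3i: "bmp 3 integrable_on UNIV"
    by (rule compact_support_integrable(1)[where r=1]) (auto simp: bmp_eq_0 intro!: continuous_intros)
  then have \<kappa>0: "\<kappa> \<ge> 0" unfolding \<kappa>_def by (simp add: integral_nonneg)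
  have ki: "(\<lambda>z. (bmp 3 z / 6) *\<^sub>R f (t *\<^sub>R z)) integrable_on UNIV"
    if "continuous_on (ball 0 \<rho>) f" "t \<in> {0<..<\<rho>}" for t and f :: "complex \<Rightarrow> 'b"
    by (rule kernel_continuous(2)[OF _ _ S S1[OF that(2)] cS[OF that(1)]])
       (auto simp: bmp_eq_0 intro!: continuous_intros)
  \<comment> \<open>As t tends to 0, the average tends to \<kappa> times \<partial>v(0); the slack
    \<open>e\<close> absorbs the difference at the small scale t.\<close>
  have lim: "norm (2 *\<^sub>R vs 0) * \<kappa> \<le> norm (N T) + c * T + 4 * e" if "e > 0" for e
  proof -
    have "isCont w 0"
      using cw T by (simp add: continuous_on_eq_continuous_at)
    then obtain d where d: "d > 0" "\<And>z. norm z < d \<Longrightarrow> norm (w z - w 0) < e"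
      using \<open>e > 0\<close> unfolding continuous_at_eps_delta by (force simp: dist_norm)
    define t where "t = min (d / 2) T"
    have t: "0 < t" "t \<le> T" "t < d" "t \<in> {0<..<\<rho>}" using d(1) T by (auto simp: t_def)
    have "norm (integral UNIV (\<lambda>z. (bmp 3 z / 6) *\<^sub>R (w (t *\<^sub>R z) - w 0))) \<le> 4 * e"
    proof (rule kernel_integral_bound[OF _ _ _ S S1[OF t(4)]])
      show "continuous_on (S t) (\<lambda>z. w (t *\<^sub>R z) - w 0)"
        by (intro continuous_intros cS cw)
      show "norm (w (t *\<^sub>R z) - w 0) \<le> e" if "norm z < 1" for z
      proof -
        have "norm (t *\<^sub>R z) \<le> t * 1" using that t by (auto intro!: mult_left_mono)
        moreover have "t * 1 < d" using t by simp
        ultimately have "norm (t *\<^sub>R z) < d" by linarith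
        then show ?thesis using d(2)[of "t *\<^sub>R z"] by simp
      qed
      show "\<bar>bmp 3 z / 6\<bar> \<le> 1" for z using bmp_le_1[of 3 z] bmp_nonneg[of 3 z] by (simp del: bmp_nonneg)
    qed (use \<open>e > 0\<close> in \<open>auto simp: bmp_eq_0 intro!: continuous_intros\<close>)
    moreover have "integral UNIV (\<lambda>z. (bmp 3 z / 6) *\<^sub>R (w (t *\<^sub>R z) - w 0)) = N t - \<kappa> *\<^sub>R w 0"
    proof -
      have "(\<lambda>z. (bmp 3 z / 6) *\<^sub>R w 0) integrable_on UNIV"
        by (rule compact_support_integrable(1)[where r=1]) (auto simp: bmp_eq_0 intro!: continuous_intros)
      moreover have "integral UNIV (\<lambda>z. (bmp 3 z / 6) *\<^sub>R w 0) = \<kappa> *\<^sub>R w 0"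
      proof -
        have "((\<lambda>z. bmp 3 z *\<^sub>R (w 0 /\<^sub>R 6)) has_integral integral UNIV (bmp 3) *\<^sub>R (w 0 /\<^sub>R 6)) UNIV"
          by (intro has_integral_scaleR_left integrable_integral b3i)
        then show ?thesis by (simp add: integral_unique \<kappa>_def field_simps)
      qed
      ultimately show ?thesis
        unfolding Neq[OF t(4)] scaleR_diff_right w_def[symmetric]
        using ki[OF cw t(4)] by (subst integral_diff) auto
    qed
    ultimately have "norm (\<kappa> *\<^sub>R w 0) \<le> norm (N t) + 4 * e"
      by (smt (verit) norm_minus_commute norm_triangle_ineq2)
    also have "norm (N t) \<le> norm (N T) + c * T"
      using Ndiff[OF t(1,2)] by (smt (verit) norm_minus_commute norm_triangle_ineq2)
    finally have "norm (\<kappa> *\<^sub>R w 0) \<le> norm (N T) + c * T + 4 * e" by simp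
    moreover have "norm (\<kappa> *\<^sub>R w 0) = norm (2 *\<^sub>R vs 0) * \<kappa>" using \<kappa>0 by (simp add: w0)
    ultimately show ?thesis by linarith
  qed
  have "norm (2 *\<^sub>R vs 0) * \<kappa> \<le> norm (N T) + c * T"
    by (rule field_le_epsilon) (use lim[of "e / 4" for e] in fastforce)
  moreover have "norm (N T) \<le> integral UNIV (\<lambda>z. bmp 3 z / 6 * norm (vs (T *\<^sub>R z) - J0 (vt (T *\<^sub>R z))))"
  proof -
    have T': "T \<in> {0<..<\<rho>}" using T by simp
    have i: "(\<lambda>z. (bmp 3 z / 6) *\<^sub>R norm (w (T *\<^sub>R z))) integrable_on UNIV"
      by (rule kernel_continuous(2)[OF _ _ S S1[OF T']])
         (auto simp: bmp_eq_0 intro!: continuous_intros cS cw)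
    show ?thesis
      unfolding Neq[OF T'] using i
      by (intro integral_norm_bound_integral ki[OF cw T', unfolded w_def]) (auto simp: w_def)
  qed
  ultimately show ?thesis by (simp add: \<kappa>_def c_def)
qed

section \<open>Energy cutoffs\<close>

text \<open>The standard bump exp(- 1/x - 1/(1 - x)) times powers of 1/x and 1/(1 - x). With these
  powers the family is closed under differentiation up to linear combinations, so smoothness becomes
  an induction.\<close>

definition expbump :: "nat \<Rightarrow> nat \<Rightarrow> real \<Rightarrow> real" where
  "expbump m n x = (if 0 < x \<and> x < 1
     then (1 / x) ^ m * (1 / (1 - x)) ^ n * exp (- (1 / x) - 1 / (1 - x)) else 0)"

lemma expbump_nonneg: "expbump m n x \<ge> 0"
  by (auto simp: expbump_def)

lemma power_exp_minus_le_fact: "y ^ k * exp (- y) \<le> fact k" if "y \<ge> 0" for y :: real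
proof -
  have "(\<Sum>i\<in>{k}. y ^ i /\<^sub>R fact i) \<le> (\<Sum>i. y ^ i /\<^sub>R fact i)"
    by (rule sum_le_suminf) (use that summable_exp_generic[of y] in auto)
  then have "y ^ k / fact k \<le> exp y"
    by (simp add: exp_def field_simps)
  then show ?thesis by (simp add: exp_minus field_simps)
qed

text \<open>Two extra powers of 1/x, or of 1/(1 - x), are absorbed by the exponential through y^k
  exp(-y) \<le> k!. Quadratic vanishing at both ends is what gives derivative 0 there.\<close>

lemma expbump_le: "expbump m n x \<le> fact (m + 2) * fact n * x\<^sup>2" "expbump m n x \<le> fact m * fact (n + 2) * (x - 1)\<^sup>2"
proof -
  consider "0 < x" "x < 1" | "\<not> (0 < x \<and> x < 1)" by auto
  then have "expbump m n x \<le> fact (m + 2) * fact n * x\<^sup>2 \<and> expbump m n x \<le> fact m * fact (n + 2) * (x - 1)\<^sup>2"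
  proof cases
    case 1
    define y w where "y = 1 / x" and "w = 1 / (1 - x)"
    have yw: "y > 0" "w > 0" using 1 by (auto simp: y_def w_def)
    have e: "expbump m n x = (y ^ m * exp (- y)) * (w ^ n * exp (- w))"
    proof -
      have "exp (- (1 / x) - 1 / (1 - x)) = exp (- y) * exp (- w)"
        by (simp add: y_def w_def flip: exp_add)
      then show ?thesis using 1 by (simp add: expbump_def y_def w_def)
    qed
    have yx: "y * x = 1" "w * (1 - x) = 1" using 1 by (auto simp: y_def w_def)
    have "(y ^ (m + 2) * exp (- y)) * x\<^sup>2 = y ^ m * exp (- y) * (y * x)\<^sup>2"
      by (simp add: power_add power_mult_distrib power2_eq_square)
    then have "y ^ m * exp (- y) = (y ^ (m + 2) * exp (- y)) * x\<^sup>2" by (simp add: yx)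
    also have "\<dots> \<le> fact (m + 2) * x\<^sup>2"
      by (intro mult_right_mono power_exp_minus_le_fact) (use yw in auto)
    finally have a: "y ^ m * exp (- y) \<le> fact (m + 2) * x\<^sup>2" .
    have "(w ^ (n + 2) * exp (- w)) * (1 - x)\<^sup>2 = w ^ n * exp (- w) * (w * (1 - x))\<^sup>2"
      by (simp add: power_add power_mult_distrib power2_eq_square)
    then have "w ^ n * exp (- w) = (w ^ (n + 2) * exp (- w)) * (1 - x)\<^sup>2" by (simp add: yx)
    also have "\<dots> \<le> fact (n + 2) * (1 - x)\<^sup>2"
      by (intro mult_right_mono power_exp_minus_le_fact) (use yw in auto)
    finally have b: "w ^ n * exp (- w) \<le> fact (n + 2) * (x - 1)\<^sup>2" by (simp add: power2_commute)
    have "(y ^ m * exp (- y)) * (w ^ n * exp (- w)) \<le> (fact (m + 2) * x\<^sup>2) * fact n"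
      using yw by (intro mult_mono a power_exp_minus_le_fact) auto
    moreover have "(y ^ m * exp (- y)) * (w ^ n * exp (- w)) \<le> fact m * (fact (n + 2) * (x - 1)\<^sup>2)"
      using yw by (intro mult_mono b power_exp_minus_le_fact) auto
    ultimately show ?thesis unfolding e by (simp only: mult.assoc mult.commute[of "x\<^sup>2"])
  next
    case 2
    then have "expbump m n x = 0" by (auto simp: expbump_def)
    then show ?thesis by simp
  qed
  then show "expbump m n x \<le> fact (m + 2) * fact n * x\<^sup>2" "expbump m n x \<le> fact m * fact (n + 2) * (x - 1)\<^sup>2" by auto
qed

lemma has_real_derivative_0_quadratic:
  fixes f :: "real \<Rightarrow> real"
  assumes "\<And>x. \<bar>f x - f a\<bar> \<le> C * (x - a)\<^sup>2"
  shows "(f has_real_derivative 0) (at a)"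
proof -
  have "((\<lambda>h. (f (a + h) - f a) / h) \<longlongrightarrow> 0) (at 0)"
  proof (rule tendsto_rabs_zero_cancel, rule tendsto_sandwich)
    show "\<forall>\<^sub>F h in at 0. 0 \<le> \<bar>(f (a + h) - f a) / h\<bar>" by simp
    have "\<bar>(f (a + h) - f a) / h\<bar> \<le> C * \<bar>h\<bar>" if "h \<noteq> 0" for h
      using assms[of "a + h"] that by (simp add: field_simps power2_eq_square)
    then show "\<forall>\<^sub>F h in at 0. \<bar>(f (a + h) - f a) / h\<bar> \<le> C * \<bar>h\<bar>"
      by (auto simp: eventually_at_filter)
    show "((\<lambda>h. C * \<bar>h\<bar>) \<longlongrightarrow> 0) (at 0)" by (auto intro!: tendsto_eq_intros)
  qed simp
  then show ?thesis by (simp add: DERIV_def)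
qed

lemma expbump_derivative:
  "(expbump m n has_real_derivative
     - real m * expbump (Suc m) n x + real n * expbump m (Suc n) x
     + expbump (m + 2) n x - expbump m (n + 2) x) (at x)"
proof -
  consider "0 < x" "x < 1" | "x < 0 \<or> x > 1" | "x = 0" | "x = 1" by linarith
  then show ?thesis
  proof cases
    case 1
    have "((\<lambda>x. (1 / x) ^ m * (1 / (1 - x)) ^ n * exp (- (1 / x) - 1 / (1 - x))) has_real_derivative
     - real m * expbump (Suc m) n x + real n * expbump m (Suc n) x
     + expbump (m + 2) n x - expbump m (n + 2) x) (at x)"
    proof -
      define y w E where "y = 1 / x" and "w = 1 / (1 - x)" and "E = exp (- y - w)"
      have r1: "((\<lambda>x. 1 / x) has_real_derivative - (y\<^sup>2)) (at x)"
        using 1 by (auto intro!: derivative_eq_intros simp: y_def power2_eq_square)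
      have r2: "((\<lambda>x. 1 / (1 - x)) has_real_derivative w\<^sup>2) (at x)"
        using 1 by (auto intro!: derivative_eq_intros simp: w_def power2_eq_square)
      have d3: "((\<lambda>x. exp (- (1 / x) - 1 / (1 - x))) has_real_derivative E * (y\<^sup>2 - w\<^sup>2)) (at x)"
        using DERIV_chain2[OF DERIV_exp DERIV_diff[OF DERIV_minus[OF r1] r2]] by (simp add: E_def y_def w_def)
      have d1: "((\<lambda>x. (1 / x) ^ m) has_real_derivative - real m * y ^ Suc m) (at x)"
        by (rule DERIV_cong[OF DERIV_power[OF r1]], cases m)
           (auto simp: power2_eq_square y_def[symmetric] algebra_simps)
      have d2: "((\<lambda>x. (1 / (1 - x)) ^ n) has_real_derivative real n * w ^ Suc n) (at x)"
        by (rule DERIV_cong[OF DERIV_power[OF r2]], cases n)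
           (auto simp: power2_eq_square w_def[symmetric] algebra_simps)
      have e: "expbump m n x = y ^ m * w ^ n * E" for m n
        using 1 by (simp add: expbump_def y_def w_def E_def)
      show ?thesis
        by (rule DERIV_cong[OF DERIV_mult[OF DERIV_mult[OF d1 d2] d3]])
           (simp add: e y_def[symmetric] w_def[symmetric] E_def[symmetric] power_add algebra_simps power2_eq_square)
    qed
    then show ?thesis
      by (rule has_field_derivative_transform_within_open[where S="{0<..<1}"]) (use 1 in \<open>auto simp: expbump_def\<close>)
  next
    case 2
    have "((\<lambda>x. 0) has_real_derivative
     - real m * expbump (Suc m) n x + real n * expbump m (Suc n) x
     + expbump (m + 2) n x - expbump m (n + 2) x) (at x)"
      using 2 by (auto simp: expbump_def)
    then show ?thesis
      by (rule has_field_derivative_transform_within_open[where S="- {0..1}"])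
         (use 2 in \<open>auto simp: expbump_def\<close>)
  next
    case 3
    have "(expbump m n has_real_derivative 0) (at 0)"
      by (rule has_real_derivative_0_quadratic[where C="fact (m + 2) * fact n"])
         (use expbump_le(1)[of m n] expbump_nonneg[of m n] in \<open>simp add: expbump_def[of m n 0]\<close>)
    then show ?thesis using 3 by (simp add: expbump_def[of _ _ 0])
  next
    case 4
    have "(expbump m n has_real_derivative 0) (at 1)"
      by (rule has_real_derivative_0_quadratic[where C="fact m * fact (n + 2)"])
         (use expbump_le(2)[of m n] expbump_nonneg[of m n] in \<open>simp add: expbump_def[of m n 1]\<close>)
    then show ?thesis using 4 by (simp add: expbump_def[of _ _ 1])
  qed
qed

text \<open>The span of the bumps rescaled to the interval from a to a + w. It is closed under
  differentiation, hence all its members are of class C^k for every k.\<close>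

inductive bump_comb :: "real \<Rightarrow> real \<Rightarrow> (real \<Rightarrow> real) \<Rightarrow> bool" for a w where
  basic: "bump_comb a w (\<lambda>x. expbump m n ((x - a) / w))"
| scale: "bump_comb a w f \<Longrightarrow> bump_comb a w (\<lambda>x. c * f x)"
| add: "bump_comb a w f \<Longrightarrow> bump_comb a w g \<Longrightarrow> bump_comb a w (\<lambda>x. f x + g x)"

lemma bump_comb_derivative:
  assumes "bump_comb a w f" "w \<noteq> 0"
  shows "\<exists>f'. bump_comb a w f' \<and> (\<forall>x. (f has_real_derivative f' x) (at x))"
  using assms(1)
proof induction
  case (basic m n)
  define e where "e m n x = expbump m n ((x - a) / w)" for m n x
  have e: "bump_comb a w (e m n)" for m n unfolding e_def[abs_def] by (rule bump_comb.basic)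
  define f' where "f' x = (1/w) * (((- real m) * e (Suc m) n x + real n * e m (Suc n) x) + (e (m + 2) n x + (-1) * e m (n + 2) x))" for x
  have "bump_comb a w f'"
    unfolding f'_def[abs_def] by (intro bump_comb.scale bump_comb.add e)
  moreover have "((\<lambda>x. expbump m n ((x - a) / w)) has_real_derivative f' x) (at x)" for x
  proof -
    have "((\<lambda>x. (x - a) / w) has_real_derivative 1 / w) (at x)"
      using assms(2) by (auto intro!: derivative_eq_intros)
    from DERIV_chain2[OF expbump_derivative this] show ?thesis
      by (rule DERIV_cong) (simp add: f'_def e_def)
  qed
  ultimately show ?case by blast
next
  case (scale f c)
  then obtain f' where "bump_comb a w f'" "\<And>x. (f has_real_derivative f' x) (at x)" by blast
  then show ?case by (intro exI[of _ "\<lambda>x. c * f' x"]) (auto intro!: bump_comb.scale DERIV_cmult)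
next
  case (add f g)
  then obtain f' g' where "bump_comb a w f'" "\<And>x. (f has_real_derivative f' x) (at x)"
    "bump_comb a w g'" "\<And>x. (g has_real_derivative g' x) (at x)" by blast
  then show ?case by (intro exI[of _ "\<lambda>x. f' x + g' x"]) (auto intro!: bump_comb.add DERIV_add)
qed

lemma bump_comb_Ck_on:
  assumes "w \<noteq> 0"
  shows "bump_comb a w f \<Longrightarrow> Ck_on k UNIV f"
proof (induction k arbitrary: f)
  case 0
  then show ?case
    using bump_comb_derivative[OF 0 assms] by (auto intro: DERIV_isCont intro!: continuous_at_imp_continuous_on)
next
  case (Suc k)
  obtain f' where f': "bump_comb a w f'" "\<And>x. (f has_real_derivative f' x) (at x)"
    using bump_comb_derivative[OF Suc.prems assms] by blast
  have "f differentiable (at x)" for x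
    using f'(2) by (auto simp: real_differentiable_def)
  moreover have "frechet_derivative f (at x) v = v * f' x" for x v
    using fun_cong[OF frechet_derivative_at[OF f'(2)[of x, unfolded has_field_derivative_def]], of v] by (simp only: mult.commute)
  ultimately show ?case
    using Suc.IH[OF bump_comb.scale[OF f'(1)]] by simp
qed

text \<open>The bump is divided by its integral, of which \<open>c\<close> is the reciprocal; N
  \<ge> c keeps the height c / N at most 1, as \<open>energy_cutoffs\<close> demands. The primitive
  \<open>\<Phi>\<close> runs from -1/2 to 1/2 and serves as a smoothed half sign. Wide cutoffs are
  low, which is the source of the contradiction for large slopes.\<close>

lemma energy_cutoff_exists:
  obtains c where "c > 0"
    "\<And>a N. N \<ge> c \<Longrightarrow> \<exists>\<phi> \<Phi>. \<phi> \<in> energy_cutoffs \<and> continuous_on UNIV \<phi> \<and>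
       (\<forall>x. (\<Phi> has_real_derivative \<phi> x) (at x)) \<and> (\<forall>x. 0 \<le> \<phi> x \<and> \<phi> x \<le> c / N) \<and>
       (\<forall>x\<in>{a<..<a + N}. \<phi> x > 0) \<and> (\<forall>x\<le>a. \<Phi> x = - 1 / 2) \<and> (\<forall>x\<ge>a + N. \<Phi> x = 1 / 2) \<and>
       (\<forall>x. \<bar>\<Phi> x\<bar> \<le> 1 / 2)"
proof -
  define b where "b = expbump 0 0"
  have b01: "0 \<le> b x" "b x \<le> 1" for x
    using order_trans[of "- (1 / x)" 0 "1 / (1 - x)"] by (auto simp: b_def expbump_def)
  have b0: "b x = 0" if "x \<notin> {0<..<1}" for x using that by (auto simp: b_def expbump_def)
  have bp: "b x > 0" if "x \<in> {0<..<1}" for x using that by (auto simp: b_def expbump_def)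
  have bc: "continuous_on UNIV b"
    unfolding b_def by (intro continuous_at_imp_continuous_on ballI) (rule DERIV_isCont[OF expbump_derivative])
  define Bi where "Bi = integral {0..1} b"
  have hb: "(b has_integral Bi) {0..1}"
    unfolding Bi_def by (intro integrable_integral integrable_continuous_interval continuous_on_subset[OF bc]) auto
  have Bpos: "Bi > 0"
  proof -
    have "Bi \<ge> 0" unfolding Bi_def by (rule integral_nonneg) (use hb b01 in auto)
    moreover have "Bi \<noteq> 0"
    proof
      assume "Bi = 0"
      then have "b (1/2) = 0"
        using has_integral_0_cbox_imp_0[of 0 1 b "1/2"] hb b01 continuous_on_subset[OF bc]
        by auto
      then show False using bp[of "1/2"] by simp
    qed
    ultimately show ?thesis by simp
  qed
  define c where "c = 1 / Bi"
  have c: "c > 0" using Bpos by (simp add: c_def)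
  have "\<exists>\<phi> \<Phi>. \<phi> \<in> energy_cutoffs \<and> continuous_on UNIV \<phi> \<and>
       (\<forall>x. (\<Phi> has_real_derivative \<phi> x) (at x)) \<and> (\<forall>x. 0 \<le> \<phi> x \<and> \<phi> x \<le> c / N) \<and>
       (\<forall>x\<in>{a<..<a + N}. \<phi> x > 0) \<and> (\<forall>x\<le>a. \<Phi> x = - 1 / 2) \<and> (\<forall>x\<ge>a + N. \<Phi> x = 1 / 2) \<and>
       (\<forall>x. \<bar>\<Phi> x\<bar> \<le> 1 / 2)" if N: "N \<ge> c" for a N
  proof -
    have N0: "N > 0" using N c by linarith
    define \<phi> where "\<phi> x = c / N * b ((x - a) / N)" for x
    have cN: "c / N \<ge> 0" "c / N \<le> 1" using c N N0 by auto
    have \<phi>c: "continuous_on S \<phi>" for S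
      unfolding \<phi>_def by (intro continuous_intros continuous_on_compose2[OF bc]) (use N0 in auto)
    have \<phi>b: "0 \<le> \<phi> x" "\<phi> x \<le> c / N" for x
      using b01[of "(x - a) / N"] cN mult_left_le[of "b ((x - a) / N)" "c / N"]
        mult_nonneg_nonneg[of "c / N" "b ((x - a) / N)"] unfolding \<phi>_def by blast+
    have \<phi>0: "\<phi> x = 0" if "x \<notin> {a<..<a + N}" for x
      using b0[of "(x - a) / N"] that N0 by (auto simp: \<phi>_def field_simps)
    have \<phi>p: "\<phi> x > 0" if "x \<in> {a<..<a + N}" for x
      using bp[of "(x - a) / N"] that N0 c by (auto simp: \<phi>_def field_simps)
    have "((\<lambda>x. b ((1/N) *\<^sub>R x + (- a/N))) has_integral Bi /\<^sub>R (1/N) ^ DIM(real)) (cbox ((0 - (- a/N)) /\<^sub>R (1/N)) ((1 - (- a/N)) /\<^sub>R (1/N)))"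
      by (rule has_integral_affinity') (use hb N0 in auto)
    then have "((\<lambda>x. b ((x - a) / N)) has_integral (N * Bi)) {a..a + N}"
    proof -
      have "(1 - (- a/N)) /\<^sub>R (1/N) = a + N" "(0 - (- a/N)) /\<^sub>R (1/N) = a" using N0 by (simp_all add: field_simps)
      moreover have "Bi /\<^sub>R (1/N) ^ DIM(real) = N * Bi" by simp
      moreover have "(1/N) *\<^sub>R x + (- a/N) = (x - a) / N" for x by (simp add: diff_divide_distrib)
      ultimately show ?thesis using \<open>(_ has_integral _) (cbox _ _)\<close> by (simp only: cbox_interval)
    qed
    then have "(\<phi> has_integral (c / N * (N * Bi))) {a..a + N}"
      unfolding \<phi>_def by (rule has_integral_mult_right)
    then have hi: "(\<phi> has_integral 1) {a..a + N}"
      using N0 Bpos by (simp add: c_def)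
    have hU: "(\<phi> has_integral 1) UNIV"
      by (rule has_integral_on_superset[OF hi]) (use \<phi>0 in auto)
    have "bump_comb a N \<phi>"
      unfolding \<phi>_def[abs_def] b_def by (intro bump_comb.scale bump_comb.basic)
    then have Ck: "Ck_on k UNIV \<phi>" for k
      by (rule bump_comb_Ck_on[rotated]) (use N0 in auto)
    have "{r. \<phi> r \<noteq> 0} \<subseteq> {a..a + N}"
    proof
      fix x assume "x \<in> {r. \<phi> r \<noteq> 0}"
      then have "x \<in> {a<..<a + N}" using \<phi>0[of x] by blast
      then show "x \<in> {a..a + N}" by simp
    qed
    then have "compact (closure {r. \<phi> r \<noteq> 0})"
      by (metis bounded_closed_interval bounded_subset compact_closure)
    then have mem: "\<phi> \<in> energy_cutoffs"
      using hU Ck \<phi>b cN unfolding energy_cutoffs_def smooth_on_def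
      by (auto intro!: exI[of _ UNIV] exI[of _ \<phi>] intro: order_trans)
    \<comment> \<open>The base point lies to the left of the support, so a point x \<ge> a is
      interior to the interval on which the primitive is differentiated.\<close>
    define \<Psi> where "\<Psi> x = integral {a - 1..x} \<phi>" for x
    have int: "\<phi> integrable_on {l..x}" for l x by (intro integrable_continuous_interval \<phi>c)
    have \<Psi>a: "\<Psi> x = 0" if "x \<le> a" for x
    proof -
      have "integral {a - 1..x} \<phi> = integral {a - 1..x} (\<lambda>_. 0)"
        by (rule integral_cong) (use \<phi>0 that in auto)
      then show ?thesis by (simp add: \<Psi>_def)
    qed
    have \<Psi>b: "\<Psi> x = 1" if "x \<ge> a + N" for x
    proof -
      have "(\<phi> has_integral 1) {a - 1..x}"
        by (rule has_integral_on_superset[OF hi]) (use \<phi>0 that N0 in auto)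
      then show ?thesis by (simp add: \<Psi>_def integral_unique)
    qed
    have \<Psi>m: "0 \<le> \<Psi> x \<and> \<Psi> x \<le> 1" for x
    proof -
      have "0 \<le> \<Psi> x" unfolding \<Psi>_def by (rule integral_nonneg) (use int \<phi>b in auto)
      moreover have "\<Psi> x \<le> \<Psi> (max x (a + N))"
        unfolding \<Psi>_def by (rule integral_subset_le) (use int \<phi>b in auto)
      ultimately show ?thesis using \<Psi>b[of "max x (a + N)"] by simp
    qed
    have d: "(\<Psi> has_real_derivative \<phi> x) (at x)" for x
    proof (cases "x < a")
      case True
      have "((\<lambda>_. 0) has_real_derivative \<phi> x) (at x)" using \<phi>0[of x] True by simp
      then show ?thesis
        by (rule has_field_derivative_transform_within_open[where S="{..<a}"]) (use \<Psi>a True in auto)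
    next
      case False
      have "(\<Psi> has_real_derivative \<phi> x) (at x within {a - 1..x + 1})"
        unfolding \<Psi>_def by (rule integral_has_real_derivative[OF \<phi>c]) (use False in auto)
      moreover have "at x within {a - 1..x + 1} = at x"
        by (rule at_within_interior) (use False in \<open>simp add: interior_atLeastAtMost_real\<close>)
      ultimately show ?thesis by simp
    qed
    have dS: "((\<lambda>x. \<Psi> x - 1 / 2) has_real_derivative \<phi> x) (at x)" for x
      using DERIV_diff[OF d DERIV_const] by simp
    show ?thesis
    proof (rule exI[of _ \<phi>], rule exI[of _ "\<lambda>x. \<Psi> x - 1 / 2"], intro conjI allI impI ballI)
      show "\<bar>\<Psi> x - 1 / 2\<bar> \<le> 1 / 2" for x using \<Psi>m[of x] unfolding abs_le_iff by linarith
    qed (use mem \<phi>c dS \<phi>b \<phi>p \<Psi>a \<Psi>b in auto)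
  qed
  then show ?thesis by (rule that[OF c])
qed

section \<open>Near-harmonic functions\<close>

lemma norm_scaleR_le: "0 \<le> t \<Longrightarrow> norm z \<le> 1 \<Longrightarrow> norm (t *\<^sub>R z) \<le> t"
  using mult_left_mono[of "norm z" 1 t] by simp

lemma bmp_integrable: "n > 0 \<Longrightarrow> bmp n integrable_on UNIV"
  by (rule compact_support_integrable(1)[where r=1]) (auto simp: bmp_eq_0 intro!: continuous_intros)

lemma bmp_integral_pos:
  assumes "n > 0" shows "integral UNIV (bmp n) > 0"
proof -
  have "integral UNIV (bmp n) \<ge> 0" by (rule integral_nonneg) (auto intro: bmp_integrable[OF assms])
  moreover have "integral UNIV (bmp n) \<noteq> 0"
  proof
    assume "integral UNIV (bmp n) = 0"
    then have "integral (qbox 1) (bmp n) = 0"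
      using compact_support_integrable(2)[of "bmp n" 1 1] continuous_on_bmp[OF continuous_on_id, of UNIV n]
      by (simp add: bmp_eq_0 assms id_def)
    moreover have c: "continuous_on S (bmp n)" for S
      using continuous_on_bmp[OF continuous_on_id, of S n] by (simp add: id_def)
    then have "(bmp n has_integral integral (qbox 1) (bmp n)) (qbox 1)"
      unfolding qbox_def by (intro integrable_integral integrable_continuous)
    ultimately have "(bmp n has_integral 0) (cbox (Complex (-1) (-1)) (Complex 1 1))"
      by (simp add: qbox_def)
    moreover have "box (Complex (-1) (-1)) (Complex 1 1) \<noteq> {}"
      by (auto simp: box_ne_empty Basis_complex_def complex_inner_1_right complex_inner_i_right)
    ultimately have "bmp n 0 = 0"
      by (intro has_integral_0_cbox_imp_0[where x=0, OF c]) (auto simp: in_cbox_complex_iff)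
    then show False by (simp add: bmp_def)
  qed
  ultimately show ?thesis by simp
qed

text \<open>The gradient of bmp 2 is -4 z bmp 1, so integrating bmp 2 by parts against the
  coordinates gives all second moments of bmp 1; they are isotropic.\<close>

lemma bmp_quadratic_integral:
  "integral UNIV (\<lambda>z. bmp 1 z * (x * Re z + y * Im z)\<^sup>2) = (x\<^sup>2 + y\<^sup>2) * integral UNIV (bmp 2) / 4"
proof -
  interpret b2: kernel "bmp 2" "\<lambda>z. - 4 * Re z * bmp 1 z" "\<lambda>z. - 4 * Im z * bmp 1 z"
    using kernel_bmp[of 2] by simp
  have k: "(\<lambda>z. bmp 1 z *\<^sub>R f z) integrable_on UNIV" if "continuous_on UNIV f" for f :: "complex \<Rightarrow> real"
    by (rule kernel_continuous(2)[OF _ _ open_UNIV]) (use that in \<open>auto simp: bmp_eq_0 intro!: continuous_intros\<close>)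
  have m: "integral UNIV (\<lambda>z. (- 4 * f z * bmp 1 z) *\<^sub>R g z) = - 4 * integral UNIV (\<lambda>z. bmp 1 z *\<^sub>R (f z * g z))"
    for f g :: "complex \<Rightarrow> real"
    by (subst integral_mult_right[symmetric]) (simp add: mult_ac)
  have 1: "integral UNIV (\<lambda>z. bmp 1 z *\<^sub>R (Re z * Re z)) = integral UNIV (bmp 2) / 4"
    using b2.ibp(1)[OF open_UNIV subset_UNIV C1_on_Re_Im(1)] unfolding m by simp
  have 2: "integral UNIV (\<lambda>z. bmp 1 z *\<^sub>R (Re z * Im z)) = 0"
    using b2.ibp(1)[OF open_UNIV subset_UNIV C1_on_Re_Im(2)] unfolding m by simp
  have 3: "integral UNIV (\<lambda>z. bmp 1 z *\<^sub>R (Im z * Im z)) = integral UNIV (bmp 2) / 4"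
    using b2.ibp(2)[OF open_UNIV subset_UNIV C1_on_Re_Im(2)] unfolding m by simp
  have i: "(\<lambda>z. bmp 1 z *\<^sub>R (Re z * Re z)) integrable_on UNIV" "(\<lambda>z. bmp 1 z *\<^sub>R (Re z * Im z)) integrable_on UNIV"
    "(\<lambda>z. bmp 1 z *\<^sub>R (Im z * Im z)) integrable_on UNIV"
    by (rule k, intro continuous_intros)+
  have "((\<lambda>z. x\<^sup>2 * (bmp 1 z *\<^sub>R (Re z * Re z)) + (2 * x * y) * (bmp 1 z *\<^sub>R (Re z * Im z)) + y\<^sup>2 * (bmp 1 z *\<^sub>R (Im z * Im z)))
     has_integral (x\<^sup>2 * (integral UNIV (bmp 2) / 4) + (2 * x * y) * 0 + y\<^sup>2 * (integral UNIV (bmp 2) / 4))) UNIV"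
    by (intro has_integral_add has_integral_mult_right integrable_integral[OF i(1), unfolded 1]
        integrable_integral[OF i(2), unfolded 2] integrable_integral[OF i(3), unfolded 3])
  then show ?thesis
    by (simp add: integral_unique power2_eq_square algebra_simps)
qed

text \<open>Lets a displacement of the centre be moved onto the kernel, so that averages of the
  gradient of \<open>a\<close> can be compared without a modulus of continuity of that
  gradient.\<close>

lemma bmp2_Lipschitz: "\<bar>bmp 2 z - bmp 2 w\<bar> \<le> 4 * norm (z - w)"
proof -
  have "norm (bmp 2 z - bmp 2 w) \<le> 4 * norm (z - w)"
  proof (rule differentiable_bound[where S=UNIV])
    show "(bmp 2 has_derivative (\<lambda>h. Re h *\<^sub>R (- 4 * Re x * bmp 1 x) + Im h *\<^sub>R (- 4 * Im x * bmp 1 x))) (at x within UNIV)" for x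
      using C1_onD(4)[OF C1_on_bmp[of 2 UNIV]] by simp
    show "onorm (\<lambda>h. Re h *\<^sub>R (- 4 * Re x * bmp 1 x) + Im h *\<^sub>R (- 4 * Im x * bmp 1 x)) \<le> 4" for x
    proof (rule onorm_le)
      fix h :: complex
      have "\<bar>h \<bullet> x\<bar> \<le> norm h * norm x" by (rule Cauchy_Schwarz_ineq2)
      then have a: "\<bar>Re h * Re x + Im h * Im x\<bar> \<le> norm h * norm x" by (simp add: inner_complex_def)
      have "norm (Re h *\<^sub>R (- 4 * Re x * bmp 1 x) + Im h *\<^sub>R (- 4 * Im x * bmp 1 x)) = \<bar>(- 4 * bmp 1 x) * (Re h * Re x + Im h * Im x)\<bar>"
        by (simp add: algebra_simps)
      also have "\<dots> = 4 * bmp 1 x * \<bar>Re h * Re x + Im h * Im x\<bar>"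
        by (subst abs_mult) simp
      also have "\<dots> \<le> 4 * bmp 1 x * (norm h * norm x)" using a by (intro mult_left_mono) auto
      also have "\<dots> \<le> 4 * norm h"
      proof (cases "norm x < 1")
        case True
        have "bmp 1 x * (norm h * norm x) \<le> 1 * (norm h * 1)"
          by (intro mult_mono bmp_le_1) (use True in auto)
        then show ?thesis by simp
      qed (simp add: bmp_eq_0)
      finally show "norm (Re h *\<^sub>R (- 4 * Re x * bmp 1 x) + Im h *\<^sub>R (- 4 * Im x * bmp 1 x)) \<le> 4 * norm h" .
    qed
  qed auto
  then show ?thesis by simp
qed

text \<open>The 1-form p ds + q dt stands for the pullback of \<open>lambda_inf\<close>:
  \<open>\<theta>\<close> is its uniform distance from the conjugate differential - a2 ds + a1 dt,
  and \<open>\<eta>\<close> bounds its exterior derivative qs - pt in L^1 only. \<open>K\<close>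
  bounds the gradient of \<open>a\<close>.\<close>

locale near_harmonic =
  fixes R K \<theta> \<eta> :: real and a a1 a2 p ps pt q qs qt :: "complex \<Rightarrow> real"
  assumes a: "C1_on UNIV a a1 a2" and p: "C1_on UNIV p ps pt" and q: "C1_on UNIV q qs qt"
    and K: "\<And>z. norm z \<le> R \<Longrightarrow> \<bar>a1 z\<bar> \<le> K" "\<And>z. norm z \<le> R \<Longrightarrow> \<bar>a2 z\<bar> \<le> K"
    and \<theta>: "\<And>z. norm z \<le> R \<Longrightarrow> \<bar>a1 z - q z\<bar> \<le> \<theta>" "\<And>z. norm z \<le> R \<Longrightarrow> \<bar>a2 z + p z\<bar> \<le> \<theta>"
    and \<eta>: "(\<integral>\<^sup>+z\<in>cball 0 R. ennreal \<bar>qs z - pt z\<bar> \<partial>lborel) \<le> ennreal \<eta>" "\<eta> \<ge> 0"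
    and R: "R > 0"
begin

lemma K0: "K \<ge> 0" and \<theta>0: "\<theta> \<ge> 0"
  using K(1)[of 0] \<theta>(1)[of 0] R by auto

lemmas ca = C1_onD[OF a] and cp = C1_onD[OF p] and cq = C1_onD[OF q]

lemma continuous_affine: "continuous_on UNIV f \<Longrightarrow> continuous_on UNIV (\<lambda>z. f (w + T *\<^sub>R z))"
  for f :: "complex \<Rightarrow> real" and T :: real
  by (erule continuous_on_compose2) (auto intro!: continuous_intros)

lemma kernel_integrable:
  fixes k f :: "complex \<Rightarrow> real"
  assumes "continuous_on UNIV k" "\<And>z. norm z \<ge> 1 \<Longrightarrow> k z = 0" "continuous_on UNIV f"
  shows "(\<lambda>z. k z * f z) integrable_on UNIV"
  using kernel_continuous(2)[OF assms(1,2) open_UNIV subset_UNIV assms(3)] by simp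

lemma kernel_integral_le:
  fixes k f :: "complex \<Rightarrow> real"
  assumes "continuous_on UNIV k" "\<And>z. norm z \<ge> 1 \<Longrightarrow> k z = 0" "\<And>z. \<bar>k z\<bar> \<le> 1"
    and "continuous_on UNIV f" "\<And>z. norm z < 1 \<Longrightarrow> \<bar>f z\<bar> \<le> B" "B \<ge> 0"
  shows "\<bar>integral UNIV (\<lambda>z. k z * f z)\<bar> \<le> 4 * B"
  using kernel_integral_bound[OF assms(1,2,3) open_UNIV subset_UNIV assms(4)] assms(5,6) by simp

text \<open>Substitution y = w + T z; the factor 1 / T^2 is the Jacobian.\<close>

lemma curl_kernel_bound:
  assumes k: "continuous_on UNIV k" "\<And>z. norm z \<ge> 1 \<Longrightarrow> k z = 0" "\<And>z. 0 \<le> k z \<and> k z \<le> 1"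
    and T: "T > 0" "norm w + T \<le> R"
  shows "integral UNIV (\<lambda>z. k z * \<bar>qs (w + T *\<^sub>R z) - pt (w + T *\<^sub>R z)\<bar>) \<le> \<eta> / T\<^sup>2"
proof -
  define f where "f y = k ((y - w) /\<^sub>R T) * \<bar>qs y - pt y\<bar>" for y
  have fc: "continuous_on UNIV f"
    unfolding f_def by (intro continuous_intros continuous_on_compose2[OF k(1)] cq cp) auto
  have k0: "k ((y - w) /\<^sub>R T) = 0" if "norm (y - w) \<ge> T" for y
  proof (rule k(2))
    have "norm ((y - w) /\<^sub>R T) = norm (y - w) / T" using T unfolding norm_scaleR by (simp add: field_simps)
    then show "1 \<le> norm ((y - w) /\<^sub>R T)" using that T by simp
  qed
  have out: "T \<le> norm (y - w)" if "norm y \<ge> R" for y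
    using that T norm_triangle_ineq2[of y w] by linarith
  have "integral UNIV (\<lambda>z. f (w + T *\<^sub>R z)) = integral UNIV f /\<^sub>R T\<^sup>2"
    by (rule integral_compact_support_affine[where r=R]) (use fc T k0 out in \<open>auto simp: f_def\<close>)
  moreover have "integral UNIV f \<le> 1 * \<eta>"
  proof (rule integral_le_nn_integral_bound[where S="cball 0 R" and r=R])
    show "f z \<le> 1 * \<bar>qs z - pt z\<bar>" for z
      using k(3)[of "(z - w) /\<^sub>R T"] mult_right_mono[of "k ((z - w) /\<^sub>R T)" 1 "\<bar>qs z - pt z\<bar>"] by (simp add: f_def)
  qed (use fc k k0 out \<eta> in \<open>auto simp: f_def\<close>)
  ultimately show ?thesis
    using T by (simp add: f_def divide_right_mono divide_inverse mult.commute)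
qed

lemma a_Lipschitz:
  assumes "norm z \<le> R" "norm w \<le> R"
  shows "\<bar>a z - a w\<bar> \<le> 2 * K * norm (z - w)"
proof -
  have "norm (a z - a w) \<le> 2 * K * norm (z - w)"
  proof (rule differentiable_bound[where S="cball 0 R"])
    show "(a has_derivative (\<lambda>h. Re h *\<^sub>R a1 x + Im h *\<^sub>R a2 x)) (at x within cball 0 R)" for x
      using ca(4)[of x] by (auto intro: has_derivative_at_withinI)
    show "onorm (\<lambda>h. Re h *\<^sub>R a1 x + Im h *\<^sub>R a2 x) \<le> 2 * K" if "x \<in> cball 0 R" for x
    proof (rule onorm_le)
      fix h :: complex
      have "\<bar>Re h * a1 x\<bar> \<le> norm h * K" "\<bar>Im h * a2 x\<bar> \<le> norm h * K"
        unfolding abs_mult using that by (auto intro!: mult_mono abs_Re_le_cmod abs_Im_le_cmod K)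
      then show "norm (Re h *\<^sub>R a1 x + Im h *\<^sub>R a2 x) \<le> 2 * K * norm h" by (simp add: algebra_simps)
    qed
  qed (use assms in auto)
  then show ?thesis by simp
qed

abbreviation "c \<equiv> integral UNIV (bmp 2)"

text \<open>The derivative of the average in its radius t is a flux of the gradient. Replacing (a1,
  a2) by (q, -p) costs \<open>\<theta>\<close>, and integration by parts turns the remaining flux
  into an integral of qs - pt. That bound is of size \<eta> / t, not integrable at 0, so radii below
  \<open>\<tau>\<close> are handled by the Lipschitz bound of \<open>a\<close> instead.\<close>

lemma mean_value:
  assumes T: "0 < \<tau>" "\<tau> \<le> T" "norm w + T \<le> R"
  shows "\<bar>integral UNIV (\<lambda>z. bmp 2 z * a (w + T *\<^sub>R z)) - c * a w\<bar> \<le> 8 * K * \<tau> + T * (8 * \<theta> + \<eta> / (6 * \<tau>))"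
proof -
  interpret b3: kernel "bmp 3" "\<lambda>z. - 6 * Re z * bmp 2 z" "\<lambda>z. - 6 * Im z * bmp 2 z"
    using kernel_bmp[of 3] by simp
  define A where "A t = integral UNIV (\<lambda>z. bmp 2 z * a (w + t *\<^sub>R z))" for t
  define A' where "A' t = integral UNIV (\<lambda>z. bmp 2 z * (Re z * a1 (w + t *\<^sub>R z) + Im z * a2 (w + t *\<^sub>R z)))" for t
  have b2c: "continuous_on UNIV (bmp 2)" by (intro continuous_intros)
  have dA: "(A has_vector_derivative A' t) (at t)" for t
    using kernel_param_derivative[OF b2c _ open_UNIV a open_UNIV, where c=w and T=t]
    by (simp add: A_def[abs_def] A'_def bmp_eq_0)
  have in_ball: "norm (w + t *\<^sub>R z) \<le> R" if "norm z < 1" "0 \<le> t" "t \<le> T" for z t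
  proof -
    have "norm (t *\<^sub>R z) \<le> t" using that by (intro norm_scaleR_le) auto
    then show ?thesis using norm_triangle_ineq[of w "t *\<^sub>R z"] that T by linarith
  qed
  have A'b: "\<bar>A' t\<bar> \<le> 8 * \<theta> + \<eta> / (6 * \<tau>)" if t: "\<tau> \<le> t" "t \<le> T" for t
  proof -
    have t0: "t > 0" using t T by linarith
    have aff: "C1_on UNIV (\<lambda>z. f (w + t *\<^sub>R z)) (\<lambda>z. t *\<^sub>R fs (w + t *\<^sub>R z)) (\<lambda>z. t *\<^sub>R ft (w + t *\<^sub>R z))"
      if "C1_on UNIV f fs ft" for f fs ft :: "complex \<Rightarrow> real" by (rule C1_on_affine[OF that]) simp
    \<comment> \<open>\<open>E1\<close> and \<open>E2\<close> are the replacement errors;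
      \<open>Q - P\<close> is the flux of p ds + q dt.\<close>
    define E1 where "E1 = integral UNIV (\<lambda>z. (bmp 2 z * Re z) * (a1 (w + t *\<^sub>R z) - q (w + t *\<^sub>R z)))"
    define E2 where "E2 = integral UNIV (\<lambda>z. (bmp 2 z * Im z) * (a2 (w + t *\<^sub>R z) + p (w + t *\<^sub>R z)))"
    define Q where "Q = integral UNIV (\<lambda>z. (bmp 2 z * Re z) * q (w + t *\<^sub>R z))"
    define P where "P = integral UNIV (\<lambda>z. (bmp 2 z * Im z) * p (w + t *\<^sub>R z))"
    have kR: "continuous_on UNIV (\<lambda>z. bmp 2 z * Re z)" "\<And>z. norm z \<ge> 1 \<Longrightarrow> bmp 2 z * Re z = 0" "\<bar>bmp 2 z * Re z\<bar> \<le> 1"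
      and kI: "continuous_on UNIV (\<lambda>z. bmp 2 z * Im z)" "\<And>z. norm z \<ge> 1 \<Longrightarrow> bmp 2 z * Im z = 0" "\<bar>bmp 2 z * Im z\<bar> \<le> 1" for z
    proof -
      show "\<bar>bmp 2 z * Re z\<bar> \<le> 1" "\<bar>bmp 2 z * Im z\<bar> \<le> 1"
        using bmp_le_1[of 2 z] abs_Re_le_cmod[of z] abs_Im_le_cmod[of z]
        by (cases "norm z < 1"; auto simp: abs_mult bmp_eq_0 intro!: mult_le_one)+
    qed (auto simp: bmp_eq_0 intro!: continuous_intros)
    note ki = kernel_integrable[OF kR(1,2)] kernel_integrable[OF kI(1,2)]
    note cc = continuous_affine[OF ca(1)] continuous_affine[OF ca(2)] continuous_affine[OF cq(3)] continuous_affine[OF cp(3)]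
    have "A' t = E1 + Q + (E2 - P)"
    proof -
      have "((\<lambda>z. (bmp 2 z * Re z) * (a1 (w + t *\<^sub>R z) - q (w + t *\<^sub>R z)) + (bmp 2 z * Re z) * q (w + t *\<^sub>R z)
         + ((bmp 2 z * Im z) * (a2 (w + t *\<^sub>R z) + p (w + t *\<^sub>R z)) - (bmp 2 z * Im z) * p (w + t *\<^sub>R z))) has_integral
         (E1 + Q + (E2 - P))) UNIV"
        unfolding E1_def E2_def P_def Q_def
        by (intro has_integral_add has_integral_diff integrable_integral ki continuous_on_diff continuous_on_add cc)
      then have "((\<lambda>z. bmp 2 z * (Re z * a1 (w + t *\<^sub>R z) + Im z * a2 (w + t *\<^sub>R z))) has_integral (E1 + Q + (E2 - P))) UNIV"
        by (rule has_integral_eq[rotated]) (simp add: algebra_simps)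
      then show ?thesis by (simp add: A'_def integral_unique)
    qed
    moreover have "\<bar>E1\<bar> \<le> 4 * \<theta>" "\<bar>E2\<bar> \<le> 4 * \<theta>"
      unfolding E1_def E2_def using t0 t \<theta>0
      by (intro kernel_integral_le kR kI continuous_on_diff continuous_on_add cc \<theta> in_ball; simp)+
    moreover have "\<bar>Q - P\<bar> \<le> \<eta> / (6 * t)"
    proof -
      \<comment> \<open>z times bmp 2 is minus one sixth of the gradient of bmp 3, so the radial
        moments become integrals of qs and pt.\<close>
      have "t * integral UNIV (\<lambda>z. bmp 3 z * qs (w + t *\<^sub>R z)) = 6 * Q"
        using b3.ibp(1)[OF open_UNIV subset_UNIV aff[OF q]]
        by (simp add: Q_def mult_ac flip: integral_mult_right)
      moreover have "t * integral UNIV (\<lambda>z. bmp 3 z * pt (w + t *\<^sub>R z)) = 6 * P"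
        using b3.ibp(2)[OF open_UNIV subset_UNIV aff[OF p]]
        by (simp add: P_def mult_ac flip: integral_mult_right)
      moreover have "integral UNIV (\<lambda>z. bmp 3 z * (qs (w + t *\<^sub>R z) - pt (w + t *\<^sub>R z))) =
          integral UNIV (\<lambda>z. bmp 3 z * qs (w + t *\<^sub>R z)) - integral UNIV (\<lambda>z. bmp 3 z * pt (w + t *\<^sub>R z))"
        unfolding right_diff_distrib
        by (intro integral_diff kernel_integrable b3.cont b3.zero continuous_affine cq cp)
      ultimately have "6 * (Q - P) = t * integral UNIV (\<lambda>z. bmp 3 z * (qs (w + t *\<^sub>R z) - pt (w + t *\<^sub>R z)))"
        by (simp add: right_diff_distrib)
      moreover have "norm (integral UNIV (\<lambda>z. bmp 3 z * (qs (w + t *\<^sub>R z) - pt (w + t *\<^sub>R z)))) \<le>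
          integral UNIV (\<lambda>z. bmp 3 z * \<bar>qs (w + t *\<^sub>R z) - pt (w + t *\<^sub>R z)\<bar>)"
        by (intro integral_norm_bound_integral kernel_integrable b3.cont b3.zero continuous_on_diff continuous_on_rabs continuous_affine cq cp)
           (simp_all add: abs_mult)
      moreover have "integral UNIV (\<lambda>z. bmp 3 z * \<bar>qs (w + t *\<^sub>R z) - pt (w + t *\<^sub>R z)\<bar>) \<le> \<eta> / t\<^sup>2"
        by (rule curl_kernel_bound) (use b3.cont b3.zero bmp_le_1 t0 t T in auto)
      moreover define X where "X = integral UNIV (\<lambda>z. bmp 3 z * (qs (w + t *\<^sub>R z) - pt (w + t *\<^sub>R z)))"
      ultimately have e: "6 * (Q - P) = t * X" and X: "norm X \<le> \<eta> / t\<^sup>2" by simp_all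
      have "6 * \<bar>Q - P\<bar> = \<bar>6 * (Q - P)\<bar>" by (simp only: abs_mult abs_numeral)
      also have "\<dots> = t * \<bar>X\<bar>" unfolding e using t0 by (simp add: abs_mult)
      also have "\<dots> \<le> t * (\<eta> / t\<^sup>2)" using t0 X by (intro mult_left_mono) auto
      finally have "6 * \<bar>Q - P\<bar> \<le> t * (\<eta> / t\<^sup>2)" .
      then show ?thesis using t0 by (simp add: power2_eq_square field_simps)
    qed
    moreover have "\<eta> / (6 * t) \<le> \<eta> / (6 * \<tau>)"
      using t T \<eta>(2) by (intro divide_left_mono) auto
    ultimately show ?thesis by linarith
  qed
  have "norm (A T - A \<tau>) \<le> (8 * \<theta> + \<eta> / (6 * \<tau>)) * norm (T - \<tau>)"
  proof (rule differentiable_bound[where S="{\<tau>..T}"])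
    show "(A has_derivative (\<lambda>h. h *\<^sub>R A' x)) (at x within {\<tau>..T})" for x
      using dA[of x] by (auto simp: has_vector_derivative_def intro: has_derivative_at_withinI)
    show "onorm (\<lambda>h. h *\<^sub>R A' x) \<le> 8 * \<theta> + \<eta> / (6 * \<tau>)" if "x \<in> {\<tau>..T}" for x
      by (rule onorm_le) (use A'b[of x] that in \<open>simp add: abs_mult mult.commute mult_left_mono\<close>)
  qed (use T in auto)
  also have "\<dots> \<le> (8 * \<theta> + \<eta> / (6 * \<tau>)) * T"
    using T \<theta>0 \<eta>(2) by (intro mult_left_mono) auto
  finally have 1: "\<bar>A T - A \<tau>\<bar> \<le> T * (8 * \<theta> + \<eta> / (6 * \<tau>))" by (simp add: mult.commute)
  \<comment> \<open>At the innermost radius the average is compared with the value at the centre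
    through the Lipschitz constant 2 K.\<close>
  have "A \<tau> - c * a w = integral UNIV (\<lambda>z. bmp 2 z * (a (w + \<tau> *\<^sub>R z) - a w))"
  proof -
    have "((\<lambda>z. bmp 2 z * a (w + \<tau> *\<^sub>R z) - bmp 2 z * a w) has_integral (A \<tau> - c * a w)) UNIV"
      unfolding A_def
      by (intro has_integral_diff has_integral_mult_left integrable_integral kernel_integrable b2c continuous_affine ca bmp_integrable)
         (auto simp: bmp_eq_0)
    then show ?thesis by (simp add: right_diff_distrib integral_unique)
  qed
  moreover have "\<bar>integral UNIV (\<lambda>z. bmp 2 z * (a (w + \<tau> *\<^sub>R z) - a w))\<bar> \<le> 4 * (2 * K * \<tau>)"
  proof (rule kernel_integral_le)
    show "\<bar>a (w + \<tau> *\<^sub>R z) - a w\<bar> \<le> 2 * K * \<tau>" if "norm z < 1" for z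
    proof -
      have "\<bar>a (w + \<tau> *\<^sub>R z) - a w\<bar> \<le> 2 * K * norm (\<tau> *\<^sub>R z)"
        using a_Lipschitz[OF in_ball[OF that, of \<tau>], of w] T by simp
      also have "\<dots> \<le> 2 * K * (\<tau> * 1)"
        using that T K0 norm_scaleR_le[of \<tau> z] by (intro mult_left_mono) auto
      finally show ?thesis by simp
    qed
  qed (use T K0 bmp_le_1 in \<open>auto simp: bmp_eq_0 intro!: continuous_intros continuous_affine ca\<close>)
  ultimately show ?thesis using 1 unfolding A_def[symmetric] by linarith
qed

text \<open>The slope is the average of the gradient at the large scale T. Averages of
  \<open>a\<close> at scale T stay close to c times \<open>a\<close> by the mean value estimate, and
  their gradient hardly varies for |w| \<le> L, because moving the centre by w moves the normalised
  kernel only by w / T. The errors pull in opposite directions: T has to be large against L^2, then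
  \<theta> and \<eta> small against 1 / T.\<close>

lemma slope_exists:
  assumes T: "0 < \<tau>" "\<tau> \<le> T" "L \<le> T" "2 * T \<le> R" "L \<ge> 0"
  obtains m1 m2 where
    "\<And>z. norm z \<le> L \<Longrightarrow> c * \<bar>a z - a 0 - (m1 * Re z + m2 * Im z)\<bar> \<le>
      2 * (8 * K * \<tau> + T * (8 * \<theta> + \<eta> / (6 * \<tau>))) + 128 * K * L\<^sup>2 / T"
proof -
  define m1 where "m1 = integral UNIV (\<lambda>z. bmp 2 z * a1 (T *\<^sub>R z)) / c"
  define m2 where "m2 = integral UNIV (\<lambda>z. bmp 2 z * a2 (T *\<^sub>R z)) / c"
  define G where "G w = integral UNIV (\<lambda>z. bmp 2 z * a (w + T *\<^sub>R z))" for w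
  define \<beta> where "\<beta> = 8 * K * \<tau> + T * (8 * \<theta> + \<eta> / (6 * \<tau>))"
  have T0: "T > 0" using T by linarith
  have b2c: "continuous_on S (bmp 2)" for S
    using continuous_on_bmp[OF continuous_on_id, of S 2] by (simp add: id_def)
  have "c * \<bar>a w - a 0 - (m1 * Re w + m2 * Im w)\<bar> \<le> 2 * \<beta> + 128 * K * L\<^sup>2 / T" if w: "norm w \<le> L" for w
  proof -
    define D where "D y = Re w * a1 y + Im w * a2 y" for y
    have Dc: "continuous_on UNIV D" unfolding D_def by (intro continuous_intros ca)
    have Db: "\<bar>D y\<bar> \<le> 2 * K * norm w" if "norm y \<le> R" for y
    proof -
      have "\<bar>Re w * a1 y\<bar> \<le> norm w * K" "\<bar>Im w * a2 y\<bar> \<le> norm w * K"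
        unfolding abs_mult using that by (auto intro!: mult_mono abs_Re_le_cmod abs_Im_le_cmod K)
      then show ?thesis unfolding D_def by (simp add: algebra_simps abs_le_iff)
    qed
    define g where "g t = integral UNIV (\<lambda>z. bmp 2 z * D (t *\<^sub>R w + T *\<^sub>R z))" for t :: real
    have dG: "((\<lambda>t. G (t *\<^sub>R w)) has_vector_derivative g t) (at t within {0..1})" if "t \<in> {0..1}" for t
    proof -
      have e: "integral (qbox 1) (\<lambda>z. bmp 2 z * f (s *\<^sub>R w + T *\<^sub>R z)) = integral UNIV (\<lambda>z. bmp 2 z * f (s *\<^sub>R w + T *\<^sub>R z))"
        if "continuous_on UNIV f" for f :: "complex \<Rightarrow> real" and s :: real
        by (rule compact_support_integrable(2)[where r=1, symmetric])
           (auto simp: bmp_eq_0 intro!: continuous_intros continuous_affine that)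
      have "((\<lambda>t. integral (qbox 1) (\<lambda>z. bmp 2 z * a (t *\<^sub>R w + T *\<^sub>R z))) has_vector_derivative
          integral (qbox 1) (\<lambda>z. bmp 2 z * D (t *\<^sub>R w + T *\<^sub>R z))) (at t within {0..1})"
        unfolding qbox_def
      proof (rule leibniz_rule_vector_derivative)
        show "((\<lambda>x. bmp 2 z * a (x *\<^sub>R w + T *\<^sub>R z)) has_vector_derivative bmp 2 z * D (x *\<^sub>R w + T *\<^sub>R z)) (at x within {0..1})" for x z
        proof -
          have "((\<lambda>x. a (T *\<^sub>R z + x *\<^sub>R w)) has_vector_derivative Re w *\<^sub>R a1 (T *\<^sub>R z + x *\<^sub>R w) + Im w *\<^sub>R a2 (T *\<^sub>R z + x *\<^sub>R w)) (at x within {0..1})"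
            by (rule C1_on_has_derivative_along[OF a]) simp
          then have "((\<lambda>x. bmp 2 z * a (T *\<^sub>R z + x *\<^sub>R w)) has_vector_derivative bmp 2 z * D (T *\<^sub>R z + x *\<^sub>R w)) (at x within {0..1})"
            unfolding D_def real_scaleR_def by (rule has_vector_derivative_mult_right)
          then show ?thesis by (simp only: add.commute)
        qed
        show "(\<lambda>z. bmp 2 z * a (x *\<^sub>R w + T *\<^sub>R z)) integrable_on cbox (Complex (- 1) (- 1)) (Complex 1 1)" for x :: real
          by (intro integrable_continuous continuous_on_mult b2c continuous_on_subset[OF continuous_affine[OF ca(3)]]) auto
        show "continuous_on ({0..1} \<times> cbox (Complex (- 1) (- 1)) (Complex 1 1)) (\<lambda>(x, z). bmp 2 z * D (x *\<^sub>R w + T *\<^sub>R z))"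
          unfolding split_beta
          by (intro continuous_intros continuous_on_compose2[OF Dc]) auto
      qed (use that in auto)
      then show ?thesis unfolding e[OF Dc] e[OF ca(3)] G_def g_def .
    qed
    have gd: "\<bar>g t - g 0\<bar> \<le> 128 * K * L\<^sup>2 / T" if t: "t \<in> {0..1}" for t
    proof -
      \<comment> \<open>Displacement of the centre in the rescaled variable; its norm is at most 1,
        so both kernels are supported in the disc of radius 2.\<close>
      define v where "v = (t / T) *\<^sub>R w"
      have v: "norm v \<le> norm w / T" "norm v \<le> 1" "T *\<^sub>R v = t *\<^sub>R w"
      proof -
        have "norm v = t * (norm w / T)" using t T0 by (simp add: v_def)
        also have "\<dots> \<le> 1 * (norm w / T)" using t T0 by (intro mult_right_mono) auto
        finally show "norm v \<le> norm w / T" by simp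
        also have "\<dots> \<le> 1" using w T T0 by simp
        finally show "norm v \<le> 1" .
        show "T *\<^sub>R v = t *\<^sub>R w" using T0 by (simp add: v_def)
      qed
      define f where "f y = bmp 2 (y - v) * D (T *\<^sub>R y)" for y
      have DT: "continuous_on UNIV (\<lambda>y. D (T *\<^sub>R y))" using continuous_affine[OF Dc, of 0 T] by simp
      have fc: "continuous_on UNIV f" unfolding f_def by (intro continuous_intros DT)
      have n2: "norm (y - v) \<ge> 1" "norm y \<ge> 1" if "norm y > 2" for y
        using that norm_triangle_ineq2[of y v] v(2) by linarith+
      have f0: "f y = 0" if "norm y > 2" for y using n2[OF that] by (simp add: f_def bmp_eq_0)
      have "f (v + 1 *\<^sub>R z) = bmp 2 z * D (t *\<^sub>R w + T *\<^sub>R z)" for z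
        by (simp add: f_def scaleR_add_right v(3))
      then have "g t = integral UNIV (\<lambda>z. f (v + 1 *\<^sub>R z))" unfolding g_def by (simp only:)
      also have "\<dots> = integral UNIV f /\<^sub>R 1\<^sup>2"
        by (rule integral_compact_support_affine[OF fc f0]) auto
      finally have gt: "g t = integral UNIV f" by simp
      have f0c: "continuous_on UNIV (\<lambda>y. bmp 2 y * D (T *\<^sub>R y))" by (intro continuous_intros DT)
      have g00: "g 0 = integral UNIV (\<lambda>y. bmp 2 y * D (T *\<^sub>R y))" by (simp add: g_def)
      have "g t - g 0 = integral UNIV (\<lambda>y. f y - bmp 2 y * D (T *\<^sub>R y))"
        unfolding gt g00
        by (intro integral_diff[symmetric] compact_support_integrable(1)[OF fc f0] compact_support_integrable(1)[OF f0c, of 2])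
           (simp_all add: bmp_eq_0)
      \<comment> \<open>Lipschitz constant 4 of the kernel times |v| \<le> L / T, times the bound 2
        K L of the directional derivative, times the area 16 of the square of half-width 2.\<close>
      moreover have "norm (integral UNIV (\<lambda>y. f y - bmp 2 y * D (T *\<^sub>R y))) \<le> (4 * (L / T) * (2 * K * L)) * (4 * 2\<^sup>2)"
      proof (rule integral_compact_support_bound)
        show "continuous_on UNIV (\<lambda>y. f y - bmp 2 y * D (T *\<^sub>R y))" by (intro continuous_intros fc f0c)
        show z: "f y - bmp 2 y * D (T *\<^sub>R y) = 0" if "norm y > 2" for y
          using f0[OF that] n2[OF that] by (simp add: bmp_eq_0)
        show "norm (f y - bmp 2 y * D (T *\<^sub>R y)) \<le> 4 * (L / T) * (2 * K * L)" for y
        proof (cases "norm y > 2")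
          case True
          then show ?thesis using z[OF True] K0 T T0 by simp
        next
          case False
          have "norm (T *\<^sub>R y) \<le> R" 
          proof -
            have "T * norm y \<le> T * 2" using False T0 by (intro mult_left_mono) auto
            then have "T * norm y \<le> R" using T by linarith
            then show ?thesis using T0 by simp
          qed
          then have d: "\<bar>D (T *\<^sub>R y)\<bar> \<le> 2 * K * L" using Db w K0 mult_left_mono[of "norm w" L "2 * K"] by (meson order_trans mult_nonneg_nonneg zero_le_numeral)
          have "\<bar>bmp 2 (y - v) - bmp 2 y\<bar> \<le> 4 * norm (y - v - y)" by (rule bmp2_Lipschitz)
          also have "\<dots> = 4 * norm v" by simp
          also have "norm v \<le> L / T" using v(1) w T0 by (meson divide_right_mono order_trans less_imp_le)
          finally have e: "\<bar>bmp 2 (y - v) - bmp 2 y\<bar> \<le> 4 * (L / T)" by simp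
          have "norm (f y - bmp 2 y * D (T *\<^sub>R y)) = \<bar>bmp 2 (y - v) - bmp 2 y\<bar> * \<bar>D (T *\<^sub>R y)\<bar>"
            by (simp add: f_def abs_mult[symmetric] left_diff_distrib)
          also have "\<dots> \<le> 4 * (L / T) * (2 * K * L)"
            by (rule mult_mono[OF e d]) (use T T0 in auto)
          finally show ?thesis .
        qed
      qed auto
      moreover have "(4 * (L / T) * (2 * K * L)) * (4 * 2\<^sup>2) = 128 * K * L\<^sup>2 / T" by (simp add: power2_eq_square)
      ultimately show ?thesis by (simp only: real_norm_def)
    qed
    have g0: "g 0 = c * (m1 * Re w + m2 * Im w)"
    proof -
      have "((\<lambda>z. Re w * (bmp 2 z * a1 (T *\<^sub>R z)) + Im w * (bmp 2 z * a2 (T *\<^sub>R z))) has_integral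
          (Re w * (c * m1) + Im w * (c * m2))) UNIV"
      proof (intro has_integral_add has_integral_mult_right)
        have "(\<lambda>z. bmp 2 z * f (0 + T *\<^sub>R z)) integrable_on UNIV" if "continuous_on UNIV f" for f
          by (intro kernel_integrable b2c continuous_affine that) (auto simp: bmp_eq_0)
        from this[OF ca(1)] this[OF ca(2)]
        show "((\<lambda>z. bmp 2 z * a1 (T *\<^sub>R z)) has_integral (c * m1)) UNIV" "((\<lambda>z. bmp 2 z * a2 (T *\<^sub>R z)) has_integral (c * m2)) UNIV"
          using bmp_integral_pos[OF pos2] by (simp_all add: m1_def m2_def has_integral_integral)
      qed
      moreover have "(\<lambda>z. Re w * (bmp 2 z * a1 (T *\<^sub>R z)) + Im w * (bmp 2 z * a2 (T *\<^sub>R z))) = (\<lambda>z. bmp 2 z * D (0 *\<^sub>R w + T *\<^sub>R z))"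
        by (simp add: D_def algebra_simps)
      ultimately show ?thesis by (simp add: g_def integral_unique algebra_simps)
    qed
    define H where "H t = G (t *\<^sub>R w) - t *\<^sub>R g 0" for t :: real
    have "norm (H 1 - H 0) \<le> 128 * K * L\<^sup>2 / T * norm (1 - 0 :: real)"
    proof (rule differentiable_bound[where S="{0..1}"])
      show "(H has_derivative (\<lambda>h. h *\<^sub>R (g x - g 0))) (at x within {0..1})" if "x \<in> {0..1}" for x
        using dG[OF that] unfolding H_def has_vector_derivative_def
        by (auto intro!: derivative_eq_intros simp: algebra_simps)
      show "onorm (\<lambda>h. h *\<^sub>R (g x - g 0)) \<le> 128 * K * L\<^sup>2 / T" if "x \<in> {0..1}" for x
        by (rule onorm_le, unfold real_norm_def real_scaleR_def abs_mult, subst mult.commute)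
           (intro mult_right_mono gd that abs_ge_zero)
    qed auto
    then have "\<bar>G w - G 0 - c * (m1 * Re w + m2 * Im w)\<bar> \<le> 128 * K * L\<^sup>2 / T"
      by (simp add: H_def g0 algebra_simps)
    moreover have "\<bar>G w - c * a w\<bar> \<le> \<beta>" "\<bar>G 0 - c * a 0\<bar> \<le> \<beta>"
      unfolding G_def \<beta>_def by (rule mean_value; use T w T0 in simp)+
    moreover have "c * \<bar>a w - a 0 - (m1 * Re w + m2 * Im w)\<bar> = \<bar>c * a w - c * a 0 - c * (m1 * Re w + m2 * Im w)\<bar>"
    proof -
      have "c * \<bar>x\<bar> = \<bar>c * x\<bar>" for x using bmp_integral_pos[OF pos2] by (simp add: abs_mult)
      then show ?thesis by (simp only: right_diff_distrib)
    qed
    ultimately show ?thesis by linarith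
  qed
  then show ?thesis unfolding \<beta>_def by (rule that)
qed

end

section \<open>Energy estimates for near-harmonic functions\<close>

context near_harmonic begin

text \<open>Caccioppoli's argument: the form p ds + q dt is tested against a - a 0 times a cutoff on
  the disc of radius 2. The expression a1 q - a2 p is nearly the squared gradient, and integration
  by parts leaves only terms that carry a - a 0 or \<theta>.\<close>

lemma gradient_integral_small_oscillation:
  assumes R2: "2 \<le> R" and \<gamma>: "\<And>z. norm z \<le> 2 \<Longrightarrow> \<bar>a z - a 0\<bar> \<le> \<gamma>"
  shows "(\<integral>\<^sup>+z\<in>cball 0 1. ennreal ((a1 z)\<^sup>2 + (a2 z)\<^sup>2) \<partial>lborel) \<le> ennreal (64 / 9 * (\<gamma> * \<eta> / 4 + 16 * \<gamma> * (K + \<theta>) + 8 * K * \<theta>))"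
proof -
  interpret b2: kernel "bmp 2" "\<lambda>z. - 4 * Re z * bmp 1 z" "\<lambda>z. - 4 * Im z * bmp 1 z"
    using kernel_bmp[of 2] by simp
  have \<gamma>0: "\<gamma> \<ge> 0" using \<gamma>[of 0] by simp
  define f where "f z = a z - a 0" for z
  have f: "C1_on UNIV f a1 a2" unfolding f_def by (rule C1_on_diff_const[OF a])
  note cf = C1_onD[OF f]
  have aff: "C1_on UNIV (\<lambda>z. g (2 *\<^sub>R z)) (\<lambda>z. 2 *\<^sub>R gs (2 *\<^sub>R z)) (\<lambda>z. 2 *\<^sub>R gt (2 *\<^sub>R z))"
    if "C1_on UNIV g gs gt" for g gs gt :: "complex \<Rightarrow> real"
    using C1_on_affine[OF that, of UNIV 0 2] by simp
  have c2: "continuous_on UNIV g \<Longrightarrow> continuous_on UNIV (\<lambda>z. g (2 *\<^sub>R z))" for g :: "complex \<Rightarrow> real"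
    using continuous_affine[of g 0 2] by simp
  have in2: "norm (2 *\<^sub>R z) \<le> 2" "norm (2 *\<^sub>R z) \<le> R" if "norm z < 1" for z :: complex using that R2 by simp_all
  note ki = kernel_integrable[OF b2.cont(1) b2.zero(1)]
  \<comment> \<open>Cutoff integrals of the s-derivative of (a - a 0) q and of the t-derivative of
    (a - a 0) p. Below, \<open>Y\<close> is the part containing qs - pt and \<open>Z\<close> is what
    remains.\<close>
  define Xq where "Xq = integral UNIV (\<lambda>z. bmp 2 z * (a1 (2 *\<^sub>R z) * q (2 *\<^sub>R z) + f (2 *\<^sub>R z) * qs (2 *\<^sub>R z)))"
  define Xp where "Xp = integral UNIV (\<lambda>z. bmp 2 z * (a2 (2 *\<^sub>R z) * p (2 *\<^sub>R z) + f (2 *\<^sub>R z) * pt (2 *\<^sub>R z)))"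
  have neg4: "- integral UNIV (\<lambda>z. (- 4 * g z * bmp 1 z) *\<^sub>R h z) = 4 * integral UNIV (\<lambda>z. (bmp 1 z * g z) * h z)" for g h :: "complex \<Rightarrow> real"
  proof -
    have "integral UNIV (\<lambda>z. (- 4 * g z * bmp 1 z) *\<^sub>R h z) = (- 4) * integral UNIV (\<lambda>z. (bmp 1 z * g z) * h z)"
      by (subst integral_mult_right[symmetric]) (simp add: mult_ac)
    then show ?thesis by simp
  qed
  have two: "integral UNIV (\<lambda>z. bmp 2 z *\<^sub>R 2 *\<^sub>R h z) = 2 * integral UNIV (\<lambda>z. bmp 2 z * h z)" for h :: "complex \<Rightarrow> real"
    by (subst integral_mult_right[symmetric]) (simp add: mult_ac)
  have Xq: "Xq = 2 * integral UNIV (\<lambda>z. (bmp 1 z * Re z) * (f (2 *\<^sub>R z) * q (2 *\<^sub>R z)))"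
    using b2.ibp(1)[OF open_UNIV subset_UNIV aff[OF C1_on_mult[OF f q]]] unfolding neg4 two Xq_def by simp
  have Xp: "Xp = 2 * integral UNIV (\<lambda>z. (bmp 1 z * Im z) * (f (2 *\<^sub>R z) * p (2 *\<^sub>R z)))"
    using b2.ibp(2)[OF open_UNIV subset_UNIV aff[OF C1_on_mult[OF f p]]] unfolding neg4 two Xp_def by simp
  have b: "\<bar>integral UNIV (\<lambda>z. (bmp 1 z * g z) * (f (2 *\<^sub>R z) * h (2 *\<^sub>R z)))\<bar> \<le> 4 * (\<gamma> * (K + \<theta>))"
    if g: "continuous_on UNIV g" "\<And>z. \<bar>g z\<bar> \<le> norm z" and h: "continuous_on UNIV h" "\<And>z. norm z \<le> R \<Longrightarrow> \<bar>h z\<bar> \<le> K + \<theta>" for g h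
  proof (rule kernel_integral_le)
    show "\<bar>bmp 1 z * g z\<bar> \<le> 1" for z
      using bmp_le_1[of 1 z] g(2)[of z] by (cases "norm z < 1") (auto simp: abs_mult bmp_eq_0 intro!: mult_le_one)
    show "\<bar>f (2 *\<^sub>R z) * h (2 *\<^sub>R z)\<bar> \<le> \<gamma> * (K + \<theta>)" if "norm z < 1" for z
      unfolding abs_mult f_def using \<gamma>0 by (intro mult_mono \<gamma> h(2) in2 that) auto
  qed (use \<gamma>0 K0 \<theta>0 g h in \<open>auto simp: bmp_eq_0 intro!: continuous_intros c2 cf\<close>)
  have pq: "\<bar>q z\<bar> \<le> K + \<theta>" "\<bar>p z\<bar> \<le> K + \<theta>" if "norm z \<le> R" for z
    using K[OF that] \<theta>[OF that] by linarith+
  have "\<bar>Xq\<bar> \<le> 8 * (\<gamma> * (K + \<theta>))"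
    unfolding Xq using b[OF C1_onD(3)[OF C1_on_Re_Im(1)] abs_Re_le_cmod cq(3) pq(1)] by (simp add: abs_mult)
  moreover have "\<bar>Xp\<bar> \<le> 8 * (\<gamma> * (K + \<theta>))"
    unfolding Xp using b[OF C1_onD(3)[OF C1_on_Re_Im(2)] abs_Im_le_cmod cp(3) pq(2)] by (simp add: abs_mult)
  moreover define Y where "Y = integral UNIV (\<lambda>z. bmp 2 z * (f (2 *\<^sub>R z) * (qs (2 *\<^sub>R z) - pt (2 *\<^sub>R z))))"
  have "\<bar>Y\<bar> \<le> \<gamma> * (\<eta> / 2\<^sup>2)"
  proof -
    have kk: "(\<lambda>z. bmp 2 z * \<bar>qs (2 *\<^sub>R z) - pt (2 *\<^sub>R z)\<bar>) integrable_on UNIV"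
      by (intro ki continuous_intros c2 cq cp)
    have "norm Y \<le> integral UNIV (\<lambda>z. \<gamma> * (bmp 2 z * \<bar>qs (2 *\<^sub>R z) - pt (2 *\<^sub>R z)\<bar>))"
      unfolding Y_def
    proof (rule integral_norm_bound_integral)
      show "(\<lambda>z. bmp 2 z * (f (2 *\<^sub>R z) * (qs (2 *\<^sub>R z) - pt (2 *\<^sub>R z)))) integrable_on UNIV"
        by (intro ki continuous_intros c2 cf cq cp)
      show "(\<lambda>z. \<gamma> * (bmp 2 z * \<bar>qs (2 *\<^sub>R z) - pt (2 *\<^sub>R z)\<bar>)) integrable_on UNIV"
        by (rule integrable_on_mult_right[OF kk])
      show "norm (bmp 2 z * (f (2 *\<^sub>R z) * (qs (2 *\<^sub>R z) - pt (2 *\<^sub>R z)))) \<le> \<gamma> * (bmp 2 z * \<bar>qs (2 *\<^sub>R z) - pt (2 *\<^sub>R z)\<bar>)" for z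
      proof (cases "norm z < 1")
        case True
        have "\<bar>f (2 *\<^sub>R z)\<bar> * (bmp 2 z * \<bar>qs (2 *\<^sub>R z) - pt (2 *\<^sub>R z)\<bar>) \<le> \<gamma> * (bmp 2 z * \<bar>qs (2 *\<^sub>R z) - pt (2 *\<^sub>R z)\<bar>)"
          unfolding f_def by (intro mult_right_mono \<gamma> in2 True) auto
        then show ?thesis by (simp add: abs_mult mult_ac)
      qed (simp add: bmp_eq_0)
    qed
    also have "\<dots> = \<gamma> * integral UNIV (\<lambda>z. bmp 2 z * \<bar>qs (2 *\<^sub>R z) - pt (2 *\<^sub>R z)\<bar>)" by simp
    also have "\<dots> \<le> \<gamma> * (\<eta> / 2\<^sup>2)"
      using curl_kernel_bound[OF b2.cont(1) b2.zero(1), of 2 0] bmp_le_1 R2 \<gamma>0 by (intro mult_left_mono) auto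
    finally show ?thesis by simp
  qed
  moreover define Z where "Z = integral UNIV (\<lambda>z. bmp 2 z * (a1 (2 *\<^sub>R z) * q (2 *\<^sub>R z) - a2 (2 *\<^sub>R z) * p (2 *\<^sub>R z)))"
  have "Z = Xq - Xp - Y"
  proof -
    have "((\<lambda>z. bmp 2 z * (a1 (2 *\<^sub>R z) * q (2 *\<^sub>R z) + f (2 *\<^sub>R z) * qs (2 *\<^sub>R z))
        - bmp 2 z * (a2 (2 *\<^sub>R z) * p (2 *\<^sub>R z) + f (2 *\<^sub>R z) * pt (2 *\<^sub>R z))
        - bmp 2 z * (f (2 *\<^sub>R z) * (qs (2 *\<^sub>R z) - pt (2 *\<^sub>R z)))) has_integral (Xq - Xp - Y)) UNIV"
      unfolding Xq_def Xp_def Y_def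
      by (intro has_integral_diff integrable_integral ki continuous_on_add continuous_on_diff continuous_on_mult c2 cf cq cp ca)
    then have "((\<lambda>z. bmp 2 z * (a1 (2 *\<^sub>R z) * q (2 *\<^sub>R z) - a2 (2 *\<^sub>R z) * p (2 *\<^sub>R z))) has_integral (Xq - Xp - Y)) UNIV"
      by (rule has_integral_eq[rotated]) (simp add: algebra_simps)
    then show ?thesis unfolding Z_def by (rule integral_unique)
  qed
  moreover define G where "G z = (a1 z)\<^sup>2 + (a2 z)\<^sup>2" for z
  have Gc: "continuous_on UNIV G" unfolding G_def by (intro continuous_intros ca)
  define V where "V = integral UNIV (\<lambda>z. bmp 2 z * G (2 *\<^sub>R z))"
  have "V \<le> Z + 8 * K * \<theta>"
  proof -
    have "V - Z = integral UNIV (\<lambda>z. bmp 2 z * (G (2 *\<^sub>R z) - (a1 (2 *\<^sub>R z) * q (2 *\<^sub>R z) - a2 (2 *\<^sub>R z) * p (2 *\<^sub>R z))))"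
      unfolding V_def Z_def right_diff_distrib[of "bmp 2 _" "G _"]
      by (intro integral_diff[symmetric] ki c2 Gc continuous_intros ca cq cp)
    moreover have "\<bar>integral UNIV (\<lambda>z. bmp 2 z * (G (2 *\<^sub>R z) - (a1 (2 *\<^sub>R z) * q (2 *\<^sub>R z) - a2 (2 *\<^sub>R z) * p (2 *\<^sub>R z))))\<bar> \<le> 4 * (2 * K * \<theta>)"
    proof (rule kernel_integral_le[OF b2.cont(1) b2.zero(1)])
      fix z :: complex assume z: "norm z < 1"
      have "\<bar>a1 (2 *\<^sub>R z) * (a1 (2 *\<^sub>R z) - q (2 *\<^sub>R z))\<bar> \<le> K * \<theta>" "\<bar>a2 (2 *\<^sub>R z) * (a2 (2 *\<^sub>R z) + p (2 *\<^sub>R z))\<bar> \<le> K * \<theta>"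
        unfolding abs_mult by (intro mult_mono K \<theta> in2 z; use K0 in simp)+
      moreover have "G (2 *\<^sub>R z) - (a1 (2 *\<^sub>R z) * q (2 *\<^sub>R z) - a2 (2 *\<^sub>R z) * p (2 *\<^sub>R z)) =
        a1 (2 *\<^sub>R z) * (a1 (2 *\<^sub>R z) - q (2 *\<^sub>R z)) + a2 (2 *\<^sub>R z) * (a2 (2 *\<^sub>R z) + p (2 *\<^sub>R z))"
        by (simp add: G_def algebra_simps power2_eq_square)
      ultimately show "\<bar>G (2 *\<^sub>R z) - (a1 (2 *\<^sub>R z) * q (2 *\<^sub>R z) - a2 (2 *\<^sub>R z) * p (2 *\<^sub>R z))\<bar> \<le> 2 * K * \<theta>" by linarith
    qed (use bmp_le_1 K0 \<theta>0 in \<open>auto intro!: c2 Gc continuous_intros ca cq cp\<close>)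
    ultimately show ?thesis by linarith
  qed
  ultimately have Vb: "V \<le> \<gamma> * \<eta> / 4 + 16 * \<gamma> * (K + \<theta>) + 8 * K * \<theta>" by (auto simp: abs_le_iff)
  \<comment> \<open>The same integrand in unscaled coordinates. On the unit disc the cutoff is at
    least (3/4)^2, whence 16/9; the substitution contributes the factor 4.\<close>
  define g where "g z = bmp 2 (z /\<^sub>R 2) * G z" for z
  have gc: "continuous_on UNIV g" unfolding g_def by (intro continuous_intros Gc)
  have g0: "g z = 0" if "norm z > 2" for z using that by (simp add: g_def bmp_eq_0)
  have "V = integral UNIV g /\<^sub>R 2\<^sup>2"
  proof -
    have "g (0 + 2 *\<^sub>R z) = bmp 2 z * G (2 *\<^sub>R z)" for z by (simp add: g_def)
    then show ?thesis
      using integral_compact_support_affine[OF gc g0, where m=2 and c=0] unfolding V_def by (simp only: zero_less_numeral)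
  qed
  then have gi: "(g has_integral 4 * V) UNIV"
    using compact_support_integrable(1)[OF gc g0, where r=2] by (simp add: has_integral_integral mult.commute)
  have "(\<integral>\<^sup>+z\<in>cball 0 1. ennreal (G z) \<partial>lborel) \<le> (\<integral>\<^sup>+z. ennreal (16 / 9 * g z) \<partial>lborel)"
  proof (rule nn_integral_mono)
    fix z :: complex
    have G0: "G z \<ge> 0" by (simp add: G_def)
    show "ennreal (G z) * indicator (cball 0 1) z \<le> ennreal (16 / 9 * g z)"
    proof (cases "norm z \<le> 1")
      case True
      have "(norm z)\<^sup>2 \<le> 1" using True by (simp add: power_le_one)
      then have "3 / 4 \<le> max 0 (1 - (norm (z /\<^sub>R 2))\<^sup>2)" by (simp add: power2_eq_square)
      then have "(3 / 4)\<^sup>2 \<le> bmp 2 (z /\<^sub>R 2)" unfolding bmp_def by (rule power_mono) simp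
      then have "(9 / 16) * G z \<le> g z" unfolding g_def using G0 by (intro mult_right_mono) (auto simp: power2_eq_square)
      then show ?thesis using True by (auto intro!: ennreal_leI)
    qed (auto simp: g_def G0)
  qed
  also have "\<dots> = ennreal (16 / 9 * (4 * V))"
  proof (rule nn_integral_has_integral_lborel)
    show "(\<lambda>z. 16 / 9 * g z) \<in> borel_measurable borel"
      by (intro borel_measurable_continuous_onI continuous_intros gc)
    show "((\<lambda>z. 16 / 9 * g z) has_integral 16 / 9 * (4 * V)) UNIV" by (intro has_integral_mult_right gi)
  qed (simp add: g_def G_def)
  also have "\<dots> \<le> ennreal (64 / 9 * (\<gamma> * \<eta> / 4 + 16 * \<gamma> * (K + \<theta>) + 8 * K * \<theta>))"
  proof (rule ennreal_leI)
    have "16 / 9 * (4 * V) = 64 / 9 * V" by simp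
    also have "\<dots> \<le> 64 / 9 * (\<gamma> * \<eta> / 4 + 16 * \<gamma> * (K + \<theta>) + 8 * K * \<theta>)"
      by (rule mult_left_mono[OF Vb]) simp
    finally show "16 / 9 * (4 * V) \<le> 64 / 9 * (\<gamma> * \<eta> / 4 + 16 * \<gamma> * (K + \<theta>) + 8 * K * \<theta>)" .
  qed
  finally show ?thesis by (simp add: G_def)
qed

end

context near_harmonic begin

text \<open>Two evaluations of the cutoff integral of the derivative of \<Phi>(a(L z)) in the
  direction of the slope are compared. From above, \<phi> D \<le> \<nu> h + \<phi> |\<nabla>a|^2 /
  (4 \<nu>) separates height from energy. From below, after integration by parts, \<Phi>(a(L z)) is
  half the sign of a linear function outside a thin strip, so the integral is almost c / 2 or
  more.\<close>

lemma large_slope_energy: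
  assumes L: "0 < L" "L \<le> R" and m: "m1\<^sup>2 + m2\<^sup>2 \<ge> s\<^sup>2" "s > 0"
    and b: "\<And>z. norm z \<le> L \<Longrightarrow> \<bar>a z - a 0 - (m1 * Re z + m2 * Im z)\<bar> \<le> \<beta>"
    and \<phi>: "continuous_on UNIV \<phi>" "\<And>x. (\<Phi> has_real_derivative \<phi> x) (at x)" "\<And>x. 0 \<le> \<phi> x \<and> \<phi> x \<le> h"
      "\<And>x. x \<le> a 0 - W \<Longrightarrow> \<Phi> x = - 1 / 2" "\<And>x. x \<ge> a 0 + W \<Longrightarrow> \<Phi> x = 1 / 2" "\<And>x. \<bar>\<Phi> x\<bar> \<le> 1 / 2"
    and E: "(\<integral>\<^sup>+z\<in>cball 0 R. ennreal (\<phi> (a z) * ((a1 z)\<^sup>2 + (a2 z)\<^sup>2)) \<partial>lborel) \<le> ennreal E" "E \<ge> 0"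
    and \<nu>: "\<nu> > 0" and W: "W > 0"
  shows "c / 2 - 16 * (W + \<beta>) / (s * L) \<le> 4 * \<nu> * h * L + E / (4 * \<nu> * L)"
proof -
  interpret b2: kernel "bmp 2" "\<lambda>z. - 4 * Re z * bmp 1 z" "\<lambda>z. - 4 * Im z * bmp 1 z"
    using kernel_bmp[of 2] by simp
  define \<sigma> where "\<sigma> = sqrt (m1\<^sup>2 + m2\<^sup>2)"
  have \<sigma>: "\<sigma> \<ge> s" "\<sigma> > 0" "\<sigma>\<^sup>2 = m1\<^sup>2 + m2\<^sup>2"
  proof -
    show "\<sigma> \<ge> s" unfolding \<sigma>_def by (rule real_le_rsqrt[OF m(1)])
    then show "\<sigma> > 0" using m(2) by linarith
  qed (simp add: \<sigma>_def)
  define n1 n2 where "n1 = m1 / \<sigma>" and "n2 = m2 / \<sigma>"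
  have n: "n1\<^sup>2 + n2\<^sup>2 = 1" "m1 = \<sigma> * n1" "m2 = \<sigma> * n2"
  proof -
    have "n1\<^sup>2 + n2\<^sup>2 = (m1\<^sup>2 + m2\<^sup>2) / \<sigma>\<^sup>2"
      by (simp add: n1_def n2_def power_divide add_divide_distrib)
    then show "n1\<^sup>2 + n2\<^sup>2 = 1" using \<sigma>(2) unfolding \<sigma>(3)[symmetric] by simp
  qed (use \<sigma>(2) in \<open>auto simp: n1_def n2_def\<close>)
  have CS: "(n1 * x + n2 * y)\<^sup>2 \<le> x\<^sup>2 + y\<^sup>2" for x y
  proof -
    have "x\<^sup>2 + y\<^sup>2 = (n1\<^sup>2 + n2\<^sup>2) * (x\<^sup>2 + y\<^sup>2)" by (simp add: n)
    also have "\<dots> = (n1 * x + n2 * y)\<^sup>2 + (n1 * y - n2 * x)\<^sup>2" by (simp add: power2_eq_square algebra_simps)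
    finally show ?thesis by simp
  qed
  define P where "P z = n1 * Re z + n2 * Im z" for z
  have Pc: "continuous_on UNIV P" unfolding P_def by (intro continuous_intros)
  have Pn: "\<bar>P z\<bar> \<le> norm z" for z
  proof -
    have "(P z)\<^sup>2 \<le> (norm z)\<^sup>2" using CS[of "Re z" "Im z"] unfolding P_def cmod_power2 .
    then have "\<bar>P z\<bar> \<le> \<bar>norm z\<bar>" by (simp only: abs_le_square_iff)
    then show ?thesis by simp
  qed
  have \<beta>0: "\<beta> \<ge> 0" using b[of 0] L by simp
  \<comment> \<open>Half-width of the strip |P| \<le> r outside which a(L z) is at distance at least
    W from a 0, even after the affine error \<open>\<beta>\<close>.\<close>
  define r where "r = (W + \<beta>) / (s * L)"
  have r0: "r > 0" using W \<beta>0 m L by (simp add: r_def)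
  define f where "f z = \<Phi> (a (L *\<^sub>R z))" for z
  have f: "C1_on UNIV f (\<lambda>z. \<phi> (a (L *\<^sub>R z)) * (L *\<^sub>R a1 (L *\<^sub>R z))) (\<lambda>z. \<phi> (a (L *\<^sub>R z)) * (L *\<^sub>R a2 (L *\<^sub>R z)))"
    unfolding f_def
    by (rule C1_on_real_compose[OF _ \<phi>(2,1)]) (use C1_on_affine[OF a, of UNIV 0 L] in simp)
  have cL: "continuous_on UNIV g \<Longrightarrow> continuous_on UNIV (\<lambda>z. g (L *\<^sub>R z))" for g :: "complex \<Rightarrow> real"
    using continuous_affine[of g 0 L] by simp
  have \<phi>a: "continuous_on UNIV (\<lambda>z. \<phi> (a z))" by (rule continuous_on_compose2[OF \<phi>(1) ca(3)]) simp
  note ki = kernel_integrable[OF b2.cont(1) b2.zero(1)]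
  have k1: "(\<lambda>z. bmp 1 z * g z) integrable_on UNIV" if "continuous_on UNIV g" for g
    by (rule kernel_integrable[OF _ _ that]) (auto simp: bmp_eq_0 intro!: continuous_intros)
  have neg4: "- integral UNIV (\<lambda>z. (- 4 * g z * bmp 1 z) *\<^sub>R h z) = 4 * integral UNIV (\<lambda>z. bmp 1 z * (g z * h z))" for g h :: "complex \<Rightarrow> real"
  proof -
    have "integral UNIV (\<lambda>z. (- 4 * g z * bmp 1 z) *\<^sub>R h z) = (- 4) * integral UNIV (\<lambda>z. bmp 1 z * (g z * h z))"
      by (subst integral_mult_right[symmetric]) (simp add: mult_ac)
    then show ?thesis by simp
  qed
  \<comment> \<open>Integration by parts turns the averaged derivatives \<open>A1\<close>,
    \<open>A2\<close> into four times the first moments \<open>B1\<close>, \<open>B2\<close> of f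
    against bmp 1.\<close>
  define A1 where "A1 = integral UNIV (\<lambda>z. bmp 2 z * (\<phi> (a (L *\<^sub>R z)) * (L * a1 (L *\<^sub>R z))))"
  define A2 where "A2 = integral UNIV (\<lambda>z. bmp 2 z * (\<phi> (a (L *\<^sub>R z)) * (L * a2 (L *\<^sub>R z))))"
  define B1 where "B1 = integral UNIV (\<lambda>z. bmp 1 z * (Re z * f z))"
  define B2 where "B2 = integral UNIV (\<lambda>z. bmp 1 z * (Im z * f z))"
  have AB: "A1 = 4 * B1" "A2 = 4 * B2"
    using b2.ibp[OF open_UNIV subset_UNIV f] unfolding neg4 A1_def A2_def B1_def B2_def by simp_all
  define G where "G z = \<phi> (a z) * ((a1 z)\<^sup>2 + (a2 z)\<^sup>2)" for z
  have Gc: "continuous_on UNIV G" unfolding G_def by (intro continuous_intros \<phi>a ca)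
  have G0: "G z \<ge> 0" for z using \<phi>(3) by (simp add: G_def)
  have upper: "n1 * A1 + n2 * A2 \<le> 4 * \<nu> * h * L + E / (4 * \<nu> * L)"
  proof -
    define V where "V = integral UNIV (\<lambda>z. bmp 2 z * G (L *\<^sub>R z))"
    have "((\<lambda>z. n1 * (bmp 2 z * (\<phi> (a (L *\<^sub>R z)) * (L * a1 (L *\<^sub>R z)))) + n2 * (bmp 2 z * (\<phi> (a (L *\<^sub>R z)) * (L * a2 (L *\<^sub>R z)))))
       has_integral (n1 * A1 + n2 * A2)) UNIV"
      unfolding A1_def A2_def
      by (intro has_integral_add has_integral_mult_right integrable_integral ki continuous_on_mult continuous_on_const cL \<phi>a ca)
    moreover have "((\<lambda>z. (L * \<nu> * h) * bmp 2 z + (L / (4 * \<nu>)) * (bmp 2 z * G (L *\<^sub>R z))) has_integral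
        ((L * \<nu> * h) * c + (L / (4 * \<nu>)) * V)) UNIV"
      unfolding V_def
      by (intro has_integral_add has_integral_mult_right integrable_integral ki cL Gc bmp_integrable) simp
    ultimately have "n1 * A1 + n2 * A2 \<le> (L * \<nu> * h) * c + (L / (4 * \<nu>)) * V"
    proof (rule has_integral_le)
      fix z :: complex
      define w where "w = L *\<^sub>R z"
      define D where "D = n1 * a1 w + n2 * a2 w"
      \<comment> \<open>The parameter \<open>\<nu>\<close> balances the two terms: a small \<nu>
        keeps the contribution of the height down, and a large L then keeps that of the energy
        down.\<close>
      have "0 \<le> (2 * \<nu> - D)\<^sup>2" by simp
      then have "4 * \<nu> * D \<le> 4 * \<nu> * \<nu> + D\<^sup>2" by (simp add: power2_eq_square algebra_simps)
      also have "D\<^sup>2 \<le> (a1 w)\<^sup>2 + (a2 w)\<^sup>2" unfolding D_def by (rule CS)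
      finally have "\<phi> (a w) * (4 * \<nu> * D) \<le> \<phi> (a w) * (4 * \<nu> * \<nu> + ((a1 w)\<^sup>2 + (a2 w)\<^sup>2))"
        using \<phi>(3)[of "a w"] by (intro mult_left_mono) auto
      also have "\<dots> \<le> 4 * \<nu> * \<nu> * h + G w"
        using \<phi>(3)[of "a w"] \<nu> mult_left_mono[of "\<phi> (a w)" h "4 * \<nu> * \<nu>"] by (simp add: G_def algebra_simps)
      finally have "\<phi> (a w) * D \<le> \<nu> * h + G w / (4 * \<nu>)" using \<nu> by (simp add: field_simps)
      then have "(bmp 2 z * L) * (\<phi> (a w) * D) \<le> (bmp 2 z * L) * (\<nu> * h + G w / (4 * \<nu>))"
        using L by (intro mult_left_mono) auto
      then show "n1 * (bmp 2 z * (\<phi> (a (L *\<^sub>R z)) * (L * a1 (L *\<^sub>R z)))) + n2 * (bmp 2 z * (\<phi> (a (L *\<^sub>R z)) * (L * a2 (L *\<^sub>R z))))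
         \<le> (L * \<nu> * h) * bmp 2 z + (L / (4 * \<nu>)) * (bmp 2 z * G (L *\<^sub>R z))"
        unfolding w_def[symmetric] D_def by (simp add: algebra_simps)
    qed
    also have "(L * \<nu> * h) * c \<le> (L * \<nu> * h) * 4"
    proof (rule mult_left_mono)
      show "c \<le> 4"
        using kernel_integral_le[OF b2.cont(1) b2.zero(1) _ continuous_on_const, of 1 1] bmp_le_1 by (auto simp: abs_le_iff)
      show "0 \<le> L * \<nu> * h" using L \<nu> \<phi>(3)[of 0] by auto
    qed
    also have "(L / (4 * \<nu>)) * V \<le> (L / (4 * \<nu>)) * (E / L\<^sup>2)"
    proof (rule mult_left_mono)
      define g where "g z = bmp 2 (z /\<^sub>R L) * G z" for z
      have gc: "continuous_on UNIV g" unfolding g_def by (intro continuous_intros Gc)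
      have g0: "g z = 0" if "norm z > L" for z
      proof -
        have "norm (z /\<^sub>R L) = norm z / L" using L by (simp add: divide_inverse mult.commute)
        then have "norm (z /\<^sub>R L) \<ge> 1" using that L by simp
        then show ?thesis by (simp only: g_def bmp_eq_0[OF _ zero_less_numeral] mult_zero_left)
      qed
      have "g (0 + L *\<^sub>R z) = bmp 2 z * G (L *\<^sub>R z)" for z using L by (simp add: g_def)
      then have "V = integral UNIV g /\<^sub>R L\<^sup>2"
        using integral_compact_support_affine[OF gc g0 L(1), where c=0] unfolding V_def by (simp only:)
      moreover have "integral UNIV g \<le> 1 * E"
      proof (rule integral_le_nn_integral_bound[OF gc g0])
        show "g z \<le> 1 * G z" for z unfolding g_def using G0 by (intro mult_right_mono bmp_le_1)
        show "(\<integral>\<^sup>+z\<in>cball 0 R. ennreal (G z) \<partial>lborel) \<le> ennreal E" using E(1) by (simp add: G_def)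
        show "g z = 0" if "z \<notin> cball 0 R" for z using that L by (intro g0) auto
      qed (use G0 E in \<open>auto simp: g_def\<close>)
      ultimately show "V \<le> E / L\<^sup>2" using L by (simp add: divide_right_mono divide_inverse mult.commute)
    qed (use L \<nu> in auto)
    also have "(L / (4 * \<nu>)) * (E / L\<^sup>2) = E / (4 * \<nu> * L)" using L by (simp add: power2_eq_square)
    finally show ?thesis by (simp add: mult_ac)
  qed
  have lower: "c / 8 - 4 * r \<le> n1 * B1 + n2 * B2"
  proof -
    have fc: "continuous_on UNIV f" by (rule C1_onD(3)[OF f])
    have ReIm: "continuous_on UNIV Re" "continuous_on UNIV Im" using C1_onD(3)[OF C1_on_Re_Im(1)] C1_onD(3)[OF C1_on_Re_Im(2)] by auto
    have h1: "((\<lambda>z. n1 * (bmp 1 z * (Re z * f z)) + n2 * (bmp 1 z * (Im z * f z))) has_integral (n1 * B1 + n2 * B2)) UNIV"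
      unfolding B1_def B2_def
      by (intro has_integral_add has_integral_mult_right integrable_integral k1 continuous_on_mult fc ReIm)
    have h2: "((\<lambda>z. (1/2) * (bmp 1 z * (n1 * Re z + n2 * Im z)\<^sup>2) - r * bmp 1 z) has_integral
        ((1/2) * ((n1\<^sup>2 + n2\<^sup>2) * c / 4) - r * integral UNIV (bmp 1))) UNIV"
      unfolding bmp_quadratic_integral[symmetric]
      by (intro has_integral_diff has_integral_mult_right integrable_integral k1 bmp_integrable continuous_intros) simp
    have "(1/2) * ((n1\<^sup>2 + n2\<^sup>2) * c / 4) - r * integral UNIV (bmp 1) \<le> n1 * B1 + n2 * B2"
    proof (rule has_integral_le[OF h2 h1])
      fix z :: complex
      \<comment> \<open>Outside the strip P f = |P| / 2, which is at least P^2 / 2 as |P| \<le> 1.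
        Inside it P f is at least - |P| / 2, and subtracting r makes up for both this and P^2 /
        2.\<close>
      have "P z * f z \<ge> (1/2) * (P z)\<^sup>2 - r" if z: "norm z < 1"
      proof -
        have P1: "\<bar>P z\<bar> \<le> 1" using Pn[of z] z by linarith
        have P2: "(P z)\<^sup>2 \<le> \<bar>P z\<bar>"
          using mult_left_le[OF P1, of "\<bar>P z\<bar>"] by (simp add: power2_eq_square)
        have aL: "\<bar>a (L *\<^sub>R z) - a 0 - \<sigma> * L * P z\<bar> \<le> \<beta>"
          using b[of "L *\<^sub>R z"] norm_scaleR_le[of L z] L z by (simp add: P_def n(2,3) algebra_simps)
        consider "\<bar>P z\<bar> \<le> r" | "P z > r" | "P z < - r" by linarith
        then show ?thesis
        proof cases
          case 1
          have "\<bar>P z * f z\<bar> \<le> \<bar>P z\<bar> * (1/2)" unfolding abs_mult f_def by (intro mult_left_mono \<phi>) auto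
          then show ?thesis using 1 P2 by linarith
        next
          case 2
          have "W + \<beta> = s * (L * r)" using m L by (simp add: r_def)
          also have "\<dots> \<le> \<sigma> * (L * P z)"
            using 2 \<sigma> L r0 m by (intro mult_mono) auto
          finally have "f z = 1 / 2" unfolding f_def using aL by (intro \<phi>(5)) (simp add: mult.assoc)
          then have "P z * f z = P z / 2" by simp
          then show ?thesis using 2 r0 P2 by linarith
        next
          case 3
          have "W + \<beta> = s * (L * r)" using m L by (simp add: r_def)
          also have "\<dots> \<le> \<sigma> * (L * (- P z))"
            using 3 \<sigma> L r0 m by (intro mult_mono) auto
          finally have "f z = - 1 / 2" unfolding f_def using aL by (intro \<phi>(4)) (simp add: mult.assoc)
          then have "P z * f z = - P z / 2" by simp
          then show ?thesis using 3 r0 P2 by linarith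
        qed
      qed
      then have "bmp 1 z * ((1/2) * (P z)\<^sup>2 - r) \<le> bmp 1 z * (P z * f z)"
        by (cases "norm z < 1") (auto intro!: mult_left_mono simp: bmp_eq_0)
      then show "(1/2) * (bmp 1 z * (n1 * Re z + n2 * Im z)\<^sup>2) - r * bmp 1 z \<le> n1 * (bmp 1 z * (Re z * f z)) + n2 * (bmp 1 z * (Im z * f z))"
        unfolding P_def by (simp add: algebra_simps)
    qed
    moreover have "r * integral UNIV (bmp 1) \<le> r * 4"
    proof (rule mult_left_mono)
      have "continuous_on UNIV (bmp 1)" using continuous_on_bmp[OF continuous_on_id, of UNIV 1] by (simp add: id_def)
      then show "integral UNIV (bmp 1) \<le> 4"
        using kernel_integral_le[of "bmp 1" "\<lambda>_. 1" 1] bmp_le_1[of 1] by (auto simp: abs_le_iff bmp_eq_0)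
    qed (use r0 in auto)
    ultimately show ?thesis by (simp add: n)
  qed
  have "n1 * A1 + n2 * A2 = 4 * (n1 * B1 + n2 * B2)" unfolding AB by (simp add: algebra_simps)
  then have "4 * (c / 8 - 4 * r) \<le> n1 * A1 + n2 * A2" using mult_left_mono[OF lower, of 4] by simp
  also note upper
  finally have "4 * (c / 8 - 4 * r) \<le> 4 * \<nu> * h * L + E / (4 * \<nu> * L)" .
  then show ?thesis by (simp add: r_def)
qed

end

text \<open>A slope of at least \<open>s\<close> over the length \<open>L\<close> contradicts the
  energy bound; a smaller one makes the oscillation on the disc of radius 2 small, hence also the
  gradient energy. The constants are fixed in the order in which they are used up: each depends only
  on earlier ones and on K, E, \<epsilon>, and \<theta>, \<eta> come last because they must be small
  against the averaging scale.\<close>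

lemma near_harmonic_gradient_small:
  fixes K E \<epsilon> :: real
  assumes Kp: "K > 0" and \<epsilon>: "\<epsilon> > 0" and E: "E \<ge> 0"
  obtains R \<eta> \<theta> :: real where "R \<ge> 2" "\<eta> > 0" "\<theta> > 0"
    "\<And>a a1 a2 p ps pt q qs qt. near_harmonic R K \<theta> \<eta> a a1 a2 p ps pt q qs qt \<Longrightarrow>
      (\<And>\<phi>. \<phi> \<in> energy_cutoffs \<Longrightarrow>
        (\<integral>\<^sup>+z\<in>cball 0 R. ennreal (\<phi> (a z) * ((a1 z)\<^sup>2 + (a2 z)\<^sup>2)) \<partial>lborel) \<le> ennreal E) \<Longrightarrow>
      (\<integral>\<^sup>+z\<in>cball 0 1. ennreal ((a1 z)\<^sup>2 + (a2 z)\<^sup>2) \<partial>lborel) \<le> ennreal \<epsilon>"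
proof -
  define \<mu> where "\<mu> = integral UNIV (bmp 2)"
  have \<mu>: "\<mu> > 0" unfolding \<mu>_def by (rule bmp_integral_pos[OF pos2])
  obtain cb where cb: "cb > 0"
    "\<And>a N. N \<ge> cb \<Longrightarrow> \<exists>\<phi> \<Phi>. \<phi> \<in> energy_cutoffs \<and> continuous_on UNIV \<phi> \<and>
       (\<forall>x. (\<Phi> has_real_derivative \<phi> x) (at x)) \<and> (\<forall>x. 0 \<le> \<phi> x \<and> \<phi> x \<le> cb / N) \<and>
       (\<forall>x\<in>{a<..<a + N}. \<phi> x > 0) \<and> (\<forall>x\<le>a. \<Phi> x = - 1 / 2) \<and> (\<forall>x\<ge>a + N. \<Phi> x = 1 / 2) \<and>
       (\<forall>x. \<bar>\<Phi> x\<bar> \<le> 1 / 2)"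
    using energy_cutoff_exists by blast
  \<comment> \<open>With \<eta>, \<theta> \<le> 1 the two terms carrying \<gamma> add up to at most
    9 \<epsilon> / 128; the term 8 K \<theta> gets an equal share, and 64/9 times the sum is
    \<epsilon>.\<close>
  define \<gamma> where "\<gamma> = 9 * \<epsilon> / (128 * (1 + 16 * (K + 1)))"
  have \<gamma>: "\<gamma> > 0" using \<epsilon> Kp by (simp add: \<gamma>_def)
  \<comment> \<open>On the disc of radius 2 a slope below s contributes at most 2 s = \<gamma> / 2;
    the affine error \<open>\<beta>\<close> may use the other half.\<close>
  define s where "s = \<gamma> / 4"
  have s: "s > 0" using \<gamma> by (simp add: s_def)
  \<comment> \<open>The cutoff will have half-width W = \<kappa> L. Since W + \<beta> \<le> 2
    \<kappa> L, the strip error 16 (W + \<beta>) / (s L) is then at most \<mu> / 16.\<close>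
  define \<kappa> where "\<kappa> = s * \<mu> / 512"
  have \<kappa>: "\<kappa> > 0" using s \<mu> by (simp add: \<kappa>_def)
  \<comment> \<open>The cutoff height will be at most h = cb / (2 \<kappa> L), and this value makes
    the height term 4 \<nu> h L equal to \<mu> / 8.\<close>
  define \<nu> where "\<nu> = \<mu> * \<kappa> / (16 * cb)"
  have \<nu>: "\<nu> > 0" using \<mu> \<kappa> cb by (simp add: \<nu>_def)
  \<comment> \<open>Long enough to contain the disc of radius 2, for the cutoff width 2 \<kappa> L
    to be admissible, and for the energy term E / (4 \<nu> L) to fall to \<mu> / 16.\<close>
  define L where "L = max 2 (max (cb / (2 * \<kappa>)) (4 * E / (\<nu> * \<mu>)))"
  have L: "L \<ge> 2" "cb / (2 * \<kappa>) \<le> L" "4 * E / (\<nu> * \<mu>) \<le> L" by (auto simp: L_def)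
  define \<beta> where "\<beta> = min (\<gamma> / 2) \<kappa>"
  have \<beta>: "\<beta> > 0" "\<beta> \<le> \<gamma> / 2" "\<beta> \<le> \<kappa>" using \<gamma> \<kappa> by (auto simp: \<beta>_def)
  \<comment> \<open>Brings the variation 128 K L^2 / T of the averaged gradient down to a quarter of
    the allowed \<mu> \<beta>.\<close>
  define T where "T = max L (512 * K * L\<^sup>2 / (\<mu> * \<beta>))"
  have T: "L \<le> T" "512 * K * L\<^sup>2 / (\<mu> * \<beta>) \<le> T" "T > 0" using L by (auto simp: T_def)
  define \<tau> where "\<tau> = min T (\<mu> * \<beta> / (64 * K))"
  have \<tau>: "\<tau> > 0" "\<tau> \<le> T" "\<tau> \<le> \<mu> * \<beta> / (64 * K)" using T \<mu> \<beta> Kp by (auto simp: \<tau>_def)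
  \<comment> \<open>The bound with T serves the affine error, the one with \<epsilon> the term 8 K
    \<theta> of the gradient estimate.\<close>
  define \<theta> where "\<theta> = min 1 (min (\<mu> * \<beta> / (128 * T)) (9 * \<epsilon> / (1024 * K)))"
  have th: "\<theta> > 0" "\<theta> \<le> 1" "\<theta> \<le> \<mu> * \<beta> / (128 * T)" "\<theta> \<le> 9 * \<epsilon> / (1024 * K)"
    using T \<mu> \<beta> Kp \<epsilon> by (auto simp: \<theta>_def)
  define \<eta> where "\<eta> = min 1 (3 * \<mu> * \<beta> * \<tau> / (8 * T))"
  have et: "\<eta> > 0" "\<eta> \<le> 1" "\<eta> \<le> 3 * \<mu> * \<beta> * \<tau> / (8 * T)" using T \<mu> \<beta> \<tau> by (auto simp: \<eta>_def)
  define R where "R = 2 * T"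
  have Rb: "R \<ge> 2" "L \<le> R" using T L by (auto simp: R_def)
  show ?thesis
  proof (rule that[OF Rb(1) et(1) th(1)])
    fix a a1 a2 p ps pt q qs qt
    assume nh: "near_harmonic R K \<theta> \<eta> a a1 a2 p ps pt q qs qt"
      and en: "\<And>\<phi>. \<phi> \<in> energy_cutoffs \<Longrightarrow>
        (\<integral>\<^sup>+z\<in>cball 0 R. ennreal (\<phi> (a z) * ((a1 z)\<^sup>2 + (a2 z)\<^sup>2)) \<partial>lborel) \<le> ennreal E"
    interpret near_harmonic R K \<theta> \<eta> a a1 a2 p ps pt q qs qt by fact
    have pr: "2 * T \<le> R" "0 \<le> L" using L by (auto simp: R_def)
    obtain m1 m2 where m0: "\<And>z. norm z \<le> L \<Longrightarrow> \<mu> * \<bar>a z - a 0 - (m1 * Re z + m2 * Im z)\<bar> \<le>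
      2 * (8 * K * \<tau> + T * (8 * \<theta> + \<eta> / (6 * \<tau>))) + 128 * K * L\<^sup>2 / T"
      using slope_exists[OF \<tau>(1,2) T(1) pr] unfolding \<mu>_def[symmetric] by blast
    have "2 * (8 * K * \<tau> + T * (8 * \<theta> + \<eta> / (6 * \<tau>))) + 128 * K * L\<^sup>2 / T \<le> \<mu> * \<beta>"
    proof -
      have "16 * K * \<tau> \<le> \<mu> * \<beta> / 4" using \<tau>(3) Kp by (simp add: field_simps)
      moreover have "16 * T * \<theta> \<le> \<mu> * \<beta> / 8" using th(3) T by (simp add: field_simps)
      moreover have "2 * T * (\<eta> / (6 * \<tau>)) \<le> \<mu> * \<beta> / 8" using et(3) T \<tau>(1) by (simp add: field_simps)
      moreover have "128 * K * L\<^sup>2 / T \<le> \<mu> * \<beta> / 4" using T(2,3) \<mu> \<beta>(1) by (simp add: field_simps)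
      moreover have "\<mu> * \<beta> > 0" using \<mu> \<beta> by simp
      moreover have "2 * (8 * K * \<tau> + T * (8 * \<theta> + \<eta> / (6 * \<tau>))) = 16 * K * \<tau> + 16 * T * \<theta> + 2 * T * (\<eta> / (6 * \<tau>))"
        by (simp add: algebra_simps)
      ultimately show ?thesis by linarith
    qed
    then have m: "\<bar>a z - a 0 - (m1 * Re z + m2 * Im z)\<bar> \<le> \<beta>" if "norm z \<le> L" for z
      using m0[OF that] \<mu> by (meson mult_le_cancel_left_pos order_trans)
    \<comment> \<open>Otherwise the budget reads \<mu> (1/2 - 1/16) \<le> \<mu> (1/8 + 1/16), which
      is false.\<close>
    have slope: "m1\<^sup>2 + m2\<^sup>2 < s\<^sup>2"
    proof (rule ccontr)
      assume "\<not> ?thesis"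
      then have ms: "m1\<^sup>2 + m2\<^sup>2 \<ge> s\<^sup>2" by simp
      define W where "W = \<kappa> * L"
      have W: "W > 0" using \<kappa> L by (simp add: W_def)
      have N: "2 * W \<ge> cb" using L(2) \<kappa> by (simp add: W_def field_simps)
      obtain \<phi> \<Phi> where \<phi>: "\<phi> \<in> energy_cutoffs" "continuous_on UNIV \<phi>" "\<And>x. (\<Phi> has_real_derivative \<phi> x) (at x)"
        "\<And>x. 0 \<le> \<phi> x \<and> \<phi> x \<le> cb / (2 * W)" "\<And>x. x \<le> a 0 - W \<Longrightarrow> \<Phi> x = - 1 / 2"
        "\<And>x. x \<ge> a 0 - W + 2 * W \<Longrightarrow> \<Phi> x = 1 / 2" "\<And>x. \<bar>\<Phi> x\<bar> \<le> 1 / 2"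
        using cb(2)[OF N, of "a 0 - W"] by blast
      have A: "\<mu> / 2 - 16 * (W + \<beta>) / (s * L) \<le> 4 * \<nu> * (cb / (2 * W)) * L + E / (4 * \<nu> * L)"
        unfolding \<mu>_def
        by (rule large_slope_energy[OF _ Rb(2) ms s m \<phi>(2,3,4,5) _ \<phi>(7) en[OF \<phi>(1)] E \<nu> W])
           (use L \<phi>(6) in auto)
      have B: "16 * (W + \<beta>) / (s * L) \<le> \<mu> / 16"
      proof -
        have "W + \<beta> \<le> 2 * \<kappa> * L"
        proof -
          have "\<kappa> * 1 \<le> \<kappa> * L" using \<kappa> L(1) by (intro mult_left_mono) auto
          then show ?thesis using \<beta>(3) unfolding W_def by linarith
        qed
        then have "16 * (W + \<beta>) / (s * L) \<le> 16 * (2 * \<kappa> * L) / (s * L)"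
          using s L by (intro divide_right_mono) auto
        also have "\<dots> = \<mu> / 16" using s L by (simp add: \<kappa>_def)
        finally show ?thesis .
      qed
      have C: "4 * \<nu> * (cb / (2 * W)) * L = \<mu> / 8"
        using \<kappa> L cb(1) by (simp add: W_def \<nu>_def)
      have D: "E / (4 * \<nu> * L) \<le> \<mu> / 16"
        using L(1,3) \<nu> \<mu> by (simp add: field_simps)
      have "\<mu> / 2 - \<mu> / 16 \<le> \<mu> / 2 - 16 * (W + \<beta>) / (s * L)" by (rule diff_left_mono[OF B])
      also note A
      also have "4 * \<nu> * (cb / (2 * W)) * L + E / (4 * \<nu> * L) \<le> \<mu> / 8 + \<mu> / 16"
        unfolding C by (rule add_left_mono[OF D])
      finally show False using \<mu> by simp
    qed
    have osc: "\<bar>a z - a 0\<bar> \<le> \<gamma>" if z: "norm z \<le> 2" for z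
    proof -
      have "\<bar>m1 * Re z + m2 * Im z\<bar> \<le> s * norm z"
      proof -
        have "\<bar>(Complex m1 m2) \<bullet> z\<bar> \<le> norm (Complex m1 m2) * norm z" by (rule Cauchy_Schwarz_ineq2)
        also have "norm (Complex m1 m2) \<le> s"
          by (rule power2_le_imp_le) (use slope s in \<open>auto simp: cmod_power2\<close>)
        finally show ?thesis by (simp add: inner_complex_def mult_right_mono)
      qed
      also have "\<dots> \<le> s * 2" using z s by (intro mult_left_mono) auto
      finally show ?thesis using m[of z] z L \<beta>(2) unfolding s_def by linarith
    qed
    have "64 / 9 * (\<gamma> * \<eta> / 4 + 16 * \<gamma> * (K + \<theta>) + 8 * K * \<theta>) \<le> \<epsilon>"
    proof -
      have "\<gamma> * \<eta> / 4 \<le> \<gamma> * 1" using \<gamma> et by (simp add: mult_left_le)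
      moreover have "16 * \<gamma> * (K + \<theta>) \<le> 16 * \<gamma> * (K + 1)" using \<gamma> th by (intro mult_left_mono) auto
      moreover have "\<gamma> * 1 + 16 * \<gamma> * (K + 1) = 9 * \<epsilon> / 128"
      proof -
        have "\<gamma> * 1 + 16 * \<gamma> * (K + 1) = \<gamma> * (1 + 16 * (K + 1))" by (simp add: algebra_simps)
        also have "\<dots> = 9 * \<epsilon> / 128"
        proof -
          have "9 * \<epsilon> / (128 * X) * X = 9 * \<epsilon> / 128" if "X \<noteq> 0" for X using that by simp
          then show ?thesis using Kp unfolding \<gamma>_def by (smt (verit))
        qed
        finally show ?thesis .
      qed
      moreover have "8 * K * \<theta> \<le> 9 * \<epsilon> / 128" using th(4) Kp by (simp add: field_simps)
      ultimately have "\<gamma> * \<eta> / 4 + 16 * \<gamma> * (K + \<theta>) + 8 * K * \<theta> \<le> 9 * \<epsilon> / 64" by linarith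
      then have "64 / 9 * (\<gamma> * \<eta> / 4 + 16 * \<gamma> * (K + \<theta>) + 8 * K * \<theta>) \<le> 64 / 9 * (9 * \<epsilon> / 64)"
        by (rule mult_left_mono) simp
      then show ?thesis by simp
    qed
    then show "(\<integral>\<^sup>+z\<in>cball 0 1. ennreal ((a1 z)\<^sup>2 + (a2 z)\<^sup>2) \<partial>lborel) \<le> ennreal \<epsilon>"
      using gradient_integral_small_oscillation[OF Rb(1) osc] by (meson ennreal_leI order_trans)
  qed
qed

section \<open>Smooth maps\<close>

lemma linear_norm_bound:
  fixes f :: "'a::euclidean_space \<Rightarrow> 'b::real_normed_vector"
  assumes "linear f" "\<And>b. b \<in> Basis \<Longrightarrow> norm (f b) \<le> c"
  shows "norm (f w) \<le> c * DIM('a) * norm w"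
proof -
  have "f w = f (\<Sum>b\<in>Basis. (w \<bullet> b) *\<^sub>R b)" by (simp add: euclidean_representation)
  also have "\<dots> = (\<Sum>b\<in>Basis. (w \<bullet> b) *\<^sub>R f b)"
    by (simp add: linear_sum[OF assms(1)] linear_cmul[OF assms(1)])
  finally have "norm (f w) \<le> (\<Sum>b\<in>Basis. norm ((w \<bullet> b) *\<^sub>R f b))"
    by (simp add: sum_norm_le)
  also have "\<dots> \<le> (\<Sum>b\<in>(Basis :: 'a set). norm w * c)"
    by (rule sum_mono) (auto intro!: mult_mono Basis_le_norm assms)
  finally show ?thesis by (simp add: mult_ac)
qed

lemma bilinear_norm_bound:
  fixes f :: "'a::euclidean_space \<Rightarrow> 'b::euclidean_space \<Rightarrow> 'c::real_normed_vector"
  assumes "bilinear f" "\<And>b b'. b \<in> Basis \<Longrightarrow> b' \<in> Basis \<Longrightarrow> norm (f b b') \<le> c"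
  shows "norm (f v w) \<le> c * DIM('a) * DIM('b) * norm v * norm w"
proof -
  have 1: "norm (f b w) \<le> c * DIM('b) * norm w" if "b \<in> Basis" for b
    by (rule linear_norm_bound) (use assms that in \<open>auto simp: bilinear_def\<close>)
  have "norm (f v w) \<le> (c * DIM('b) * norm w) * DIM('a) * norm v"
    by (rule linear_norm_bound[of "\<lambda>v. f v w"]) (use assms 1 in \<open>auto simp: bilinear_def\<close>)
  then show ?thesis by (simp add: mult_ac)
qed

lemma Ck_on_subset: "Ck_on k S f \<Longrightarrow> T \<subseteq> S \<Longrightarrow> Ck_on k T f"
  by (induction k arbitrary: f) (auto intro: continuous_on_subset)

lemma Ck_on_cong_open:
  assumes "open S" "\<And>x. x \<in> S \<Longrightarrow> f x = h x"
  shows "Ck_on k S h \<Longrightarrow> Ck_on k S f"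
  using assms(2)
proof (induction k arbitrary: f h)
  case 0
  then show ?case using continuous_on_cong[of S S f h] by simp
next
  case (Suc k)
  have hd: "h differentiable (at x)" if "x \<in> S" for x using Suc.prems(1) that by auto
  have d: "(f has_derivative frechet_derivative h (at x)) (at x)" if "x \<in> S" for x
    using has_derivative_transform_within_open[OF hd[OF that, unfolded frechet_derivative_works] assms(1) that]
      Suc.prems(2) by simp
  have e: "frechet_derivative f (at x) v = frechet_derivative h (at x) v" if "x \<in> S" for x v
    using frechet_derivative_at[OF d[OF that]] by simp
  have "Ck_on k S (\<lambda>x. frechet_derivative f (at x) v)" for v
    by (rule Suc.IH[of "\<lambda>x. frechet_derivative h (at x) v"]) (use Suc.prems(1) e in auto)
  then show ?case using d by (auto simp: differentiable_def)
qed

lemma Ck_on_local: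
  assumes "\<And>x. x \<in> S \<Longrightarrow> \<exists>T. open T \<and> x \<in> T \<and> Ck_on k T f"
  shows "Ck_on k S f"
  using assms
proof (induction k arbitrary: f)
  case 0
  have "isCont f x" if x: "x \<in> S" for x
  proof -
    obtain T where "open T" "x \<in> T" "Ck_on 0 T f" using 0[OF x] by blast
    then show ?thesis by (simp add: continuous_on_eq_continuous_at)
  qed
  then show ?case by (simp add: continuous_at_imp_continuous_on)
next
  case (Suc k)
  have "Ck_on k S (\<lambda>x. frechet_derivative f (at x) v)" for v
  proof (rule Suc.IH)
    fix x assume "x \<in> S"
    then obtain T where "open T" "x \<in> T" "Ck_on (Suc k) T f" using Suc.prems by blast
    then show "\<exists>T. open T \<and> x \<in> T \<and> Ck_on k T (\<lambda>x. frechet_derivative f (at x) v)"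
      by (intro exI[of _ T]) simp
  qed
  moreover have "f differentiable (at x)" if x: "x \<in> S" for x
  proof -
    obtain T where "x \<in> T" "Ck_on (Suc k) T f" using Suc.prems[OF x] by blast
    then show ?thesis by simp
  qed
  ultimately show ?case by (simp only: Ck_on.simps) blast
qed

lemma smooth_onE:
  assumes "smooth_on S f" "x \<in> S"
  obtains T h where "open T" "x \<in> T" "\<And>k. Ck_on k T h" "\<And>y. y \<in> T \<Longrightarrow> y \<in> S \<Longrightarrow> h y = f y"
proof -
  have "\<exists>T h. open T \<and> x \<in> T \<and> (\<forall>k. Ck_on k T h) \<and> (\<forall>y\<in>T \<inter> S. h y = f y)"
    using assms unfolding smooth_on_def by (rule bspec)
  then obtain T h where "open T \<and> x \<in> T \<and> (\<forall>k. Ck_on k T h) \<and> (\<forall>y\<in>T \<inter> S. h y = f y)"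
    by (elim exE)
  then show ?thesis by (intro that[of T h]) blast+
qed

text \<open>On an open set the local extensions in \<open>smooth_on\<close> coincide with f near
  each point, and \<open>Ck_on\<close> is a local property.\<close>

lemma smooth_on_open_imp_Ck_on:
  assumes "smooth_on S f" "open S"
  shows "Ck_on k S f"
proof (rule Ck_on_local)
  fix x assume x: "x \<in> S"
  obtain O' h where h: "open O'" "x \<in> O'" "\<And>k. Ck_on k O' h" "\<And>y. y \<in> O' \<Longrightarrow> y \<in> S \<Longrightarrow> h y = f y"
    using assms(1) x by (rule smooth_onE) blast
  have o: "open (O' \<inter> S)" using h(1) assms(2) by (rule open_Int)
  have "Ck_on k (O' \<inter> S) f"
    by (rule Ck_on_cong_open[OF o _ Ck_on_subset[OF h(3)]]) (use h(4) in auto)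
  then show "\<exists>T. open T \<and> x \<in> T \<and> Ck_on k T f"
    using o h(2) x by blast
qed

lemma Ck_on_compose_affine:
  assumes "bounded_linear L" "\<And>y. y \<in> T \<Longrightarrow> c + L y \<in> S" and T: "open T"
  shows "Ck_on k S h \<Longrightarrow> Ck_on k T (\<lambda>y. h (c + L y))"
proof (induction k arbitrary: h)
  case 0
  interpret L: bounded_linear L by fact
  show ?case
    using 0 assms(2) by (auto intro!: continuous_on_compose2[where g=h and t=S] continuous_intros L.continuous_on)
next
  case (Suc k)
  interpret L: bounded_linear L by fact
  have d: "((\<lambda>y. h (c + L y)) has_derivative (\<lambda>v. frechet_derivative h (at (c + L y)) (L v))) (at y)" if "y \<in> T" for y
  proof -
    have "((\<lambda>y. c + L y) has_derivative L) (at y)"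
      by (auto intro!: derivative_eq_intros L.has_derivative)
    moreover have "h differentiable (at (c + L y))" using Suc.prems assms(2)[OF that] by auto
    ultimately show ?thesis
      using has_derivative_compose[of "\<lambda>y. c + L y" L y UNIV h] by (simp add: frechet_derivative_works)
  qed
  have "(\<lambda>v. frechet_derivative h (at (c + L y)) (L v)) = frechet_derivative (\<lambda>y. h (c + L y)) (at y)" if "y \<in> T" for y
    by (rule frechet_derivative_at[OF d[OF that]])
  then have e: "frechet_derivative (\<lambda>y. h (c + L y)) (at y) v = frechet_derivative h (at (c + L y)) (L v)" if "y \<in> T" for y v
    using that by metis
  have c: "Ck_on k T (\<lambda>y. frechet_derivative h (at (c + L y)) (L v))" for v
    by (rule Suc.IH[of "\<lambda>x. frechet_derivative h (at x) (L v)"]) (use Suc.prems in auto)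
  have "Ck_on k T (\<lambda>y. frechet_derivative (\<lambda>y. h (c + L y)) (at y) v)" for v
    by (rule Ck_on_cong_open[OF T e c])
  then show ?case using d by (auto simp: differentiable_def)
qed

lemma smooth_on_compose_affine:
  assumes "smooth_on S f" "bounded_linear L" "\<And>y. y \<in> T \<Longrightarrow> c + L y \<in> S"
  shows "smooth_on T (\<lambda>y. f (c + L y))"
  unfolding smooth_on_def
proof
  interpret L: bounded_linear L by fact
  fix y assume y: "y \<in> T"
  obtain O' h where h: "open O'" "c + L y \<in> O'" "\<And>k. Ck_on k O' h" "\<And>y. y \<in> O' \<Longrightarrow> y \<in> S \<Longrightarrow> h y = f y"
    using assms(1) assms(3)[OF y] by (rule smooth_onE) blast
  define Q where "Q = (\<lambda>y. c + L y) -` O'"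
  have "open Q" unfolding Q_def
    by (intro open_vimage h continuous_intros L.continuous_on)
  moreover have "Ck_on k Q (\<lambda>y. h (c + L y))" for k
    by (rule Ck_on_compose_affine[OF assms(2) _ \<open>open Q\<close> h(3)]) (auto simp: Q_def)
  moreover have "y \<in> Q" "\<forall>z\<in>Q \<inter> T. h (c + L z) = f (c + L z)"
    using h(2,4) assms(3) by (auto simp: Q_def)
  ultimately show "\<exists>O' h. open O' \<and> y \<in> O' \<and> (\<forall>k. Ck_on k O' h) \<and> (\<forall>z\<in>O' \<inter> T. h z = f (c + L z))"
    by blast
qed

lemma smooth_on_continuous_on:
  assumes "smooth_on S f" shows "continuous_on S f"
  unfolding continuous_on_eq_continuous_within
proof
  fix x assume x: "x \<in> S"
  obtain O' h where h: "open O'" "x \<in> O'" "\<And>k. Ck_on k O' h" "\<And>y. y \<in> O' \<Longrightarrow> y \<in> S \<Longrightarrow> h y = f y"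
    using assms x by (rule smooth_onE) blast
  have "isCont h x" using h(1,2) h(3)[of 0] by (simp add: continuous_on_eq_continuous_at)
  then have c: "continuous (at x within S) h" by (rule continuous_at_imp_continuous_at_within)
  obtain d where d: "d > 0" "ball x d \<subseteq> O'" using h(1,2) open_contains_ball by blast
  show "continuous (at x within S) f"
    by (rule continuous_transform_within[OF c d(1) x]) (use d(2) h(4) in \<open>auto simp: dist_commute subset_iff\<close>)
qed

lemma smooth_on_differentiable_within:
  assumes "smooth_on S f" "x \<in> S" shows "f differentiable (at x within S)"
proof -
  obtain O' h where h: "open O'" "x \<in> O'" "\<And>k. Ck_on k O' h" "\<And>y. y \<in> O' \<Longrightarrow> y \<in> S \<Longrightarrow> h y = f y"
    using assms by (rule smooth_onE) blast
  have "h differentiable (at x within S)" using h(2) h(3)[of "Suc 0"] by (simp add: differentiable_at_withinI)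
  then obtain D where D: "(h has_derivative D) (at x within S)" unfolding differentiable_def by blast
  obtain d where d: "d > 0" "ball x d \<subseteq> O'" using h(1,2) open_contains_ball by blast
  have "(f has_derivative D) (at x within S)"
    by (rule has_derivative_transform_within[OF D d(1) assms(2)]) (use d(2) h(4) in \<open>auto simp: dist_commute subset_iff\<close>)
  then show ?thesis unfolding differentiable_def by blast
qed

lemma Ck_on_1D:
  assumes "Ck_on (Suc 0) S f" "x \<in> S"
  shows "(f has_derivative frechet_derivative f (at x)) (at x)" "continuous_on S (\<lambda>x. frechet_derivative f (at x) v)"
  using assms by (auto simp: frechet_derivative_works)

lemma complex_linear_Re_Im:
  assumes "linear (f :: complex \<Rightarrow> 'b::real_vector)"
  shows "f h = Re h *\<^sub>R f 1 + Im h *\<^sub>R f \<i>"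
proof -
  have "f h = f (Re h *\<^sub>R 1 + Im h *\<^sub>R \<i>)" by (rule arg_cong[where f=f]) (simp add: complex_eq_iff)
  then show ?thesis by (simp only: linear_add[OF assms] linear_cmul[OF assms])
qed

lemma Ck_on_imp_C1_on:
  assumes "Ck_on (Suc k) S f"
  shows "C1_on S f (\<lambda>z. frechet_derivative f (at z) 1) (\<lambda>z. frechet_derivative f (at z) \<i>)"
proof -
  have "continuous_on S (\<lambda>z. frechet_derivative f (at z) v)" for v
    using assms by (cases k) (auto intro!: continuous_at_imp_continuous_on differentiable_imp_continuous_within)
  moreover have "(f has_derivative (\<lambda>h. Re h *\<^sub>R frechet_derivative f (at z) 1 + Im h *\<^sub>R frechet_derivative f (at z) \<i>)) (at z)"
    if "z \<in> S" for z
  proof -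
    have "f differentiable (at z)" using assms that by simp
    then have d: "(f has_derivative frechet_derivative f (at z)) (at z)" by (simp add: frechet_derivative_works)
    show ?thesis
      by (rule has_derivative_eq_rhs[OF d]) (use complex_linear_Re_Im[OF has_derivative_linear[OF d]] in blast)
  qed
  ultimately show ?thesis unfolding C1_on_def by blast
qed

section \<open>The splitting defined by a complex structure\<close>

locale cplx_struct =
  fixes j :: "real \<times> 'e::real_normed_vector \<Rightarrow> real \<times> 'e"
  assumes lin: "linear j" and sq: "j (j v) = - v"
begin

definition "\<rho> = fst (j dr)"

lemma denom: "1 + \<rho>\<^sup>2 > 0" "1 + \<rho>\<^sup>2 \<noteq> 0"
  using add_pos_nonneg[of 1 "\<rho>\<^sup>2"] by auto

lemmas j_simps = linear_add[OF lin] linear_diff[OF lin] linear_cmul[OF lin] linear_neg[OF lin] sq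

text \<open>\<xi> is the common kernel of dr and dr \<circ> j; in this form membership is two scalar
  equations.\<close>

lemma xi_iff: "y \<in> xi j \<longleftrightarrow> fst y = 0 \<and> fst (j y) = 0"
proof
  assume "y \<in> xi j"
  then have y: "y \<in> {0} \<times> UNIV" "y \<in> j ` ({0} \<times> UNIV)" unfolding xi_def by blast+
  then obtain x where "y = j x" "x \<in> {0} \<times> UNIV" by blast
  moreover have "fst y = 0" "fst x = 0" using y(1) \<open>x \<in> {0} \<times> UNIV\<close> by (simp_all add: mem_Times_iff)
  ultimately show "fst y = 0 \<and> fst (j y) = 0" by (simp add: sq)
next
  assume a: "fst y = 0 \<and> fst (j y) = 0"
  have "y = j (- j y)" by (simp add: j_simps)
  moreover have "- j y \<in> {0} \<times> UNIV" using a by (cases "j y") auto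
  ultimately have "y \<in> j ` ({0} \<times> UNIV)" by (rule image_eqI)
  then show "y \<in> xi j" using a by (cases y) (auto simp: xi_def)
qed

text \<open>Applying dr and dr \<circ> j to w = \<sigma> \<partial>_r + \<lambda> j \<partial>_r + y
  removes y and leaves two linear equations with determinant -(1 + \<rho>^2). They are always
  solvable, so the splitting exists for every j and depends rationally on it.\<close>

definition "sg w = (fst w + \<rho> * fst (j w)) / (1 + \<rho>\<^sup>2)"
definition "lm w = (\<rho> * fst w - fst (j w)) / (1 + \<rho>\<^sup>2)"
definition "pr w = w - sg w *\<^sub>R dr - lm w *\<^sub>R j dr"

lemma sg_lm: "sg w + lm w * \<rho> = fst w" "sg w * \<rho> - lm w = fst (j w)"
proof -
  have e: "sg w * (1 + \<rho>\<^sup>2) = fst w + \<rho> * fst (j w)" "lm w * (1 + \<rho>\<^sup>2) = \<rho> * fst w - fst (j w)"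
    using denom(2) by (simp_all add: sg_def lm_def)
  have "(sg w + lm w * \<rho>) * (1 + \<rho>\<^sup>2) = sg w * (1 + \<rho>\<^sup>2) + \<rho> * (lm w * (1 + \<rho>\<^sup>2))" by (simp add: algebra_simps)
  also have "\<dots> = fst w * (1 + \<rho>\<^sup>2)" unfolding e by (simp add: algebra_simps power2_eq_square)
  finally show "sg w + lm w * \<rho> = fst w" using denom(2) by simp
  have "(sg w * \<rho> - lm w) * (1 + \<rho>\<^sup>2) = \<rho> * (sg w * (1 + \<rho>\<^sup>2)) - lm w * (1 + \<rho>\<^sup>2)" by (simp add: algebra_simps)
  also have "\<dots> = fst (j w) * (1 + \<rho>\<^sup>2)" unfolding e by (simp add: algebra_simps power2_eq_square)
  finally show "sg w * \<rho> - lm w = fst (j w)" using denom(2) by simp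
qed

lemma fst_dr [simp]: "fst dr = 1" by (simp add: dr_def)

lemma pr_in_xi: "pr w \<in> xi j"
  using sg_lm[of w] unfolding xi_iff pr_def by (simp add: j_simps \<rho>_def[symmetric])

lemma split_vec_eq: "split_vec j w = (sg w, lm w, pr w)"
  unfolding split_vec_def
proof (rule the_equality, goal_cases)
  case 1
  show ?case using pr_in_xi by (simp add: pr_def reeb_def)
next
  case (2 t)
  obtain a b y where t: "t = (a, b, y)" by (cases t)
  have y: "fst y = 0" "fst (j y) = 0" and w: "w = a *\<^sub>R dr + b *\<^sub>R j dr + y"
    using 2 by (auto simp: t xi_iff reeb_def)
  have 1: "fst w = a + b * \<rho>" unfolding w by (simp add: y \<rho>_def)
  have 2: "fst (j w) = a * \<rho> - b" unfolding w by (simp add: j_simps y \<rho>_def)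
  have ab: "a = sg w" "b = lm w"
    unfolding sg_def lm_def 1 2
    by (subst nonzero_eq_divide_eq[OF denom(2)], simp add: algebra_simps power2_eq_square)+
  have "y = w - a *\<^sub>R dr - b *\<^sub>R j dr" by (subst w) simp
  then have "y = pr w" unfolding pr_def ab .
  then show ?case unfolding t ab by simp
qed

lemma sigma_eq: "sigma_form j w = sg w" and lambda_eq: "lambda_form j w = lm w" and proj_eq: "proj_xi j w = pr w"
  by (simp_all add: sigma_form_def lambda_form_def proj_xi_def split_vec_eq)

lemma sg_j: "sg (j w) = - lm w" and lm_j: "lm (j w) = sg w"
  by (auto simp: sg_def lm_def j_simps minus_divide_left algebra_simps)

lemma pr_j: "pr (j w) = j (pr w)"
  by (simp add: pr_def sg_j lm_j j_simps)

lemma pr_id: "y \<in> xi j \<Longrightarrow> pr y = y"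
  by (simp add: pr_def sg_def lm_def xi_iff)

lemma linear_pr: "linear pr"
  by (rule linearI) (simp_all add: pr_def sg_def lm_def j_simps algebra_simps add_divide_distrib diff_divide_distrib)

lemma decomp: "w = sg w *\<^sub>R dr + lm w *\<^sub>R j dr + pr w"
  by (simp add: pr_def)

text \<open>On a holomorphic map this says that the density of \<sigma> \<and> \<lambda> is
  |\<nabla>a|^2 / (1 + \<rho>^2), so a bound on \<rho> makes the \<lambda>-energy comparable with an
  energy of \<open>a\<close> alone.\<close>

lemma sigma_wedge_lambda:
  "sigma_form j w * lambda_form j (j w) - sigma_form j (j w) * lambda_form j w = ((fst w)\<^sup>2 + (fst (j w))\<^sup>2) / (1 + \<rho>\<^sup>2)"
proof -
  have "(fst w)\<^sup>2 + (fst (j w))\<^sup>2 = (1 + \<rho>\<^sup>2) * ((sg w)\<^sup>2 + (lm w)\<^sup>2)"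
    unfolding sg_lm[of w, symmetric] by (simp add: power2_eq_square algebra_simps)
  then show ?thesis using denom
    by (simp add: sigma_eq lambda_eq sg_j lm_j power2_eq_square)
qed

end

text \<open>For w = \<partial>_s u and the limit 2-form as \<beta> this is the density
  \<open>F\<close>. The complement of \<xi> is measured by dr and dr \<circ> j instead of \<sigma>
  and \<lambda>, because on a holomorphic map these give exactly |\<nabla>a|^2.\<close>

definition coercive_form :: "(real \<times> 'e::real_normed_vector \<Rightarrow> real \<times> 'e) \<Rightarrow> ('e \<Rightarrow> 'e \<Rightarrow> real) \<Rightarrow> real \<times> 'e \<Rightarrow> real" where
  "coercive_form j \<beta> w = \<beta> (snd (proj_xi j w)) (snd (j (proj_xi j w))) + (fst w)\<^sup>2 + (fst (j w))\<^sup>2"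

text \<open>Both halves of the symmetrised \<omega> agree on a pair w, j w, by antisymmetry and
  because j squares to -1.\<close>

lemma (in cplx_struct) omega_form_J:
  assumes "bilinear (winf i (snd x))" "\<And>a b. winf i (snd x) a b = - winf i (snd x) b a" "J i x = j"
  shows "omega_form J winf i x w (j w) = winf i (snd x) (snd (proj_xi j w)) (snd (j (proj_xi j w)))"
proof -
  have "winf i (snd x) a (- b) = winf i (snd x) b a" for a b
    using assms(2)[of b a] bilinear_rneg[OF assms(1)] by simp
  then show ?thesis
    by (simp add: omega_form_def pull_V_def assms(3) proj_eq pr_j sq)
qed

lemma (in cplx_struct) coercive_form_pos:
  assumes "\<And>y. y \<in> xi j \<Longrightarrow> y \<noteq> 0 \<Longrightarrow> \<beta> (snd y) (snd (j y)) > 0" "\<beta> 0 0 = 0" "w \<noteq> 0"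
  shows "coercive_form j \<beta> w > 0"
proof (cases "pr w = 0")
  case False
  then have "\<beta> (snd (pr w)) (snd (j (pr w))) > 0" using assms(1) pr_in_xi by blast
  then show ?thesis by (simp add: coercive_form_def proj_eq add_pos_nonneg)
next
  case True
  have "fst w \<noteq> 0 \<or> fst (j w) \<noteq> 0"
  proof (rule ccontr)
    assume "\<not> ?thesis"
    then have "w = pr w" by (simp add: pr_def sg_def lm_def)
    then show False using True assms(3) by simp
  qed
  then have "(fst w)\<^sup>2 + (fst (j w))\<^sup>2 > 0" by (auto simp: sum_power2_gt_zero_iff)
  then show ?thesis using True assms(2) linear_0[OF lin]
    by (simp add: coercive_form_def proj_eq)
qed

section \<open>Symmetry of second partial derivatives\<close>

lemma second_difference_mvt:
  fixes f :: "complex \<Rightarrow> real"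
  assumes f: "C1_on (ball z r) f fs ft" and g: "C1_on (ball z r) (\<lambda>w. Re d * fs w + Im d * ft w) gs gt"
    and h: "0 < h" "2 * h < r" and n: "norm d \<le> 1" "norm e \<le> 1"
  shows "\<exists>w. dist z w \<le> 2 * h \<and>
    f (z + h *\<^sub>R e + h *\<^sub>R d) - f (z + h *\<^sub>R d) - f (z + h *\<^sub>R e) + f z = h * h * (Re e * gs w + Im e * gt w)"
proof -
  have near: "dist z (z + x *\<^sub>R d + y *\<^sub>R e) \<le> 2 * h" if "0 \<le> x" "x \<le> h" "0 \<le> y" "y \<le> h" for x y :: real
  proof -
    have "norm (x *\<^sub>R d) \<le> h * 1" "norm (y *\<^sub>R e) \<le> h * 1"
      unfolding norm_scaleR using that n by (intro mult_mono; simp)+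
    then have "norm (x *\<^sub>R d + y *\<^sub>R e) \<le> 2 * h" using norm_triangle_ineq[of "x *\<^sub>R d" "y *\<^sub>R e"] by linarith
    then show ?thesis by (simp add: dist_norm norm_minus_commute algebra_simps)
  qed
  define D where "D w = Re d * fs w + Im d * ft w" for w
  have d1: "((\<lambda>t. f (w + t *\<^sub>R d)) has_real_derivative D (w + t *\<^sub>R d)) (at t)" if "w + t *\<^sub>R d \<in> ball z r" for w t
    using C1_on_has_derivative_along[OF f that] by (simp add: has_real_derivative_iff_has_vector_derivative D_def)
  have d2: "((\<lambda>t. D (w + t *\<^sub>R e)) has_real_derivative (Re e * gs (w + t *\<^sub>R e) + Im e * gt (w + t *\<^sub>R e))) (at t)"
    if "w + t *\<^sub>R e \<in> ball z r" for w t
    using C1_on_has_derivative_along[OF g that] by (simp add: has_real_derivative_iff_has_vector_derivative D_def)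
  have in_ball: "z + y *\<^sub>R e + x *\<^sub>R d \<in> ball z r" if "0 \<le> x" "x \<le> h" "0 \<le> y" "y \<le> h" for x y :: real
    using near[OF that] h by (simp add: add.commute add.left_commute)
  define g1 where "g1 x = f (z + h *\<^sub>R e + x *\<^sub>R d) - f (z + 0 *\<^sub>R e + x *\<^sub>R d)" for x
  have "\<exists>x. 0 < x \<and> x < h \<and> g1 h - g1 0 = (h - 0) * (D (z + h *\<^sub>R e + x *\<^sub>R d) - D (z + 0 *\<^sub>R e + x *\<^sub>R d))"
    unfolding g1_def by (rule MVT2[OF h(1)]) (intro DERIV_diff d1 in_ball; use h in simp)
  then obtain x where x: "0 < x" "x < h" "g1 h - g1 0 = h * (D (z + h *\<^sub>R e + x *\<^sub>R d) - D (z + 0 *\<^sub>R e + x *\<^sub>R d))"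
    by auto
  define k where "k y = D (z + x *\<^sub>R d + y *\<^sub>R e)" for y
  have "\<exists>y. 0 < y \<and> y < h \<and> k h - k 0 = (h - 0) *
      (Re e * gs (z + x *\<^sub>R d + y *\<^sub>R e) + Im e * gt (z + x *\<^sub>R d + y *\<^sub>R e))"
    unfolding k_def
  proof (rule MVT2[OF h(1)], rule d2)
    show "z + x *\<^sub>R d + y *\<^sub>R e \<in> ball z r" if "0 \<le> y" "y \<le> h" for y
      using near[of x y] that x h by simp
  qed
  then obtain y where y: "0 < y" "y < h" "k h - k 0 = h * (Re e * gs (z + x *\<^sub>R d + y *\<^sub>R e) + Im e * gt (z + x *\<^sub>R d + y *\<^sub>R e))"
    by auto
  have "g1 h - g1 0 = h * (k h - k 0)" using x(3) by (simp add: k_def add_ac)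
  then have "g1 h - g1 0 = h * h * (Re e * gs (z + x *\<^sub>R d + y *\<^sub>R e) + Im e * gt (z + x *\<^sub>R d + y *\<^sub>R e))"
    by (simp add: y(3))
  then show ?thesis
    using near[of x y] x y by (intro exI[of _ "z + x *\<^sub>R d + y *\<^sub>R e"]) (simp add: g1_def)
qed

text \<open>A second difference over a parallelogram of side h is h^2 times either mixed partial at
  some nearby point; continuity identifies the two as h shrinks. It serves to cancel the second
  derivatives of u in the exterior derivative of a pullback.\<close>

lemma mixed_partials_commute:
  fixes f :: "complex \<Rightarrow> real"
  assumes S: "open S" and f: "C1_on S f fs ft" and fs: "C1_on S fs fss fst'" and ft: "C1_on S ft fts ftt" and z: "z \<in> S"
  shows "fst' z = fts z"
proof -
  obtain r where r: "r > 0" "ball z r \<subseteq> S" using S z open_contains_ball by blast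
  note sub = C1_on_subset[OF _ r(2)]
  have c: "isCont fst' z" "isCont fts z"
    using C1_onD(1,2)[OF fs] C1_onD(1,2)[OF ft] S z by (auto simp: continuous_on_eq_continuous_at)
  have "\<bar>fst' z - fts z\<bar> \<le> e" if "e > 0" for e
  proof -
    obtain d where d: "d > 0" "\<And>w. dist w z < d \<Longrightarrow> \<bar>fst' w - fst' z\<bar> < e / 2" "\<And>w. dist w z < d \<Longrightarrow> \<bar>fts w - fts z\<bar> < e / 2"
    proof -
      obtain d1 where "d1 > 0" "\<And>w. dist w z < d1 \<Longrightarrow> \<bar>fst' w - fst' z\<bar> < e / 2"
        using c(1) that \<open>e > 0\<close> unfolding continuous_at_eps_delta by (metis dist_real_def half_gt_zero)
      moreover obtain d2 where "d2 > 0" "\<And>w. dist w z < d2 \<Longrightarrow> \<bar>fts w - fts z\<bar> < e / 2"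
        using c(2) that \<open>e > 0\<close> unfolding continuous_at_eps_delta by (metis dist_real_def half_gt_zero)
      ultimately show ?thesis using that[of "min d1 d2"] by simp
    qed
    define h where "h = min d r / 4"
    have h: "0 < h" "2 * h < r" "2 * h < d" using d r by (auto simp: h_def min_def)
    obtain w where w: "dist z w \<le> 2 * h" "f (z + h *\<^sub>R \<i> + h *\<^sub>R 1) - f (z + h *\<^sub>R 1) - f (z + h *\<^sub>R \<i>) + f z = h * h * fst' w"
      using second_difference_mvt[OF sub[OF f], where d=1 and e=\<i>, of fss fst' h] sub[OF fs] h by auto
    obtain w' where w': "dist z w' \<le> 2 * h" "f (z + h *\<^sub>R 1 + h *\<^sub>R \<i>) - f (z + h *\<^sub>R \<i>) - f (z + h *\<^sub>R 1) + f z = h * h * fts w'"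
      using second_difference_mvt[OF sub[OF f], where d=\<i> and e=1, of fts ftt h] sub[OF ft] h by auto
    have "h * h * fst' w = h * h * fts w'" unfolding w(2)[symmetric] w'(2)[symmetric] by (simp add: algebra_simps)
    then have "fst' w = fts w'" using h by simp
    moreover have "\<bar>fst' w - fst' z\<bar> < e / 2" "\<bar>fts w' - fts z\<bar> < e / 2"
      using d(2)[of w] d(3)[of w'] w(1) w'(1) h by (simp_all add: dist_commute)
    ultimately show ?thesis by linarith
  qed
  then have "\<bar>fst' z - fts z\<bar> \<le> 0" by (rule field_le_epsilon) simp
  then show ?thesis by simp
qed

section \<open>Uniform estimates in a chart\<close>

lemma frechet_derivative_eqI: "(f has_derivative f') (at x) \<Longrightarrow> frechet_derivative f (at x) = f'"
  using frechet_derivative_at[of f f' x] by simp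

lemma linear_frechet_derivative_param:
  fixes F :: "'e::real_normed_vector \<Rightarrow> 'a::real_vector \<Rightarrow> 'b::real_normed_vector"
  assumes "open S" "\<And>y. y \<in> S \<Longrightarrow> linear (F y)" "\<And>y v. y \<in> S \<Longrightarrow> (\<lambda>y. F y v) differentiable (at y)" "y \<in> S"
  shows "linear (\<lambda>v. frechet_derivative (\<lambda>y. F y v) (at y) e)"
proof (rule linearI)
  have d: "((\<lambda>y. F y v) has_derivative frechet_derivative (\<lambda>y. F y v) (at y)) (at y)" for v
    using assms(3)[OF assms(4)] by (simp add: frechet_derivative_works)
  fix v w c
  have "((\<lambda>y. F y (v + w)) has_derivative (\<lambda>e. frechet_derivative (\<lambda>y. F y v) (at y) e + frechet_derivative (\<lambda>y. F y w) (at y) e)) (at y)"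
    by (rule has_derivative_transform_within_open[OF has_derivative_add[OF d d] assms(1,4)])
       (simp add: linear_add[OF assms(2)])
  from frechet_derivative_eqI[OF this]
  show "frechet_derivative (\<lambda>y. F y (v + w)) (at y) e =
      frechet_derivative (\<lambda>y. F y v) (at y) e + frechet_derivative (\<lambda>y. F y w) (at y) e" by simp
  have "((\<lambda>y. F y (c *\<^sub>R v)) has_derivative (\<lambda>e. c *\<^sub>R frechet_derivative (\<lambda>y. F y v) (at y) e)) (at y)"
    by (rule has_derivative_transform_within_open[OF has_derivative_scaleR_right[OF d] assms(1,4)])
       (simp add: linear_cmul[OF assms(2)])
  from frechet_derivative_eqI[OF this]
  show "frechet_derivative (\<lambda>y. F y (c *\<^sub>R v)) (at y) e = c *\<^sub>R frechet_derivative (\<lambda>y. F y v) (at y) e" by simp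
qed

lemma compact_bound_finite:
  fixes f :: "'i \<Rightarrow> 'e::topological_space \<Rightarrow> 'b::real_normed_vector"
  assumes "compact K" "finite A" "\<And>i. i \<in> A \<Longrightarrow> continuous_on K (f i)"
  obtains M where "M > 0" "\<And>i y. i \<in> A \<Longrightarrow> y \<in> K \<Longrightarrow> norm (f i y) \<le> M"
proof -
  have "\<exists>b. \<forall>y\<in>K. norm (f i y) \<le> b" if "i \<in> A" for i
    using compact_imp_bounded[OF compact_continuous_image[OF assms(3)[OF that] assms(1)]]
    by (auto simp: bounded_iff)
  then obtain b where b: "\<And>i y. i \<in> A \<Longrightarrow> y \<in> K \<Longrightarrow> norm (f i y) \<le> b i" by metis
  define M where "M = 1 + (\<Sum>i\<in>A. \<bar>b i\<bar>)"
  have "norm (f i y) \<le> M" if "i \<in> A" "y \<in> K" for i y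
    using b[OF that] member_le_sum[of i A "\<lambda>i. \<bar>b i\<bar>"] that assms(2) by (simp add: M_def)
  moreover have "M > 0" unfolding M_def by (simp add: add_pos_nonneg sum_nonneg)
  ultimately show ?thesis using that by blast
qed

text \<open>Smoothness is given for each fixed vector only. Linearity reduces uniform bounds to
  finitely many basis vectors, for each of which compactness of \<open>K\<close> applies.\<close>

lemma linear_field_bounds:
  fixes F :: "'e::euclidean_space \<Rightarrow> 'a::euclidean_space \<Rightarrow> 'b::real_normed_vector"
  assumes S: "open S" and lin: "\<And>y. y \<in> S \<Longrightarrow> linear (F y)" and sm: "\<And>v. smooth_on S (\<lambda>y. F y v)"
    and K: "compact K" "K \<subseteq> S"
  obtains M where "M > 0" "\<And>y v. y \<in> K \<Longrightarrow> norm (F y v) \<le> M * norm v"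
    "\<And>y v e. y \<in> K \<Longrightarrow> norm (frechet_derivative (\<lambda>y. F y v) (at y) e) \<le> M * norm v * norm e"
proof -
  have Ck: "Ck_on (Suc 0) S (\<lambda>y. F y v)" for v by (rule smooth_on_open_imp_Ck_on[OF sm S])
  have diff: "(\<lambda>y. F y v) differentiable (at y)" if "y \<in> S" for y v using Ck[of v] that by auto
  have "continuous_on K (\<lambda>y. F y b)" for b
    by (rule continuous_on_subset[OF smooth_on_continuous_on[OF sm] K(2)])
  then obtain M0 where M0: "M0 > 0" "\<And>b y. b \<in> Basis \<Longrightarrow> y \<in> K \<Longrightarrow> norm (F y b) \<le> M0"
    using compact_bound_finite[OF K(1) finite_Basis[where 'a='a], of "\<lambda>b y. F y b"] by metis
  have cd: "continuous_on K (\<lambda>y. frechet_derivative (\<lambda>y. F y v) (at y) e)" for v e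
  proof -
    have "continuous_on S (\<lambda>y. frechet_derivative (\<lambda>y. F y v) (at y) e)" using Ck[of v] by simp
    then show ?thesis by (rule continuous_on_subset[OF _ K(2)])
  qed
  obtain M1 where M1: "M1 > 0" "\<And>p y. p \<in> Basis \<times> Basis \<Longrightarrow> y \<in> K \<Longrightarrow> norm (frechet_derivative (\<lambda>y. F y (fst p)) (at y) (snd p)) \<le> M1"
    by (rule compact_bound_finite[OF K(1), of "Basis \<times> Basis :: ('a \<times> 'e) set" "\<lambda>p y. frechet_derivative (\<lambda>y. F y (fst p)) (at y) (snd p)"])
       (simp, rule cd, blast)
  define M where "M = M0 * DIM('a) + M1 * DIM('a) * DIM('e)"
  have p: "M0 * DIM('a) \<le> M" "M1 * DIM('a) * DIM('e) \<le> M" "M > 0"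
    using M0(1) M1(1) by (auto simp: M_def intro!: add_pos_nonneg)
  show ?thesis
  proof (rule that[OF p(3)])
    fix y v assume y: "y \<in> K"
    then have yS: "y \<in> S" using K by auto
    have "norm (F y v) \<le> M0 * DIM('a) * norm v"
      by (rule linear_norm_bound[OF lin[OF yS]]) (use M0(2) y in auto)
    then show "norm (F y v) \<le> M * norm v" using p(1) mult_right_mono[OF p(1), of "norm v"] by simp
    fix e
    have "bilinear (\<lambda>v e. frechet_derivative (\<lambda>y. F y v) (at y) e)"
      unfolding bilinear_def
      using linear_frechet_derivative_param[OF S lin diff yS] linear_frechet_derivative[OF diff[OF yS]] by blast
    then have "norm (frechet_derivative (\<lambda>y. F y v) (at y) e) \<le> M1 * DIM('a) * DIM('e) * norm v * norm e"
      by (rule bilinear_norm_bound[of "\<lambda>v e. frechet_derivative (\<lambda>y. F y v) (at y) e"]) (use M1(2) y in force)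
    also have "\<dots> \<le> M * norm v * norm e"
      using p(2) by (intro mult_right_mono) auto
    finally show "norm (frechet_derivative (\<lambda>y. F y v) (at y) e) \<le> M * norm v * norm e" .
  qed
qed

lemma bilinear_field_bounds:
  fixes F :: "'e::euclidean_space \<Rightarrow> 'a::euclidean_space \<Rightarrow> 'c::euclidean_space \<Rightarrow> real"
  assumes S: "open S" and lin: "\<And>y. y \<in> S \<Longrightarrow> bilinear (F y)" and sm: "\<And>v w. smooth_on S (\<lambda>y. F y v w)"
    and K: "compact K" "K \<subseteq> S"
  obtains M where "M > 0" "\<And>y v w. y \<in> K \<Longrightarrow> \<bar>F y v w\<bar> \<le> M * norm v * norm w"
    "\<And>y v w e. y \<in> K \<Longrightarrow> \<bar>frechet_derivative (\<lambda>y. F y v w) (at y) e\<bar> \<le> M * norm v * norm w * norm e"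
proof -
  have l: "linear (F y v)" "linear (\<lambda>v. F y v w)" if "y \<in> S" for y v w
    using lin[OF that] by (auto simp: bilinear_def)
  have "\<exists>M>0. (\<forall>y w. y \<in> K \<longrightarrow> norm (F y v w) \<le> M * norm w) \<and>
    (\<forall>y w e. y \<in> K \<longrightarrow> norm (frechet_derivative (\<lambda>y. F y v w) (at y) e) \<le> M * norm w * norm e)" for v
    by (rule linear_field_bounds[OF S, of "\<lambda>y. F y v", OF l(1) sm K]) blast+
  then obtain N where N: "\<And>v. N v > 0" "\<And>v y w. y \<in> K \<Longrightarrow> norm (F y v w) \<le> N v * norm w"
    "\<And>v y w e. y \<in> K \<Longrightarrow> norm (frechet_derivative (\<lambda>y. F y v w) (at y) e) \<le> N v * norm w * norm e"
    by metis
  define M0 where "M0 = (\<Sum>b\<in>Basis. N b)"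
  have NM: "N b \<le> M0" if "b \<in> Basis" for b
    unfolding M0_def using that N(1) by (intro member_le_sum) (auto intro: less_imp_le)
  have M0: "M0 > 0" unfolding M0_def using N(1) by (intro sum_pos) auto
  define M where "M = M0 * DIM('a)"
  have Mp: "M > 0" using M0 by (simp add: M_def)
  have diff: "(\<lambda>y. F y v w) differentiable (at y)" if "y \<in> S" for y v w
    using smooth_on_open_imp_Ck_on[OF sm S, of "Suc 0"] that by auto
  show ?thesis
  proof (rule that[OF Mp])
    fix y v w assume y: "y \<in> K"
    then have yS: "y \<in> S" using K by auto
    have "norm (F y v w) \<le> M0 * norm w * DIM('a) * norm v"
    proof (rule linear_norm_bound[OF l(2)[OF yS]])
      fix b :: 'a assume "b \<in> Basis"
      then show "norm (F y b w) \<le> M0 * norm w"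
        using N(2)[OF y, of b w] mult_right_mono[OF NM, of b "norm w"] by simp
    qed
    then show "\<bar>F y v w\<bar> \<le> M * norm v * norm w" by (simp add: M_def mult_ac)
    fix e
    have "norm (frechet_derivative (\<lambda>y. F y v w) (at y) e) \<le> M0 * norm w * norm e * DIM('a) * norm v"
    proof (rule linear_norm_bound[OF linear_frechet_derivative_param[OF S l(2) diff yS]])
      fix b :: 'a assume b: "b \<in> Basis"
      have "N b * (norm w * norm e) \<le> M0 * (norm w * norm e)" using NM[OF b] by (intro mult_right_mono) auto
      then show "norm (frechet_derivative (\<lambda>y. F y b w) (at y) e) \<le> M0 * norm w * norm e"
        using N(3)[OF y, of b w e] by (simp add: mult.assoc)
    qed
    then show "\<bar>frechet_derivative (\<lambda>y. F y v w) (at y) e\<bar> \<le> M * norm v * norm w * norm e"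
      by (simp add: M_def mult_ac)
  qed
qed

text \<open>A supremum of reals dominates its members once the set is bounded; the second assumption
  supplies some bound.\<close>

lemma tensor_norm_upper:
  assumes "tensor_norm nrm h k T \<le> c" "\<And>Xs. length Xs = k \<Longrightarrow> \<forall>X\<in>set Xs. h X X \<le> 1 \<Longrightarrow> nrm (T Xs) \<le> b"
    and "length Xs = k" "\<forall>X\<in>set Xs. h X X \<le> 1"
  shows "nrm (T Xs) \<le> c"
proof -
  have "nrm (T Xs) \<le> tensor_norm nrm h k T"
    unfolding tensor_norm_def
    by (rule cSUP_upper) (use assms in \<open>auto intro!: bdd_aboveI2\<close>)
  then show ?thesis using assms(1) by linarith
qed

text \<open>Passes from the operator norm of a metric to the Euclidean one. Division by sqrt M |X|
  makes a vector admissible in the supremum, once for each argument, and measuring the value loses a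
  factor sqrt m.\<close>

lemma tensor_norm_bilinear_bound:
  fixes f :: "'k::euclidean_space \<Rightarrow> 'k \<Rightarrow> 'k"
  assumes h: "m > 0" "M > 0" "\<And>w. m * (norm w)\<^sup>2 \<le> h w w" "\<And>w. h w w \<le> M * (norm w)\<^sup>2" "\<And>a w. h (a *\<^sub>R w) (a *\<^sub>R w) = a\<^sup>2 * h w w"
    and T: "\<And>X Y. T [X, Y] = f X Y" and f: "bilinear f"
    and c: "tensor_norm (\<lambda>y. sqrt (h y y)) h 2 T \<le> c"
  shows "norm (f X Y) \<le> c * M / sqrt m * norm X * norm Y"
proof -
  obtain b where b: "\<And>X Y. norm (f X Y) \<le> b * norm X * norm Y" "b \<ge> 0"
    using bilinear_bounded_pos[OF f] by (metis less_imp_le)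
  have n1: "norm X \<le> 1 / sqrt m" if "h X X \<le> 1" for X
  proof -
    have "(norm X)\<^sup>2 \<le> 1 / m" using h(3)[of X] that h(1) by (simp add: field_simps)
    then have "norm X \<le> sqrt (1 / m)" by (rule real_le_rsqrt)
    then show ?thesis by (simp add: real_sqrt_divide)
  qed
  have up: "sqrt (h w w) \<le> sqrt M * norm w" "sqrt m * norm w \<le> sqrt (h w w)" for w
    using real_sqrt_le_mono[OF h(4)[of w]] real_sqrt_le_mono[OF h(3)[of w]] by (simp_all add: real_sqrt_mult)
  have main: "sqrt (h (f X Y) (f X Y)) \<le> c" if "h X X \<le> 1" "h Y Y \<le> 1" for X Y
  proof -
    have "sqrt (h (T [X, Y]) (T [X, Y])) \<le> c"
    proof (rule tensor_norm_upper[OF c])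
      fix Xs :: "'k list" assume Xs: "length Xs = 2" "\<forall>X\<in>set Xs. h X X \<le> 1"
      then obtain X Y where XY: "Xs = [X, Y]" by (metis One_nat_def Suc_1 length_0_conv length_Suc_conv)
      have "norm (f X Y) \<le> b * (1 / sqrt m) * (1 / sqrt m)"
      proof (rule order_trans[OF b(1)])
        have nn: "norm X \<le> 1 / sqrt m" "norm Y \<le> 1 / sqrt m" using n1 Xs(2) XY by auto
        show "b * norm X * norm Y \<le> b * (1 / sqrt m) * (1 / sqrt m)"
          by (intro mult_mono nn order_refl) (use b(2) h(1) in auto)
      qed
      then show "sqrt (h (T Xs) (T Xs)) \<le> sqrt M * (b * (1 / sqrt m) * (1 / sqrt m))"
        unfolding XY T using up(1)[of "f X Y"] h(2) by (meson mult_left_mono order_trans real_sqrt_ge_zero less_imp_le)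
    qed (use that in auto)
    then show ?thesis by (simp add: T)
  qed
  have sM: "sqrt M > 0" "sqrt m > 0" using h by auto
  show ?thesis
  proof (cases "X = 0 \<or> Y = 0")
    case True
    then have "f X Y = 0" using bilinear_lzero[OF f] bilinear_rzero[OF f] by auto
    moreover have "c \<ge> 0" using main[of 0 0] h(3)[of 0] h(4)[of 0] up(2)[of "f 0 0"] bilinear_lzero[OF f]
      by (simp add: bilinear_lzero[OF f])
    ultimately show ?thesis using h by auto
  next
    case False
    define s where "s X = 1 / (sqrt M * norm X)" for X :: 'k
    have s1: "h (s X *\<^sub>R X) (s X *\<^sub>R X) \<le> 1" if "X \<noteq> 0" for X
      using h(4)[of X] that h(2) unfolding h(5) by (simp add: s_def power_divide power_mult_distrib field_simps)
    have sp: "s X > 0" if "X \<noteq> 0" for X using that sM by (simp add: s_def)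
    have "sqrt m * norm (f (s X *\<^sub>R X) (s Y *\<^sub>R Y)) \<le> c"
      using main[OF s1 s1, of X Y] False up(2)[of "f (s X *\<^sub>R X) (s Y *\<^sub>R Y)"] by force
    moreover have "f (s X *\<^sub>R X) (s Y *\<^sub>R Y) = (s X * s Y) *\<^sub>R f X Y"
      by (simp add: bilinear_lmul[OF f] bilinear_rmul[OF f])
    ultimately have "sqrt m * (s X * s Y * norm (f X Y)) \<le> c"
      using sp[of X] sp[of Y] False by simp
    moreover have "s X * s Y = 1 / (M * norm X * norm Y)" using h(2) by (simp add: s_def field_simps)
    ultimately have "sqrt m * norm (f X Y) / (M * norm X * norm Y) \<le> c" by simp
    then show ?thesis using False h sM by (simp add: field_simps)
  qed
qed

lemma tensor_norm_linear_bound: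
  fixes f :: "'k::euclidean_space \<Rightarrow> 'k"
  assumes h: "m > 0" "M > 0" "\<And>w. m * (norm w)\<^sup>2 \<le> h w w" "\<And>w. h w w \<le> M * (norm w)\<^sup>2" "\<And>a w. h (a *\<^sub>R w) (a *\<^sub>R w) = a\<^sup>2 * h w w"
    and T: "\<And>X. T [X] = f X" and f: "linear f"
    and c: "tensor_norm (\<lambda>y. sqrt (h y y)) h 1 T \<le> c"
  shows "norm (f X) \<le> c * sqrt M / sqrt m * norm X"
proof -
  obtain b where b: "\<And>X. norm (f X) \<le> b * norm X" "b \<ge> 0"
    using linear_bounded_pos[OF f] by (metis less_imp_le)
  have n1: "norm X \<le> 1 / sqrt m" if "h X X \<le> 1" for X
  proof -
    have "(norm X)\<^sup>2 \<le> 1 / m" using h(3)[of X] that h(1) by (simp add: field_simps)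
    then have "norm X \<le> sqrt (1 / m)" by (rule real_le_rsqrt)
    then show ?thesis by (simp add: real_sqrt_divide)
  qed
  have up: "sqrt (h w w) \<le> sqrt M * norm w" "sqrt m * norm w \<le> sqrt (h w w)" for w
    using real_sqrt_le_mono[OF h(4)[of w]] real_sqrt_le_mono[OF h(3)[of w]] by (simp_all add: real_sqrt_mult)
  have main: "sqrt (h (f X) (f X)) \<le> c" if "h X X \<le> 1" for X
  proof -
    have "sqrt (h (T [X]) (T [X])) \<le> c"
    proof (rule tensor_norm_upper[OF c])
      fix Xs :: "'k list" assume Xs: "length Xs = 1" "\<forall>X\<in>set Xs. h X X \<le> 1"
      then obtain X where XY: "Xs = [X]" by (metis One_nat_def length_0_conv length_Suc_conv)
      have "norm (f X) \<le> b * (1 / sqrt m)"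
      proof (rule order_trans[OF b(1)])
        have "norm X \<le> 1 / sqrt m" using n1 Xs(2) XY by auto
        then show "b * norm X \<le> b * (1 / sqrt m)" using b(2) by (rule mult_left_mono)
      qed
      then show "sqrt (h (T Xs) (T Xs)) \<le> sqrt M * (b * (1 / sqrt m))"
        unfolding XY T using up(1)[of "f X"] h(2) by (meson mult_left_mono order_trans real_sqrt_ge_zero less_imp_le)
    qed (use that in auto)
    then show ?thesis by (simp add: T)
  qed
  have sM: "sqrt M > 0" "sqrt m > 0" using h by auto
  show ?thesis
  proof (cases "X = 0")
    case True
    then show ?thesis using linear_0[OF f] by simp
  next
    case False
    define s where "s = 1 / (sqrt M * norm X)"
    have s1: "h (s *\<^sub>R X) (s *\<^sub>R X) \<le> 1"
      using h(4)[of X] False h(2) unfolding h(5) by (simp add: s_def power_divide power_mult_distrib field_simps)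
    have sp: "s > 0" using False sM by (simp add: s_def)
    have "sqrt m * norm (f (s *\<^sub>R X)) \<le> c"
      using main[OF s1] up(2)[of "f (s *\<^sub>R X)"] by linarith
    then have "sqrt m * (s * norm (f X)) \<le> c"
      using sp by (simp add: linear_cmul[OF f])
    then show ?thesis using False sM by (simp add: s_def field_simps)
  qed
qed

section \<open>Asymptotically cylindrical structures in charts\<close>

text \<open>Sending y to the functional \<open>G y\<close> is injective by positivity, hence onto in
  finite dimension. It makes the description operator in \<open>christoffel\<close>
  meaningful.\<close>

lemma ex1_riesz:
  fixes G :: "'k::euclidean_space \<Rightarrow> 'k \<Rightarrow> real"
  assumes b: "bilinear G" and pos: "\<And>v. v \<noteq> 0 \<Longrightarrow> G v v > 0" and r: "linear r"
  shows "\<exists>!y. \<forall>z. G y z = r z"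
proof -
  define L where "L y = (\<Sum>b\<in>Basis. G y b *\<^sub>R b)" for y
  have Lb: "L y \<bullet> b = G y b" if "b \<in> Basis" for y b
    using that by (simp add: L_def inner_sum_left inner_Basis if_distrib cong: if_cong)
  have l: "linear L"
    by (rule linearI) (simp_all add: L_def bilinear_ladd[OF b] bilinear_lmul[OF b] scaleR_add_left sum.distrib scaleR_sum_right)
  have lin: "linear (G y)" for y using b by (simp add: bilinear_def)
  have eqI: "\<forall>z. G y z = q z" if "linear q" "\<And>b. b \<in> Basis \<Longrightarrow> G y b = q b" for y and q :: "'k \<Rightarrow> real"
    using linear_eq_stdbasis[OF lin that(1)] that(2) by metis
  have inj: "inj L"
  proof (rule linear_injective_0[OF l, THEN iffD2], intro allI impI)
    fix y assume "L y = 0"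
    then have "G y b = 0" if "b \<in> Basis" for b using Lb[OF that, of y] by simp
    then have "\<forall>z. G y z = 0" by (intro eqI[of "\<lambda>_. 0"]) (auto simp: linear_zero)
    then have "G y y = 0" by blast
    then show "y = 0" using pos[of y] by force
  qed
  have s: "surj L" by (rule linear_injective_imp_surjective[OF l inj refl])
  obtain y where y: "L y = (\<Sum>b\<in>Basis. r b *\<^sub>R b)" using surjD[OF s, of "\<Sum>b\<in>Basis. r b *\<^sub>R b"] by metis
  have "G y b = r b" if "b \<in> Basis" for b
    using Lb[OF that, of y] that unfolding y by (simp add: inner_sum_left inner_Basis if_distrib cong: if_cong)
  then have 1: "\<forall>z. G y z = r z" by (rule eqI[OF r])
  moreover have "y' = y" if "\<forall>z. G y' z = r z" for y'
  proof -
    have "L y' = L y" using that 1 by (simp add: L_def)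
    then show ?thesis using inj by (simp add: inj_eq)
  qed
  ultimately show ?thesis by blast
qed

text \<open>The boundary r = 0 is included: in each basis direction arbitrarily small steps stay
  inside the half-cylinder, the step along \<partial>_r being taken forward, and this already
  determines the derivative.\<close>

lemma halfspace_derivative_unique:
  fixes f :: "real \<times> 'e::euclidean_space \<Rightarrow> 'b::real_normed_vector"
  assumes Q: "open Q" and x: "x \<in> {0::real..} \<times> Q"
    and f: "(f has_derivative f') (at x within {0::real..} \<times> Q)" "(f has_derivative f'') (at x within {0::real..} \<times> Q)"
  shows "f' = f''"
proof (rule frechet_derivative_unique_within[OF f])
  fix b :: "real \<times> 'e" and e :: real assume b: "b \<in> Basis" and e: "e > 0"
  have xs: "fst x \<ge> 0" "snd x \<in> Q" using x by (auto simp: mem_Times_iff)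
  show "\<exists>d. 0 < \<bar>d\<bar> \<and> \<bar>d\<bar> < e \<and> x + d *\<^sub>R b \<in> {0::real..} \<times> Q"
  proof (cases "snd b = 0")
    case True
    then have "fst b = 1" using b by (auto simp: Basis_prod_def)
    then show ?thesis using True xs e by (intro exI[of _ "e / 2"]) (auto simp: mem_Times_iff)
  next
    case False
    then have b0: "fst b = 0" "norm (snd b) = 1" using b by (auto simp: Basis_prod_def)
    obtain r where r: "r > 0" "ball (snd x) r \<subseteq> Q" using Q xs(2) open_contains_ball by blast
    define d where "d = min r e / 2"
    have d: "0 < d" "d < r" "d < e" using r e by (auto simp: d_def min_def)
    have "snd x + d *\<^sub>R snd b \<in> ball (snd x) r" using d b0 by (simp add: dist_norm)
    then show ?thesis using r d xs b0 by (intro exI[of _ d]) (auto simp: mem_Times_iff)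
  qed
qed

locale asymp_cyl =
  fixes d :: nat and B :: "'e::euclidean_space list" and I :: "'i set" and C :: "'i \<Rightarrow> ('v::t2_space, 'e) chart"
    and g :: "'i \<Rightarrow> real \<times> 'e \<Rightarrow> real \<times> 'e \<Rightarrow> real \<times> 'e \<Rightarrow> real"
    and J Jinf :: "'i \<Rightarrow> real \<times> 'e \<Rightarrow> real \<times> 'e \<Rightarrow> real \<times> 'e"
    and winf :: "'i \<Rightarrow> 'e \<Rightarrow> 'e \<Rightarrow> 'e \<Rightarrow> real"
  assumes man: "closed_oriented_manifold d B I C"
    and acs: "almost_complex_structure I (watlas C) J"
    and met: "riemannian_metric I (watlas C) g" and tig: "translation_invariant I C g"
    and ac: "asymptotically_cylindrical I C g J Jinf winf"
begin

abbreviation "R i \<equiv> chart_range (C i)"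
abbreviation "S i \<equiv> {0::real..} \<times> chart_range (C i)"

lemma chart_range_watlas: "chart_range (watlas C i) = S i"
  by (force simp: chart_range_def watlas_def wchart_def)

lemma watlas_simps: "fst (watlas C i) = {0..} \<times> fst (C i)" "snd (watlas C i) x = (fst x, snd (C i) (snd x))"
  by (auto simp: watlas_def wchart_def map_prod_def split: prod.splits)

lemma chart:
  assumes "i \<in> I"
  shows "open (fst (C i))" "open (R i)" "homeomorphism (fst (C i)) (R i) (snd (C i)) (chart_inv (C i))"
  using man assms by (auto simp: closed_oriented_manifold_def)

lemma chart_cover: "\<exists>i\<in>I. p \<in> fst (C i)"
  using man unfolding closed_oriented_manifold_def by blast

lemmas acs_Jinf = ac[unfolded asymptotically_cylindrical_def, THEN conjunct1]
  and ti_Jinf = ac[unfolded asymptotically_cylindrical_def, THEN conjunct2, THEN conjunct1]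
  and tail_J = ac[unfolded asymptotically_cylindrical_def, THEN conjunct2, THEN conjunct2, THEN conjunct1]
  and d_lambda_inf = ac[unfolded asymptotically_cylindrical_def, THEN conjunct2, THEN conjunct2, THEN conjunct2, THEN conjunct1]
  and reeb_inf_eq = ac[unfolded asymptotically_cylindrical_def, THEN conjunct2, THEN conjunct2, THEN conjunct2, THEN conjunct2, THEN conjunct1]
  and closed_winf = ac[unfolded asymptotically_cylindrical_def, THEN conjunct2, THEN conjunct2, THEN conjunct2, THEN conjunct2, THEN conjunct2, THEN conjunct1]
  and winf_reeb = ac[unfolded asymptotically_cylindrical_def, THEN conjunct2, THEN conjunct2, THEN conjunct2, THEN conjunct2, THEN conjunct2, THEN conjunct2, THEN conjunct1]
  and winf_pos_inf = ac[unfolded asymptotically_cylindrical_def, THEN conjunct2, THEN conjunct2, THEN conjunct2, THEN conjunct2, THEN conjunct2, THEN conjunct2, THEN conjunct2, THEN conjunct1]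
  and omega_pos = ac[unfolded asymptotically_cylindrical_def, THEN conjunct2, THEN conjunct2, THEN conjunct2, THEN conjunct2, THEN conjunct2, THEN conjunct2, THEN conjunct2, THEN conjunct2, THEN conjunct1]

lemma acs_unfold:
  assumes "almost_complex_structure I (watlas C) A"
  shows "i \<in> I \<Longrightarrow> x \<in> S i \<Longrightarrow> cplx_struct (A i x)" "i \<in> I \<Longrightarrow> smooth_on (S i) (\<lambda>x. A i x v)"
proof -
  note a = assms[unfolded almost_complex_structure_def endo_field_def chart_range_watlas]
  assume i: "i \<in> I"
  show "smooth_on (S i) (\<lambda>x. A i x v)" using a i by blast
  assume x: "x \<in> S i"
  have "linear (A i x)" using a i x by blast
  moreover have "A i x (A i x v) = - v" for v using a i x by blast
  ultimately show "cplx_struct (A i x)" by (rule cplx_struct.intro)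
qed

lemmas J_struct = acs_unfold(1)[OF acs] and Jinf_struct = acs_unfold(1)[OF acs_Jinf]
  and smooth_J = acs_unfold(2)[OF acs] and smooth_Jinf = acs_unfold(2)[OF acs_Jinf]

lemma smooth_g: "i \<in> I \<Longrightarrow> smooth_on (S i) (\<lambda>x. g i x v w)"
  and bilinear_g: "i \<in> I \<Longrightarrow> x \<in> S i \<Longrightarrow> bilinear (g i x)"
  and g_pos: "i \<in> I \<Longrightarrow> x \<in> S i \<Longrightarrow> v \<noteq> 0 \<Longrightarrow> g i x v v > 0"
proof -
  note m = met[unfolded riemannian_metric_def bilinear_field_def chart_range_watlas]
  show "i \<in> I \<Longrightarrow> smooth_on (S i) (\<lambda>x. g i x v w)" using m by blast
  show "i \<in> I \<Longrightarrow> x \<in> S i \<Longrightarrow> bilinear (g i x)" using m by blast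
  show "i \<in> I \<Longrightarrow> x \<in> S i \<Longrightarrow> v \<noteq> 0 \<Longrightarrow> g i x v v > 0" using m by blast
qed

lemma translation_invariantD:
  assumes "translation_invariant I C T" "i \<in> I" "x \<in> S i"
  shows "T i x = T i (0, snd x)"
proof -
  obtain r y where x: "x = (r, y)" "r \<ge> 0" "y \<in> R i" using assms(3) by (cases x) auto
  have "T i (r, y) = T i (0, y)" using assms(1,2) x(2,3) unfolding translation_invariant_def by blast
  then show ?thesis unfolding x(1) snd_conv .
qed

lemma Jinf_invariant: "i \<in> I \<Longrightarrow> x \<in> S i \<Longrightarrow> Jinf i x = Jinf i (0, snd x)"
  by (rule translation_invariantD[OF ti_Jinf])

lemma g_invariant: "i \<in> I \<Longrightarrow> x \<in> S i \<Longrightarrow> g i x = g i (0, snd x)"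
  by (rule translation_invariantD[OF tig])

lemma smooth_slice: "smooth_on (S i) f \<Longrightarrow> smooth_on (R i) (\<lambda>y. f (0, y))"
proof -
  assume f: "smooth_on (S i) f"
  have "bounded_linear (\<lambda>y::'e. (0::real, y))"
    by (intro bounded_linear_Pair bounded_linear_zero bounded_linear_ident)
  from smooth_on_compose_affine[OF f this, of "R i" 0] show "smooth_on (R i) (\<lambda>y. f (0, y))"
    by (simp only: add_0) auto
qed

lemma winf_facts:
  "i \<in> I \<Longrightarrow> y \<in> R i \<Longrightarrow> bilinear (winf i y)"
  "i \<in> I \<Longrightarrow> smooth_on (R i) (\<lambda>y. winf i y v w)"
  "i \<in> I \<Longrightarrow> y \<in> R i \<Longrightarrow> winf i y v w = - winf i y w v"
proof -
  note m = closed_winf[unfolded closed_two_form_def bilinear_field_def]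
  show "i \<in> I \<Longrightarrow> y \<in> R i \<Longrightarrow> bilinear (winf i y)" using m by blast
  show "i \<in> I \<Longrightarrow> smooth_on (R i) (\<lambda>y. winf i y v w)" using m by blast
  show "i \<in> I \<Longrightarrow> y \<in> R i \<Longrightarrow> winf i y v w = - winf i y w v" using m by blast
qed

lemma within_S_unique:
  fixes f :: "real \<times> 'e \<Rightarrow> 'b::real_normed_vector"
  assumes "i \<in> I" "x \<in> S i" "(f has_derivative f') (at x within S i)" "(f has_derivative f'') (at x within S i)"
  shows "f' = f''"
  by (rule halfspace_derivative_unique[OF chart(2)[OF assms(1)] assms(2-4)])

lemma frechet_within_S:
  assumes "i \<in> I" "x \<in> S i" "(f has_derivative f') (at x within S i)"
  shows "frechet_derivative f (at x within S i) = f'"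
  using within_S_unique[OF assms(1,2) _ assms(3)] assms(3)
  by (metis differentiableI frechet_derivative_works)

text \<open>A field independent of r can be differentiated on the open chart range of V, where no
  boundary occurs.\<close>

lemma has_derivative_slice:
  assumes "i \<in> I" "x \<in> S i" "\<And>x. x \<in> S i \<Longrightarrow> f x = h (snd x)" "h differentiable (at (snd x))"
  shows "(f has_derivative (\<lambda>e. frechet_derivative h (at (snd x)) (snd e))) (at x within S i)"
proof -
  have "((\<lambda>x. h (snd x)) has_derivative (\<lambda>e. frechet_derivative h (at (snd x)) (snd e))) (at x within S i)"
    using has_derivative_compose[of snd snd x "S i" h] assms(4)
    by (simp add: frechet_derivative_works has_derivative_snd)
  then show ?thesis
    by (rule has_derivative_transform_within[OF _ zero_less_one assms(2)]) (use assms(3) in auto)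
qed

lemma frechet_slice:
  assumes "i \<in> I" "x \<in> S i" "\<And>x. x \<in> S i \<Longrightarrow> f x = h (snd x)" "h differentiable (at (snd x))"
  shows "frechet_derivative f (at x within S i) e = frechet_derivative h (at (snd x)) (snd e)"
  using frechet_within_S[OF assms(1,2) has_derivative_slice[OF assms]] by simp

lemma differentiable_slice:
  assumes "i \<in> I" "smooth_on (R i) h" "y \<in> R i" shows "h differentiable (at y)"
  using smooth_on_open_imp_Ck_on[OF assms(2) chart(2)[OF assms(1)], of "Suc 0"] assms(3) by simp

text \<open>Translation invariance moves the point to r = 0, and there K times the unit sphere is
  compact. This makes the constants uniform on the non-compact half-cylinder.\<close>

lemma metric_bounds:
  fixes G :: "real \<times> 'e \<Rightarrow> real \<times> 'e \<Rightarrow> real \<times> 'e \<Rightarrow> real"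
  assumes "i \<in> I" "compact K" "K \<subseteq> R i"
    and G: "\<And>x. x \<in> S i \<Longrightarrow> bilinear (G x)" "\<And>x v. x \<in> S i \<Longrightarrow> v \<noteq> 0 \<Longrightarrow> G x v v > (0::real)"
      "\<And>x. x \<in> S i \<Longrightarrow> G x = G (0, snd x)" "\<And>v w. smooth_on (S i) (\<lambda>x. G x v w)"
  obtains m M where "m > 0" "M > 0" "\<And>x v. x \<in> {0..} \<times> K \<Longrightarrow> m * (norm v)\<^sup>2 \<le> G x v v"
    "\<And>x v w. x \<in> {0..} \<times> K \<Longrightarrow> \<bar>G x v w\<bar> \<le> M * norm v * norm w"
    "\<And>y v w e. y \<in> K \<Longrightarrow> \<bar>frechet_derivative (\<lambda>y. G (0, y) v w) (at y) e\<bar> \<le> M * norm v * norm w * norm e"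
proof -
  have K0: "(0, y) \<in> S i" if "y \<in> K" for y using that assms by auto
  obtain M where M: "M > 0" "\<And>y v w. y \<in> K \<Longrightarrow> \<bar>G (0, y) v w\<bar> \<le> M * norm v * norm w"
    "\<And>y v w e. y \<in> K \<Longrightarrow> \<bar>frechet_derivative (\<lambda>y. G (0, y) v w) (at y) e\<bar> \<le> M * norm v * norm w * norm e"
    by (rule bilinear_field_bounds[OF chart(2)[OF assms(1)], of "\<lambda>y. G (0, y)", OF _ smooth_slice[OF G(4)] assms(2,3)])
       (use G(1) in auto)
  define Q where "Q p = G (0, fst p) (snd p) (snd p)" for p
  have Qc: "continuous_on (K \<times> sphere 0 1) Q"
  proof -
    \<comment> \<open>Expansion in the basis gives joint continuity in point and vector from
      continuity for fixed vectors.\<close>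
    have e: "G (0, y) v v = (\<Sum>b\<in>Basis. \<Sum>b'\<in>Basis. (v \<bullet> b) * (v \<bullet> b') * G (0, y) b b')" if "y \<in> K" for y v
    proof -
      have b: "bilinear (G (0, y))" using G(1) K0[OF that] by blast
      have "G (0, y) v v = G (0, y) (\<Sum>b\<in>Basis. (v \<bullet> b) *\<^sub>R b) (\<Sum>b\<in>Basis. (v \<bullet> b) *\<^sub>R b)" by (simp add: euclidean_representation)
      also have "\<dots> = (\<Sum>(b, b')\<in>Basis \<times> Basis. G (0, y) ((v \<bullet> b) *\<^sub>R b) ((v \<bullet> b') *\<^sub>R b'))"
        by (rule bilinear_sum[OF b])
      also have "\<dots> = (\<Sum>b\<in>Basis. \<Sum>b'\<in>Basis. (v \<bullet> b) * (v \<bullet> b') * G (0, y) b b')"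
        by (simp add: sum.cartesian_product bilinear_lmul[OF b] bilinear_rmul[OF b] mult_ac)
      finally show ?thesis .
    qed
    have c: "continuous_on K (\<lambda>y. G (0, y) b b')" for b b'
      by (rule continuous_on_subset[OF smooth_on_continuous_on[OF smooth_slice[OF G(4)]] assms(3)])
    have "continuous_on (K \<times> sphere 0 1) (\<lambda>p. \<Sum>b\<in>Basis. \<Sum>b'\<in>Basis. (snd p \<bullet> b) * (snd p \<bullet> b') * G (0, fst p) b b')"
      by (intro continuous_intros continuous_on_compose2[OF c]) auto
    then show ?thesis
      by (rule continuous_on_eq) (auto simp: Q_def e)
  qed
  have "\<exists>m>0. \<forall>y\<in>K. \<forall>v. m * (norm v)\<^sup>2 \<le> G (0, y) v v"
  proof (cases "K = {}")
    case False
    have "K \<times> sphere (0 :: real \<times> 'e) 1 \<noteq> {}" using False by simp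
    moreover have "compact (K \<times> sphere (0 :: real \<times> 'e) 1)" by (intro compact_Times assms) auto
    ultimately obtain p where p: "p \<in> K \<times> sphere 0 1" "\<And>q. q \<in> K \<times> sphere 0 1 \<Longrightarrow> Q p \<le> Q q"
      using continuous_attains_inf[OF _ _ Qc] by blast
    have "snd p \<noteq> 0" "fst p \<in> K" using p(1) by (auto simp: mem_Times_iff)
    then have "Q p > 0" using G(2)[OF K0, of "fst p" "snd p"] by (simp add: Q_def)
    moreover have "Q p * (norm v)\<^sup>2 \<le> G (0, y) v v" if "y \<in> K" for y v
    proof (cases "v = 0")
      case True
      then show ?thesis using bilinear_lzero[OF G(1)[OF K0[OF that]]] by simp
    next
      case v: False
      have b: "bilinear (G (0, y))" using G(1) K0[OF that] by blast
      have "Q p \<le> Q (y, v /\<^sub>R norm v)" by (rule p(2)) (use that v in auto)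
      also have "\<dots> = G (0, y) v v / (norm v)\<^sup>2"
        by (simp add: Q_def bilinear_lmul[OF b] bilinear_rmul[OF b] power2_eq_square field_simps)
      finally show ?thesis using v by (simp add: field_simps)
    qed
    ultimately show ?thesis by blast
  qed (auto intro: exI[of _ 1])
  then obtain m where m: "m > 0" "\<And>y v. y \<in> K \<Longrightarrow> m * (norm v)\<^sup>2 \<le> G (0, y) v v" by blast
  show ?thesis
  proof (rule that[OF m(1) M(1) _ _ M(3)])
    fix x :: "real \<times> 'e" and v w assume x: "x \<in> {0..} \<times> K"
    then have "x \<in> S i" and k: "snd x \<in> K" using assms(3) by (auto simp: mem_Times_iff)
    then have e: "G x = G (0, snd x)" by (intro G(3))
    show "m * (norm v)\<^sup>2 \<le> G x v v" unfolding e by (rule m(2)[OF k])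
    show "\<bar>G x v w\<bar> \<le> M * norm v * norm w" unfolding e by (rule M(2)[OF k])
  qed
qed

lemma g_bounds:
  assumes "i \<in> I" "compact K" "K \<subseteq> R i"
  obtains m M where "m > 0" "M > 0" "\<And>x v. x \<in> {0..} \<times> K \<Longrightarrow> m * (norm v)\<^sup>2 \<le> g i x v v"
    "\<And>x v w. x \<in> {0..} \<times> K \<Longrightarrow> \<bar>g i x v w\<bar> \<le> M * norm v * norm w"
    "\<And>y v w e. y \<in> K \<Longrightarrow> \<bar>frechet_derivative (\<lambda>y. g i (0, y) v w) (at y) e\<bar> \<le> M * norm v * norm w * norm e"
proof (rule metric_bounds[OF assms, of "g i"])
  show "bilinear (g i x)" if "x \<in> S i" for x by (rule bilinear_g[OF assms(1) that])
  show "g i x v v > 0" if "x \<in> S i" "v \<noteq> 0" for x v by (rule g_pos[OF assms(1) that])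
  show "g i x = g i (0, snd x)" if "x \<in> S i" for x by (rule g_invariant[OF assms(1) that])
  show "smooth_on (S i) (\<lambda>x. g i x v w)" for v w by (rule smooth_g[OF assms(1)])
next
  fix m M
  assume a: "m > 0" "M > 0" "\<And>x v. x \<in> {0..} \<times> K \<Longrightarrow> m * (norm v)\<^sup>2 \<le> g i x v v"
    "\<And>x v w. x \<in> {0..} \<times> K \<Longrightarrow> \<bar>g i x v w\<bar> \<le> M * norm v * norm w"
    "\<And>y v w e. y \<in> K \<Longrightarrow> \<bar>frechet_derivative (\<lambda>y. g i (0, y) v w) (at y) e\<bar> \<le> M * norm v * norm w * norm e"
  show thesis by (rule that; fact a)
qed

text \<open>Testing Koszul's formula for the symbol y with z = y gives m |y|^2 \<le> (3/2) M |v| |w|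
  |y|; bilinearity follows from uniqueness. The bound serves to recover coordinate derivatives from
  covariant ones.\<close>

lemma christoffel_bound:
  assumes "i \<in> I" "compact K" "K \<subseteq> R i"
  obtains M where "M > 0" "\<And>x v w. x \<in> {0..} \<times> K \<Longrightarrow> norm (christoffel (S i) (g i) x v w) \<le> M * norm v * norm w"
    "\<And>x. x \<in> {0..} \<times> K \<Longrightarrow> bilinear (christoffel (S i) (g i) x)"
proof -
  obtain m M where m: "m > 0" "M > 0" "\<And>x v. x \<in> {0..} \<times> K \<Longrightarrow> m * (norm v)\<^sup>2 \<le> g i x v v"
    "\<And>x v w. x \<in> {0..} \<times> K \<Longrightarrow> \<bar>g i x v w\<bar> \<le> M * norm v * norm w"
    "\<And>y v w e. y \<in> K \<Longrightarrow> \<bar>frechet_derivative (\<lambda>y. g i (0, y) v w) (at y) e\<bar> \<le> M * norm v * norm w * norm e"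
    using g_bounds[OF assms] by blast
  define D where "D y a b e = frechet_derivative (\<lambda>y. g i (0, y) a b) (at y) e" for y a b e
  define \<Gamma> where "\<Gamma> x v w = christoffel (S i) (g i) x v w" for x v w
  define rhs where "rhs x v w z = (D (snd x) w z (snd v) + D (snd x) v z (snd w) - D (snd x) v w (snd z)) / 2" for x v w z :: "real \<times> 'e"
  have lin: "linear (\<lambda>a. D y a b e)" "linear (\<lambda>b. D y a b e)" "linear (D y a b)" if y: "y \<in> K" for y a b e
  proof -
    have o: "open (R i)" and yR: "y \<in> R i" and bil: "\<And>y. y \<in> R i \<Longrightarrow> bilinear (g i (0, y))"
      using chart(2) assms y bilinear_g[OF assms(1)] by auto
    have df: "(\<lambda>y. g i (0, y) a b) differentiable (at y)" if "y \<in> R i" for a b y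
      by (rule differentiable_slice[OF assms(1) smooth_slice[OF smooth_g[OF assms(1)]] that])
    show "linear (\<lambda>a. D y a b e)" unfolding D_def
      by (rule linear_frechet_derivative_param[OF o _ df yR]) (use bil in \<open>unfold bilinear_def, blast\<close>)
    show "linear (\<lambda>b. D y a b e)" unfolding D_def
      by (rule linear_frechet_derivative_param[OF o _ df yR]) (use bil in \<open>unfold bilinear_def, blast\<close>)
    show "linear (D y a b)" unfolding D_def by (rule linear_frechet_derivative[OF df[OF yR]])
  qed
  have ch: "\<Gamma> x v w = (THE y. \<forall>z. g i x y z = rhs x v w z)" if x: "x \<in> {0..} \<times> K" for x v w
  proof -
    have xS: "x \<in> S i" using x assms(3) by (auto simp: mem_Times_iff)
    have "frechet_derivative (\<lambda>x. g i x a b) (at x within S i) e = D (snd x) a b (snd e)" for a b e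
      unfolding D_def
    proof (rule frechet_slice[OF assms(1) xS, of "\<lambda>x. g i x a b" "\<lambda>y. g i (0, y) a b"])
      show "g i x a b = g i (0, snd x) a b" if "x \<in> S i" for x
        by (subst g_invariant[OF assms(1) that]) (rule refl)
      show "(\<lambda>y. g i (0, y) a b) differentiable at (snd x)"
        by (rule differentiable_slice[OF assms(1) smooth_slice[OF smooth_g[OF assms(1)]]]) (use xS in \<open>simp add: mem_Times_iff\<close>)
    qed
    then show ?thesis by (simp add: \<Gamma>_def christoffel_def rhs_def)
  qed
  have rlin: "linear (rhs x v w)" "rhs x (v + v') w z = rhs x v w z + rhs x v' w z" "rhs x v (w + w') z = rhs x v w z + rhs x v w' z"
    "rhs x (c *\<^sub>R v) w z = c * rhs x v w z" "rhs x v (c *\<^sub>R w) z = c * rhs x v w z" if x: "x \<in> {0..} \<times> K" for x v w v' w' c z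
  proof -
    have y: "snd x \<in> K" using x by auto
    note ls = linear_add[OF lin(1)[OF y]] linear_add[OF lin(2)[OF y]] linear_add[OF lin(3)[OF y]]
      linear_cmul[OF lin(1)[OF y]] linear_cmul[OF lin(2)[OF y]] linear_cmul[OF lin(3)[OF y]]
    show "linear (rhs x v w)"
      by (rule linearI) (simp_all add: rhs_def ls algebra_simps add_divide_distrib diff_divide_distrib)
    show "rhs x (v + v') w z = rhs x v w z + rhs x v' w z" "rhs x v (w + w') z = rhs x v w z + rhs x v w' z"
      "rhs x (c *\<^sub>R v) w z = c * rhs x v w z" "rhs x v (c *\<^sub>R w) z = c * rhs x v w z"
      by (simp_all add: rhs_def ls algebra_simps add_divide_distrib diff_divide_distrib)
  qed
  have xS: "x \<in> S i" if "x \<in> {0..} \<times> K" for x using that assms(3) by (auto simp: mem_Times_iff)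
  have ex1: "\<exists>!y. \<forall>z. g i x y z = rhs x v w z" if x: "x \<in> {0..} \<times> K" for x v w
    by (rule ex1_riesz[OF bilinear_g[OF assms(1) xS[OF x]] g_pos[OF assms(1) xS[OF x]] rlin(1)[OF x]])
  have \<Gamma>: "g i x (\<Gamma> x v w) z = rhs x v w z" if x: "x \<in> {0..} \<times> K" for x v w z
    unfolding ch[OF x] using theI'[OF ex1[OF x]] by blast
  have uniq: "\<Gamma> x v w = y" if x: "x \<in> {0..} \<times> K" and "\<And>z. g i x y z = rhs x v w z" for x v w y
    unfolding ch[OF x] by (rule the1_equality[OF ex1[OF x]]) (use that in blast)
  show ?thesis
  proof (rule that[of "3 * M / (2 * m)"])
    show "3 * M / (2 * m) > 0" using m by simp
    fix x :: "real \<times> 'e" assume x: "x \<in> {0..} \<times> K"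
    have gb: "bilinear (g i x)" by (rule bilinear_g[OF assms(1) xS[OF x]])
    show "bilinear (christoffel (S i) (g i) x)"
      unfolding bilinear_def \<Gamma>_def[symmetric]
      by (intro conjI allI linearI; rule uniq[OF x])
         (simp_all add: \<Gamma>[OF x] bilinear_ladd[OF gb] bilinear_lmul[OF gb] rlin[OF x])
    fix v w :: "real \<times> 'e"
    define y where "y = \<Gamma> x v w"
    have sx: "snd x \<in> K" using x by auto
    have Db: "\<bar>D (snd x) a b (snd e)\<bar> \<le> M * norm a * norm b * norm e" for a b e :: "real \<times> 'e"
    proof -
      have "norm (snd e) \<le> norm e" by (metis norm_snd_le prod.collapse)
      then have "M * norm a * norm b * norm (snd e) \<le> M * norm a * norm b * norm e"
        using m(2) by (intro mult_left_mono) auto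
      then show ?thesis using m(5)[OF sx, of a b "snd e"] unfolding D_def by linarith
    qed
    have "m * (norm y)\<^sup>2 \<le> g i x y y" by (rule m(3)[OF x])
    also have "\<dots> = rhs x v w y" unfolding y_def by (rule \<Gamma>[OF x])
    also have "\<dots> \<le> 3 * (M * norm v * norm w * norm y) / 2"
    proof -
      have "D (snd x) w y (snd v) \<le> M * norm v * norm w * norm y" "D (snd x) v y (snd w) \<le> M * norm v * norm w * norm y"
        "- D (snd x) v w (snd y) \<le> M * norm v * norm w * norm y"
        using Db[of w y v] Db[of v y w] Db[of v w y] by (simp_all add: abs_le_iff mult_ac)
      moreover have "(p + q - r) / 2 \<le> 3 * X / 2" if "p \<le> X" "q \<le> X" "- r \<le> X" for p q r X :: real
        using that by simp
      ultimately show ?thesis unfolding rhs_def by blast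
    qed
    finally have "m * norm y * norm y \<le> (3 * M / 2 * norm v * norm w) * norm y" by (simp add: power2_eq_square mult_ac)
    then have "m * norm y \<le> 3 * M / 2 * norm v * norm w"
      using m by (cases "y = 0") auto
    then have "norm y \<le> 3 * M / (2 * m) * norm v * norm w" using m by (simp add: field_simps)
    then show "norm (christoffel (S i) (g i) x v w) \<le> 3 * M / (2 * m) * norm v * norm w"
      by (simp add: y_def \<Gamma>_def)
  qed
qed

end

section \<open>Comparison of the splittings of two complex structures\<close>

lemma norm_fst_le': "norm (fst w) \<le> norm w" and norm_snd_le': "norm (snd w) \<le> norm w"
  by (metis norm_fst_le norm_snd_le prod.collapse)+

lemma norm_dr [simp]: "norm dr = 1"
  by (simp add: dr_def norm_Pair)

lemma (in cplx_struct) pr_bound: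
  assumes L: "\<And>w. norm (j w) \<le> \<Lambda> * norm w" "\<Lambda> \<ge> 1"
  shows "norm (pr w) \<le> (1 + (1 + \<Lambda> * \<Lambda>) + 2 * \<Lambda> * \<Lambda>) * norm w"
proof -
  have \<rho>: "\<bar>\<rho>\<bar> \<le> \<Lambda>" using norm_fst_le'[of "j dr"] L(1)[of dr] by (simp add: \<rho>_def)
  have f: "\<bar>fst w\<bar> \<le> norm w" "\<bar>fst (j w)\<bar> \<le> \<Lambda> * norm w"
    using norm_fst_le'[of w] norm_fst_le'[of "j w"] L(1)[of w] by auto
  have D: "\<bar>a / (1 + \<rho>\<^sup>2)\<bar> \<le> \<bar>a\<bar>" for a
    using denom by (simp add: abs_mult divide_le_eq mult_le_cancel_left1)
  have "\<bar>\<rho> * fst (j w)\<bar> \<le> \<Lambda> * (\<Lambda> * norm w)" unfolding abs_mult using \<rho> f L by (intro mult_mono) auto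
  then have s: "\<bar>sg w\<bar> \<le> (1 + \<Lambda> * \<Lambda>) * norm w"
    using D[of "fst w + \<rho> * fst (j w)"] f unfolding sg_def by (simp add: algebra_simps)
  have "\<bar>\<rho> * fst w\<bar> \<le> \<Lambda> * norm w" unfolding abs_mult using \<rho> f L by (intro mult_mono) auto
  then have l: "\<bar>lm w\<bar> \<le> 2 * \<Lambda> * norm w"
    using D[of "\<rho> * fst w - fst (j w)"] f unfolding lm_def by linarith
  have "norm (pr w) \<le> norm w + norm (sg w *\<^sub>R (dr :: real \<times> 'e)) + norm (lm w *\<^sub>R j dr)"
    unfolding pr_def using norm_triangle_ineq4[of w "sg w *\<^sub>R dr"] norm_triangle_ineq4[of "w - sg w *\<^sub>R dr" "lm w *\<^sub>R j dr"]
    by linarith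
  also have "norm (lm w *\<^sub>R j dr) \<le> (2 * \<Lambda> * norm w) * \<Lambda>"
    unfolding norm_scaleR using l L(1)[of dr] L(2) by (intro mult_mono) auto
  finally show ?thesis using s by (simp add: algebra_simps)
qed

text \<open>Later \<open>j\<close> is J at a point and \<open>k\<close> is Jinf there, whose Reeb
  vector has no \<partial>_r component by (AC3); \<open>\<epsilon>\<close> is their
  distance.\<close>

locale two_structs = j: cplx_struct j + k: cplx_struct k
  for j k :: "real \<times> 'e::real_normed_vector \<Rightarrow> real \<times> 'e" +
  fixes \<Lambda> \<epsilon> :: real
  assumes k0: "fst (k dr) = 0" and \<Lambda>: "\<Lambda> \<ge> 1"
    and jb: "norm (j w) \<le> \<Lambda> * norm w" and kb: "norm (k w) \<le> \<Lambda> * norm w"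
    and jk: "norm (j w - k w) \<le> \<epsilon> * norm w"
begin

lemma eps0: "\<epsilon> \<ge> 0" using order_trans[OF norm_ge_zero jk[of dr]] by simp

text \<open>The number \<rho> is 0 for \<open>k\<close>, hence at most \<epsilon> in size for
  \<open>j\<close>. The explicit formulas for the components then differ by multiples of \<epsilon>,
  and division by 1 + \<rho>^2 never increases them.\<close>

lemma pr_diff: "norm (proj_xi j w - proj_xi k w) \<le> (2 * \<Lambda> + (2 + \<Lambda> * \<Lambda>) * \<Lambda> + \<Lambda>) * \<epsilon> * norm w"
proof -
  have kr: "k.\<rho> = 0" by (simp add: k.\<rho>_def k0)
  have \<rho>: "\<bar>j.\<rho>\<bar> \<le> \<epsilon>" "\<bar>j.\<rho>\<bar> \<le> \<Lambda>"
    using norm_fst_le'[of "j dr - k dr"] jk[of dr] norm_fst_le'[of "j dr"] jb[of dr] by (auto simp: j.\<rho>_def k0)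
  have f: "\<bar>fst w\<bar> \<le> norm w" "\<bar>fst (j w)\<bar> \<le> \<Lambda> * norm w" "\<bar>fst (k w)\<bar> \<le> \<Lambda> * norm w" "\<bar>fst (k w) - fst (j w)\<bar> \<le> \<epsilon> * norm w"
    using norm_fst_le'[of w] norm_fst_le'[of "j w"] jb[of w] norm_fst_le'[of "k w"] kb[of w]
      norm_fst_le'[of "j w - k w"] jk[of w] by auto
  have D: "\<bar>a / (1 + j.\<rho>\<^sup>2)\<bar> \<le> \<bar>a\<bar>" for a
    using j.denom by (simp add: abs_mult divide_le_eq mult_le_cancel_left1)
  have "j.sg w - k.sg w = (j.\<rho> * fst (j w) - j.\<rho> * (j.\<rho> * fst w)) / (1 + j.\<rho>\<^sup>2)"
  proof -
    have "k.sg w = fst w" by (simp add: k.sg_def kr)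
    also have "\<dots> = fst w * (1 + j.\<rho>\<^sup>2) / (1 + j.\<rho>\<^sup>2)" using j.denom by simp
    finally show ?thesis unfolding j.sg_def by (simp add: diff_divide_distrib[symmetric] algebra_simps power2_eq_square)
  qed
  moreover have "\<bar>j.\<rho> * fst (j w)\<bar> \<le> \<epsilon> * (\<Lambda> * norm w)" "\<bar>j.\<rho> * (j.\<rho> * fst w)\<bar> \<le> \<epsilon> * (\<Lambda> * norm w)"
    unfolding abs_mult using \<rho> f eps0 \<Lambda> by (auto intro!: mult_mono mult_nonneg_nonneg)
  ultimately have s: "\<bar>j.sg w - k.sg w\<bar> \<le> 2 * (\<epsilon> * (\<Lambda> * norm w))"
    using D[of "j.\<rho> * fst (j w) - j.\<rho> * (j.\<rho> * fst w)"] abs_triangle_ineq4[of "j.\<rho> * fst (j w)" "j.\<rho> * (j.\<rho> * fst w)"] by simp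
  have "j.lm w - k.lm w = (j.\<rho> * fst w + (fst (k w) - fst (j w)) + j.\<rho> * (j.\<rho> * fst (k w))) / (1 + j.\<rho>\<^sup>2)"
  proof -
    have "k.lm w = - fst (k w)" by (simp add: k.lm_def kr)
    also have "\<dots> = - fst (k w) * (1 + j.\<rho>\<^sup>2) / (1 + j.\<rho>\<^sup>2)" using j.denom by simp
    finally show ?thesis unfolding j.lm_def by (simp add: diff_divide_distrib[symmetric] algebra_simps power2_eq_square)
  qed
  moreover have "\<bar>j.\<rho> * fst w\<bar> \<le> \<epsilon> * norm w" "\<bar>j.\<rho> * (j.\<rho> * fst (k w))\<bar> \<le> \<epsilon> * (\<Lambda> * (\<Lambda> * norm w))"
    unfolding abs_mult using \<rho> f eps0 \<Lambda> by (auto intro!: mult_mono mult_nonneg_nonneg)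
  ultimately have l: "\<bar>j.lm w - k.lm w\<bar> \<le> \<epsilon> * norm w + \<epsilon> * norm w + \<epsilon> * (\<Lambda> * (\<Lambda> * norm w))"
  proof -
    assume e: "j.lm w - k.lm w = (j.\<rho> * fst w + (fst (k w) - fst (j w)) + j.\<rho> * (j.\<rho> * fst (k w))) / (1 + j.\<rho>\<^sup>2)"
      and a: "\<bar>j.\<rho> * fst w\<bar> \<le> \<epsilon> * norm w" "\<bar>j.\<rho> * (j.\<rho> * fst (k w))\<bar> \<le> \<epsilon> * (\<Lambda> * (\<Lambda> * norm w))"
    have "\<bar>x + y + z\<bar> \<le> p + q + r" if "\<bar>x\<bar> \<le> p" "\<bar>y\<bar> \<le> q" "\<bar>z\<bar> \<le> r" for x y z p q r :: real
      using that by linarith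
    from this[OF a(1) f(4) a(2)] show ?thesis unfolding e by (rule order_trans[OF D])
  qed
  have kl: "\<bar>k.lm w\<bar> \<le> \<Lambda> * norm w" using f(3) by (simp add: k.lm_def kr)
  have e: "proj_xi j w - proj_xi k w = - ((j.sg w - k.sg w) *\<^sub>R dr) - ((j.lm w - k.lm w) *\<^sub>R j dr + k.lm w *\<^sub>R (j dr - k dr))"
    by (simp add: j.proj_eq k.proj_eq j.pr_def k.pr_def algebra_simps)
  have "norm (proj_xi j w - proj_xi k w) \<le> norm ((j.sg w - k.sg w) *\<^sub>R (dr :: real \<times> 'e)) + (norm ((j.lm w - k.lm w) *\<^sub>R j dr) + norm (k.lm w *\<^sub>R (j dr - k dr)))"
    unfolding e by (rule order_trans[OF norm_triangle_ineq4], unfold norm_minus_cancel, rule add_left_mono, rule norm_triangle_ineq)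
  also have "norm ((j.lm w - k.lm w) *\<^sub>R j dr) \<le> (\<epsilon> * norm w + \<epsilon> * norm w + \<epsilon> * (\<Lambda> * (\<Lambda> * norm w))) * \<Lambda>"
    unfolding norm_scaleR using l jb[of dr] \<Lambda> by (intro mult_mono) auto
  also have "norm (k.lm w *\<^sub>R (j dr - k dr)) \<le> (\<Lambda> * norm w) * \<epsilon>"
    unfolding norm_scaleR using kl jk[of dr] eps0 \<Lambda> by (intro mult_mono) auto
  also have "norm ((j.sg w - k.sg w) *\<^sub>R (dr :: real \<times> 'e)) \<le> 2 * (\<epsilon> * (\<Lambda> * norm w))" using s by simp
  finally show ?thesis by (simp add: algebra_simps)
qed

lemma coercive_diff:
  assumes b: "bilinear \<beta>" "\<And>a b. \<bar>\<beta> a b\<bar> \<le> \<Lambda> * norm a * norm b"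
  defines "P \<equiv> 2 * \<Lambda> + (2 + \<Lambda> * \<Lambda>) * \<Lambda> + \<Lambda>" and "Q \<equiv> 1 + (1 + \<Lambda> * \<Lambda>) + 2 * \<Lambda> * \<Lambda>"
  shows "\<bar>coercive_form j \<beta> w - coercive_form k \<beta> w\<bar> \<le> (\<Lambda> * P * (\<Lambda> * Q) + \<Lambda> * Q * (\<Lambda> * P + Q) + 2 * \<Lambda>) * \<epsilon> * (norm w)\<^sup>2"
proof -
  define p where "p = proj_xi j w" define q where "q = proj_xi k w"
  define n where "n = norm w"
  have PQ: "P \<ge> 0" "Q \<ge> 0" using \<Lambda> by (auto simp: P_def Q_def intro!: add_nonneg_nonneg mult_nonneg_nonneg)
  have pb: "norm p \<le> Q * n" unfolding p_def n_def j.proj_eq Q_def by (rule j.pr_bound[OF jb \<Lambda>])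
  have qb: "norm q \<le> Q * n" unfolding q_def n_def k.proj_eq Q_def by (rule k.pr_bound[OF kb \<Lambda>])
  have pq: "norm (p - q) \<le> P * \<epsilon> * n" unfolding p_def q_def n_def P_def by (rule pr_diff)
  have n0: "n \<ge> 0" by (simp add: n_def)
  have L0: "\<Lambda> \<ge> 0" using \<Lambda> by simp
  \<comment> \<open>Telescoping: the projection and the complex structure are exchanged in turn,
    each at the cost of a factor \<epsilon>.\<close>
  have e: "\<beta> (snd p) (snd (j p)) - \<beta> (snd q) (snd (k q)) = \<beta> (snd (p - q)) (snd (j p)) + \<beta> (snd q) (snd (j p - k q))"
  proof -
    have l: "\<beta> (x - y) z = \<beta> x z - \<beta> y z" and r: "\<beta> x (y - z) = \<beta> x y - \<beta> x z" for x y z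
      using bilinear_lsub[OF b(1)] bilinear_rsub[OF b(1)] by blast+
    show ?thesis unfolding snd_diff l r by simp
  qed
  have "norm (j p) \<le> \<Lambda> * (Q * n)" using jb[of p] mult_left_mono[OF pb L0] by linarith
  then have 1: "\<bar>\<beta> (snd (p - q)) (snd (j p))\<bar> \<le> \<Lambda> * (P * \<epsilon> * n) * (\<Lambda> * (Q * n))"
    by (intro order_trans[OF b(2)] mult_mono order_trans[OF norm_snd_le'] pq mult_left_mono L0) (use L0 PQ eps0 n0 in auto)
  have "norm (j p - k q) \<le> norm (j (p - q)) + norm (j q - k q)"
    using norm_triangle_ineq[of "j (p - q)" "j q - k q"] by (simp add: j.j_simps)
  also have "\<dots> \<le> \<Lambda> * (P * \<epsilon> * n) + \<epsilon> * (Q * n)"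
    using jb[of "p - q"] jk[of q] mult_left_mono[OF pq L0] mult_left_mono[OF qb eps0] by linarith
  finally have 2: "\<bar>\<beta> (snd q) (snd (j p - k q))\<bar> \<le> \<Lambda> * (Q * n) * (\<Lambda> * (P * \<epsilon> * n) + \<epsilon> * (Q * n))"
    by (intro order_trans[OF b(2)] mult_mono order_trans[OF norm_snd_le'] qb mult_left_mono L0) (use L0 PQ eps0 n0 in auto)
  have "(fst (j w))\<^sup>2 - (fst (k w))\<^sup>2 = fst (j w - k w) * (fst (j w) + fst (k w))" by (simp add: power2_eq_square algebra_simps)
  moreover have "\<bar>fst (j w - k w) * (fst (j w) + fst (k w))\<bar> \<le> (\<epsilon> * n) * (2 * (\<Lambda> * n))"
  proof -
    have "\<bar>fst (j w) + fst (k w)\<bar> \<le> 2 * (\<Lambda> * n)"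
      using norm_fst_le'[of "j w"] norm_fst_le'[of "k w"] jb[of w] kb[of w] unfolding n_def real_norm_def by linarith
    moreover have "\<bar>fst (j w - k w)\<bar> \<le> \<epsilon> * n" using norm_fst_le'[of "j w - k w"] jk[of w] unfolding n_def real_norm_def by linarith
    ultimately show ?thesis unfolding abs_mult using eps0 n0 by (intro mult_mono) auto
  qed
  ultimately have 3: "\<bar>(fst (j w))\<^sup>2 - (fst (k w))\<^sup>2\<bar> \<le> (\<epsilon> * n) * (2 * (\<Lambda> * n))" by simp
  have "coercive_form j \<beta> w - coercive_form k \<beta> w =
      (\<beta> (snd p) (snd (j p)) - \<beta> (snd q) (snd (k q))) + ((fst (j w))\<^sup>2 - (fst (k w))\<^sup>2)"
    unfolding coercive_form_def p_def q_def by simp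
  then have "\<bar>coercive_form j \<beta> w - coercive_form k \<beta> w\<bar> \<le> \<Lambda> * (P * \<epsilon> * n) * (\<Lambda> * (Q * n)) + \<Lambda> * (Q * n) * (\<Lambda> * (P * \<epsilon> * n) + \<epsilon> * (Q * n)) + (\<epsilon> * n) * (2 * (\<Lambda> * n))"
    unfolding e using 1 2 3 by linarith
  also have "\<dots> = (\<Lambda> * P * (\<Lambda> * Q) + \<Lambda> * Q * (\<Lambda> * P + Q) + 2 * \<Lambda>) * \<epsilon> * n\<^sup>2"
    by (simp add: algebra_simps power2_eq_square)
  finally show ?thesis by (simp add: n_def)
qed

end

lemma (in cplx_struct) coercive_scale:
  assumes "bilinear \<beta>" shows "coercive_form j \<beta> (c *\<^sub>R w) = c\<^sup>2 * coercive_form j \<beta> w"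
  by (simp add: coercive_form_def proj_eq linear_cmul[OF linear_pr] j_simps bilinear_lmul[OF assms] bilinear_rmul[OF assms]
      power2_eq_square algebra_simps)

section \<open>Continuity and coercivity of the density on compact sets\<close>

lemma continuous_on_linear_field:
  fixes F :: "'x::topological_space \<Rightarrow> 'a::euclidean_space \<Rightarrow> 'b::real_normed_vector"
  assumes "\<And>x. x \<in> A \<Longrightarrow> linear (F x)" "\<And>v. continuous_on A (\<lambda>x. F x v)"
    and "continuous_on T f" "continuous_on T h" "\<And>t. t \<in> T \<Longrightarrow> f t \<in> A"
  shows "continuous_on T (\<lambda>t. F (f t) (h t))"
proof -
  have "continuous_on T (\<lambda>t. \<Sum>b\<in>Basis. (h t \<bullet> b) *\<^sub>R F (f t) b)"
    by (intro continuous_intros assms continuous_on_compose2[OF assms(2) assms(3)]) (use assms(5) in auto)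
  moreover have "F x v = (\<Sum>b\<in>Basis. (v \<bullet> b) *\<^sub>R F x b)" if "x \<in> A" for x v
  proof -
    have "F x v = F x (\<Sum>b\<in>Basis. (v \<bullet> b) *\<^sub>R b)" by (simp add: euclidean_representation)
    also have "\<dots> = (\<Sum>b\<in>Basis. (v \<bullet> b) *\<^sub>R F x b)" by (simp add: linear_sum[OF assms(1)[OF that]] linear_cmul[OF assms(1)[OF that]])
    finally show ?thesis .
  qed
  ultimately show ?thesis by (subst continuous_on_cong[OF refl]) (use assms(5) in auto)
qed

lemma continuous_on_bilinear_field:
  fixes F :: "'x::topological_space \<Rightarrow> 'a::euclidean_space \<Rightarrow> 'a \<Rightarrow> real"
  assumes "\<And>x. x \<in> A \<Longrightarrow> bilinear (F x)" "\<And>v w. continuous_on A (\<lambda>x. F x v w)"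
    and "continuous_on T f" "continuous_on T h" "continuous_on T h'" "\<And>t. t \<in> T \<Longrightarrow> f t \<in> A"
  shows "continuous_on T (\<lambda>t. F (f t) (h t) (h' t))"
proof -
  have "continuous_on T (\<lambda>t. F (f t) v (h' t))" for v
    by (rule continuous_on_linear_field[of A "\<lambda>x. F x v"]) (use assms in \<open>auto simp: bilinear_def\<close>)
  then show ?thesis
    using continuous_on_linear_field[of T "\<lambda>t v. F (f t) v (h' t)" T "\<lambda>t. t" h] assms
    by (auto simp: bilinear_def intro: continuous_intros)
qed

lemma continuous_on_proj_xi:
  fixes j :: "'x::topological_space \<Rightarrow> real \<times> 'e::euclidean_space \<Rightarrow> real \<times> 'e"
  assumes cs: "\<And>x. x \<in> A \<Longrightarrow> cplx_struct (j x)" and cj: "\<And>v. continuous_on A (\<lambda>x. j x v)"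
    and f: "continuous_on T f" "continuous_on T h" "\<And>t. t \<in> T \<Longrightarrow> f t \<in> A"
  shows "continuous_on T (\<lambda>t. proj_xi (j (f t)) (h t))"
proof -
  have lin: "linear (j x)" if "x \<in> A" for x using cs[OF that] by (simp add: cplx_struct_def)
  note cl = continuous_on_linear_field[of A j, OF lin cj f(1) _ f(3)]
  define r where "r t = fst (j (f t) dr)" for t
  have rc: "continuous_on T r" unfolding r_def by (intro continuous_intros cl)
  have "continuous_on T (\<lambda>t. h t - ((fst (h t) + r t * fst (j (f t) (h t))) / (1 + (r t)\<^sup>2)) *\<^sub>R dr
     - ((r t * fst (h t) - fst (j (f t) (h t))) / (1 + (r t)\<^sup>2)) *\<^sub>R j (f t) dr)"
    by (intro continuous_intros cl f rc) (auto simp: add_nonneg_eq_0_iff)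
  then show ?thesis
  proof (rule continuous_on_eq)
    fix t assume "t \<in> T"
    then interpret cplx_struct "j (f t)" using cs f by blast
    show "h t - ((fst (h t) + r t * fst (j (f t) (h t))) / (1 + (r t)\<^sup>2)) *\<^sub>R dr
     - ((r t * fst (h t) - fst (j (f t) (h t))) / (1 + (r t)\<^sup>2)) *\<^sub>R j (f t) dr = proj_xi (j (f t)) (h t)"
      by (simp add: proj_eq pr_def sg_def lm_def r_def \<rho>_def)
  qed
qed

lemma continuous_on_coercive_form:
  fixes j :: "'x::topological_space \<Rightarrow> real \<times> 'e::euclidean_space \<Rightarrow> real \<times> 'e"
  assumes cs: "\<And>x. x \<in> A \<Longrightarrow> cplx_struct (j x)" and cj: "\<And>v. continuous_on A (\<lambda>x. j x v)"
    and b: "\<And>x. x \<in> A \<Longrightarrow> bilinear (\<beta> x)" "\<And>a b. continuous_on A (\<lambda>x. \<beta> x a b)"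
    and f: "continuous_on T f" "continuous_on T h" "\<And>t. t \<in> T \<Longrightarrow> f t \<in> A"
  shows "continuous_on T (\<lambda>t. coercive_form (j (f t)) (\<beta> (f t)) (h t))"
proof -
  have lin: "linear (j x)" if "x \<in> A" for x using cs[OF that] by (simp add: cplx_struct_def)
  note cp = continuous_on_proj_xi[OF cs cj f]
  note cl = continuous_on_linear_field[of A j, OF lin cj f(1) _ f(3)]
  show ?thesis unfolding coercive_form_def
    by (intro continuous_intros continuous_on_bilinear_field[OF b f(1) _ _ f(3)] cl cp f)
qed

text \<open>On \<open>A\<close> times the unit sphere the density is continuous and positive, so it
  has a positive minimum and a maximum; quadratic homogeneity extends the bounds to all
  vectors.\<close>

lemma compact_coercive:
  fixes j :: "'x::topological_space \<Rightarrow> real \<times> 'e::euclidean_space \<Rightarrow> real \<times> 'e"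
  assumes A: "compact A" and cs: "\<And>x. x \<in> A \<Longrightarrow> cplx_struct (j x)" and cj: "\<And>v. continuous_on A (\<lambda>x. j x v)"
    and b: "\<And>x. x \<in> A \<Longrightarrow> bilinear (\<beta> x)" "\<And>a b. continuous_on A (\<lambda>x. \<beta> x a b)"
    and pos: "\<And>x y. x \<in> A \<Longrightarrow> y \<in> xi (j x) \<Longrightarrow> y \<noteq> 0 \<Longrightarrow> \<beta> x (snd y) (snd (j x y)) > 0"
  obtains m M where "m > 0" "M > 0" "\<And>x w. x \<in> A \<Longrightarrow> m * (norm w)\<^sup>2 \<le> coercive_form (j x) (\<beta> x) w"
    "\<And>x w. x \<in> A \<Longrightarrow> coercive_form (j x) (\<beta> x) w \<le> M * (norm w)\<^sup>2"
proof (cases "A = {}")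
  case True
  then show ?thesis using that[of 1 1] by auto
next
  case False
  define T where "T = A \<times> sphere (0 :: real \<times> 'e) 1"
  define Q where "Q p = coercive_form (j (fst p)) (\<beta> (fst p)) (snd p)" for p
  have "dr \<in> sphere (0 :: real \<times> 'e) 1" by simp
  then have T: "compact T" "T \<noteq> {}" using False A unfolding T_def by (auto intro!: compact_Times)
  have Qc: "continuous_on T Q" unfolding Q_def
    by (rule continuous_on_coercive_form[OF cs cj b]) (auto simp: T_def intro!: continuous_intros)
  obtain p where p: "p \<in> T" "\<And>q. q \<in> T \<Longrightarrow> Q p \<le> Q q" using continuous_attains_inf[OF T Qc] by blast
  obtain p' where p': "p' \<in> T" "\<And>q. q \<in> T \<Longrightarrow> Q q \<le> Q p'" using continuous_attains_sup[OF T Qc] by blast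
  have pA: "fst p \<in> A" "snd p \<noteq> 0" using p(1) by (auto simp: T_def)
  interpret cplx_struct "j (fst p)" by (rule cs[OF pA(1)])
  have Qp: "Q p > 0" unfolding Q_def
    by (rule coercive_form_pos[OF _ _ pA(2)]) (use pos pA bilinear_lzero[OF b(1)[OF pA(1)]] in auto)
  then have Qp': "Q p' > 0" using p(2)[OF p'(1)] by linarith
  have eq: "coercive_form (j x) (\<beta> x) w = (norm w)\<^sup>2 * Q (x, w /\<^sub>R norm w)" "(x, w /\<^sub>R norm w) \<in> T" if "x \<in> A" "w \<noteq> 0" for x w
  proof -
    have "w = norm w *\<^sub>R (w /\<^sub>R norm w)" using that by simp
    then show "coercive_form (j x) (\<beta> x) w = (norm w)\<^sup>2 * Q (x, w /\<^sub>R norm w)"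
      unfolding Q_def fst_conv snd_conv
      using cplx_struct.coercive_scale[OF cs[OF that(1)] b(1)[OF that(1)], of "norm w" "w /\<^sub>R norm w"] by simp
    show "(x, w /\<^sub>R norm w) \<in> T" using that by (simp add: T_def)
  qed
  have z: "coercive_form (j x) (\<beta> x) 0 = 0" if "x \<in> A" for x
    using cplx_struct.coercive_scale[OF cs[OF that] b(1)[OF that], of 0 0] by simp
  show ?thesis
  proof (rule that[OF Qp Qp'])
    fix x w assume x: "x \<in> A"
    show "Q p * (norm w)\<^sup>2 \<le> coercive_form (j x) (\<beta> x) w"
      using p(2)[OF eq(2)[OF x]] eq(1)[OF x] z[OF x] by (cases "w = 0") (simp_all add: mult.commute mult_right_mono)
    show "coercive_form (j x) (\<beta> x) w \<le> Q p' * (norm w)\<^sup>2"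
      using p'(2)[OF eq(2)[OF x]] eq(1)[OF x] z[OF x] by (cases "w = 0") (simp_all add: mult.commute mult_right_mono)
  qed
qed

section \<open>Decay and Lipschitz bounds for J in a chart\<close>

context asymp_cyl begin

abbreviation "A i x v \<equiv> J i x v - Jinf i x v"

lemma subset_S: "K \<subseteq> R i \<Longrightarrow> x \<in> {0::real..} \<times> K \<Longrightarrow> x \<in> S i"
  by (auto simp: mem_Times_iff)

lemma A_linear: "i \<in> I \<Longrightarrow> x \<in> S i \<Longrightarrow> linear (A i x)"
  using J_struct[of i x] Jinf_struct[of i x] by (intro linear_compose_sub) (auto simp: cplx_struct_def)

lemma tail_bound:
  obtains k \<delta> where "k > 0" "\<delta> > 0"
    "\<And>i x. i \<in> I \<Longrightarrow> x \<in> S i \<Longrightarrow> tensor_norm (\<lambda>y. sqrt (g i x y y)) (g i x) (l + 1) (nabla_endo C g l A i x) \<le> k * exp (- \<delta> * fst x)"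
proof -
  from spec[OF tail_J, of l] obtain k where k1: "k > 0 \<and> (\<exists>\<delta>>0. \<forall>r\<ge>0.
     tail_norm_le I C (\<lambda>i x y. sqrt (g i x y y)) g (l + 1) (nabla_endo C g l A) r (k * exp (- \<delta> * r)))"
    by (elim exE)
  from conjunct2[OF k1] obtain \<delta> where k2: "\<delta> > 0 \<and> (\<forall>r\<ge>0.
     tail_norm_le I C (\<lambda>i x y. sqrt (g i x y y)) g (l + 1) (nabla_endo C g l A) r (k * exp (- \<delta> * r)))"
    by (elim exE)
  have k: "k > 0" "\<delta> > 0" "\<And>r. r \<ge> 0 \<Longrightarrow>
     tail_norm_le I C (\<lambda>i x y. sqrt (g i x y y)) g (l + 1) (nabla_endo C g l A) r (k * exp (- \<delta> * r))"
    using k1 k2 by simp_all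
  show ?thesis
  proof (rule that[OF k(1,2)])
    fix i x assume i: "i \<in> I" and x: "x \<in> S i"
    have "fst x \<ge> 0" using x by (auto simp: mem_Times_iff)
    from k(3)[OF this] show "tensor_norm (\<lambda>y. sqrt (g i x y y)) (g i x) (l + 1) (nabla_endo C g l A i x) \<le> k * exp (- \<delta> * fst x)"
      using i x unfolding tail_norm_le_def chart_range_watlas by blast
  qed
qed

lemma g_scale: "i \<in> I \<Longrightarrow> x \<in> S i \<Longrightarrow> g i x (a *\<^sub>R w) (a *\<^sub>R w) = a\<^sup>2 * g i x w w"
proof -
  assume "i \<in> I" "x \<in> S i"
  note b = bilinear_g[OF this]
  show ?thesis by (simp add: bilinear_lmul[OF b] bilinear_rmul[OF b] power2_eq_square)
qed

text \<open>This is (AC1) with l = 0, rewritten in the Euclidean norm of the chart.\<close>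

lemma J_diff_bound:
  assumes i: "i \<in> I" and K: "compact K" "K \<subseteq> R i"
  obtains M \<delta> where "M > 0" "\<delta> > 0" "\<And>x v. x \<in> {0::real..} \<times> K \<Longrightarrow> norm (A i x v) \<le> M * exp (- \<delta> * fst x) * norm v"
proof -
  obtain m M where g: "m > 0" "M > 0" "\<And>x v. x \<in> {0::real..} \<times> K \<Longrightarrow> m * (norm v)\<^sup>2 \<le> g i x v v"
    "\<And>x v w. x \<in> {0::real..} \<times> K \<Longrightarrow> \<bar>g i x v w\<bar> \<le> M * norm v * norm w"
    by (rule g_bounds[OF i K]) blast
  obtain k \<delta> where k: "k > 0" "\<delta> > 0"
    "\<And>i x. i \<in> I \<Longrightarrow> x \<in> S i \<Longrightarrow> tensor_norm (\<lambda>y. sqrt (g i x y y)) (g i x) (0 + 1) (nabla_endo C g 0 A i x) \<le> k * exp (- \<delta> * fst x)"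
    by (rule tail_bound[of 0]) (rule that; blast)
  show ?thesis
  proof (rule that[of "k * sqrt M / sqrt m" \<delta>])
    fix x :: "real \<times> 'e" and v assume x: "x \<in> {0::real..} \<times> K"
    note xS = subset_S[OF K(2) x]
    have "norm (A i x v) \<le> (k * exp (- \<delta> * fst x)) * sqrt M / sqrt m * norm v"
    proof (rule tensor_norm_linear_bound[where h = "g i x", OF g(1,2) g(3)[OF x] _ g_scale[OF i xS] _ A_linear[OF i xS]])
      show "g i x w w \<le> M * (norm w)\<^sup>2" for w using g(4)[OF x, of w w] by (simp add: power2_eq_square mult.assoc)
      show "nabla_endo C g 0 A i x [X] = A i x X" for X by (simp add: nabla_endo_def Let_def)
      show "tensor_norm (\<lambda>y. sqrt (g i x y y)) (g i x) 1 (nabla_endo C g 0 A i x) \<le> k * exp (- \<delta> * fst x)"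
        using k(3)[OF i xS] by simp
    qed
    then show "norm (A i x v) \<le> k * sqrt M / sqrt m * exp (- \<delta> * fst x) * norm v" by (simp add: mult_ac)
  qed (use g k in auto)
qed

lemma J_has_derivative_within:
  assumes "i \<in> I" "x \<in> S i" "smooth_on (S i) f"
  shows "(f has_derivative frechet_derivative f (at x within S i)) (at x within S i)"
  using smooth_on_differentiable_within[OF assms(3,2)] frechet_derivative_works by blast

lemma smooth_A: 
  assumes "i \<in> I" "x \<in> S i"
  shows "((\<lambda>x. A i x v) has_derivative frechet_derivative (\<lambda>x. A i x v) (at x within S i)) (at x within S i)"
  using has_derivative_diff[OF J_has_derivative_within[OF assms smooth_J[OF assms(1)]] J_has_derivative_within[OF assms smooth_Jinf[OF assms(1)]]]
  by (meson differentiableI frechet_derivative_works)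

text \<open>(AC1) with l = 1 bounds the covariant derivative; the coordinate derivative differs from
  it by two Christoffel terms, both controlled by the C^0 bound.\<close>

lemma J_diff_deriv_bound:
  assumes i: "i \<in> I" and K: "compact K" "K \<subseteq> R i"
  obtains M where "M > 0" "\<And>x v e. x \<in> {0::real..} \<times> K \<Longrightarrow>
    norm (frechet_derivative (\<lambda>x. A i x v) (at x within S i) e) \<le> M * norm v * norm e"
proof -
  obtain m M where g: "m > 0" "M > 0" "\<And>x v. x \<in> {0::real..} \<times> K \<Longrightarrow> m * (norm v)\<^sup>2 \<le> g i x v v"
    "\<And>x v w. x \<in> {0::real..} \<times> K \<Longrightarrow> \<bar>g i x v w\<bar> \<le> M * norm v * norm w"
    by (rule g_bounds[OF i K]) blast
  obtain k \<delta> where k: "k > 0" "\<delta> > 0"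
    "\<And>i x. i \<in> I \<Longrightarrow> x \<in> S i \<Longrightarrow> tensor_norm (\<lambda>y. sqrt (g i x y y)) (g i x) (1 + 1) (nabla_endo C g 1 A i x) \<le> k * exp (- \<delta> * fst x)"
    by (rule tail_bound[of 1]) (rule that; blast)
  obtain N where N: "N > 0" "\<And>x v w. x \<in> {0::real..} \<times> K \<Longrightarrow> norm (christoffel (S i) (g i) x v w) \<le> N * norm v * norm w"
    "\<And>x. x \<in> {0::real..} \<times> K \<Longrightarrow> bilinear (christoffel (S i) (g i) x)"
    by (rule christoffel_bound[OF i K]) blast
  obtain L d where L: "L > 0" "d > 0" "\<And>x v. x \<in> {0::real..} \<times> K \<Longrightarrow> norm (A i x v) \<le> L * exp (- d * fst x) * norm v"
    by (rule J_diff_bound[OF i K]) (rule that; blast)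
  have L': "norm (A i x v) \<le> L * norm v" if x: "x \<in> {0::real..} \<times> K" for x v
  proof -
    have "exp (- d * fst x) \<le> 1" using x L(2) by (auto simp: mem_Times_iff)
    then have "L * exp (- d * fst x) * norm v \<le> L * 1 * norm v" using L(1) by (intro mult_right_mono mult_left_mono) auto
    then show ?thesis using L(3)[OF x, of v] by simp
  qed
  show ?thesis
  proof (rule that[of "k * M / sqrt m + 2 * (N * L)"])
    show "k * M / sqrt m + 2 * (N * L) > 0" using g k N L by (intro add_pos_pos) auto
    fix x :: "real \<times> 'e" and v e assume x: "x \<in> {0::real..} \<times> K"
    note xS = subset_S[OF K(2) x]
    define D where "D v = frechet_derivative (\<lambda>x. A i x v) (at x within S i)" for v
    have Dd: "((\<lambda>x. A i x v) has_derivative D v) (at x within S i)" for v unfolding D_def by (rule smooth_A[OF i xS])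
    have Dadd: "D (v + w) = (\<lambda>e. D v e + D w e)" for v w
    proof (rule within_S_unique[OF i xS Dd])
      show "((\<lambda>x. A i x (v + w)) has_derivative (\<lambda>e. D v e + D w e)) (at x within S i)"
        by (rule has_derivative_transform_within[OF has_derivative_add[OF Dd Dd] zero_less_one xS])
           (simp add: linear_add[OF A_linear[OF i]])
    qed
    have Dscale: "D (c *\<^sub>R v) = (\<lambda>e. c *\<^sub>R D v e)" for c v
    proof (rule within_S_unique[OF i xS Dd])
      show "((\<lambda>x. A i x (c *\<^sub>R v)) has_derivative (\<lambda>e. c *\<^sub>R D v e)) (at x within S i)"
        by (rule has_derivative_transform_within[OF has_derivative_scaleR_right[OF Dd] zero_less_one xS])
           (simp add: linear_cmul[OF A_linear[OF i]])
    qed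
    note al = linear_add[OF A_linear[OF i xS]] linear_cmul[OF A_linear[OF i xS]]
    note dl = linear_add[OF has_derivative_linear[OF Dd]] linear_cmul[OF has_derivative_linear[OF Dd]]
    note cl = bilinear_ladd[OF N(3)[OF x]] bilinear_radd[OF N(3)[OF x]] bilinear_lmul[OF N(3)[OF x]] bilinear_rmul[OF N(3)[OF x]]
    \<comment> \<open>The covariant derivative of the endomorphism field J - Jinf, new slot
      first.\<close>
    define f where "f X Y = D Y X + christoffel (S i) (g i) x X (A i x Y) - A i x (christoffel (S i) (g i) x X Y)" for X Y
    have fb: "bilinear f"
    proof -
      obtain a where a: "a = A i x" by blast
      have la: "linear a" using A_linear[OF i xS] a by simp
      have f': "f = (\<lambda>X Y. D Y X + christoffel (S i) (g i) x X (a Y) - a (christoffel (S i) (g i) x X Y))"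
        by (simp add: f_def[abs_def] a)
      show ?thesis unfolding bilinear_def f'
        by (intro conjI allI linearI)
           (simp_all add: Dadd Dscale linear_add[OF la] linear_cmul[OF la] dl cl scaleR_add_right scaleR_diff_right)
    qed
    have "norm (f e v) \<le> (k * exp (- \<delta> * fst x)) * M / sqrt m * norm e * norm v"
    proof (rule tensor_norm_bilinear_bound[where h = "g i x", OF g(1,2) g(3)[OF x] _ g_scale[OF i xS] _ fb])
      show "g i x w w \<le> M * (norm w)\<^sup>2" for w using g(4)[OF x, of w w] by (simp add: power2_eq_square mult.assoc)
      show "nabla_endo C g 1 A i x [X, Y] = f X Y" for X Y
        by (simp add: nabla_endo_def Let_def cov_deriv_def f_def D_def chart_range_watlas)
      show "tensor_norm (\<lambda>y. sqrt (g i x y y)) (g i x) 2 (nabla_endo C g 1 A i x) \<le> k * exp (- \<delta> * fst x)"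
        using k(3)[OF i xS] by (simp add: numeral_2_eq_2)
    qed
    also have "\<dots> \<le> k * M / sqrt m * norm e * norm v"
    proof -
      have "exp (- \<delta> * fst x) \<le> 1" using x k(2) by (auto simp: mem_Times_iff)
      then have "k * exp (- \<delta> * fst x) \<le> k" using k(1) by (simp add: mult_left_le)
      then show ?thesis using g by (intro mult_right_mono divide_right_mono) auto
    qed
    finally have 1: "norm (f e v) \<le> k * M / sqrt m * norm e * norm v" .
    have "N * norm e * norm (A i x v) \<le> N * norm e * (L * norm v)"
      using N(1) by (intro mult_left_mono L'[OF x]) auto
    then have 2: "norm (christoffel (S i) (g i) x e (A i x v)) \<le> N * norm e * (L * norm v)"
      using N(2)[OF x, of e "A i x v"] by linarith
    have "L * norm (christoffel (S i) (g i) x e v) \<le> L * (N * norm e * norm v)"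
      using L(1) by (intro mult_left_mono N(2)[OF x]) auto
    then have 3: "norm (A i x (christoffel (S i) (g i) x e v)) \<le> L * (N * norm e * norm v)"
      using L'[OF x, of "christoffel (S i) (g i) x e v"] by linarith
    have Dve: "D v e = f e v - christoffel (S i) (g i) x e (A i x v) + A i x (christoffel (S i) (g i) x e v)"
      by (simp add: f_def)
    have "norm (a - b + c) \<le> norm a + norm b + norm c" for a b c :: "real \<times> 'e"
      using norm_triangle_ineq[of "a - b" c] norm_triangle_ineq4[of a b] by linarith
    then have "norm (D v e) \<le> norm (f e v) + norm (christoffel (S i) (g i) x e (A i x v)) + norm (A i x (christoffel (S i) (g i) x e v))"
      unfolding Dve .
    also have "\<dots> \<le> k * M / sqrt m * norm e * norm v + N * norm e * (L * norm v) + L * (N * norm e * norm v)"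
      using 1 2 3 by linarith
    finally show "norm (frechet_derivative (\<lambda>x. A i x v) (at x within S i) e) \<le> (k * M / sqrt m + 2 * (N * L)) * norm v * norm e"
      unfolding D_def by (simp add: algebra_simps)
  qed
qed

lemma Jinf_bounds:
  assumes i: "i \<in> I" and K: "compact K" "K \<subseteq> R i"
  obtains M where "M > 0" "\<And>x v. x \<in> {0::real..} \<times> K \<Longrightarrow> norm (Jinf i x v) \<le> M * norm v"
    "\<And>y v e. y \<in> K \<Longrightarrow> norm (frechet_derivative (\<lambda>y. Jinf i (0, y) v) (at y) e) \<le> M * norm v * norm e"
proof -
  have lin: "linear (Jinf i (0, y))" if "y \<in> R i" for y
    using Jinf_struct[OF i, of "(0, y)"] that by (simp add: cplx_struct_def)
  obtain M where M: "M > 0" "\<And>y v. y \<in> K \<Longrightarrow> norm (Jinf i (0, y) v) \<le> M * norm v"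
    "\<And>y v e. y \<in> K \<Longrightarrow> norm (frechet_derivative (\<lambda>y. Jinf i (0, y) v) (at y) e) \<le> M * norm v * norm e"
    by (rule linear_field_bounds[OF chart(2)[OF i] lin smooth_slice[OF smooth_Jinf[OF i]] K], assumption) (rule that; blast)
  show ?thesis
  proof (rule that[OF M(1) _ M(3)])
    fix x :: "real \<times> 'e" and v assume x: "x \<in> {0::real..} \<times> K"
    have e: "Jinf i x = Jinf i (0, snd x)" by (rule Jinf_invariant[OF i subset_S[OF K(2) x]])
    show "norm (Jinf i x v) \<le> M * norm v" unfolding e by (rule M(2)) (use x in auto)
  qed
qed

text \<open>The range of r is not compact, so smoothness of J alone gives no uniform constant: the
  derivative of J - Jinf is bounded through (AC1), that of Jinf by translation invariance. Convexity
  of \<open>K\<close> allows the mean value inequality.\<close>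

lemma J_Lipschitz:
  assumes i: "i \<in> I" and K: "compact K" "K \<subseteq> R i" "convex K"
  obtains M where "M > 0" "\<And>x x' v. x \<in> {0::real..} \<times> K \<Longrightarrow> x' \<in> {0::real..} \<times> K \<Longrightarrow>
    norm (J i x v - J i x' v) \<le> M * norm v * norm (x - x')"
proof -
  obtain M where M: "M > 0" "\<And>x v e. x \<in> {0::real..} \<times> K \<Longrightarrow>
    norm (frechet_derivative (\<lambda>x. A i x v) (at x within S i) e) \<le> M * norm v * norm e"
    by (rule J_diff_deriv_bound[OF i K(1,2)]) blast
  obtain N where N: "N > 0" "\<And>y v e. y \<in> K \<Longrightarrow> norm (frechet_derivative (\<lambda>y. Jinf i (0, y) v) (at y) e) \<le> N * norm v * norm e"
    by (rule Jinf_bounds[OF i K(1,2)]) blast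
  show ?thesis
  proof (rule that[of "M + N"])
    fix x x' :: "real \<times> 'e" and v assume x: "x \<in> {0::real..} \<times> K" "x' \<in> {0::real..} \<times> K"
    show "norm (J i x v - J i x' v) \<le> (M + N) * norm v * norm (x - x')"
    proof (rule differentiable_bound[OF _ _ _ x])
      show "convex ({0::real..} \<times> K)" by (intro convex_Times K) auto
      fix z assume z: "z \<in> {0::real..} \<times> K"
      note zS = subset_S[OF K(2) z]
      define D where "D e = frechet_derivative (\<lambda>x. A i x v) (at z within S i) e + frechet_derivative (\<lambda>y. Jinf i (0, y) v) (at (snd z)) (snd e)" for e
      have "((\<lambda>x. Jinf i x v) has_derivative (\<lambda>e. frechet_derivative (\<lambda>y. Jinf i (0, y) v) (at (snd z)) (snd e))) (at z within S i)"
      proof (rule has_derivative_slice[OF i zS])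
        show "Jinf i x v = Jinf i (0, snd x) v" if "x \<in> S i" for x by (subst Jinf_invariant[OF i that]) (rule refl)
        show "(\<lambda>y. Jinf i (0, y) v) differentiable at (snd z)"
          by (rule differentiable_slice[OF i smooth_slice[OF smooth_Jinf[OF i]]]) (use zS in \<open>simp add: mem_Times_iff\<close>)
      qed
      from has_derivative_add[OF smooth_A[OF i zS, of v] this]
      have "((\<lambda>x. J i x v) has_derivative D) (at z within S i)" by (simp add: D_def[abs_def])
      then show "((\<lambda>x. J i x v) has_derivative D) (at z within {0::real..} \<times> K)"
        by (rule has_derivative_subset) (use K(2) in auto)
      show "onorm D \<le> (M + N) * norm v"
      proof (rule onorm_le)
        fix e
        have "norm (D e) \<le> M * norm v * norm e + N * norm v * norm (snd e)"
          unfolding D_def by (rule norm_triangle_mono[OF M(2)[OF z] N(2)]) (use z in auto)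
        also have "N * norm v * norm (snd e) \<le> N * norm v * norm e"
          using N(1) by (intro mult_left_mono norm_snd_le') auto
        finally show "norm (D e) \<le> (M + N) * norm v * norm e" by (simp add: algebra_simps)
      qed
    qed
  qed (use M N in auto)
qed

end

lemma exp_decay_tendsto: "\<delta> > 0 \<Longrightarrow> ((\<lambda>s. c * exp (- \<delta> * (r + s)) * n) \<longlongrightarrow> (0::real)) at_top"
proof -
  assume d: "\<delta> > 0"
  have "filterlim (\<lambda>s. \<delta> * (r + s)) at_top at_top"
    by (rule filterlim_tendsto_pos_mult_at_top[OF tendsto_const d filterlim_tendsto_add_at_top[OF tendsto_const filterlim_ident]])
  then have "filterlim (\<lambda>s. - (\<delta> * (r + s))) at_bot at_top" by (simp add: filterlim_uminus_at_bot)
  from filterlim_compose[OF exp_at_bot this] have "((\<lambda>s. exp (- \<delta> * (r + s))) \<longlongrightarrow> 0) at_top" by simp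
  from tendsto_mult[OF tendsto_mult[OF tendsto_const[of c] this] tendsto_const[of n]] show ?thesis by simp
qed

lemmas frechet_derivative_worksI = frechet_derivative_works[THEN iffD1]

section \<open>Limits under translation and positivity of the density\<close>

context asymp_cyl begin

lemma shift_S: "x \<in> S i \<Longrightarrow> s \<ge> 0 \<Longrightarrow> shift s x \<in> S i"
  by (auto simp: shift_def)

lemma J_shift_tendsto:
  assumes i: "i \<in> I" and x: "x \<in> S i"
  shows "((\<lambda>s. J i (shift s x) v) \<longlongrightarrow> Jinf i x v) at_top"
proof -
  have K: "compact {snd x}" "{snd x} \<subseteq> R i" using x by auto
  obtain M \<delta> where M: "M > 0" "\<delta> > 0" "\<And>x' v. x' \<in> {0::real..} \<times> {snd x} \<Longrightarrow> norm (A i x' v) \<le> M * exp (- \<delta> * fst x') * norm v"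
    by (rule J_diff_bound[OF i K]) (rule that; blast)
  have "((\<lambda>s. J i (shift s x) v - Jinf i x v) \<longlongrightarrow> 0) at_top"
  proof (rule Lim_null_comparison[OF _ exp_decay_tendsto[OF M(2), of M "fst x" "norm v"]])
    show "\<forall>\<^sub>F s in at_top. norm (J i (shift s x) v - Jinf i x v) \<le> M * exp (- \<delta> * (fst x + s)) * norm v"
    proof (rule eventually_mono[OF eventually_ge_at_top[of 0]])
      fix s :: real assume s: "s \<ge> 0"
      have m: "shift s x \<in> {0::real..} \<times> {snd x}" using x s by (auto simp: shift_def)
      have "Jinf i (shift s x) = Jinf i (0, snd (shift s x))" by (rule Jinf_invariant[OF i shift_S[OF x s]])
      also have "\<dots> = Jinf i x" by (subst Jinf_invariant[OF i x]) (simp add: shift_def)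
      finally show "norm (J i (shift s x) v - Jinf i x v) \<le> M * exp (- \<delta> * (fst x + s)) * norm v"
        using M(3)[OF m, of v] by (simp add: shift_def)
    qed
  qed
  then show ?thesis by (simp add: Lim_null[symmetric])
qed

lemma fst_Jinf_dr: "i \<in> I \<Longrightarrow> x \<in> S i \<Longrightarrow> fst (Jinf i x dr) = 0"
  and reeb_inf_Jinf: "i \<in> I \<Longrightarrow> x \<in> S i \<Longrightarrow> reeb_inf J i x = Jinf i x dr"
proof -
  note r = reeb_inf_eq[unfolded chart_range_watlas]
  show "i \<in> I \<Longrightarrow> x \<in> S i \<Longrightarrow> reeb_inf J i x = Jinf i x dr" using r by blast
  show "i \<in> I \<Longrightarrow> x \<in> S i \<Longrightarrow> fst (Jinf i x dr) = 0" using r by metis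
qed

text \<open>The components are rational in J, and the denominators 1 + \<rho>^2 tend to 1 because
  the limit Reeb field is tangent to V.\<close>

lemma form_limits:
  assumes i: "i \<in> I" and x: "x \<in> S i"
  shows "((\<lambda>s. lambda_form (J i (shift s x)) v) \<longlongrightarrow> - fst (Jinf i x v)) at_top"
    "((\<lambda>s. proj_xi (J i (shift s x)) v) \<longlongrightarrow> proj_xi (Jinf i x) v) at_top"
proof -
  interpret k: cplx_struct "Jinf i x" by (rule Jinf_struct[OF i x])
  have kr: "k.\<rho> = 0" by (simp add: k.\<rho>_def fst_Jinf_dr[OF i x])
  define r where "r s = fst (J i (shift s x) dr)" for s
  have r0: "(r \<longlongrightarrow> 0) at_top"
    using tendsto_fst[OF J_shift_tendsto[OF i x, of dr]] by (simp add: r_def[abs_def] fst_Jinf_dr[OF i x])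
  define q where "q s v = fst (J i (shift s x) v)" for s v
  have q0: "((\<lambda>s. q s v) \<longlongrightarrow> fst (Jinf i x v)) at_top"
    unfolding q_def by (rule tendsto_fst[OF J_shift_tendsto[OF i x]])
  have e: "\<forall>\<^sub>F s in at_top. (r s * fst v - q s v) / (1 + (r s)\<^sup>2) = lambda_form (J i (shift s x)) v"
    "\<forall>\<^sub>F s in at_top. v - ((fst v + r s * q s v) / (1 + (r s)\<^sup>2)) *\<^sub>R dr - ((r s * fst v - q s v) / (1 + (r s)\<^sup>2)) *\<^sub>R J i (shift s x) dr
       = proj_xi (J i (shift s x)) v"
  proof -
    have *: "lambda_form (J i (shift s x)) v = (r s * fst v - q s v) / (1 + (r s)\<^sup>2)"
      "proj_xi (J i (shift s x)) v = v - ((fst v + r s * q s v) / (1 + (r s)\<^sup>2)) *\<^sub>R dr - ((r s * fst v - q s v) / (1 + (r s)\<^sup>2)) *\<^sub>R J i (shift s x) dr"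
      if s: "s \<ge> 0" for s
    proof -
      interpret j: cplx_struct "J i (shift s x)" by (rule J_struct[OF i shift_S[OF x s]])
      show "lambda_form (J i (shift s x)) v = (r s * fst v - q s v) / (1 + (r s)\<^sup>2)"
        by (simp add: j.lambda_eq j.lm_def j.\<rho>_def r_def q_def)
      show "proj_xi (J i (shift s x)) v = v - ((fst v + r s * q s v) / (1 + (r s)\<^sup>2)) *\<^sub>R dr - ((r s * fst v - q s v) / (1 + (r s)\<^sup>2)) *\<^sub>R J i (shift s x) dr"
        by (simp add: j.proj_eq j.pr_def j.lm_def j.sg_def j.\<rho>_def r_def q_def)
    qed
    show "\<forall>\<^sub>F s in at_top. (r s * fst v - q s v) / (1 + (r s)\<^sup>2) = lambda_form (J i (shift s x)) v"
      "\<forall>\<^sub>F s in at_top. v - ((fst v + r s * q s v) / (1 + (r s)\<^sup>2)) *\<^sub>R dr - ((r s * fst v - q s v) / (1 + (r s)\<^sup>2)) *\<^sub>R J i (shift s x) dr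
       = proj_xi (J i (shift s x)) v"
      by (rule eventually_mono[OF eventually_ge_at_top[of 0]], simp add: *)+
  qed
  have lm: "((\<lambda>s. (r s * fst v - q s v) / (1 + (r s)\<^sup>2)) \<longlongrightarrow> (0 * fst v - fst (Jinf i x v)) / (1 + 0\<^sup>2)) at_top"
    by (intro tendsto_intros r0 q0) simp
  have sg: "((\<lambda>s. (fst v + r s * q s v) / (1 + (r s)\<^sup>2)) \<longlongrightarrow> (fst v + 0 * fst (Jinf i x v)) / (1 + 0\<^sup>2)) at_top"
    by (intro tendsto_intros r0 q0) simp
  show "((\<lambda>s. lambda_form (J i (shift s x)) v) \<longlongrightarrow> - fst (Jinf i x v)) at_top"
    by (rule Lim_transform_eventually[OF _ e(1)]) (use lm in simp)
  have "((\<lambda>s. v - ((fst v + r s * q s v) / (1 + (r s)\<^sup>2)) *\<^sub>R dr - ((r s * fst v - q s v) / (1 + (r s)\<^sup>2)) *\<^sub>R J i (shift s x) dr)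
    \<longlongrightarrow> v - ((fst v + 0 * fst (Jinf i x v)) / (1 + 0\<^sup>2)) *\<^sub>R dr - ((0 * fst v - fst (Jinf i x v)) / (1 + 0\<^sup>2)) *\<^sub>R Jinf i x dr) at_top"
    by (intro tendsto_diff tendsto_const tendsto_scaleR lm sg J_shift_tendsto[OF i x])
  then have "((\<lambda>s. v - ((fst v + r s * q s v) / (1 + (r s)\<^sup>2)) *\<^sub>R dr - ((r s * fst v - q s v) / (1 + (r s)\<^sup>2)) *\<^sub>R J i (shift s x) dr)
    \<longlongrightarrow> proj_xi (Jinf i x) v) at_top"
    by (simp add: k.proj_eq k.pr_def k.sg_def k.lm_def kr)
  then show "((\<lambda>s. proj_xi (J i (shift s x)) v) \<longlongrightarrow> proj_xi (Jinf i x) v) at_top"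
    by (rule Lim_transform_eventually[OF _ e(2)])
qed

lemma lambda_inf_eq: "i \<in> I \<Longrightarrow> x \<in> S i \<Longrightarrow> lambda_inf J i x v = - fst (Jinf i x v)"
  unfolding lambda_inf_def by (rule tendsto_Lim[OF _ form_limits(1)]) auto

text \<open>\<open>xi_inf\<close> consists of limits of elements of the moving subspaces. A vector
  of \<open>xi (Jinf i x)\<close> is the limit of its own projections, so (AC5) applies to
  it.\<close>

lemma winf_Jinf_pos:
  assumes i: "i \<in> I" and x: "x \<in> S i" and y: "y \<in> xi (Jinf i x)" "y \<noteq> 0"
  shows "winf i (snd x) (snd y) (snd (Jinf i x y)) > 0"
proof -
  interpret k: cplx_struct "Jinf i x" by (rule Jinf_struct[OF i x])
  have "((\<lambda>s. proj_xi (J i (shift s x)) y) \<longlongrightarrow> y) at_top"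
    using form_limits(2)[OF i x, of y] by (simp add: k.proj_eq k.pr_id[OF y(1)])
  moreover have "proj_xi (J i (shift s x)) y \<in> xi (J i (shift s x))" if s: "s \<ge> 0" for s
  proof -
    interpret j: cplx_struct "J i (shift s x)" by (rule J_struct[OF i shift_S[OF x s]])
    show ?thesis by (simp add: j.proj_eq j.pr_in_xi)
  qed
  ultimately have "y \<in> xi_inf J i x"
    unfolding xi_inf_def mem_Collect_eq by (intro exI[of _ "\<lambda>s. proj_xi (J i (shift s x)) y"] conjI allI impI)
  moreover have "inner_product_on (xi_inf J i x) (\<lambda>a b. pull_V winf i x a (Jinf i x b))"
    using bspec[OF bspec[OF winf_pos_inf i]] x unfolding chart_range_watlas by blast
  ultimately show ?thesis using y(2) unfolding inner_product_on_def pull_V_def by simp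
qed

lemma winf_J_pos:
  assumes i: "i \<in> I" and x: "x \<in> S i" and y: "y \<in> xi (J i x)" "y \<noteq> 0"
  shows "winf i (snd x) (snd y) (snd (J i x y)) > 0"
proof -
  interpret j: cplx_struct "J i x" by (rule J_struct[OF i x])
  have sx: "snd x \<in> R i" using x by auto
  have "inner_product_on (xi (J i x)) (\<lambda>a b. omega_form J winf i x a (J i x b))"
    using bspec[OF bspec[OF omega_pos i]] x unfolding chart_range_watlas by blast
  then have "omega_form J winf i x y (J i x y) > 0" using y unfolding inner_product_on_def by simp
  then show ?thesis
    using j.omega_form_J[where winf = winf and J = J and i = i and x = x and w = y, OF winf_facts(1)[OF i sx] winf_facts(3)[OF i sx] refl] by (simp add: j.proj_eq j.pr_id[OF y(1)])
qed

abbreviation "dens i x w \<equiv> coercive_form (J i x) (winf i (snd x)) w"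

lemma winf_bound:
  assumes i: "i \<in> I" and K: "compact K" "K \<subseteq> R i"
  obtains M where "M > 0" "\<And>y v w. y \<in> K \<Longrightarrow> \<bar>winf i y v w\<bar> \<le> M * norm v * norm w"
proof -
  obtain M where M: "M > 0" "\<And>y v w. y \<in> K \<Longrightarrow> \<bar>winf i y v w\<bar> \<le> M * norm v * norm w"
    by (rule bilinear_field_bounds[OF chart(2)[OF i] winf_facts(1)[OF i] winf_facts(2)[OF i] K], assumption) (rule that; blast)
  show ?thesis by (rule that[OF M])
qed

lemma two_structs_far:
  assumes i: "i \<in> I" and K: "compact K" "K \<subseteq> R i" "convex K"
  obtains \<Lambda> M \<delta> where "M > 0" "\<delta> > 0" "\<Lambda> \<ge> 1"
    "\<And>x. x \<in> {0::real..} \<times> K \<Longrightarrow> two_structs (J i x) (Jinf i x) \<Lambda> (M * exp (- \<delta> * fst x))"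
    "\<And>y v w. y \<in> K \<Longrightarrow> \<bar>winf i y v w\<bar> \<le> \<Lambda> * norm v * norm w"
proof -
  obtain M \<delta> where M: "M > 0" "\<delta> > 0" "\<And>x v. x \<in> {0::real..} \<times> K \<Longrightarrow> norm (A i x v) \<le> M * exp (- \<delta> * fst x) * norm v"
    by (rule J_diff_bound[OF i K(1,2)]) (rule that; blast)
  obtain N where N: "N > 0" "\<And>x v. x \<in> {0::real..} \<times> K \<Longrightarrow> norm (Jinf i x v) \<le> N * norm v"
    by (rule Jinf_bounds[OF i K(1,2)]) blast
  obtain W where W: "W > 0" "\<And>y v w. y \<in> K \<Longrightarrow> \<bar>winf i y v w\<bar> \<le> W * norm v * norm w"
    by (rule winf_bound[OF i K(1,2)]) (rule that; blast)
  define L where "L = 1 + M + N + W"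
  have L: "L \<ge> 1" "N \<le> L" "W \<le> L" "M + N \<le> L" using M N W by (auto simp: L_def)
  show ?thesis
  proof (rule that[OF M(1,2) L(1)])
    show "\<bar>winf i y v w\<bar> \<le> L * norm v * norm w" if "y \<in> K" for y v w
    proof -
      have "W * (norm v * norm w) \<le> L * (norm v * norm w)" using L by (intro mult_right_mono) auto
      then show ?thesis using W(2)[OF that, of v w] by (simp add: mult.assoc)
    qed
    fix x :: "real \<times> 'e" assume x: "x \<in> {0::real..} \<times> K"
    note xS = subset_S[OF K(2) x]
    have kb: "norm (Jinf i x w) \<le> N * norm w" for w by (rule N(2)[OF x])
    have jb: "norm (J i x w) \<le> L * norm w" for w
    proof -
      have "exp (- \<delta> * fst x) \<le> 1" using x M(2) by (auto simp: mem_Times_iff)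
      then have "M * exp (- \<delta> * fst x) * norm w \<le> M * 1 * norm w" using M(1) by (intro mult_right_mono mult_left_mono) auto
      moreover have "norm (J i x w) \<le> norm (A i x w) + norm (Jinf i x w)"
        using norm_triangle_ineq[of "A i x w" "Jinf i x w"] by simp
      ultimately have "norm (J i x w) \<le> (M + N) * norm w" using M(3)[OF x, of w] kb[of w] by (simp add: algebra_simps)
      also have "\<dots> \<le> L * norm w" using L by (intro mult_right_mono) auto
      finally show ?thesis .
    qed
    have kb': "norm (Jinf i x w) \<le> L * norm w" for w
      by (rule order_trans[OF kb]) (use L in \<open>auto intro: mult_right_mono\<close>)
    show "two_structs (J i x) (Jinf i x) L (M * exp (- \<delta> * fst x))"
      by (intro two_structs.intro two_structs_axioms.intro J_struct[OF i xS] Jinf_struct[OF i xS] fst_Jinf_dr[OF i xS] L jb kb' M(3)[OF x])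
  qed
qed

text \<open>For large r the density of J is close to that of Jinf, whose bounds are translation
  invariant; the remaining range of r is compact.\<close>

lemma dens_bounds:
  assumes i: "i \<in> I" and K: "compact K" "K \<subseteq> R i" "convex K"
  obtains m M where "m > 0" "M > 0" "\<And>x w. x \<in> {0::real..} \<times> K \<Longrightarrow> m * (norm w)\<^sup>2 \<le> dens i x w"
    "\<And>x w. x \<in> {0::real..} \<times> K \<Longrightarrow> dens i x w \<le> M * (norm w)\<^sup>2"
proof -
  obtain \<Lambda> B \<delta> where ts: "B > 0" "\<delta> > 0" "\<Lambda> \<ge> 1"
    "\<And>x. x \<in> {0::real..} \<times> K \<Longrightarrow> two_structs (J i x) (Jinf i x) \<Lambda> (B * exp (- \<delta> * fst x))"
    "\<And>y v w. y \<in> K \<Longrightarrow> \<bar>winf i y v w\<bar> \<le> \<Lambda> * norm v * norm w"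
    by (rule two_structs_far[OF i K]) (rule that; blast)
  have cK: "continuous_on ({0::real..} \<times> K) (\<lambda>x. J i x v)" "continuous_on ({0::real..} \<times> K) (\<lambda>x. Jinf i x v)" for v
    by (rule continuous_on_subset[OF smooth_on_continuous_on[OF smooth_J[OF i]]] continuous_on_subset[OF smooth_on_continuous_on[OF smooth_Jinf[OF i]]];
        use K(2) in auto)+
  have cw: "continuous_on ({0::real..} \<times> K) (\<lambda>x. winf i (snd x) a b)" for a b
    by (rule continuous_on_compose2[OF smooth_on_continuous_on[OF winf_facts(2)[OF i]] continuous_on_snd[OF continuous_on_id]]) (use K(2) in auto)
  have bw: "bilinear (winf i (snd x))" if "x \<in> {0::real..} \<times> K" for x :: "real \<times> 'e"
    by (rule winf_facts(1)[OF i]) (use that K(2) in auto)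
  have inK: "{0::real..r} \<times> K \<subseteq> {0::real..} \<times> K" for r by auto
  obtain m0 M0 where k: "m0 > 0" "M0 > 0" "\<And>x w. x \<in> {0::real..0} \<times> K \<Longrightarrow> m0 * (norm w)\<^sup>2 \<le> coercive_form (Jinf i x) (winf i (snd x)) w"
    "\<And>x w. x \<in> {0::real..0} \<times> K \<Longrightarrow> coercive_form (Jinf i x) (winf i (snd x)) w \<le> M0 * (norm w)\<^sup>2"
  proof (rule compact_coercive[of "{0::real..0} \<times> K" "Jinf i" "\<lambda>x. winf i (snd x)"])
    show "compact ({0::real..0} \<times> K)" by (intro compact_Times K) auto
    show "cplx_struct (Jinf i x)" if "x \<in> {0::real..0} \<times> K" for x using subset_S[OF K(2) subsetD[OF inK that]] by (rule Jinf_struct[OF i])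
    show "continuous_on ({0::real..0} \<times> K) (\<lambda>x. Jinf i x v)" for v by (rule continuous_on_subset[OF cK(2) inK])
    show "bilinear (winf i (snd x))" if "x \<in> {0::real..0} \<times> K" for x :: "real \<times> 'e" using subsetD[OF inK that] by (rule bw)
    show "continuous_on ({0::real..0} \<times> K) (\<lambda>x. winf i (snd x) a b)" for a b by (rule continuous_on_subset[OF cw inK])
    show "winf i (snd x) (snd y) (snd (Jinf i x y)) > 0" if "x \<in> {0::real..0} \<times> K" "y \<in> xi (Jinf i x)" "y \<noteq> 0" for x y
      using subset_S[OF K(2) subsetD[OF inK that(1)]] that(2,3) by (rule winf_Jinf_pos[OF i])
  qed (rule that; blast)
  have kinf: "m0 * (norm w)\<^sup>2 \<le> coercive_form (Jinf i x) (winf i (snd x)) w \<and> coercive_form (Jinf i x) (winf i (snd x)) w \<le> M0 * (norm w)\<^sup>2"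
    if x: "x \<in> {0::real..} \<times> K" for x w
  proof -
    have x0: "(0, snd x) \<in> {0::real..0} \<times> K" using x by auto
    have e: "Jinf i x = Jinf i (0, snd x)" by (rule Jinf_invariant[OF i subset_S[OF K(2) x]])
    show ?thesis unfolding e using k(3,4)[OF x0, of w] by simp
  qed
  \<comment> \<open>The constant of \<open>coercive_diff\<close>, written out.\<close>
  define Cc where "Cc = \<Lambda> * (2 * \<Lambda> + (2 + \<Lambda> * \<Lambda>) * \<Lambda> + \<Lambda>) * (\<Lambda> * (1 + (1 + \<Lambda> * \<Lambda>) + 2 * \<Lambda> * \<Lambda>)) +
        \<Lambda> * (1 + (1 + \<Lambda> * \<Lambda>) + 2 * \<Lambda> * \<Lambda>) * (\<Lambda> * (2 * \<Lambda> + (2 + \<Lambda> * \<Lambda>) * \<Lambda> + \<Lambda>) + (1 + (1 + \<Lambda> * \<Lambda>) + 2 * \<Lambda> * \<Lambda>)) + 2 * \<Lambda>"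
  have Cd: "\<bar>dens i x w - coercive_form (Jinf i x) (winf i (snd x)) w\<bar> \<le> Cc * (B * exp (- \<delta> * fst x)) * (norm w)\<^sup>2"
    if x: "x \<in> {0::real..} \<times> K" for x w
    unfolding Cc_def by (rule two_structs.coercive_diff[OF ts(4)[OF x] bw[OF x] ts(5)]) (use x in auto)
  have "((\<lambda>s. Cc * exp (- \<delta> * (0 + s)) * B) \<longlongrightarrow> 0) at_top" by (rule exp_decay_tendsto[OF ts(2)])
  then have "\<forall>\<^sub>F s in at_top. Cc * exp (- \<delta> * (0 + s)) * B < m0 / 2"
    using order_tendstoD(2)[of _ 0 at_top "m0 / 2"] k(1) by simp
  \<comment> \<open>Beyond this height the two densities differ by at most half of the lower bound
    \<open>m0\<close> for Jinf.\<close>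
  then obtain r0 where r0: "\<And>s. s \<ge> r0 \<Longrightarrow> Cc * exp (- \<delta> * (0 + s)) * B < m0 / 2"
    by (auto simp: eventually_at_top_linorder)
  obtain m1 M1 where n: "m1 > 0" "M1 > 0" "\<And>x w. x \<in> {0::real..r0} \<times> K \<Longrightarrow> m1 * (norm w)\<^sup>2 \<le> dens i x w"
    "\<And>x w. x \<in> {0::real..r0} \<times> K \<Longrightarrow> dens i x w \<le> M1 * (norm w)\<^sup>2"
  proof (rule compact_coercive[of "{0::real..r0} \<times> K" "J i" "\<lambda>x. winf i (snd x)"])
    show "compact ({0::real..r0} \<times> K)" by (intro compact_Times K) auto
    show "cplx_struct (J i x)" if "x \<in> {0::real..r0} \<times> K" for x using subset_S[OF K(2) subsetD[OF inK that]] by (rule J_struct[OF i])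
    show "continuous_on ({0::real..r0} \<times> K) (\<lambda>x. J i x v)" for v by (rule continuous_on_subset[OF cK(1) inK])
    show "bilinear (winf i (snd x))" if "x \<in> {0::real..r0} \<times> K" for x :: "real \<times> 'e" using subsetD[OF inK that] by (rule bw)
    show "continuous_on ({0::real..r0} \<times> K) (\<lambda>x. winf i (snd x) a b)" for a b by (rule continuous_on_subset[OF cw inK])
    show "winf i (snd x) (snd y) (snd (J i x y)) > 0" if "x \<in> {0::real..r0} \<times> K" "y \<in> xi (J i x)" "y \<noteq> 0" for x y
      using subset_S[OF K(2) subsetD[OF inK that(1)]] that(2,3) by (rule winf_J_pos[OF i])
  qed (rule that; blast)
  have both: "min m1 (m0 / 2) * (norm w)\<^sup>2 \<le> dens i x w \<and> dens i x w \<le> (M1 + M0 + m0) * (norm w)\<^sup>2" if x: "x \<in> {0::real..} \<times> K" for x w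
  proof (cases "fst x \<le> r0")
    case True
    then have "x \<in> {0::real..r0} \<times> K" using x by (auto simp: mem_Times_iff)
    from n(3,4)[OF this, of w] have 1: "m1 * (norm w)\<^sup>2 \<le> dens i x w" "dens i x w \<le> M1 * (norm w)\<^sup>2" by auto
    have "min m1 (m0 / 2) * (norm w)\<^sup>2 \<le> m1 * (norm w)\<^sup>2" by (rule mult_right_mono) auto
    moreover have "M1 * (norm w)\<^sup>2 \<le> (M1 + M0 + m0) * (norm w)\<^sup>2" using k by (intro mult_right_mono) auto
    ultimately show ?thesis using 1 by linarith
  next
    case False
    then have "Cc * (B * exp (- \<delta> * fst x)) \<le> m0 / 2" using r0[of "fst x"] by (simp add: mult_ac)
    then have "Cc * (B * exp (- \<delta> * fst x)) * (norm w)\<^sup>2 \<le> m0 / 2 * (norm w)\<^sup>2" by (rule mult_right_mono) simp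
    then have d: "\<bar>dens i x w - coercive_form (Jinf i x) (winf i (snd x)) w\<bar> \<le> m0 / 2 * (norm w)\<^sup>2" using Cd[OF x, of w] by linarith
    have "min m1 (m0 / 2) * (norm w)\<^sup>2 \<le> m0 / 2 * (norm w)\<^sup>2" by (rule mult_right_mono) auto
    moreover have "(M0 + m0 / 2) * (norm w)\<^sup>2 \<le> (M1 + M0 + m0) * (norm w)\<^sup>2" using k n by (intro mult_right_mono) auto
    moreover have "(M0 + m0 / 2) * (norm w)\<^sup>2 = M0 * (norm w)\<^sup>2 + m0 / 2 * (norm w)\<^sup>2" by (simp add: algebra_simps)
    moreover have "m0 * (norm w)\<^sup>2 = m0 / 2 * (norm w)\<^sup>2 + m0 / 2 * (norm w)\<^sup>2" by simp
    ultimately show ?thesis using d kinf[OF x, of w] by linarith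
  qed
  show ?thesis
    by (rule that[of "min m1 (m0 / 2)" "M1 + M0 + m0"]) (use both k n in auto)
qed

text \<open>The exterior derivative of \<open>lambda_inf\<close> in chart components:
  \<open>lambda_inf\<close> is minus the \<partial>_r component of Jinf, and by invariance its
  derivatives may be taken on the slice r = 0.\<close>

definition "dl i x w w' = fst (frechet_derivative (\<lambda>y. Jinf i (0, y) w) (at (snd x)) (snd w'))
   - fst (frechet_derivative (\<lambda>y. Jinf i (0, y) w') (at (snd x)) (snd w))"

lemma differentiable_Jinf: "i \<in> I \<Longrightarrow> y \<in> R i \<Longrightarrow> (\<lambda>y. Jinf i (0, y) w) differentiable (at y)"
  by (rule differentiable_slice[OF _ smooth_slice[OF smooth_Jinf]])

lemma dl_bilinear:
  assumes i: "i \<in> I" and x: "x \<in> S i"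
  shows "bilinear (dl i x)"
proof -
  have y: "snd x \<in> R i" using x by auto
  have lin: "linear (Jinf i (0, y))" if "y \<in> R i" for y
    using Jinf_struct[OF i, of "(0, y)"] that by (simp add: cplx_struct_def)
  have 1: "linear (\<lambda>w. frechet_derivative (\<lambda>y. Jinf i (0, y) w) (at (snd x)) e)" for e
    by (rule linear_frechet_derivative_param[OF chart(2)[OF i] lin differentiable_Jinf[OF i] y])
  have 2: "linear (frechet_derivative (\<lambda>y. Jinf i (0, y) w) (at (snd x)))" for w
    by (rule linear_frechet_derivative[OF differentiable_Jinf[OF i y]])
  show ?thesis unfolding bilinear_def dl_def
    by (intro conjI allI linearI) (simp_all add: linear_add[OF 1] linear_cmul[OF 1] linear_add[OF 2] linear_cmul[OF 2] algebra_simps)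
qed

lemma dl_antisym: "dl i x w w' = - dl i x w' w" by (simp add: dl_def)

text \<open>(AC3) makes \<open>lambda_inf\<close> vanish on \<partial>_r throughout the chart, and
  translation invariance removes the derivative in r.\<close>

lemma dl_dr:
  assumes i: "i \<in> I" and x: "x \<in> S i"
  shows "dl i x dr w = 0"
proof -
  have y: "snd x \<in> R i" using x by auto
  have "((\<lambda>y. fst (Jinf i (0, y) dr)) has_derivative (\<lambda>e. fst (frechet_derivative (\<lambda>y. Jinf i (0, y) dr) (at (snd x)) e))) (at (snd x))"
    using frechet_derivative_worksI[OF differentiable_Jinf[OF i y]] by (rule has_derivative_fst)
  moreover have "((\<lambda>y. fst (Jinf i (0, y) dr)) has_derivative (\<lambda>e. 0)) (at (snd x))"
  proof (rule has_derivative_transform_within_open[OF has_derivative_const chart(2)[OF i] y])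
    show "0 = fst (Jinf i (0, y) dr)" if "y \<in> R i" for y by (rule fst_Jinf_dr[OF i, symmetric]) (use that in auto)
  qed
  ultimately have "(\<lambda>e. fst (frechet_derivative (\<lambda>y. Jinf i (0, y) dr) (at (snd x)) e)) = (\<lambda>e. 0)" by (rule has_derivative_unique)
  from fun_cong[OF this, of "snd w"] show ?thesis
    using linear_0[OF linear_frechet_derivative[OF differentiable_Jinf[OF i y]]] by (simp add: dl_def dr_def)
qed

text \<open>This is (AC2), once \<open>lambda_inf\<close> and \<open>reeb_inf\<close> are expressed
  through Jinf.\<close>

lemma dl_reeb:
  assumes i: "i \<in> I" and x: "x \<in> S i"
  shows "dl i x (Jinf i x dr) w = 0"
proof -
  have y: "snd x \<in> R i" using x by auto
  have "frechet_derivative (\<lambda>x. lambda_inf J i x v) (at x within S i) e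
      = - fst (frechet_derivative (\<lambda>y. Jinf i (0, y) v) (at (snd x)) (snd e))" for v e
  proof -
    have hd: "((\<lambda>y. - fst (Jinf i (0, y) v)) has_derivative (\<lambda>e. - fst (frechet_derivative (\<lambda>y. Jinf i (0, y) v) (at (snd x)) e))) (at (snd x))"
      by (intro has_derivative_minus has_derivative_fst frechet_derivative_worksI differentiable_Jinf[OF i y])
    have "frechet_derivative (\<lambda>x. lambda_inf J i x v) (at x within S i) e = frechet_derivative (\<lambda>y. - fst (Jinf i (0, y) v)) (at (snd x)) (snd e)"
    proof (rule frechet_slice[OF i x])
      fix x assume x': "x \<in> S i"
      show "lambda_inf J i x v = - fst (Jinf i (0, snd x) v)"
        unfolding lambda_inf_eq[OF i x'] by (subst Jinf_invariant[OF i x']) (rule refl)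
    qed (use hd in \<open>rule differentiableI\<close>)
    also have "\<dots> = - fst (frechet_derivative (\<lambda>y. Jinf i (0, y) v) (at (snd x)) (snd e))"
      unfolding frechet_derivative_eqI[OF hd] ..
    finally show ?thesis .
  qed
  moreover have "d_one_form (S i) (lambda_inf J i) x (reeb_inf J i x) w = 0"
    using d_lambda_inf i x unfolding chart_range_watlas by blast
  ultimately show ?thesis unfolding d_one_form_def reeb_inf_Jinf[OF i x] by (simp add: dl_def)
qed

lemma dl_proj:
  assumes i: "i \<in> I" and x: "x \<in> S i"
  shows "dl i x w w' = dl i x (proj_xi (Jinf i x) w) (proj_xi (Jinf i x) w')"
proof -
  interpret k: cplx_struct "Jinf i x" by (rule Jinf_struct[OF i x])
  note b = dl_bilinear[OF i x]
  have 1: "dl i x w v = dl i x (k.pr w) v" for w v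
    by (subst k.decomp[of w]) (simp add: bilinear_ladd[OF b] bilinear_lmul[OF b] dl_dr[OF i x] dl_reeb[OF i x])
  show ?thesis unfolding k.proj_eq using 1[of w w'] 1[of w' "k.pr w"] dl_antisym[of i x w' "k.pr w"] dl_antisym[of i x "k.pr w'" "k.pr w"]
    by linarith
qed

text \<open>Only the \<xi>-components with respect to Jinf matter. They differ by exponentially
  small terms from those with respect to J, which the \<omega>-density bounds. This is why small
  \<omega>-energy makes the pulled-back form nearly closed.\<close>

lemma dl_bound:
  assumes i: "i \<in> I" and K: "compact K" "K \<subseteq> R i" "convex K"
  obtains M \<delta> where "M > 0" "\<delta> > 0"
    "\<And>x w. x \<in> {0::real..} \<times> K \<Longrightarrow> \<bar>dl i x w (J i x w)\<bar> \<le> M * (winf i (snd x) (snd (proj_xi (J i x) w)) (snd (J i x (proj_xi (J i x) w))) + exp (- \<delta> * fst x) * (norm w)\<^sup>2)"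
proof -
  obtain N where N: "N > 0"
    "\<And>y v e. y \<in> K \<Longrightarrow> norm (frechet_derivative (\<lambda>y. Jinf i (0, y) v) (at y) e) \<le> N * norm v * norm e"
    by (rule Jinf_bounds[OF i K(1,2)]) blast
  obtain m where m: "m > 0" "\<And>x w. x \<in> {0::real..} \<times> K \<Longrightarrow> m * (norm w)\<^sup>2 \<le> dens i x w"
    by (rule dens_bounds[OF i K]) blast
  obtain \<Lambda> B \<delta> where ts: "B > 0" "\<delta> > 0" "\<Lambda> \<ge> 1"
    "\<And>x. x \<in> {0::real..} \<times> K \<Longrightarrow> two_structs (J i x) (Jinf i x) \<Lambda> (B * exp (- \<delta> * fst x))"
    by (rule two_structs_far[OF i K]) blast
  define P where "P = 2 * \<Lambda> + (2 + \<Lambda> * \<Lambda>) * \<Lambda> + \<Lambda>"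
  have P0: "P \<ge> 0" unfolding P_def using ts(3) by (intro add_nonneg_nonneg mult_nonneg_nonneg) auto
  define M where "M = 4 * N * (\<Lambda> / m + 1) * (1 + \<Lambda>) * (1 + (P * B)\<^sup>2)"
  have M1: "4 * N * \<Lambda> / m \<le> M" "4 * N * \<Lambda> * (P * B)\<^sup>2 \<le> M" "M > 0"
  proof -
    have a: "\<Lambda> / m \<ge> 0" using m ts by simp
    have "4 * N * (\<Lambda> / m) * 1 * 1 \<le> M" unfolding M_def using N ts a by (intro mult_mono) auto
    then show "4 * N * \<Lambda> / m \<le> M" by simp
    have "4 * N * 1 * \<Lambda> * (P * B)\<^sup>2 \<le> M" unfolding M_def using N ts a by (intro mult_mono) auto
    then show "4 * N * \<Lambda> * (P * B)\<^sup>2 \<le> M" by simp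
    show "M > 0" unfolding M_def using N ts a by (intro mult_pos_pos add_pos_nonneg add_nonneg_pos) auto
  qed
  show ?thesis
  proof (rule that[of M \<delta>])
    fix x :: "real \<times> 'e" and w assume x: "x \<in> {0::real..} \<times> K"
    note xS = subset_S[OF K(2) x]
    interpret ts: two_structs "J i x" "Jinf i x" \<Lambda> "B * exp (- \<delta> * fst x)" by (rule ts(4)[OF x])
    define p where "p = proj_xi (J i x) w" define q where "q = proj_xi (Jinf i x) w"
    define p' where "p' = proj_xi (J i x) (J i x w)" define q' where "q' = proj_xi (Jinf i x) (J i x w)"
    define n where "n = norm w"
    define E where "E = winf i (snd x) (snd p) (snd (J i x p))"
    define \<epsilon> where "\<epsilon> = exp (- \<delta> * fst x)"
    have eps: "0 < \<epsilon>" "\<epsilon> \<le> 1" using x ts(2) by (auto simp: \<epsilon>_def mem_Times_iff)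
    have p'p: "p' = J i x p" by (simp add: p_def p'_def ts.j.proj_eq ts.j.pr_j)
    have p'n: "norm p' \<le> \<Lambda> * norm p" unfolding p'p by (rule ts.jb)
    have pxi: "p \<in> xi (J i x)" by (simp add: p_def ts.j.proj_eq ts.j.pr_in_xi)
    have pp: "m * (norm p)\<^sup>2 \<le> E"
      using m(2)[OF x, of p] pxi
      by (simp add: coercive_form_def E_def ts.j.proj_eq ts.j.pr_id[OF pxi] ts.j.xi_iff)
    have pq: "norm (p - q) \<le> P * (B * \<epsilon>) * n" unfolding p_def q_def n_def P_def \<epsilon>_def by (rule ts.pr_diff)
    have pq': "norm (p' - q') \<le> P * (B * \<epsilon>) * (\<Lambda> * n)"
    proof -
      have "norm (p' - q') \<le> P * (B * \<epsilon>) * norm (J i x w)" unfolding p'_def q'_def P_def \<epsilon>_def by (rule ts.pr_diff)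
      also have "\<dots> \<le> P * (B * \<epsilon>) * (\<Lambda> * n)" unfolding n_def using P0 ts(1) eps by (intro mult_left_mono ts.jb) auto
      finally show ?thesis .
    qed
    \<comment> \<open>\<open>a\<close> is the part governed by the \<omega>-density,
      \<open>b\<close> the exponentially small discrepancy of the two projections.\<close>
    define a where "a = norm p" define b where "b = P * (B * \<epsilon>) * n"
    have ab: "a \<ge> 0" "b \<ge> 0" using P0 ts(1) eps by (auto simp: a_def b_def n_def)
    have qn: "norm q \<le> a + b" using norm_triangle_sub[of q p] pq by (simp add: a_def b_def norm_minus_commute)
    have qn': "norm q' \<le> \<Lambda> * (a + b)"
      using norm_triangle_sub[of q' p'] pq' p'n by (simp add: a_def b_def norm_minus_commute algebra_simps)
    have sx: "snd x \<in> K" using x by auto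
    have d1: "\<bar>fst (frechet_derivative (\<lambda>y. Jinf i (0, y) v) (at (snd x)) (snd v'))\<bar> \<le> N * norm v * norm v'" for v v' :: "real \<times> 'e"
    proof -
      have "\<bar>fst (frechet_derivative (\<lambda>y. Jinf i (0, y) v) (at (snd x)) (snd v'))\<bar> \<le> norm (frechet_derivative (\<lambda>y. Jinf i (0, y) v) (at (snd x)) (snd v'))"
        using norm_fst_le'[of "frechet_derivative (\<lambda>y. Jinf i (0, y) v) (at (snd x)) (snd v')"] by simp
      also have "\<dots> \<le> N * norm v * norm (snd v')" by (rule N(2)[OF sx])
      also have "\<dots> \<le> N * norm v * norm v'" using N(1) by (intro mult_left_mono norm_snd_le') auto
      finally show ?thesis .
    qed
    have "\<bar>dl i x w (J i x w)\<bar> = \<bar>dl i x q q'\<bar>" unfolding q_def q'_def by (subst dl_proj[OF i xS]) (rule refl)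
    also have "\<dots> \<le> 2 * N * norm q * norm q'"
      using d1[of q q'] d1[of q' q] unfolding dl_def by (simp add: mult_ac)
    also have "\<dots> \<le> 2 * N * (a + b) * (\<Lambda> * (a + b))" using N(1) ab by (intro mult_mono qn qn') auto
    also have "\<dots> = 2 * N * \<Lambda> * (a + b)\<^sup>2" by (simp add: power2_eq_square algebra_simps)
    also have "\<dots> \<le> 2 * N * \<Lambda> * (2 * a\<^sup>2 + 2 * b\<^sup>2)"
    proof -
      have "(a + b)\<^sup>2 \<le> 2 * a\<^sup>2 + 2 * b\<^sup>2" using sum_squares_bound[of a b] by (simp add: power2_sum)
      then show ?thesis using N(1) ts(3) by (intro mult_left_mono) auto
    qed
    also have "\<dots> = 4 * N * \<Lambda> / m * (m * a\<^sup>2) + 4 * N * \<Lambda> * b\<^sup>2" using m(1) by (simp add: field_simps)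
    also have "\<dots> \<le> M * E + M * (\<epsilon> * n\<^sup>2)"
    proof (rule add_mono)
      have "4 * N * \<Lambda> / m * (m * a\<^sup>2) \<le> 4 * N * \<Lambda> / m * E" using pp N ts m unfolding a_def by (intro mult_left_mono) auto
      also have "\<dots> \<le> M * E"
      proof (rule mult_right_mono[OF M1(1)])
        have "0 \<le> m * (norm p)\<^sup>2" using m by simp
        then show "0 \<le> E" using pp by linarith
      qed
      finally show "4 * N * \<Lambda> / m * (m * a\<^sup>2) \<le> M * E" .
      have "\<epsilon>\<^sup>2 \<le> \<epsilon>" using eps by (simp add: power2_eq_square mult_left_le)
      have "4 * N * \<Lambda> * b\<^sup>2 = 4 * N * \<Lambda> * (P * B)\<^sup>2 * (\<epsilon>\<^sup>2 * n\<^sup>2)" by (simp add: b_def power_mult_distrib mult_ac)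
      also have "\<dots> \<le> M * (\<epsilon> * n\<^sup>2)" using M1 \<open>\<epsilon>\<^sup>2 \<le> \<epsilon>\<close> eps N ts by (intro mult_mono) auto
      finally show "4 * N * \<Lambda> * b\<^sup>2 \<le> M * (\<epsilon> * n\<^sup>2)" .
    qed
    finally show "\<bar>dl i x w (J i x w)\<bar> \<le> M * (winf i (snd x) (snd (proj_xi (J i x) w)) (snd (J i x (proj_xi (J i x) w))) + exp (- \<delta> * fst x) * (norm w)\<^sup>2)"
      by (simp add: E_def p_def \<epsilon>_def n_def algebra_simps)
  qed (use M1 ts in auto)
qed

end

section \<open>Constants uniform over the half-cylinder\<close>

locale cyl_metric = asymp_cyl d B I C g J Jinf winf
  for d :: nat and B :: "'e::euclidean_space list" and I :: "'i set" and C :: "'i \<Rightarrow> ('v::t2_space, 'e) chart"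
    and g :: "'i \<Rightarrow> real \<times> 'e \<Rightarrow> real \<times> 'e \<Rightarrow> real \<times> 'e \<Rightarrow> real"
    and J Jinf :: "'i \<Rightarrow> real \<times> 'e \<Rightarrow> real \<times> 'e \<Rightarrow> real \<times> 'e"
    and winf :: "'i \<Rightarrow> 'e \<Rightarrow> 'e \<Rightarrow> 'e \<Rightarrow> real" +
  fixes gW :: "'i \<Rightarrow> real \<times> 'e \<Rightarrow> real \<times> 'e \<Rightarrow> real \<times> 'e \<Rightarrow> real"
  assumes metW: "riemannian_metric I (watlas C) gW" and tiW: "translation_invariant I C gW"
begin

lemma gW_facts:
  "i \<in> I \<Longrightarrow> smooth_on (S i) (\<lambda>x. gW i x v w)"
  "i \<in> I \<Longrightarrow> x \<in> S i \<Longrightarrow> bilinear (gW i x)"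
  "i \<in> I \<Longrightarrow> x \<in> S i \<Longrightarrow> v \<noteq> 0 \<Longrightarrow> gW i x v v > 0"
  "i \<in> I \<Longrightarrow> x \<in> S i \<Longrightarrow> gW i x = gW i (0, snd x)"
proof -
  note m = metW[unfolded riemannian_metric_def bilinear_field_def chart_range_watlas]
  show "i \<in> I \<Longrightarrow> smooth_on (S i) (\<lambda>x. gW i x v w)" using m by blast
  show "i \<in> I \<Longrightarrow> x \<in> S i \<Longrightarrow> bilinear (gW i x)" using m by blast
  show "i \<in> I \<Longrightarrow> x \<in> S i \<Longrightarrow> v \<noteq> 0 \<Longrightarrow> gW i x v v > 0" using m by blast
  show "i \<in> I \<Longrightarrow> x \<in> S i \<Longrightarrow> gW i x = gW i (0, snd x)" by (rule translation_invariantD[OF tiW])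
qed

abbreviation "eform i x w \<equiv> winf i (snd x) (snd (proj_xi (J i x) w)) (snd (J i x (proj_xi (J i x) w)))"

lemma eform_nonneg:
  assumes i: "i \<in> I" and x: "x \<in> S i"
  shows "eform i x w \<ge> 0"
proof -
  interpret j: cplx_struct "J i x" by (rule J_struct[OF i x])
  have b: "bilinear (winf i (snd x))" by (rule winf_facts(1)[OF i]) (use x in auto)
  have "proj_xi (J i x) w \<in> xi (J i x)" by (simp add: j.proj_eq j.pr_in_xi)
  from winf_J_pos[OF i x this] show ?thesis
    by (cases "proj_xi (J i x) w = 0") (auto simp: bilinear_lzero[OF b])
qed

text \<open>All chart estimates share one constant \<Lambda> and one rate \<delta>, so that
  compactness of V is invoked for all of them at once.\<close>

definition chart_const :: "real \<Rightarrow> real \<Rightarrow> 'i \<Rightarrow> 'e set \<Rightarrow> bool" where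
  "chart_const \<Lambda> \<delta> i K \<longleftrightarrow> (\<forall>x\<in>{0::real..} \<times> K. \<forall>w.
     norm (J i x w) \<le> \<Lambda> * norm w \<and>
     (\<forall>x'\<in>{0::real..} \<times> K. norm (J i x w - J i x' w) \<le> \<Lambda> * norm w * norm (x - x')) \<and>
     (norm w)\<^sup>2 \<le> \<Lambda> * dens i x w \<and> dens i x w \<le> \<Lambda> * (norm w)\<^sup>2 \<and>
     norm (A i x w) \<le> \<Lambda> * exp (- \<delta> * fst x) * norm w \<and>
     \<bar>dl i x w (J i x w)\<bar> \<le> \<Lambda> * (eform i x w + exp (- \<delta> * fst x) * (norm w)\<^sup>2) \<and>
     gW i x w w \<le> \<Lambda> * (norm w)\<^sup>2)"

lemma chart_constD:
  assumes "chart_const \<Lambda> \<delta> i K" "x \<in> {0::real..} \<times> K"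
  shows "norm (J i x w) \<le> \<Lambda> * norm w"
    "x' \<in> {0::real..} \<times> K \<Longrightarrow> norm (J i x w - J i x' w) \<le> \<Lambda> * norm w * norm (x - x')"
    "(norm w)\<^sup>2 \<le> \<Lambda> * dens i x w" "dens i x w \<le> \<Lambda> * (norm w)\<^sup>2"
    "norm (A i x w) \<le> \<Lambda> * exp (- \<delta> * fst x) * norm w"
    "\<bar>dl i x w (J i x w)\<bar> \<le> \<Lambda> * (eform i x w + exp (- \<delta> * fst x) * (norm w)\<^sup>2)"
    "gW i x w w \<le> \<Lambda> * (norm w)\<^sup>2"
proof -
  note c = spec[OF bspec[OF assms(1)[unfolded chart_const_def] assms(2)], of w]
  show "norm (J i x w) \<le> \<Lambda> * norm w" "(norm w)\<^sup>2 \<le> \<Lambda> * dens i x w" "dens i x w \<le> \<Lambda> * (norm w)\<^sup>2"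
    "norm (A i x w) \<le> \<Lambda> * exp (- \<delta> * fst x) * norm w"
    "\<bar>dl i x w (J i x w)\<bar> \<le> \<Lambda> * (eform i x w + exp (- \<delta> * fst x) * (norm w)\<^sup>2)"
    "gW i x w w \<le> \<Lambda> * (norm w)\<^sup>2"
    using c by simp_all
  show "x' \<in> {0::real..} \<times> K \<Longrightarrow> norm (J i x w - J i x' w) \<le> \<Lambda> * norm w * norm (x - x')" using c by blast
qed

lemma chart_const_mono:
  assumes c: "chart_const \<Lambda> \<delta> i K" and i: "i \<in> I" and K: "K' \<subseteq> K" "K \<subseteq> R i" and le: "1 \<le> \<Lambda>" "\<Lambda> \<le> \<Lambda>'" "\<delta>' \<le> \<delta>"
  shows "chart_const \<Lambda>' \<delta>' i K'"
  unfolding chart_const_def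
proof (intro ballI allI conjI)
  fix x :: "real \<times> 'e" and w assume x': "x \<in> {0::real..} \<times> K'"
  have x: "x \<in> {0::real..} \<times> K" using x' K by auto
  note cc = chart_constD[OF c x, where w = w]
  have m: "\<Lambda> * a \<le> \<Lambda>' * a" if "a \<ge> 0" for a using le that by (intro mult_right_mono) auto
  have "0 \<le> \<Lambda> * dens i x w" using order_trans[OF zero_le_power2 cc(3)] .
  then have d0: "dens i x w \<ge> 0" using le by (simp add: zero_le_mult_iff)
  have e: "exp (- \<delta> * fst x) \<le> exp (- \<delta>' * fst x)" using le x by (auto intro: mult_right_mono)
  show "norm (J i x w) \<le> \<Lambda>' * norm w" using cc(1) m[of "norm w"] by simp
  show "norm (J i x w - J i x' w) \<le> \<Lambda>' * norm w * norm (x - x')" if "x' \<in> {0::real..} \<times> K'" for x'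
  proof -
    have "x' \<in> {0::real..} \<times> K" using that K by auto
    from cc(2)[OF this] m[of "norm w * norm (x - x')"] show ?thesis by (simp add: mult.assoc)
  qed
  show "(norm w)\<^sup>2 \<le> \<Lambda>' * dens i x w" using cc(3) m[OF d0] by linarith
  show "dens i x w \<le> \<Lambda>' * (norm w)\<^sup>2" using cc(4) m[of "(norm w)\<^sup>2"] by simp
  show "gW i x w w \<le> \<Lambda>' * (norm w)\<^sup>2" using cc(7) m[of "(norm w)\<^sup>2"] by simp
  have "\<Lambda> * exp (- \<delta> * fst x) * norm w \<le> \<Lambda>' * exp (- \<delta>' * fst x) * norm w"
    using e le by (intro mult_mono mult_right_mono) auto
  then show "norm (A i x w) \<le> \<Lambda>' * exp (- \<delta>' * fst x) * norm w" using cc(5) by linarith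
  have "eform i x w \<ge> 0" by (rule eform_nonneg[OF i subset_S[OF K(2) x]])
  then have "\<Lambda> * (eform i x w + exp (- \<delta> * fst x) * (norm w)\<^sup>2) \<le> \<Lambda>' * (eform i x w + exp (- \<delta>' * fst x) * (norm w)\<^sup>2)"
    using e le by (intro mult_mono add_left_mono mult_right_mono add_nonneg_nonneg) auto
  then show "\<bar>dl i x w (J i x w)\<bar> \<le> \<Lambda>' * (eform i x w + exp (- \<delta>' * fst x) * (norm w)\<^sup>2)" using cc(6) by linarith
qed

lemma chart_const_exists:
  assumes i: "i \<in> I" and K: "compact K" "K \<subseteq> R i" "convex K"
  obtains \<Lambda> \<delta> where "\<Lambda> \<ge> 1" "\<delta> > 0" "chart_const \<Lambda> \<delta> i K"
proof -
  obtain L1 B1 d1 where ts: "B1 > 0" "d1 > 0" "L1 \<ge> 1"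
    "\<And>x. x \<in> {0::real..} \<times> K \<Longrightarrow> two_structs (J i x) (Jinf i x) L1 (B1 * exp (- d1 * fst x))"
    by (rule two_structs_far[OF i K]) blast
  obtain L2 where L2: "L2 > 0" "\<And>x x' v. x \<in> {0::real..} \<times> K \<Longrightarrow> x' \<in> {0::real..} \<times> K \<Longrightarrow>
    norm (J i x v - J i x' v) \<le> L2 * norm v * norm (x - x')"
    by (rule J_Lipschitz[OF i K]) (rule that; blast)
  obtain m3 M3 where L3: "m3 > 0" "M3 > 0" "\<And>x w. x \<in> {0::real..} \<times> K \<Longrightarrow> m3 * (norm w)\<^sup>2 \<le> dens i x w"
    "\<And>x w. x \<in> {0::real..} \<times> K \<Longrightarrow> dens i x w \<le> M3 * (norm w)\<^sup>2"
    by (rule dens_bounds[OF i K]) (rule that; blast)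
  obtain M4 d4 where L4: "M4 > 0" "d4 > 0"
    "\<And>x w. x \<in> {0::real..} \<times> K \<Longrightarrow> \<bar>dl i x w (J i x w)\<bar> \<le> M4 * (eform i x w + exp (- d4 * fst x) * (norm w)\<^sup>2)"
    by (rule dl_bound[OF i K]) (rule that; blast)
  obtain M5 where L5: "M5 > 0" "\<And>x v w. x \<in> {0..} \<times> K \<Longrightarrow> \<bar>gW i x v w\<bar> \<le> M5 * norm v * norm w"
    by (rule metric_bounds[OF i K(1,2) gW_facts(2)[OF i] gW_facts(3)[OF i] gW_facts(4)[OF i] gW_facts(1)[OF i]], assumption+) (rule that; blast)
  define \<Lambda> where "\<Lambda> = 1 + L1 + B1 + L2 + 1 / m3 + M3 + M4 + M5"
  define \<delta> where "\<delta> = min d1 d4"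
  have p: "1 / m3 > 0" using L3 by simp
  have le: "1 \<le> \<Lambda>" "L1 \<le> \<Lambda>" "B1 \<le> \<Lambda>" "L2 \<le> \<Lambda>" "1 / m3 \<le> \<Lambda>" "M3 \<le> \<Lambda>" "M4 \<le> \<Lambda>" "M5 \<le> \<Lambda>"
    unfolding \<Lambda>_def using ts L2 L3 L4 L5 p by linarith+
  show ?thesis
  proof (rule that[of \<Lambda> \<delta>])
    show "\<Lambda> \<ge> 1" "\<delta> > 0" using le ts L4 by (auto simp: \<delta>_def)
    show "chart_const \<Lambda> \<delta> i K" unfolding chart_const_def
    proof (intro ballI allI conjI)
      fix x :: "real \<times> 'e" and w assume x: "x \<in> {0::real..} \<times> K"
      interpret t: two_structs "J i x" "Jinf i x" L1 "B1 * exp (- d1 * fst x)" by (rule ts(4)[OF x])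
      have m: "b * a \<le> \<Lambda> * a" if "a \<ge> 0" "b \<le> \<Lambda>" for a b using that by (intro mult_right_mono) auto
      have fx: "fst x \<ge> 0" using x by auto
      have e: "exp (- d1 * fst x) \<le> exp (- \<delta> * fst x)" "exp (- d4 * fst x) \<le> exp (- \<delta> * fst x)"
        using fx by (auto simp: \<delta>_def intro!: mult_right_mono)
      show "norm (J i x w) \<le> \<Lambda> * norm w" using t.jb[of w] m[OF norm_ge_zero le(2), of w] by linarith
      show "norm (J i x w - J i x' w) \<le> \<Lambda> * norm w * norm (x - x')" if "x' \<in> {0::real..} \<times> K" for x'
        using L2(2)[OF x that, of w] m[OF _ le(4), of "norm w * norm (x - x')"] by (simp add: mult.assoc)
      have "(norm w)\<^sup>2 \<le> 1 / m3 * dens i x w" using L3(3)[OF x, of w] L3(1) by (simp add: field_simps)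
      also have "\<dots> \<le> \<Lambda> * dens i x w"
      proof (rule m[OF _ le(5)])
        have "0 \<le> m3 * (norm w)\<^sup>2" using L3 by simp
        then show "0 \<le> dens i x w" using L3(3)[OF x, of w] by linarith
      qed
      finally show "(norm w)\<^sup>2 \<le> \<Lambda> * dens i x w" .
      show "dens i x w \<le> \<Lambda> * (norm w)\<^sup>2" using L3(4)[OF x, of w] m[OF _ le(6), of "(norm w)\<^sup>2"] by simp
      have "norm (A i x w) \<le> B1 * exp (- d1 * fst x) * norm w" by (rule t.jk)
      also have "\<dots> \<le> \<Lambda> * exp (- \<delta> * fst x) * norm w" using e le ts by (intro mult_mono mult_right_mono) auto
      finally show "norm (A i x w) \<le> \<Lambda> * exp (- \<delta> * fst x) * norm w" .
      have "eform i x w \<ge> 0" by (rule eform_nonneg[OF i subset_S[OF K(2) x]])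
      then have "M4 * (eform i x w + exp (- d4 * fst x) * (norm w)\<^sup>2) \<le> \<Lambda> * (eform i x w + exp (- \<delta> * fst x) * (norm w)\<^sup>2)"
        using e le L4(1) by (intro mult_mono add_left_mono mult_right_mono add_nonneg_nonneg) auto
      then show "\<bar>dl i x w (J i x w)\<bar> \<le> \<Lambda> * (eform i x w + exp (- \<delta> * fst x) * (norm w)\<^sup>2)"
        using L4(3)[OF x, of w] by linarith
      show "gW i x w w \<le> \<Lambda> * (norm w)\<^sup>2"
        using L5(2)[OF x, of w w] m[OF _ le(8), of "(norm w)\<^sup>2"] by (simp add: power2_eq_square mult.assoc)
    qed
  qed
qed

text \<open>The chart may depend on p, but radius and constants do not. A map is later studied in
  the chart that belongs to its value at the centre of the disc.\<close>

definition good :: "real \<Rightarrow> real \<Rightarrow> real \<Rightarrow> 'v \<Rightarrow> bool" where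
  "good \<Lambda> \<delta> \<rho> p \<longleftrightarrow> (\<exists>i\<in>I. p \<in> fst (C i) \<and> cball (snd (C i) p) \<rho> \<subseteq> R i \<and> chart_const \<Lambda> \<delta> i (cball (snd (C i) p) \<rho>))"

lemma good_mono:
  assumes "good \<Lambda> \<delta> \<rho> p" "1 \<le> \<Lambda>" "\<Lambda> \<le> \<Lambda>'" "\<delta>' \<le> \<delta>" "\<rho>' \<le> \<rho>"
  shows "good \<Lambda>' \<delta>' \<rho>' p"
proof -
  obtain i where i: "i \<in> I" "p \<in> fst (C i)" "cball (snd (C i) p) \<rho> \<subseteq> R i" "chart_const \<Lambda> \<delta> i (cball (snd (C i) p) \<rho>)"
    using assms(1) unfolding good_def by blast
  have s: "cball (snd (C i) p) \<rho>' \<subseteq> cball (snd (C i) p) \<rho>" using assms(5) by (intro cball_subset_cball_iff[THEN iffD2]) auto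
  show ?thesis unfolding good_def
    using i chart_const_mono[OF i(4,1) s i(3) assms(2,3,4)] s by blast
qed

text \<open>Halving the radius lets one chart ball serve all centres near p.\<close>

lemma good_local: "\<exists>U \<Lambda> \<delta> \<rho>. open U \<and> p \<in> U \<and> \<Lambda> \<ge> 1 \<and> \<delta> > 0 \<and> \<rho> > 0 \<and> (\<forall>q\<in>U. good \<Lambda> \<delta> \<rho> q)"
proof -
  obtain i where i: "i \<in> I" "p \<in> fst (C i)" using chart_cover by blast
  note ch = chart[OF i(1)]
  have "snd (C i) p \<in> R i" using i by (auto simp: chart_range_def)
  then obtain r where r: "r > 0" "cball (snd (C i) p) r \<subseteq> R i" using ch(2) open_contains_cball by blast
  obtain \<Lambda> \<delta> where c: "\<Lambda> \<ge> 1" "\<delta> > 0" "chart_const \<Lambda> \<delta> i (cball (snd (C i) p) r)"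
    by (rule chart_const_exists[OF i(1) compact_cball r(2) convex_cball])
  define U where "U = fst (C i) \<inter> snd (C i) -` ball (snd (C i) p) (r / 2)"
  have "open U" unfolding U_def
    by (rule continuous_open_preimage[OF homeomorphism_cont1[OF ch(3)] ch(1)]) auto
  moreover have "p \<in> U" using i r by (auto simp: U_def)
  moreover have "good \<Lambda> \<delta> (r / 2) q" if "q \<in> U" for q
  proof -
    have q: "q \<in> fst (C i)" "dist (snd (C i) p) (snd (C i) q) < r / 2" using that by (auto simp: U_def)
    have s: "cball (snd (C i) q) (r / 2) \<subseteq> cball (snd (C i) p) r"
    proof
      fix y assume "y \<in> cball (snd (C i) q) (r / 2)"
      then show "y \<in> cball (snd (C i) p) r" using q(2) dist_triangle[of "snd (C i) p" y "snd (C i) q"] by auto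
    qed
    show ?thesis unfolding good_def
      using i(1) q(1) s r(2) chart_const_mono[OF c(3) i(1) s r(2) c(1) order_refl order_refl] by blast
  qed
  ultimately show ?thesis using c r by (intro exI[of _ U] exI[of _ \<Lambda>] exI[of _ \<delta>] exI[of _ "r / 2"]) auto
qed

text \<open>A finite subcover of V: the largest \<Lambda> and the smallest \<delta> and \<rho> work
  everywhere, by monotonicity of \<open>good\<close>.\<close>

lemma good_uniform:
  obtains \<Lambda> \<delta> \<rho> where "\<Lambda> \<ge> 1" "\<delta> > 0" "\<rho> > 0" "\<And>p. good \<Lambda> \<delta> \<rho> p"
proof -
  define P where "P U \<Lambda> \<delta> \<rho> \<longleftrightarrow> \<Lambda> \<ge> 1 \<and> \<delta> > 0 \<and> \<rho> > 0 \<and> (\<forall>q\<in>U. good \<Lambda> \<delta> \<rho> q)" for U \<Lambda> \<delta> \<rho>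
  define T where "T = {U. open U \<and> (\<exists>\<Lambda> \<delta> \<rho>. P U \<Lambda> \<delta> \<rho>)}"
  have "UNIV \<subseteq> \<Union>T"
  proof
    fix p :: 'v
    obtain U \<Lambda> \<delta> \<rho> where "open U \<and> p \<in> U \<and> \<Lambda> \<ge> 1 \<and> \<delta> > 0 \<and> \<rho> > 0 \<and> (\<forall>q\<in>U. good \<Lambda> \<delta> \<rho> q)"
      using good_local[of p] by (elim exE)
    then have "p \<in> U" "U \<in> T" unfolding T_def P_def by blast+
    then show "p \<in> \<Union>T" by blast
  qed
  moreover have "compact (UNIV :: 'v set)" using man unfolding closed_oriented_manifold_def by blast
  ultimately obtain T' where T': "T' \<subseteq> T" "finite T'" "UNIV \<subseteq> \<Union>T'"
    using compactE[of UNIV T] unfolding T_def by blast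
  have "finite F \<Longrightarrow> F \<subseteq> T \<Longrightarrow> \<exists>\<Lambda> \<delta> \<rho>. P (\<Union>F) \<Lambda> \<delta> \<rho>" for F
  proof (induction F rule: finite_induct)
    case empty
    show ?case by (intro exI[of _ 1]) (simp add: P_def)
  next
    case (insert U F)
    obtain a b c where 1: "P (\<Union>F) a b c" using insert by blast
    obtain a' b' c' where 2: "P U a' b' c'" using insert.prems unfolding T_def by blast
    have "good (max a a') (min b b') (min c c') q" if q: "q \<in> \<Union>(insert U F)" for q
    proof -
      consider "q \<in> \<Union>F" | "q \<in> U" using q by blast
      then show ?thesis
      proof cases
        case 1
        then have "good a b c q" "a \<ge> 1" using \<open>P (\<Union>F) a b c\<close> unfolding P_def by blast+
        then show ?thesis by (rule good_mono) auto
      next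
        case 2
        then have "good a' b' c' q" "a' \<ge> 1" using \<open>P U a' b' c'\<close> unfolding P_def by blast+
        then show ?thesis by (rule good_mono) auto
      qed
    qed
    then have "P (\<Union>(insert U F)) (max a a') (min b b') (min c c')" using 1 2 unfolding P_def by auto
    then show ?case by blast
  qed
  from this[OF T'(2,1)] obtain \<Lambda> \<delta> \<rho> where "P (\<Union>T') \<Lambda> \<delta> \<rho>" by blast
  then show ?thesis using that T'(3) unfolding P_def by blast
qed

end

section \<open>Holomorphic maps in charts\<close>

text \<open>\<open>T\<close> is meant to be the derivative of a change of product charts: it
  preserves the \<partial>_r component and intertwines the structures, hence respects the
  splitting.\<close>

lemma coercive_form_conj:
  assumes "cplx_struct j" "cplx_struct k" and T: "linear T" "\<And>w. fst (T w) = fst w" "T dr = dr" "\<And>w. k (T w) = T (j w)"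
    and \<beta>: "\<And>a b. \<beta>' (snd (T a)) (snd (T b)) = \<beta> (snd a) (snd b)"
  shows "coercive_form k \<beta>' (T w) = coercive_form j \<beta> w"
proof -
  interpret j: cplx_struct j by fact
  interpret k: cplx_struct k by fact
  have kdr: "k dr = T (j dr)" using T(4)[of dr] T(3) by simp
  have \<rho>: "k.\<rho> = j.\<rho>" by (simp add: k.\<rho>_def j.\<rho>_def kdr T(2))
  have "proj_xi k (T w) = T (proj_xi j w)"
    by (simp add: k.proj_eq j.proj_eq k.pr_def j.pr_def k.sg_def j.sg_def k.lm_def j.lm_def \<rho> T(2,4) kdr
        linear_diff[OF T(1)] linear_cmul[OF T(1)] T(3))
  then show ?thesis by (simp add: coercive_form_def T(2,4) \<beta>)
qed

lemma C1_on_frechet: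
  assumes "C1_on U f fs ft" "z \<in> U"
  shows "frechet_derivative f (at z) 1 = fs z" "frechet_derivative f (at z) \<i> = ft z"
  using frechet_derivative_eqI[OF C1_onD(4)[OF assms]] by simp_all

text \<open>The global partials are Frechet derivatives of f itself, so the local ones may come from
  different charts and still fit together.\<close>

lemma C1_on_UNIV_local:
  assumes "\<And>z. \<exists>U fs ft. open U \<and> z \<in> U \<and> C1_on U f fs ft"
  shows "C1_on UNIV f (\<lambda>z. frechet_derivative f (at z) 1) (\<lambda>z. frechet_derivative f (at z) \<i>)"
proof -
  have "isCont (\<lambda>z. frechet_derivative f (at z) 1) z \<and> isCont (\<lambda>z. frechet_derivative f (at z) \<i>) z \<and>
    (f has_derivative (\<lambda>h. Re h *\<^sub>R frechet_derivative f (at z) 1 + Im h *\<^sub>R frechet_derivative f (at z) \<i>)) (at z)" for z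
  proof -
    obtain U fs ft where U: "open U" "z \<in> U" "C1_on U f fs ft" using assms[of z] by blast
    note fr = C1_on_frechet[OF U(3)]
    have "continuous_on U (\<lambda>z. frechet_derivative f (at z) 1)" "continuous_on U (\<lambda>z. frechet_derivative f (at z) \<i>)"
      by (rule continuous_on_eq[OF C1_onD(1)[OF U(3)]], simp add: fr, rule continuous_on_eq[OF C1_onD(2)[OF U(3)]], simp add: fr)
    then have "isCont (\<lambda>z. frechet_derivative f (at z) 1) z" "isCont (\<lambda>z. frechet_derivative f (at z) \<i>) z"
      using U(1,2) continuous_on_eq_continuous_at by blast+
    then show ?thesis using C1_onD(4)[OF U(3,2)] fr[OF U(2)] by simp
  qed
  then show ?thesis unfolding C1_on_def by (auto intro: continuous_at_imp_continuous_on)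
qed

lemma C1_on_sum:
  assumes "finite A" "\<And>b. b \<in> A \<Longrightarrow> C1_on U (f b) (fs b) (ft b)"
  shows "C1_on U (\<lambda>z. \<Sum>b\<in>A. f b z) (\<lambda>z. \<Sum>b\<in>A. fs b z) (\<lambda>z. \<Sum>b\<in>A. ft b z)"
  using assms
proof (induction A rule: finite_induct)
  case empty
  show ?case by (simp add: C1_on_def)
next
  case (insert b A)
  then show ?case using C1_on_add[of U "f b" "fs b" "ft b"] by simp
qed

lemma C1_on_compose:
  fixes f :: "'e::euclidean_space \<Rightarrow> real"
  assumes f: "Ck_on (Suc 0) S f" and Y: "C1_on U Y Ys Yt" and YS: "\<And>z. z \<in> U \<Longrightarrow> Y z \<in> S"
  shows "C1_on U (\<lambda>z. f (Y z)) (\<lambda>z. frechet_derivative f (at (Y z)) (Ys z)) (\<lambda>z. frechet_derivative f (at (Y z)) (Yt z))"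
proof -
  have lin: "linear (frechet_derivative f (at y))" if "y \<in> S" for y
    using Ck_on_1D(1)[OF f that] by (rule has_derivative_linear)
  have "((\<lambda>z. f (Y z)) has_derivative (\<lambda>h. Re h *\<^sub>R frechet_derivative f (at (Y z)) (Ys z) + Im h *\<^sub>R frechet_derivative f (at (Y z)) (Yt z))) (at z)"
    if z: "z \<in> U" for z
    using has_derivative_compose[OF C1_onD(4)[OF Y z] Ck_on_1D(1)[OF f YS[OF z]]]
    by (simp add: linear_add[OF lin[OF YS[OF z]]] linear_cmul[OF lin[OF YS[OF z]]])
  moreover have "continuous_on U (\<lambda>z. frechet_derivative f (at (Y z)) (h z))" if "continuous_on U h" for h
  proof (rule continuous_on_linear_field[OF lin _ C1_onD(3)[OF Y] that YS])
    show "continuous_on S (\<lambda>y. frechet_derivative f (at y) v)" for v using f by simp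
  qed
  ultimately show ?thesis unfolding C1_on_def using C1_onD(1,2)[OF Y] by blast
qed

text \<open>Expansion in the basis reduces the claim to products of C^1 functions, since the field
  is known to be C^1 only for fixed vectors.\<close>

lemma C1_on_linear_field:
  fixes F :: "'e::euclidean_space \<Rightarrow> 'a::euclidean_space \<Rightarrow> real"
  assumes S: "open S" and F: "\<And>y. y \<in> S \<Longrightarrow> linear (F y)" "\<And>v. Ck_on (Suc 0) S (\<lambda>y. F y v)"
    and Y: "C1_on U Y Ys Yt" and YS: "\<And>z. z \<in> U \<Longrightarrow> Y z \<in> S" and W: "C1_on U W Ws Wt" and U: "open U"
  shows "C1_on U (\<lambda>z. F (Y z) (W z))
    (\<lambda>z. frechet_derivative (\<lambda>y. F y (W z)) (at (Y z)) (Ys z) + F (Y z) (Ws z))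
    (\<lambda>z. frechet_derivative (\<lambda>y. F y (W z)) (at (Y z)) (Yt z) + F (Y z) (Wt z))"
proof -
  have F_exp: "F y w = (\<Sum>b\<in>Basis. (w \<bullet> b) * F y b)" if y: "y \<in> S" for y w
  proof -
    have "F y w = F y (\<Sum>b\<in>Basis. (w \<bullet> b) *\<^sub>R b)" by (simp add: euclidean_representation)
    also have "\<dots> = (\<Sum>b\<in>Basis. (w \<bullet> b) * F y b)" by (simp add: linear_sum[OF F(1)[OF y]] linear_cmul[OF F(1)[OF y]])
    finally show ?thesis .
  qed
  have df: "(\<lambda>y. F y v) differentiable (at y)" if "y \<in> S" for v y using F(2)[of v] that by simp
  define D where "D y w e = frechet_derivative (\<lambda>y. F y w) (at y) e" for y w e
  have D_exp: "D y w e = (\<Sum>b\<in>Basis. (w \<bullet> b) * D y b e)" if y: "y \<in> S" for y w e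
  proof -
    have l: "linear (\<lambda>w. D y w e)" unfolding D_def by (rule linear_frechet_derivative_param[OF S F(1) df y])
    have "D y w e = D y (\<Sum>b\<in>Basis. (w \<bullet> b) *\<^sub>R b) e" by (simp add: euclidean_representation)
    also have "\<dots> = (\<Sum>b\<in>Basis. (w \<bullet> b) * D y b e)" by (simp add: linear_sum[OF l] linear_cmul[OF l])
    finally show ?thesis .
  qed
  have "C1_on U (\<lambda>z. \<Sum>b\<in>Basis. (W z \<bullet> b) * F (Y z) b)
    (\<lambda>z. \<Sum>b\<in>Basis. (Ws z \<bullet> b) * F (Y z) b + (W z \<bullet> b) * D (Y z) b (Ys z))
    (\<lambda>z. \<Sum>b\<in>Basis. (Wt z \<bullet> b) * F (Y z) b + (W z \<bullet> b) * D (Y z) b (Yt z))"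
    unfolding D_def
    by (intro C1_on_sum C1_on_mult C1_on_linear[OF W bounded_linear_inner_left] C1_on_compose[OF F(2) Y YS]) auto
  then have c: "C1_on U (\<lambda>z. \<Sum>b\<in>Basis. (W z \<bullet> b) * F (Y z) b)
    (\<lambda>z. D (Y z) (W z) (Ys z) + F (Y z) (Ws z)) (\<lambda>z. D (Y z) (W z) (Yt z) + F (Y z) (Wt z))"
    by (rule C1_on_cong) (subst D_exp[OF YS], assumption, subst F_exp[OF YS], assumption, simp add: sum.distrib)+
  have "C1_on U (\<lambda>z. F (Y z) (W z)) (\<lambda>z. D (Y z) (W z) (Ys z) + F (Y z) (Ws z)) (\<lambda>z. D (Y z) (W z) (Yt z) + F (Y z) (Wt z))"
    unfolding C1_on_def
  proof (intro conjI ballI)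
    fix z assume z: "z \<in> U"
    show "((\<lambda>z. F (Y z) (W z)) has_derivative (\<lambda>h. Re h *\<^sub>R (D (Y z) (W z) (Ys z) + F (Y z) (Ws z)) + Im h *\<^sub>R (D (Y z) (W z) (Yt z) + F (Y z) (Wt z)))) (at z)"
      by (rule has_derivative_transform_within_open[OF C1_onD(4)[OF c z] U z]) (simp add: F_exp[OF YS])
  qed (use C1_onD[OF c] in auto)
  then show ?thesis unfolding D_def .
qed

section \<open>Changes of chart on the half-cylinder\<close>

context asymp_cyl begin

lemma chart_overlap:
  assumes i: "i \<in> I" and j: "j \<in> I"
  defines "Q \<equiv> snd (C i) ` (fst (C i) \<inter> fst (C j))"
  shows "open Q" "Q \<subseteq> R i" "q \<in> fst (C i) \<Longrightarrow> transition (C i) (C j) (snd (C i) q) = snd (C j) q"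
    "y \<in> Q \<Longrightarrow> (transition (C i) (C j) has_derivative frechet_derivative (transition (C i) (C j)) (at y within Q)) (at y)"
proof -
  note ci = chart[OF i] note cj = chart[OF j]
  have "openin (top_of_set (R i)) Q" unfolding Q_def
    by (rule homeomorphism_imp_open_map[OF ci(3)]) (use cj(1) in auto)
  then show o: "open Q" using ci(2) openin_open_eq by blast
  show "Q \<subseteq> R i" unfolding Q_def chart_range_def by auto
  show "q \<in> fst (C i) \<Longrightarrow> transition (C i) (C j) (snd (C i) q) = snd (C j) q"
    using homeomorphism_apply1[OF ci(3)] by (simp add: transition_def)
  note smooth = man[unfolded closed_oriented_manifold_def, THEN conjunct2, THEN conjunct2, THEN conjunct2,
    THEN conjunct2, THEN conjunct2, THEN conjunct2, THEN conjunct1]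
  have sm: "smooth_on Q (transition (C i) (C j))" using bspec[OF bspec[OF smooth i] j] unfolding Q_def .
  assume y: "y \<in> Q"
  have "(transition (C i) (C j) has_derivative frechet_derivative (transition (C i) (C j)) (at y within Q)) (at y within Q)"
    by (rule frechet_derivative_worksI[OF smooth_on_differentiable_within[OF sm y]])
  then show "(transition (C i) (C j) has_derivative frechet_derivative (transition (C i) (C j)) (at y within Q)) (at y)"
    by (simp only: at_within_open[OF y o])
qed

text \<open>The charts of W are products, so their changes are the identity in r; uniqueness of
  derivatives up to the boundary identifies the derivative within the half-cylinder.\<close>

lemma transition_watlas:
  assumes i: "i \<in> I" and j: "j \<in> I" and p: "fst p \<ge> 0" "snd p \<in> fst (C i)" "snd p \<in> fst (C j)"
  shows "transition_deriv (watlas C i) (watlas C j) p = (\<lambda>w. (fst w, transition_deriv (C i) (C j) (snd p) (snd w)))"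
proof -
  define Q where "Q = snd (C i) ` (fst (C i) \<inter> fst (C j))"
  note o = chart_overlap[OF i j, folded Q_def]
  define y where "y = snd (C i) (snd p)"
  have yQ: "y \<in> Q" using p by (auto simp: y_def Q_def)
  define TV where "TV = transition_deriv (C i) (C j) (snd p)"
  have TV: "(transition (C i) (C j) has_derivative TV) (at y)"
    using o(4)[OF yQ] by (simp add: TV_def transition_deriv_def y_def Q_def)
  have inj: "inj_on (snd (C i)) (fst (C i))"
    by (rule inj_on_inverseI[of _ "chart_inv (C i)"]) (rule homeomorphism_apply1[OF chart(3)[OF i]])
  have injW: "inj_on (snd (watlas C i)) (fst (watlas C i))"
    using inj by (auto simp: inj_on_def watlas_simps)
  have img: "snd (watlas C i) ` (fst (watlas C i) \<inter> fst (watlas C j)) = {0::real..} \<times> Q"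
    by (force simp: watlas_simps Q_def)
  have tr: "transition (watlas C i) (watlas C j) x = (fst x, transition (C i) (C j) (snd x))" if x: "x \<in> {0::real..} \<times> Q" for x
  proof -
    obtain r q where x': "x = (r, snd (C i) q)" "r \<ge> 0" "q \<in> fst (C i)" "q \<in> fst (C j)"
      using x by (cases x) (auto simp: Q_def)
    have "chart_inv (watlas C i) x = (r, q)" unfolding chart_inv_def
      by (rule inv_into_f_eq[OF injW]) (use x' in \<open>auto simp: watlas_simps\<close>)
    then show ?thesis using o(3)[OF x'(3)] by (simp add: transition_def watlas_simps x'(1))
  qed
  have pS: "snd (watlas C i) p = (fst p, y)" by (simp add: watlas_simps y_def)
  have pQ: "(fst p, y) \<in> {0::real..} \<times> Q" using p yQ by simp
  have "((\<lambda>x. (fst x, transition (C i) (C j) (snd x))) has_derivative (\<lambda>w. (fst w, TV (snd w)))) (at (fst p, y) within {0::real..} \<times> Q)"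
    using TV by (intro has_derivative_Pair has_derivative_fst has_derivative_ident has_derivative_compose[OF has_derivative_snd[OF has_derivative_ident], where g = "transition (C i) (C j)" and g' = TV]) simp
  then have hd: "(transition (watlas C i) (watlas C j) has_derivative (\<lambda>w. (fst w, TV (snd w)))) (at (fst p, y) within {0::real..} \<times> Q)"
    by (rule has_derivative_transform_within[OF _ zero_less_one pQ]) (simp add: tr)
  show ?thesis unfolding transition_deriv_def[of "watlas C i"] img pS TV_def[symmetric]
    by (rule halfspace_derivative_unique[OF o(1) pQ _ hd])
       (use hd in \<open>simp add: frechet_derivative_works[symmetric] differentiableI\<close>)
qed

lemma transition_facts:
  fixes p :: "real \<times> 'v"
  assumes i: "i \<in> I" and j: "j \<in> I" and p: "fst p \<ge> 0" "snd p \<in> fst (C i)" "snd p \<in> fst (C j)"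
  defines "T \<equiv> (\<lambda>w. (fst w, transition_deriv (C i) (C j) (snd p) (snd w)))"
  shows "linear T" "T dr = dr"
    "endo_field I (watlas C) A' \<Longrightarrow> A' j (snd (watlas C j) p) (T w) = T (A' i (snd (watlas C i) p) w)"
    "bilinear_field I (watlas C) b \<Longrightarrow> b j (snd (watlas C j) p) (T w) (T w') = b i (snd (watlas C i) p) w w'"
    "winf j (snd (snd (watlas C j) p)) (snd (T w)) (snd (T w')) = winf i (snd (snd (watlas C i) p)) (snd w) (snd w')"
    "(transition (C i) (C j) has_derivative transition_deriv (C i) (C j) (snd p)) (at (snd (C i) (snd p)))"
proof -
  have q: "snd (C i) (snd p) \<in> snd (C i) ` (fst (C i) \<inter> fst (C j))" using p by auto
  show hd: "(transition (C i) (C j) has_derivative transition_deriv (C i) (C j) (snd p)) (at (snd (C i) (snd p)))"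
    using chart_overlap(4)[OF i j q] by (simp add: transition_deriv_def)
  note l = has_derivative_linear[OF hd]
  show "linear T" unfolding T_def by (rule linearI) (simp_all add: linear_add[OF l] linear_cmul[OF l])
  show "T dr = dr" by (simp add: T_def dr_def linear_0[OF l])
  note Te = transition_watlas[OF i j p, folded T_def]
  have pW: "p \<in> fst (watlas C i) \<inter> fst (watlas C j)" using p by (simp add: watlas_simps mem_Times_iff)
  show "A' j (snd (watlas C j) p) (T w) = T (A' i (snd (watlas C i) p) w)" if "endo_field I (watlas C) A'"
  proof -
    have "A' j (snd (watlas C j) p) (transition_deriv (watlas C i) (watlas C j) p w) =
        transition_deriv (watlas C i) (watlas C j) p (A' i (snd (watlas C i) p) w)"
      by (rule spec[OF bspec[OF bspec[OF bspec[OF conjunct2[OF that[unfolded endo_field_def]] i] j] pW]])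
    then show ?thesis unfolding Te .
  qed
  show "b j (snd (watlas C j) p) (T w) (T w') = b i (snd (watlas C i) p) w w'" if "bilinear_field I (watlas C) b"
  proof -
    have "b j (snd (watlas C j) p) (transition_deriv (watlas C i) (watlas C j) p w) (transition_deriv (watlas C i) (watlas C j) p w') = b i (snd (watlas C i) p) w w'"
      by (rule spec[OF spec[OF bspec[OF bspec[OF bspec[OF conjunct2[OF that[unfolded bilinear_field_def]] i] j] pW]]])
    then show ?thesis unfolding Te .
  qed
  have bw: "bilinear_field I C winf" using closed_winf unfolding closed_two_form_def by (rule conjunct1)
  have pC: "snd p \<in> fst (C i) \<inter> fst (C j)" using p by simp
  have "winf j (snd (C j) (snd p)) (transition_deriv (C i) (C j) (snd p) a) (transition_deriv (C i) (C j) (snd p) b)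
      = winf i (snd (C i) (snd p)) a b" for a b
    by (rule spec[OF spec[OF bspec[OF bspec[OF bspec[OF conjunct2[OF bw[unfolded bilinear_field_def]] i] j] pC]]])
  then show "winf j (snd (snd (watlas C j) p)) (snd (T w)) (snd (T w')) = winf i (snd (snd (watlas C i) p)) (snd w) (snd w')"
    by (simp add: T_def watlas_simps)
qed

abbreviation "X v i z \<equiv> snd (watlas C i) (v z)"
abbreviation "Dm v i z \<equiv> map_deriv (watlas C i) v z"
abbreviation "Dom v i \<equiv> {z. v z \<in> fst (watlas C i)}"

lemma chart_at_facts: "fst p \<ge> 0 \<Longrightarrow> chart_at I C p \<in> I \<and> p \<in> fst (watlas C (chart_at I C p))"
proof -
  assume p: "fst p \<ge> 0"
  obtain i where "i \<in> I" "snd p \<in> fst (C i)" using chart_cover by blast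
  then have "i \<in> I \<and> p \<in> fst (watlas C i)" using p by (simp add: watlas_simps mem_Times_iff)
  then show ?thesis unfolding chart_at_def by (rule someI)
qed

section \<open>Scalar functions attached to a holomorphic map\<close>

context
  fixes v :: "complex \<Rightarrow> real \<times> 'v"
  assumes hol: "J_holomorphic I C J v"
begin

lemma fst_nonneg: "fst (v z) \<ge> 0" and v_continuous: "continuous_on UNIV v"
  by (rule spec[OF hol[unfolded J_holomorphic_def, THEN conjunct1]] hol[unfolded J_holomorphic_def, THEN conjunct2, THEN conjunct1])+

lemma dom_eq: "Dom v i = {z. snd (v z) \<in> fst (C i)}"
  using fst_nonneg by (auto simp: watlas_simps mem_Times_iff)

lemma open_dom: "i \<in> I \<Longrightarrow> open (Dom v i)"
proof -
  assume i: "i \<in> I"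
  have "open (UNIV \<inter> (\<lambda>z. snd (v z)) -` fst (C i))"
    by (rule continuous_open_preimage[OF _ open_UNIV chart(1)[OF i]]) (intro continuous_intros v_continuous)
  then show ?thesis by (simp add: dom_eq vimage_def)
qed

lemma X_in_S: "i \<in> I \<Longrightarrow> z \<in> Dom v i \<Longrightarrow> X v i z \<in> S i"
  by (auto simp: watlas_simps mem_Times_iff chart_range_def)

lemma X_Ck: "i \<in> I \<Longrightarrow> Ck_on k (Dom v i) (X v i)"
  by (rule smooth_on_open_imp_Ck_on[OF bspec[OF hol[unfolded J_holomorphic_def, THEN conjunct2, THEN conjunct2, THEN conjunct1]] open_dom])

lemma X_C1: "i \<in> I \<Longrightarrow> C1_on (Dom v i) (X v i) (\<lambda>z. Dm v i z 1) (\<lambda>z. Dm v i z \<i>)"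
  unfolding map_deriv_def by (rule Ck_on_imp_C1_on[OF X_Ck])

lemma X_derivative: "i \<in> I \<Longrightarrow> z \<in> Dom v i \<Longrightarrow> (X v i has_derivative Dm v i z) (at z)"
  using Ck_on_1D(1)[OF X_Ck] unfolding map_deriv_def by blast

lemma Dm_J: "i \<in> I \<Longrightarrow> z \<in> Dom v i \<Longrightarrow> Dm v i z \<i> = J i (X v i z) (Dm v i z 1)"
proof -
  assume "i \<in> I" "z \<in> Dom v i"
  then have "Dm v i z (\<i> * 1) = J i (X v i z) (Dm v i z 1)"
    using hol[unfolded J_holomorphic_def, THEN conjunct2, THEN conjunct2, THEN conjunct2] by blast
  then show ?thesis by simp
qed

lemma Dm_transition:
  assumes i: "i \<in> I" and j: "j \<in> I" and z: "z \<in> Dom v i" "z \<in> Dom v j"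
  shows "Dm v j z h = (fst (Dm v i z h), transition_deriv (C i) (C j) (snd (v z)) (snd (Dm v i z h)))"
proof -
  have p: "fst (v z) \<ge> 0" "snd (v z) \<in> fst (C i)" "snd (v z) \<in> fst (C j)" using z fst_nonneg by (auto simp: watlas_simps mem_Times_iff)
  note tf = transition_facts(6)[OF i j p]
  note d = X_derivative[OF i z(1)]
  have sX: "snd (C i) (snd (v z)) = snd (X v i z)" by (simp add: watlas_simps)
  have "((\<lambda>y. (fst (X v i y), transition (C i) (C j) (snd (X v i y)))) has_derivative
     (\<lambda>h. (fst (Dm v i z h), transition_deriv (C i) (C j) (snd (v z)) (snd (Dm v i z h))))) (at z)"
    by (intro has_derivative_Pair has_derivative_fst[OF d] has_derivative_compose[OF has_derivative_snd[OF d] tf[unfolded sX]])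
  then have "(X v j has_derivative (\<lambda>h. (fst (Dm v i z h), transition_deriv (C i) (C j) (snd (v z)) (snd (Dm v i z h))))) (at z)"
  proof (rule has_derivative_transform_within_open[OF _ open_Int[OF open_dom[OF i] open_dom[OF j]]])
    show "z \<in> Dom v i \<inter> Dom v j" using z by blast
    fix y assume "y \<in> Dom v i \<inter> Dom v j"
    then have "snd (v y) \<in> fst (C i)" by (auto simp: watlas_simps)
    then show "(fst (X v i y), transition (C i) (C j) (snd (X v i y))) = X v j y"
      using chart_overlap(3)[OF i j] by (simp add: watlas_simps)
  qed
  from fun_cong[OF frechet_derivative_eqI[OF this], of h] show ?thesis by (simp add: map_deriv_def)
qed

text \<open>The density \<open>F\<close>. Only \<partial>_s u is inserted, since \<partial>_t u = J
  \<partial>_s u. The chart is an arbitrary choice, which \<open>chart_independent\<close> makes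
  harmless.\<close>

definition "fden z = (let i = chart_at I C (v z) in dens i (X v i z) (Dm v i z 1))"
text \<open>The value of the pulled-back form \<open>lambda_inf\<close> on the direction h.\<close>

definition "lamp z h = (let i = chart_at I C (v z) in - fst (Jinf i (X v i z) (Dm v i z h)))"

lemma chart_independent:
  assumes i: "i \<in> I" and z: "z \<in> Dom v i"
  shows "fden z = dens i (X v i z) (Dm v i z 1)" "lamp z h = - fst (Jinf i (X v i z) (Dm v i z h))"
    "bilinear_field I (watlas C) b \<Longrightarrow>
      b (chart_at I C (v z)) (X v (chart_at I C (v z)) z) (Dm v (chart_at I C (v z)) z h) (Dm v (chart_at I C (v z)) z k) = b i (X v i z) (Dm v i z h) (Dm v i z k)"
    "fst (J (chart_at I C (v z)) (X v (chart_at I C (v z)) z) dr) = fst (J i (X v i z) dr)"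
proof -
  define j where "j = chart_at I C (v z)"
  have j: "j \<in> I" "z \<in> Dom v j" using chart_at_facts[OF fst_nonneg, of z] by (auto simp: j_def)
  have p: "fst (v z) \<ge> 0" "snd (v z) \<in> fst (C i)" "snd (v z) \<in> fst (C j)" using z j fst_nonneg by (auto simp: watlas_simps mem_Times_iff)
  define T where "T = (\<lambda>w::real \<times> 'e. (fst w, transition_deriv (C i) (C j) (snd (v z)) (snd w)))"
  note tf0 = transition_facts[OF i j(1) p]
  have tf: "linear T" "T dr = dr" "fst (T w) = fst w"
    "endo_field I (watlas C) A' \<Longrightarrow> A' j (X v j z) (T w) = T (A' i (X v i z) w)"
    "bilinear_field I (watlas C) b \<Longrightarrow> b j (X v j z) (T w) (T w') = b i (X v i z) w w'"
    "winf j (snd (X v j z)) (snd (T w)) (snd (T w')) = winf i (snd (X v i z)) (snd w) (snd w')" for A' b w w'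
    unfolding T_def by ((rule tf0(1) tf0(2) fst_conv tf0(5)) | (erule tf0(3) tf0(4)))+
  have DT: "Dm v j z h = T (Dm v i z h)" for h unfolding T_def by (rule Dm_transition[OF i j(1) z j(2)])
  have eJ: "endo_field I (watlas C) J" "endo_field I (watlas C) Jinf"
    by (rule conjunct1[OF acs[unfolded almost_complex_structure_def]] conjunct1[OF acs_Jinf[unfolded almost_complex_structure_def]])+
  show "fden z = dens i (X v i z) (Dm v i z 1)"
    unfolding fden_def Let_def j_def[symmetric] DT
    by (rule coercive_form_conj[where \<beta>' = "winf j (snd (X v j z))" and \<beta> = "winf i (snd (X v i z))", OF J_struct[OF i X_in_S[OF i z]] J_struct[OF j(1) X_in_S[OF j]] tf(1) tf(3,2) tf(4)[OF eJ(1)] tf(6)])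
  show "lamp z h = - fst (Jinf i (X v i z) (Dm v i z h))"
    unfolding lamp_def Let_def j_def[symmetric] DT tf(4)[OF eJ(2)] tf(3) ..
  show "b (chart_at I C (v z)) (X v (chart_at I C (v z)) z) (Dm v (chart_at I C (v z)) z h) (Dm v (chart_at I C (v z)) z k) = b i (X v i z) (Dm v i z h) (Dm v i z k)"
    if "bilinear_field I (watlas C) b"
    unfolding j_def[symmetric] DT by (rule tf(5)[OF that])
  show "fst (J (chart_at I C (v z)) (X v (chart_at I C (v z)) z) dr) = fst (J i (X v i z) dr)"
    unfolding j_def[symmetric] using tf(4)[OF eJ(1), of dr] tf(2) tf(3)[of "J i (X v i z) dr"] by simp
qed

definition "av z = fst (v z)"
definition "av1 z = frechet_derivative av (at z) 1"
definition "av2 z = frechet_derivative av (at z) \<i>"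

lemma av_C1_local: "i \<in> I \<Longrightarrow> C1_on (Dom v i) av (\<lambda>z. fst (Dm v i z 1)) (\<lambda>z. fst (Dm v i z \<i>))"
  using C1_on_linear[OF X_C1 bounded_linear_fst] by (simp add: watlas_simps av_def[abs_def])

lemma av_C1: "C1_on UNIV av av1 av2"
  unfolding av1_def[abs_def] av2_def[abs_def]
proof (rule C1_on_UNIV_local)
  fix z
  show "\<exists>U fs ft. open U \<and> z \<in> U \<and> C1_on U av fs ft"
    using chart_at_facts[OF fst_nonneg, of z] open_dom av_C1_local by blast
qed

lemma av12: "i \<in> I \<Longrightarrow> z \<in> Dom v i \<Longrightarrow> av1 z = fst (Dm v i z 1)"
  "i \<in> I \<Longrightarrow> z \<in> Dom v i \<Longrightarrow> av2 z = fst (Dm v i z \<i>)"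
  using C1_on_frechet[OF av_C1_local] by (simp_all add: av1_def av2_def)

lemma fden_split:
  assumes i: "i \<in> I" and z: "z \<in> Dom v i"
  shows "fden z = winf i (snd (X v i z)) (snd (proj_xi (J i (X v i z)) (Dm v i z 1))) (snd (J i (X v i z) (proj_xi (J i (X v i z)) (Dm v i z 1))))
     + (av1 z)\<^sup>2 + (av2 z)\<^sup>2"
  by (simp add: chart_independent(1)[OF i z] coercive_form_def av12[OF i z] Dm_J[OF i z])

lemma fden_continuous: "continuous_on UNIV fden"
proof -
  have "isCont fden z" for z
  proof -
    obtain i where i: "i \<in> I" "z \<in> Dom v i" using chart_at_facts[OF fst_nonneg, of z] by blast
    have "continuous_on (Dom v i) (\<lambda>z. coercive_form (J i (X v i z)) (winf i (snd (X v i z))) (Dm v i z 1))"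
    proof (rule continuous_on_coercive_form[of "S i" "J i" "\<lambda>x. winf i (snd x)"])
      show "continuous_on (S i) (\<lambda>x. J i x w)" for w by (rule smooth_on_continuous_on[OF smooth_J[OF i(1)]])
      show "continuous_on (S i) (\<lambda>x. winf i (snd x) a b)" for a b
        by (rule continuous_on_compose2[OF smooth_on_continuous_on[OF winf_facts(2)[OF i(1)]] continuous_on_snd[OF continuous_on_id]]) auto
      show "bilinear (winf i (snd x))" if "x \<in> S i" for x by (rule winf_facts(1)[OF i(1)]) (use that in auto)
    qed (use J_struct[OF i(1)] X_in_S[OF i(1)] C1_onD[OF X_C1[OF i(1)]] in auto)
    then have "continuous_on (Dom v i) fden" by (rule continuous_on_eq) (simp add: chart_independent(1)[OF i(1)])
    then show ?thesis using i(2) open_dom[OF i(1)] by (simp add: continuous_on_eq_continuous_at)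
  qed
  then show ?thesis by (simp add: continuous_at_imp_continuous_on)
qed

lemma lamp_C1_local:
  assumes i: "i \<in> I" and W: "C1_on (Dom v i) (\<lambda>z. Dm v i z h) Ws Wt"
  shows "C1_on (Dom v i) (\<lambda>z. lamp z h)
    (\<lambda>z. - (fst (frechet_derivative (\<lambda>y. Jinf i (0, y) (Dm v i z h)) (at (snd (X v i z))) (snd (Dm v i z 1))) + fst (Jinf i (X v i z) (Ws z))))
    (\<lambda>z. - (fst (frechet_derivative (\<lambda>y. Jinf i (0, y) (Dm v i z h)) (at (snd (X v i z))) (snd (Dm v i z \<i>))) + fst (Jinf i (X v i z) (Wt z))))"
proof -
  define F where "F y w = - fst (Jinf i (0, y) w)" for y w
  have lin: "linear (F y)" if "y \<in> R i" for y
  proof -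
    have "linear (Jinf i (0, y))" using Jinf_struct[OF i, of "(0, y)"] that by (simp add: cplx_struct_def)
    from linear_compose[OF this, of "\<lambda>w. - fst w"] show ?thesis
      by (simp add: F_def[abs_def] o_def linear_compose_neg linear_fst)
  qed
  have Fd: "((\<lambda>y. F y w) has_derivative (\<lambda>e. - fst (frechet_derivative (\<lambda>y. Jinf i (0, y) w) (at y) e))) (at y)" if "y \<in> R i" for y w
    unfolding F_def by (intro has_derivative_minus has_derivative_fst frechet_derivative_worksI differentiable_Jinf[OF i that])
  have Ff: "frechet_derivative (\<lambda>y. F y w) (at y) e = - fst (frechet_derivative (\<lambda>y. Jinf i (0, y) w) (at y) e)" if "y \<in> R i" for y w e
    using frechet_derivative_eqI[OF Fd[OF that]] by simp
  have Ck: "Ck_on (Suc 0) (R i) (\<lambda>y. F y w)" for w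
  proof -
    have "continuous_on (R i) (\<lambda>y. frechet_derivative (\<lambda>y. Jinf i (0, y) w) (at y) e)" for e
      using smooth_on_open_imp_Ck_on[OF smooth_slice[OF smooth_Jinf[OF i]] chart(2)[OF i], of "Suc 0"] by simp
    then have "continuous_on (R i) (\<lambda>y. - fst (frechet_derivative (\<lambda>y. Jinf i (0, y) w) (at y) e))" for e
      by (intro continuous_intros)
    then have "continuous_on (R i) (\<lambda>y. frechet_derivative (\<lambda>y. F y w) (at y) e)" for e
      by (rule continuous_on_eq) (simp add: Ff)
    moreover have "(\<lambda>y. F y w) differentiable at y" if "y \<in> R i" for y using Fd[OF that] by (rule differentiableI)
    ultimately show ?thesis by simp
  qed
  have sX: "snd (X v i z) \<in> R i" if "z \<in> Dom v i" for z using X_in_S[OF i that] by auto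
  have JX: "Jinf i (X v i z) = Jinf i (0, snd (X v i z))" if "z \<in> Dom v i" for z by (rule Jinf_invariant[OF i X_in_S[OF i that]])
  have "C1_on (Dom v i) (\<lambda>z. F (snd (X v i z)) (Dm v i z h))
    (\<lambda>z. frechet_derivative (\<lambda>y. F y (Dm v i z h)) (at (snd (X v i z))) (snd (Dm v i z 1)) + F (snd (X v i z)) (Ws z))
    (\<lambda>z. frechet_derivative (\<lambda>y. F y (Dm v i z h)) (at (snd (X v i z))) (snd (Dm v i z \<i>)) + F (snd (X v i z)) (Wt z))"
    by (rule C1_on_linear_field[OF chart(2)[OF i] lin Ck C1_on_linear[OF X_C1[OF i] bounded_linear_snd] sX W open_dom[OF i]])
  then have c: "C1_on (Dom v i) (\<lambda>z. F (snd (X v i z)) (Dm v i z h))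
    (\<lambda>z. - (fst (frechet_derivative (\<lambda>y. Jinf i (0, y) (Dm v i z h)) (at (snd (X v i z))) (snd (Dm v i z 1))) + fst (Jinf i (X v i z) (Ws z))))
    (\<lambda>z. - (fst (frechet_derivative (\<lambda>y. Jinf i (0, y) (Dm v i z h)) (at (snd (X v i z))) (snd (Dm v i z \<i>))) + fst (Jinf i (X v i z) (Wt z))))"
    by (rule C1_on_cong) (subst Ff[OF sX], assumption, subst JX, assumption, simp add: F_def)+
  have e: "F (snd (X v i z)) (Dm v i z h) = lamp z h" if "z \<in> Dom v i" for z
    unfolding chart_independent(2)[OF i that] F_def by (subst JX[OF that]) (rule refl)
  show ?thesis unfolding C1_on_def
    using C1_onD(1,2)[OF c] has_derivative_transform_within_open[OF C1_onD(4)[OF c] open_dom[OF i], of _ "\<lambda>z. lamp z h"] e by blast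
qed

lemma Dm_C1:
  assumes i: "i \<in> I"
  shows "C1_on (Dom v i) (\<lambda>z. Dm v i z h) (\<lambda>z. frechet_derivative (\<lambda>z. Dm v i z h) (at z) 1) (\<lambda>z. frechet_derivative (\<lambda>z. Dm v i z h) (at z) \<i>)"
proof (rule Ck_on_imp_C1_on)
  have "Ck_on (Suc (Suc 0)) (Dom v i) (X v i)" by (rule X_Ck[OF i])
  from spec[OF conjunct2[OF this[unfolded Ck_on.simps(2)[of "Suc 0"]]], of h]
  have "Ck_on (Suc 0) (Dom v i) (\<lambda>z. frechet_derivative (X v i) (at z) h)" .
  then show "Ck_on (Suc 0) (Dom v i) (\<lambda>z. Dm v i z h)" by (simp only: map_deriv_def)
qed

definition "lps h z = frechet_derivative (\<lambda>z. lamp z h) (at z) 1"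
definition "lpt h z = frechet_derivative (\<lambda>z. lamp z h) (at z) \<i>"

lemma lamp_C1: "C1_on UNIV (\<lambda>z. lamp z h) (lps h) (lpt h)"
  unfolding lps_def[abs_def] lpt_def[abs_def]
proof (rule C1_on_UNIV_local)
  fix z
  show "\<exists>U fs ft. open U \<and> z \<in> U \<and> C1_on U (\<lambda>z. lamp z h) fs ft"
    using chart_at_facts[OF fst_nonneg, of z] open_dom lamp_C1_local[OF _ Dm_C1] by blast
qed

text \<open>Second derivatives of u enter both terms and cancel by symmetry, which leaves the
  differential of \<open>lambda_inf\<close> evaluated on \<partial>_s u and \<partial>_t u.\<close>

lemma lamp_exterior:
  assumes i: "i \<in> I" and z: "z \<in> Dom v i"
  shows "lps \<i> z - lpt 1 z = dl i (X v i z) (Dm v i z 1) (Dm v i z \<i>)"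
proof -
  have mixed: "frechet_derivative (\<lambda>z. Dm v i z 1) (at z) \<i> = frechet_derivative (\<lambda>z. Dm v i z \<i>) (at z) 1"
  proof (rule euclidean_eqI)
    fix b :: "real \<times> 'e" assume "b \<in> Basis"
    show "frechet_derivative (\<lambda>z. Dm v i z 1) (at z) \<i> \<bullet> b = frechet_derivative (\<lambda>z. Dm v i z \<i>) (at z) 1 \<bullet> b"
      by (rule mixed_partials_commute[OF open_dom[OF i] C1_on_linear[OF X_C1[OF i] bounded_linear_inner_left]
          C1_on_linear[OF Dm_C1[OF i] bounded_linear_inner_left] C1_on_linear[OF Dm_C1[OF i] bounded_linear_inner_left] z])
  qed
  show ?thesis unfolding lps_def lpt_def C1_on_frechet[OF lamp_C1_local[OF i Dm_C1[OF i]] z] mixed dl_def by simp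
qed

end

end

section \<open>Energy densities\<close>

text \<open>The Jacobian s^2 of a dilation of the plane is also the factor by which quadratic
  densities of a rescaled map grow, so rescaling preserves energies.\<close>

lemma nn_integral_affine_cball:
  fixes f :: "complex \<Rightarrow> real" and s :: real
  assumes f: "continuous_on UNIV f" and s: "s > 0"
  shows "(\<integral>\<^sup>+z\<in>cball 0 r. ennreal (s\<^sup>2 * f (c + s *\<^sub>R z)) \<partial>lborel) = (\<integral>\<^sup>+z\<in>cball c (s * r). ennreal (f z) \<partial>lborel)"
proof -
  have [measurable]: "f \<in> borel_measurable borel" using f by (rule borel_measurable_continuous_onI)
  have [measurable]: "cball c (s * r) \<in> sets borel" by simp
  have D: "DIM(complex) = 2" by simp
  have "(\<integral>\<^sup>+z\<in>cball c (s * r). ennreal (f z) \<partial>lborel) =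
    (\<integral>\<^sup>+z. ennreal (f z) * indicator (cball c (s * r)) z \<partial>density (distr lborel borel (\<lambda>x. c + s *\<^sub>R x)) (\<lambda>_. ennreal (\<bar>s\<bar> ^ DIM(complex))))"
    using s by (subst lborel_affine[of s c]) auto
  also have "\<dots> = (\<integral>\<^sup>+z. ennreal (\<bar>s\<bar> ^ DIM(complex)) * (ennreal (f z) * indicator (cball c (s * r)) z) \<partial>distr lborel borel (\<lambda>x. c + s *\<^sub>R x))"
    by (rule nn_integral_density) (simp, measurable)
  also have "\<dots> = (\<integral>\<^sup>+z. ennreal (\<bar>s\<bar> ^ DIM(complex)) * (ennreal (f (c + s *\<^sub>R z)) * indicator (cball c (s * r)) (c + s *\<^sub>R z)) \<partial>lborel)"
    by (rule nn_integral_distr) measurable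
  also have "\<dots> = (\<integral>\<^sup>+z\<in>cball 0 r. ennreal (s\<^sup>2 * f (c + s *\<^sub>R z)) \<partial>lborel)"
  proof (rule nn_integral_cong)
    fix z :: complex
    have "norm (s *\<^sub>R z) \<le> s * r \<longleftrightarrow> norm z \<le> r" using s by simp
    then have i: "indicator (cball c (s * r)) (c + s *\<^sub>R z) = (indicator (cball 0 r) z :: ennreal)"
      by (simp add: indicator_def dist_norm)
    show "ennreal (\<bar>s\<bar> ^ DIM(complex)) * (ennreal (f (c + s *\<^sub>R z)) * indicator (cball c (s * r)) (c + s *\<^sub>R z))
       = ennreal (s\<^sup>2 * f (c + s *\<^sub>R z)) * indicator (cball 0 r) z"
      unfolding i D using s by (simp add: ennreal_mult' mult.assoc)
  qed
  finally show ?thesis ..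
qed

lemma energy_cutoff_continuous: "\<phi> \<in> energy_cutoffs \<Longrightarrow> continuous_on UNIV \<phi>"
  and energy_cutoff_range: "\<phi> \<in> energy_cutoffs \<Longrightarrow> 0 \<le> \<phi> x \<and> \<phi> x \<le> 1"
  unfolding energy_cutoffs_def using smooth_on_continuous_on by auto

lemma ext_integral_nonneg: "(\<And>z. f z \<ge> 0) \<Longrightarrow> ext_integral f = enn2ereal (\<integral>\<^sup>+z. ennreal (f z) \<partial>lborel)"
  by (simp add: ext_integral_def ennreal_neg zero_ennreal.rep_eq)

locale cyl_good = cyl_metric d B I C g J Jinf winf gW
  for d :: nat and B :: "'e::euclidean_space list" and I :: "'i set" and C :: "'i \<Rightarrow> ('v::t2_space, 'e) chart"
    and g :: "'i \<Rightarrow> real \<times> 'e \<Rightarrow> real \<times> 'e \<Rightarrow> real \<times> 'e \<Rightarrow> real"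
    and J Jinf :: "'i \<Rightarrow> real \<times> 'e \<Rightarrow> real \<times> 'e \<Rightarrow> real \<times> 'e"
    and winf :: "'i \<Rightarrow> 'e \<Rightarrow> 'e \<Rightarrow> 'e \<Rightarrow> real"
    and gW :: "'i \<Rightarrow> real \<times> 'e \<Rightarrow> real \<times> 'e \<Rightarrow> real \<times> 'e \<Rightarrow> real" +
  fixes \<Lambda> \<delta> \<rho> :: real
  assumes \<Lambda>1: "\<Lambda> \<ge> 1" and \<delta>0: "\<delta> > 0" and \<rho>0: "\<rho> > 0" and goodp: "\<And>p. good \<Lambda> \<delta> \<rho> p"
begin

lemma good_chart:
  assumes hol: "J_holomorphic I C J v"
  obtains i where "i \<in> I" "z \<in> Dom v i" "X v i z \<in> {0::real..} \<times> cball (snd (X v i z)) \<rho>"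
    "cball (snd (X v i z)) \<rho> \<subseteq> R i" "chart_const \<Lambda> \<delta> i (cball (snd (X v i z)) \<rho>)"
proof -
  obtain i where i: "i \<in> I" "snd (v z) \<in> fst (C i)" "cball (snd (C i) (snd (v z))) \<rho> \<subseteq> R i"
    "chart_const \<Lambda> \<delta> i (cball (snd (C i) (snd (v z))) \<rho>)"
    using goodp[of "snd (v z)"] unfolding good_def by blast
  have e: "snd (X v i z) = snd (C i) (snd (v z))" by (simp add: watlas_simps)
  show ?thesis
    by (rule that[OF i(1)]) (use i fst_nonneg[OF hol, of z] \<rho>0 in \<open>auto simp: watlas_simps mem_Times_iff\<close>)
qed

text \<open>The density of the \<omega>-energy. As a difference its continuity follows from that of
  \<open>F\<close>; in any chart it equals \<open>eform\<close>.\<close>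

definition "ev v z = fden v z - (av1 v z)\<^sup>2 - (av2 v z)\<^sup>2"

context
  fixes v :: "complex \<Rightarrow> real \<times> 'v"
  assumes hol: "J_holomorphic I C J v"
begin

lemma ev_chart:
  assumes "i \<in> I" "z \<in> Dom v i"
  shows "ev v z = eform i (X v i z) (Dm v i z 1)"
  using fden_split[OF hol assms] by (simp add: ev_def)

lemma ev_nonneg: "ev v z \<ge> 0"
proof -
  obtain i where i: "i \<in> I" "z \<in> Dom v i" using chart_at_facts[OF fst_nonneg[OF hol], of z] by blast
  show ?thesis unfolding ev_chart[OF i] by (rule eform_nonneg[OF i(1) X_in_S[OF hol i]])
qed

lemma ev_continuous: "continuous_on UNIV (ev v)"
  unfolding ev_def[abs_def] by (intro continuous_intros fden_continuous[OF hol] C1_onD[OF av_C1[OF hol]])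

lemma fden_nonneg: "fden v z \<ge> 0" and grad_le_fden: "(av1 v z)\<^sup>2 + (av2 v z)\<^sup>2 \<le> fden v z" and ev_le_fden: "ev v z \<le> fden v z"
  and fden_ev: "fden v z = ev v z + ((av1 v z)\<^sup>2 + (av2 v z)\<^sup>2)"
  using ev_nonneg[of z] zero_le_power2[of "av1 v z"] zero_le_power2[of "av2 v z"] unfolding ev_def by linarith+

lemma Dm_bound:
  assumes "i \<in> I" "z \<in> Dom v i" "chart_const \<Lambda> \<delta> i K" "X v i z \<in> {0::real..} \<times> K"
  shows "(norm (Dm v i z 1))\<^sup>2 \<le> \<Lambda> * fden v z"
  using chart_constD(3)[OF assms(3,4)] chart_independent(1)[OF hol assms(1,2)] by simp

text \<open>With J in place of Jinf the left sides of the first two would be 0, so only the decay of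
  J - Jinf enters there. The third is the bound on the differential of \<open>lambda_inf\<close>.
  The last compares the \<lambda>-density with |\<nabla>a|^2 through |\<rho>| \<le>
  \<Lambda>.\<close>

lemma pointwise_estimates:
  "\<bar>av1 v z - lamp v z \<i>\<bar> \<le> \<Lambda>\<^sup>2 * exp (- \<delta> * av v z) * sqrt (\<Lambda> * fden v z)"
  "\<bar>av2 v z + lamp v z 1\<bar> \<le> \<Lambda>\<^sup>2 * exp (- \<delta> * av v z) * sqrt (\<Lambda> * fden v z)"
  "\<bar>lps v \<i> z - lpt v 1 z\<bar> \<le> \<Lambda> * (ev v z + exp (- \<delta> * av v z) * (\<Lambda> * fden v z))"
  "gradient_norm I C gW v z \<le> sqrt (\<Lambda> * ((1 + \<Lambda>)\<^sup>2 * (\<Lambda> * fden v z)))"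
  "\<phi> \<in> energy_cutoffs \<Longrightarrow>
    pullback_density I C (\<lambda>i x a b. \<phi> (fst x) * (sigma_form (J i x) a * lambda_form (J i x) b - sigma_form (J i x) b * lambda_form (J i x) a)) v z
      \<ge> \<phi> (av v z) * ((av1 v z)\<^sup>2 + (av2 v z)\<^sup>2) / (1 + \<Lambda>\<^sup>2)"
proof -
  obtain i where i: "i \<in> I" "z \<in> Dom v i" and x: "X v i z \<in> {0::real..} \<times> cball (snd (X v i z)) \<rho>"
    and c: "chart_const \<Lambda> \<delta> i (cball (snd (X v i z)) \<rho>)" by (rule good_chart[OF hol, of z]) (rule that)
  define x0 where "x0 = X v i z" define w where "w = Dm v i z 1"
  note cc = chart_constD[OF c x, folded x0_def]
  have J: "Dm v i z \<i> = J i x0 w" using Dm_J[OF hol i] by (simp add: x0_def w_def)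
  have xS: "x0 \<in> S i" unfolding x0_def by (rule X_in_S[OF hol i])
  interpret j: cplx_struct "J i x0" by (rule J_struct[OF i(1) xS])
  have fx: "fst x0 = av v z" by (simp add: x0_def watlas_simps av_def[OF hol])
  have nw: "norm w \<le> sqrt (\<Lambda> * fden v z)"
    using Dm_bound[OF i c x] by (simp add: w_def real_le_rsqrt)
  have L2: "\<Lambda> \<le> \<Lambda>\<^sup>2" using \<Lambda>1 by (simp add: power2_eq_square mult_le_cancel_left1)
  have nJ: "norm (J i x0 w) \<le> \<Lambda> * norm w" by (rule cc(1))
  note a12 = av12[OF hol i, folded w_def]
  note lm = chart_independent(2)[OF hol i, folded x0_def w_def]
  have "av1 v z - lamp v z \<i> = - fst (J i x0 (J i x0 w) - Jinf i x0 (J i x0 w))"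
    unfolding a12(1) lm J by (simp add: j.sq)
  then have "\<bar>av1 v z - lamp v z \<i>\<bar> = \<bar>fst (J i x0 (J i x0 w) - Jinf i x0 (J i x0 w))\<bar>" by (simp only: abs_minus_cancel)
  also have "\<dots> \<le> norm (J i x0 (J i x0 w) - Jinf i x0 (J i x0 w))"
    using norm_fst_le'[of "J i x0 (J i x0 w) - Jinf i x0 (J i x0 w)"] by simp
  also have "\<dots> \<le> \<Lambda> * exp (- \<delta> * fst x0) * norm (J i x0 w)" by (rule cc(5))
  also have "\<dots> \<le> \<Lambda> * exp (- \<delta> * fst x0) * (\<Lambda> * sqrt (\<Lambda> * fden v z))"
    using \<Lambda>1 nw by (intro mult_left_mono order_trans[OF nJ]) auto
  finally show "\<bar>av1 v z - lamp v z \<i>\<bar> \<le> \<Lambda>\<^sup>2 * exp (- \<delta> * av v z) * sqrt (\<Lambda> * fden v z)"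
    by (simp add: fx power2_eq_square mult_ac)
  have "\<bar>av2 v z + lamp v z 1\<bar> = \<bar>fst (J i x0 w - Jinf i x0 w)\<bar>"
    unfolding a12(2) J lm by (simp add: w_def)
  also have "\<dots> \<le> norm (J i x0 w - Jinf i x0 w)" using norm_fst_le'[of "J i x0 w - Jinf i x0 w"] by simp
  also have "\<dots> \<le> \<Lambda> * exp (- \<delta> * fst x0) * norm w" by (rule cc(5))
  also have "\<dots> \<le> \<Lambda>\<^sup>2 * exp (- \<delta> * fst x0) * sqrt (\<Lambda> * fden v z)"
    using L2 nw \<Lambda>1 by (intro mult_mono) auto
  finally show "\<bar>av2 v z + lamp v z 1\<bar> \<le> \<Lambda>\<^sup>2 * exp (- \<delta> * av v z) * sqrt (\<Lambda> * fden v z)" by (simp add: fx)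
  have nw2: "(norm w)\<^sup>2 \<le> \<Lambda> * fden v z" using Dm_bound[OF i c x] by (simp add: w_def)
  have "\<bar>lps v \<i> z - lpt v 1 z\<bar> = \<bar>dl i x0 w (J i x0 w)\<bar>"
    unfolding lamp_exterior[OF hol i] J by (simp add: x0_def w_def)
  also have "\<dots> \<le> \<Lambda> * (eform i x0 w + exp (- \<delta> * fst x0) * (norm w)\<^sup>2)" by (rule cc(6))
  also have "\<dots> \<le> \<Lambda> * (ev v z + exp (- \<delta> * av v z) * (\<Lambda> * fden v z))"
    unfolding ev_chart[OF i] fx x0_def[symmetric] w_def[symmetric] using \<Lambda>1 nw2 by (intro mult_left_mono add_left_mono) auto
  finally show "\<bar>lps v \<i> z - lpt v 1 z\<bar> \<le> \<Lambda> * (ev v z + exp (- \<delta> * av v z) * (\<Lambda> * fden v z))" .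
  have bW: "bilinear_field I (watlas C) gW" using metW unfolding riemannian_metric_def by (rule conjunct1)
  show "gradient_norm I C gW v z \<le> sqrt (\<Lambda> * ((1 + \<Lambda>)\<^sup>2 * (\<Lambda> * fden v z)))"
    unfolding gradient_norm_def Let_def chart_independent(3)[OF hol i bW] x0_def[symmetric]
  proof (rule cSUP_least)
    show "{h::complex. norm h \<le> 1} \<noteq> {}" by (auto intro: exI[of _ 0])
    fix h :: complex assume h: "h \<in> {h. norm h \<le> 1}"
    have hb: "\<bar>Re h\<bar> \<le> 1" "\<bar>Im h\<bar> \<le> 1" using h abs_Re_le_cmod[of h] abs_Im_le_cmod[of h] by auto
    have "Dm v i z h = Re h *\<^sub>R w + Im h *\<^sub>R J i x0 w"
      using complex_linear_Re_Im[OF has_derivative_linear[OF X_derivative[OF hol i]], of h] unfolding J w_def[symmetric] .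
    then have "norm (Dm v i z h) \<le> \<bar>Re h\<bar> * norm w + \<bar>Im h\<bar> * norm (J i x0 w)"
      using norm_triangle_ineq[of "Re h *\<^sub>R w" "Im h *\<^sub>R J i x0 w"] by simp
    also have "\<dots> \<le> 1 * norm w + 1 * (\<Lambda> * norm w)" using hb nJ by (intro add_mono mult_mono) auto
    finally have "norm (Dm v i z h) \<le> (1 + \<Lambda>) * norm w" by (simp add: algebra_simps)
    then have "(norm (Dm v i z h))\<^sup>2 \<le> (1 + \<Lambda>)\<^sup>2 * (norm w)\<^sup>2" by (metis norm_ge_zero power_mono power_mult_distrib)
    also have "\<dots> \<le> (1 + \<Lambda>)\<^sup>2 * (\<Lambda> * fden v z)" using nw2 by (rule mult_left_mono) simp
    finally have "\<Lambda> * (norm (Dm v i z h))\<^sup>2 \<le> \<Lambda> * ((1 + \<Lambda>)\<^sup>2 * (\<Lambda> * fden v z))" using \<Lambda>1 by (intro mult_left_mono) auto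
    with cc(7)[of "Dm v i z h"] show "sqrt (gW i x0 (Dm v i z h) (Dm v i z h)) \<le> sqrt (\<Lambda> * ((1 + \<Lambda>)\<^sup>2 * (\<Lambda> * fden v z)))"
      by (intro real_sqrt_le_mono) linarith
  qed
  assume \<phi>: "\<phi> \<in> energy_cutoffs"
  define k where "k = chart_at I C (v z)"
  have k: "k \<in> I" "z \<in> Dom v k" using chart_at_facts[OF fst_nonneg[OF hol], of z] by (auto simp: k_def)
  interpret k: cplx_struct "J k (X v k z)" by (rule J_struct[OF k(1) X_in_S[OF hol k]])
  have "k.\<rho> = fst (J i x0 dr)" unfolding k.\<rho>_def using chart_independent(4)[OF hol i] by (simp add: k_def x0_def)
  moreover have "\<bar>fst (J i x0 dr)\<bar> \<le> \<Lambda>" using norm_fst_le'[of "J i x0 dr"] cc(1)[of dr] by simp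
  ultimately have "\<bar>k.\<rho>\<bar> \<le> \<bar>\<Lambda>\<bar>" by simp
  then have kr: "k.\<rho>\<^sup>2 \<le> \<Lambda>\<^sup>2" by (rule abs_le_square_iff[THEN iffD1])
  have "pullback_density I C (\<lambda>i x a b. \<phi> (fst x) * (sigma_form (J i x) a * lambda_form (J i x) b - sigma_form (J i x) b * lambda_form (J i x) a)) v z
     = \<phi> (av v z) * (((av1 v z)\<^sup>2 + (av2 v z)\<^sup>2) / (1 + k.\<rho>\<^sup>2))"
    unfolding pullback_density_def Let_def k_def[symmetric] Dm_J[OF hol k] k.sigma_wedge_lambda av12[OF hol k]
    by (simp add: watlas_simps av_def[OF hol])
  moreover have "\<phi> (av v z) * ((av1 v z)\<^sup>2 + (av2 v z)\<^sup>2) / (1 + \<Lambda>\<^sup>2) \<le> \<phi> (av v z) * ((av1 v z)\<^sup>2 + (av2 v z)\<^sup>2) / (1 + k.\<rho>\<^sup>2)"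
    using kr energy_cutoff_range[OF \<phi>] k.denom by (intro divide_left_mono mult_pos_pos mult_nonneg_nonneg add_pos_nonneg) auto
  ultimately show "pullback_density I C (\<lambda>i x a b. \<phi> (fst x) * (sigma_form (J i x) a * lambda_form (J i x) b - sigma_form (J i x) b * lambda_form (J i x) a)) v z
      \<ge> \<phi> (av v z) * ((av1 v z)\<^sup>2 + (av2 v z)\<^sup>2) / (1 + \<Lambda>\<^sup>2)" by simp
qed

lemma pullback_omega: "pullback_density I C (omega_form J winf) v z = ev v z"
proof -
  define k where "k = chart_at I C (v z)"
  have k: "k \<in> I" "z \<in> Dom v k" using chart_at_facts[OF fst_nonneg[OF hol], of z] by (auto simp: k_def)
  interpret k: cplx_struct "J k (X v k z)" by (rule J_struct[OF k(1) X_in_S[OF hol k]])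
  have sx: "snd (X v k z) \<in> R k" using X_in_S[OF hol k] by auto
  show ?thesis
    unfolding pullback_density_def Let_def k_def[symmetric] Dm_J[OF hol k] ev_chart[OF k]
    by (rule k.omega_form_J[where winf = winf and J = J and i = k and x = "X v k z", OF winf_facts(1)[OF k(1) sx] winf_facts(3)[OF k(1) sx] refl])
qed

text \<open>Both energies come from nonnegative densities, so finiteness of the sum bounds each of
  them.\<close>

lemma energy_bounds:
  assumes fin: "energy I C J winf v < \<infinity>"
  obtains E where "E \<ge> 0" "(\<integral>\<^sup>+z. ennreal (ev v z) \<partial>lborel) \<le> ennreal E"
    "\<And>\<phi>. \<phi> \<in> energy_cutoffs \<Longrightarrow> (\<integral>\<^sup>+z. ennreal (\<phi> (av v z) * ((av1 v z)\<^sup>2 + (av2 v z)\<^sup>2)) \<partial>lborel) \<le> ennreal E"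
proof -
  define f where "f \<phi> = pullback_density I C (\<lambda>i x a b. \<phi> (fst x) * (sigma_form (J i x) a * lambda_form (J i x) b - sigma_form (J i x) b * lambda_form (J i x) a)) v" for \<phi> :: "real \<Rightarrow> real"
  define h where "h \<phi> z = \<phi> (av v z) * ((av1 v z)\<^sup>2 + (av2 v z)\<^sup>2)" for \<phi> :: "real \<Rightarrow> real" and z
  have h0: "h \<phi> z \<ge> 0" if "\<phi> \<in> energy_cutoffs" for \<phi> z unfolding h_def using energy_cutoff_range[OF that] by simp
  have fh: "f \<phi> z \<ge> h \<phi> z / (1 + \<Lambda>\<^sup>2)" if "\<phi> \<in> energy_cutoffs" for \<phi> z
    using pointwise_estimates(5)[OF that, of z] by (simp add: f_def h_def)
  have L: "1 + \<Lambda>\<^sup>2 > 0" by (simp add: add_pos_nonneg)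
  have f0: "f \<phi> z \<ge> 0" if "\<phi> \<in> energy_cutoffs" for \<phi> z
    by (rule order_trans[OF _ fh[OF that]]) (use h0[OF that] L in simp)
  define e where "e = (\<integral>\<^sup>+z. ennreal (ev v z) \<partial>lborel)"
  define l where "l = (SUP \<phi>\<in>energy_cutoffs. enn2ereal (\<integral>\<^sup>+z. ennreal (f \<phi> z) \<partial>lborel))"
  have eo: "energy_omega I C J winf v = enn2ereal e"
  proof -
    have "pullback_density I C (omega_form J winf) v = ev v" by (rule ext) (rule pullback_omega)
    then show ?thesis unfolding energy_omega_def e_def by (simp only: ext_integral_nonneg[OF ev_nonneg])
  qed
  have el: "energy_lambda I C J v = l"
    unfolding energy_lambda_def l_def f_def[symmetric] by (rule SUP_cong[OF refl]) (rule ext_integral_nonneg[OF f0])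
  have up: "enn2ereal (\<integral>\<^sup>+z. ennreal (f \<phi> z) \<partial>lborel) \<le> l" if "\<phi> \<in> energy_cutoffs" for \<phi>
    unfolding l_def by (rule SUP_upper[OF that])
  obtain c where c: "c > 0" "\<And>a N. N \<ge> c \<Longrightarrow> \<exists>\<phi> \<Phi>. \<phi> \<in> energy_cutoffs \<and> continuous_on UNIV \<phi> \<and>
       (\<forall>x. (\<Phi> has_real_derivative \<phi> x) (at x)) \<and> (\<forall>x. 0 \<le> \<phi> x \<and> \<phi> x \<le> c / N) \<and>
       (\<forall>x\<in>{a<..<a + N}. \<phi> x > 0) \<and> (\<forall>x\<le>a. \<Phi> x = - 1 / 2) \<and> (\<forall>x\<ge>a + N. \<Phi> x = 1 / 2) \<and>
       (\<forall>x. \<bar>\<Phi> x\<bar> \<le> 1 / 2)" using energy_cutoff_exists by blast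
  \<comment> \<open>Existence of a cutoff makes the supremum nonnegative; only then does finiteness
    of the sum bound each summand.\<close>
  then obtain \<phi>0 where \<phi>0: "\<phi>0 \<in> energy_cutoffs" using c(2)[OF order_refl] by blast
  have l0: "l \<ge> 0" using order_trans[OF enn2ereal_nonneg up[OF \<phi>0]] .
  have "enn2ereal e + l < \<infinity>" using fin unfolding energy_def eo el .
  then have "enn2ereal e < \<infinity>" "l < \<infinity>" using l0 enn2ereal_nonneg[of e] by (auto simp: less_top[symmetric])
  then obtain lr where lr: "l = ereal lr" "lr \<ge> 0" using l0 by (cases l) auto
  have "e < \<infinity>" using \<open>enn2ereal e < \<infinity>\<close> by (metis enn2ereal_eq_top_iff less_ennreal.rep_eq infinity_ennreal_def top_ennreal.rep_eq top_ereal_def)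
  then obtain er where er: "e = ennreal er" "er \<ge> 0" by (cases e) auto
  define E where "E = er + (1 + \<Lambda>\<^sup>2) * lr"
  have E0: "E \<ge> 0" "er \<le> E" "(1 + \<Lambda>\<^sup>2) * lr \<le> E" using er lr L by (auto simp: E_def)
  show ?thesis
  proof (rule that[OF E0(1)])
    show "(\<integral>\<^sup>+z. ennreal (ev v z) \<partial>lborel) \<le> ennreal E"
      unfolding e_def[symmetric] er(1) by (rule ennreal_leI[OF E0(2)])
    fix \<phi> assume \<phi>: "\<phi> \<in> energy_cutoffs"
    have hc: "continuous_on UNIV (h \<phi>)" unfolding h_def[abs_def]
      by (intro continuous_intros continuous_on_compose2[OF energy_cutoff_continuous[OF \<phi>]] C1_onD[OF av_C1[OF hol]]) auto
    \<comment> \<open>Measurability is established for \<open>h \<phi>\<close> only, so the constant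
      is pulled out of its integral; the density \<open>f \<phi>\<close> enters by
      monotonicity.\<close>
    then have hm[measurable]: "h \<phi> \<in> borel_measurable borel" by (rule borel_measurable_continuous_onI)
    have "(\<integral>\<^sup>+z. ennreal (f \<phi> z) \<partial>lborel) \<le> ennreal lr"
      using up[OF \<phi>] lr by (simp add: less_eq_ennreal.rep_eq)
    have "(\<integral>\<^sup>+z. ennreal (h \<phi> z) \<partial>lborel) = (\<integral>\<^sup>+z. ennreal (1 + \<Lambda>\<^sup>2) * ennreal (h \<phi> z / (1 + \<Lambda>\<^sup>2)) \<partial>lborel)"
    proof (rule nn_integral_cong)
      fix z
      show "ennreal (h \<phi> z) = ennreal (1 + \<Lambda>\<^sup>2) * ennreal (h \<phi> z / (1 + \<Lambda>\<^sup>2))"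
        by (subst ennreal_mult'[symmetric]) (use L in auto)
    qed
    also have "\<dots> = ennreal (1 + \<Lambda>\<^sup>2) * (\<integral>\<^sup>+z. ennreal (h \<phi> z / (1 + \<Lambda>\<^sup>2)) \<partial>lborel)"
      by (rule nn_integral_cmult) measurable
    also have "\<dots> \<le> ennreal (1 + \<Lambda>\<^sup>2) * (\<integral>\<^sup>+z. ennreal (f \<phi> z) \<partial>lborel)"
      by (intro mult_left_mono nn_integral_mono ennreal_leI fh[OF \<phi>]) auto
    also have "\<dots> \<le> ennreal (1 + \<Lambda>\<^sup>2) * ennreal lr" by (rule mult_left_mono) (fact, simp)
    also have "\<dots> = ennreal ((1 + \<Lambda>\<^sup>2) * lr)" using L lr by (simp add: ennreal_mult')
    also have "\<dots> \<le> ennreal E" by (rule ennreal_leI[OF E0(3)])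
    finally show "(\<integral>\<^sup>+z. ennreal (\<phi> (av v z) * ((av1 v z)\<^sup>2 + (av2 v z)\<^sup>2)) \<partial>lborel) \<le> ennreal E" by (simp add: h_def)
  qed
qed

end

text \<open>Chain rule with a real factor s: derivatives scale by s, quadratic densities by s^2, and
  holomorphy survives because J is linear.\<close>

lemma rescale:
  fixes c :: complex and s :: real
  assumes hol: "J_holomorphic I C J u" and s: "s > 0"
  defines "v \<equiv> \<lambda>z. u (c + s *\<^sub>R z)"
  shows "J_holomorphic I C J v" "fden v z = s\<^sup>2 * fden u (c + s *\<^sub>R z)" "av v z = av u (c + s *\<^sub>R z)"
    "av1 v z = s * av1 u (c + s *\<^sub>R z)" "av2 v z = s * av2 u (c + s *\<^sub>R z)" "ev v z = s\<^sup>2 * ev u (c + s *\<^sub>R z)"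
proof -
  have D: "Dm v i z h = s *\<^sub>R Dm u i (c + s *\<^sub>R z) h" if "i \<in> I" "c + s *\<^sub>R z \<in> Dom u i" for i z h
  proof -
    have "((\<lambda>z. X u i (c + s *\<^sub>R z)) has_derivative (\<lambda>h. Dm u i (c + s *\<^sub>R z) (s *\<^sub>R h))) (at z)"
      by (rule has_derivative_compose[of "\<lambda>z. c + s *\<^sub>R z" "\<lambda>h. s *\<^sub>R h" z UNIV, OF _ X_derivative[OF hol that]])
         (auto intro!: derivative_eq_intros)
    from fun_cong[OF frechet_derivative_eqI[OF this], of h] show ?thesis
      using linear_cmul[OF has_derivative_linear[OF X_derivative[OF hol that]], of s h] by (simp add: map_deriv_def v_def)
  qed
  have bl: "bounded_linear (\<lambda>z::complex. s *\<^sub>R z)" by (rule bounded_linear_scaleR_right)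
  have cont: "continuous_on UNIV v" unfolding v_def
    by (rule continuous_on_compose2[OF v_continuous[OF hol]]) (auto intro!: continuous_intros)
  have sm: "smooth_on (Dom v i) (X v i)" if "i \<in> I" for i
    unfolding v_def
    by (rule smooth_on_compose_affine[OF bspec[OF hol[unfolded J_holomorphic_def, THEN conjunct2, THEN conjunct2, THEN conjunct1] that] bl]) simp
  have Jeq: "Dm v i z (\<i> * h) = J i (X v i z) (Dm v i z h)" if "i \<in> I" "v z \<in> fst (watlas C i)" for i z h
  proof -
    have z: "c + s *\<^sub>R z \<in> Dom u i" using that(2) by (simp add: v_def)
    have l: "linear (J i (X u i (c + s *\<^sub>R z)))" using J_struct[OF that(1) X_in_S[OF hol that(1) z]] by (simp add: cplx_struct_def)
    have "Dm u i (c + s *\<^sub>R z) (\<i> * h) = J i (X u i (c + s *\<^sub>R z)) (Dm u i (c + s *\<^sub>R z) h)"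
      using hol[unfolded J_holomorphic_def, THEN conjunct2, THEN conjunct2, THEN conjunct2] that(1) z by blast
    then show ?thesis unfolding D[OF that(1) z] by (simp add: v_def linear_cmul[OF l])
  qed
  show holv: "J_holomorphic I C J v" unfolding J_holomorphic_def
    using cont sm Jeq fst_nonneg[OF hol] by (simp add: v_def)
  obtain i where i: "i \<in> I" "z \<in> Dom v i" using chart_at_facts[OF fst_nonneg[OF holv], of z] by blast
  have iu: "c + s *\<^sub>R z \<in> Dom u i" using i(2) by (simp add: v_def)
  have Xe: "X v i z = X u i (c + s *\<^sub>R z)" by (simp add: v_def)
  interpret j: cplx_struct "J i (X u i (c + s *\<^sub>R z))" by (rule J_struct[OF i(1) X_in_S[OF hol i(1) iu]])
  have bw: "bilinear (winf i (snd (X u i (c + s *\<^sub>R z))))" by (rule winf_facts(1)[OF i(1)]) (use X_in_S[OF hol i(1) iu] in auto)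
  show f: "fden v z = s\<^sup>2 * fden u (c + s *\<^sub>R z)"
    unfolding chart_independent(1)[OF holv i] chart_independent(1)[OF hol i(1) iu] D[OF i(1) iu] Xe
    by (rule j.coercive_scale[OF bw])
  show "av v z = av u (c + s *\<^sub>R z)" unfolding av_def[OF hol] av_def[OF holv] by (simp add: v_def)
  show a: "av1 v z = s * av1 u (c + s *\<^sub>R z)" "av2 v z = s * av2 u (c + s *\<^sub>R z)"
    by (simp_all add: av12[OF holv i] av12[OF hol i(1) iu] D[OF i(1) iu])
  show "ev v z = s\<^sup>2 * ev u (c + s *\<^sub>R z)" by (simp add: ev_def f a power_mult_distrib algebra_simps)
qed

end

section \<open>Regularity and point picking\<close>

text \<open>A finite integral is nearly exhausted by a large ball, and \<open>D\<close> only gets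
  what that ball leaves over.\<close>

lemma nn_integral_tail:
  fixes f :: "complex \<Rightarrow> real"
  assumes f: "continuous_on UNIV f" and E: "(\<integral>\<^sup>+z. ennreal (f z) \<partial>lborel) \<le> ennreal E" and \<eta>: "\<eta> > 0"
  obtains b where "b \<ge> 0" "\<And>D. D \<in> sets borel \<Longrightarrow> D \<inter> cball 0 b = {} \<Longrightarrow> (\<integral>\<^sup>+z\<in>D. ennreal (f z) \<partial>lborel) \<le> ennreal \<eta>"
proof -
  have [measurable]: "f \<in> borel_measurable borel" using f by (rule borel_measurable_continuous_onI)
  define A where "A n = (\<integral>\<^sup>+z\<in>cball 0 (real n). ennreal (f z) \<partial>lborel)" for n
  define T where "T = (\<integral>\<^sup>+z. ennreal (f z) \<partial>lborel)"
  have [measurable]: "cball (0::complex) r \<in> sets borel" for r by simp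
  have "(SUP n. A n) = (\<integral>\<^sup>+z. (SUP n. ennreal (f z) * indicator (cball 0 (real n)) z) \<partial>lborel)"
    unfolding A_def
  proof (rule nn_integral_monotone_convergence_SUP[symmetric])
    show "incseq (\<lambda>n z. ennreal (f z) * indicator (cball 0 (real n)) z)"
      by (auto simp: incseq_def le_fun_def indicator_def)
  qed measurable
  also have "\<dots> = T" unfolding T_def
  proof (rule nn_integral_cong)
    fix z :: complex
    obtain n :: nat where n: "norm z \<le> real n" using real_arch_simple by blast
    show "(SUP n. ennreal (f z) * indicator (cball 0 (real n)) z) = ennreal (f z)"
    proof (rule antisym)
      show "(SUP n. ennreal (f z) * indicator (cball 0 (real n)) z) \<le> ennreal (f z)"
        by (rule SUP_least) (auto simp: indicator_def)
      have "ennreal (f z) = ennreal (f z) * indicator (cball 0 (real n)) z" using n by simp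
      also have "\<dots> \<le> (SUP n. ennreal (f z) * indicator (cball 0 (real n)) z)" by (rule SUP_upper) simp
      finally show "ennreal (f z) \<le> (SUP n. ennreal (f z) * indicator (cball 0 (real n)) z)" .
    qed
  qed
  finally have sup: "(SUP n. A n) = T" .
  have Tfin: "T < top" using E ennreal_less_top[of E] unfolding T_def by (rule le_less_trans)
  show ?thesis
  proof (cases "T \<le> ennreal \<eta>")
    case True
    have "(\<integral>\<^sup>+z\<in>D. ennreal (f z) \<partial>lborel) \<le> ennreal \<eta>" for D
      by (rule order_trans[OF _ True]) (auto simp: T_def indicator_def intro!: nn_integral_mono)
    then show ?thesis using that[of 0] by simp
  next
    case False
    obtain t where t: "T = ennreal t" "t \<ge> 0" using Tfin by (cases T) auto
    have tn: "t > \<eta>" using False t \<eta> by (simp add: not_le ennreal_less_iff)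
    have "ennreal (t - \<eta>) < (SUP n. A n)" unfolding sup t(1) using tn \<eta> by (simp add: ennreal_less_iff)
    then obtain n where n: "ennreal (t - \<eta>) < A n" by (auto simp: less_SUP_iff)
    show ?thesis
    proof (rule that[of "real n"])
      fix D :: "complex set" assume D[measurable]: "D \<in> sets borel" and dis: "D \<inter> cball 0 (real n) = {}"
      define Sd where "Sd = (\<integral>\<^sup>+z\<in>D. ennreal (f z) \<partial>lborel)"
      have "Sd + A n = (\<integral>\<^sup>+z. ennreal (f z) * indicator D z + ennreal (f z) * indicator (cball 0 (real n)) z \<partial>lborel)"
        unfolding Sd_def A_def by (rule nn_integral_add[symmetric]) measurable
      also have "\<dots> \<le> T" unfolding T_def
      proof (rule nn_integral_mono)
        fix z :: complex
        show "ennreal (f z) * indicator D z + ennreal (f z) * indicator (cball 0 (real n)) z \<le> ennreal (f z)"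
          using dis by (cases "z \<in> D"; cases "z \<in> cball 0 (real n)") auto
      qed
      finally have le: "Sd + A n \<le> ennreal t" unfolding t(1) .
      then have "Sd \<le> ennreal t" "A n \<le> ennreal t" by (metis add_increasing2 add_increasing order_trans zero_le order_refl)+
      then obtain s a where sa: "Sd = ennreal s" "s \<ge> 0" "A n = ennreal a" "a \<ge> 0"
        by (metis ennreal_cases ennreal_less_top leD top.extremum_unique)
      have "s + a \<le> t" using le sa t by (simp add: ennreal_plus[symmetric] del: ennreal_plus)
      moreover have "t - \<eta> < a" using n sa tn by (simp add: ennreal_less_iff)
      ultimately show "(\<integral>\<^sup>+z\<in>D. ennreal (f z) \<partial>lborel) \<le> ennreal \<eta>"
        unfolding Sd_def[symmetric] sa(1) by (intro ennreal_leI) linarith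
    qed simp
  qed
qed

context cyl_good begin

text \<open>Bound for the derivative where F \<le> 16: then |\<partial>_s u| is at most sqrt(16
  \<Lambda>) and |\<partial>_t u| at most \<Lambda> times that. On the disc of radius
  \<open>r16\<close> the map moves by at most \<rho> / 2.\<close>

definition "L16 = (1 + \<Lambda>) * sqrt (\<Lambda> * 16)"
definition "r16 = min 1 (\<rho> / (2 * L16))"

lemma L16_pos: "L16 > 0" and r16_pos: "0 < r16" "r16 \<le> 1" "L16 * r16 \<le> \<rho> / 2"
proof -
  show 1: "L16 > 0" using \<Lambda>1 by (simp add: L16_def)
  show "0 < r16" "r16 \<le> 1" using 1 \<rho>0 by (auto simp: r16_def)
  have "L16 * r16 \<le> L16 * (\<rho> / (2 * L16))" using 1 by (intro mult_left_mono) (auto simp: r16_def)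
  then show "L16 * r16 \<le> \<rho> / 2" using 1 by (simp add: field_simps)
qed

text \<open>A first-exit argument along rays: while the path stays in the chart ball of radius
  \<rho>, the derivative bound confines it to radius \<rho> / 2, so it never gets to leave.\<close>

lemma stay_in_chart:
  assumes hol: "J_holomorphic I C J v" and F: "\<And>z. norm z \<le> 1 \<Longrightarrow> fden v z \<le> 16"
    and i: "i \<in> I" "0 \<in> Dom v i" "cball (snd (X v i 0)) \<rho> \<subseteq> R i" "chart_const \<Lambda> \<delta> i (cball (snd (X v i 0)) \<rho>)"
    and z: "norm z < r16"
  shows "z \<in> Dom v i \<and> X v i z \<in> {0::real..} \<times> cball (snd (X v i 0)) \<rho> \<and> norm (X v i z - X v i 0) \<le> L16 * norm z \<and>
    norm (Dm v i z 1) \<le> L16 \<and> norm (Dm v i z \<i>) \<le> L16"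
proof -
  define y0 where "y0 = snd (X v i 0)"
  define K where "K = cball y0 \<rho>"
  note c = i(4)[folded y0_def K_def]
  note ch = chart[OF i(1)]
  define Od where "Od = {q \<in> fst (C i). dist y0 (snd (C i) q) < \<rho>}"
  have Od: "open Od"
  proof -
    have "open (fst (C i) \<inter> snd (C i) -` ball y0 \<rho>)"
      by (rule continuous_open_preimage[OF homeomorphism_cont1[OF ch(3)] ch(1)]) auto
    moreover have "Od = fst (C i) \<inter> snd (C i) -` ball y0 \<rho>" by (auto simp: Od_def)
    ultimately show ?thesis by simp
  qed
  have sub: "cball y0 (\<rho> / 2) \<subseteq> R i" using i(3) \<rho>0 by (auto simp: y0_def)
  \<comment> \<open>Compactness in the Hausdorff space V makes this set closed in V, not merely in
    the chart; the path therefore cannot escape from the chart domain in a limit.\<close>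
  define N where "N = chart_inv (C i) ` cball y0 (\<rho> / 2)"
  have "compact N" unfolding N_def
    by (rule compact_continuous_image[OF continuous_on_subset[OF homeomorphism_cont2[OF ch(3)] sub] compact_cball])
  then have Ncl: "closed N" by (rule compact_imp_closed)
  have NO: "N \<subseteq> Od"
  proof
    fix q assume "q \<in> N"
    then obtain y where y: "y \<in> cball y0 (\<rho> / 2)" "q = chart_inv (C i) y" by (auto simp: N_def)
    have yR: "y \<in> R i" using y(1) sub by blast
    have "snd (C i) q = y" unfolding y(2) by (rule homeomorphism_apply2[OF ch(3) yR])
    moreover have "q \<in> fst (C i)" unfolding y(2) using homeomorphism_image2[OF ch(3)] yR by blast
    ultimately show "q \<in> Od" using y(1) \<rho>0 by (auto simp: Od_def)
  qed
  have ON: "q \<in> N" if "q \<in> Od" "dist y0 (snd (C i) q) \<le> \<rho> / 2" for q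
  proof -
    have "q = chart_inv (C i) (snd (C i) q)" using homeomorphism_apply1[OF ch(3), of q] that(1) by (simp add: Od_def)
    moreover have "snd (C i) q \<in> cball y0 (\<rho> / 2)" using that(2) by simp
    ultimately show ?thesis unfolding N_def by (rule image_eqI)
  qed
  have inK: "w \<in> Dom v i \<and> X v i w \<in> {0::real..} \<times> K" if "snd (v w) \<in> Od" for w
    using that fst_nonneg[OF hol, of w] by (auto simp: Od_def K_def watlas_simps mem_Times_iff)
  have Dn: "norm (Dm v i w h) \<le> L16 * norm h" if "snd (v w) \<in> Od" "norm w \<le> 1" for w h
  proof -
    note w = inK[OF that(1)]
    have "(norm (Dm v i w 1))\<^sup>2 \<le> \<Lambda> * fden v w" by (rule Dm_bound[OF hol i(1) conjunct1[OF w] c conjunct2[OF w]])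
    also have "\<dots> \<le> \<Lambda> * 16" using F[OF that(2)] \<Lambda>1 by (intro mult_left_mono) auto
    finally have 1: "norm (Dm v i w 1) \<le> sqrt (\<Lambda> * 16)" by (rule real_le_rsqrt)
    have 2: "norm (Dm v i w \<i>) \<le> \<Lambda> * sqrt (\<Lambda> * 16)"
    proof -
      have "norm (Dm v i w \<i>) \<le> \<Lambda> * norm (Dm v i w 1)"
        unfolding Dm_J[OF hol i(1) conjunct1[OF w]] by (rule chart_constD(1)[OF c conjunct2[OF w]])
      also have "\<dots> \<le> \<Lambda> * sqrt (\<Lambda> * 16)" using 1 \<Lambda>1 by (intro mult_left_mono) auto
      finally show ?thesis .
    qed
    have "Dm v i w h = Re h *\<^sub>R Dm v i w 1 + Im h *\<^sub>R Dm v i w \<i>"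
      by (rule complex_linear_Re_Im[OF has_derivative_linear[OF X_derivative[OF hol i(1) conjunct1[OF w]]]])
    then have "norm (Dm v i w h) \<le> \<bar>Re h\<bar> * norm (Dm v i w 1) + \<bar>Im h\<bar> * norm (Dm v i w \<i>)"
      using norm_triangle_ineq[of "Re h *\<^sub>R Dm v i w 1" "Im h *\<^sub>R Dm v i w \<i>"] by simp
    also have "\<dots> \<le> norm h * sqrt (\<Lambda> * 16) + norm h * (\<Lambda> * sqrt (\<Lambda> * 16))"
      using 1 2 abs_Re_le_cmod[of h] abs_Im_le_cmod[of h] by (intro add_mono mult_mono) auto
    finally show ?thesis by (simp add: L16_def algebra_simps)
  qed
  define f where "f t = snd (v (t *\<^sub>R z))" for t :: real
  have fc: "continuous_on D f" for D unfolding f_def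
    by (intro continuous_on_snd continuous_on_compose2[OF v_continuous[OF hol]] continuous_intros) auto
  have tz: "norm (t *\<^sub>R z) \<le> norm z" if "t \<in> {0..1}" for t :: real
    using that by (simp add: mult_left_le_one_le)
  have z1: "norm z \<le> 1" using z r16_pos(2) by linarith
  have step: "norm (X v i (t *\<^sub>R z) - X v i 0) \<le> L16 * norm (t *\<^sub>R z)" if t: "t \<in> {0..1}" and O: "\<And>s. s \<in> {0..t} \<Longrightarrow> f s \<in> Od" for t
  proof -
    have "norm (X v i (t *\<^sub>R z) - X v i (0 *\<^sub>R z)) \<le> L16 * norm z * norm (t - 0)"
    proof (rule differentiable_bound[of "{0..t}" "\<lambda>s. X v i (s *\<^sub>R z)" "\<lambda>s h. Dm v i (s *\<^sub>R z) (h *\<^sub>R z)"])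
      fix s assume s: "s \<in> {0..t}"
      have Os: "snd (v (s *\<^sub>R z)) \<in> Od" using O[OF s] by (simp add: f_def)
      have sn: "norm (s *\<^sub>R z) \<le> 1" using tz[of s] s t z1 by simp
      show "((\<lambda>s. X v i (s *\<^sub>R z)) has_derivative (\<lambda>h. Dm v i (s *\<^sub>R z) (h *\<^sub>R z))) (at s within {0..t})"
        by (rule has_derivative_compose[of "\<lambda>s. s *\<^sub>R z" "\<lambda>h. h *\<^sub>R z" s "{0..t}", OF _ X_derivative[OF hol i(1) conjunct1[OF inK[OF Os]]]])
           (auto intro!: derivative_eq_intros)
      show "onorm (\<lambda>h. Dm v i (s *\<^sub>R z) (h *\<^sub>R z)) \<le> L16 * norm z"
      proof (rule onorm_le)
        fix h :: real
        have "norm (Dm v i (s *\<^sub>R z) (h *\<^sub>R z)) \<le> L16 * norm (h *\<^sub>R z)" by (rule Dn[OF Os sn])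
        then show "norm (Dm v i (s *\<^sub>R z) (h *\<^sub>R z)) \<le> L16 * norm z * norm h" by (simp add: mult_ac)
      qed
    qed (use t in auto)
    then show ?thesis using t by (simp add: mult_ac)
  qed
  have half: "dist y0 (snd (C i) (f t)) \<le> \<rho> / 2" if t: "t \<in> {0..1}" and O: "\<And>s. s \<in> {0..t} \<Longrightarrow> f s \<in> Od" for t
  proof -
    have "dist y0 (snd (C i) (f t)) = norm (snd (X v i (t *\<^sub>R z) - X v i 0))"
      by (simp add: y0_def f_def watlas_simps dist_norm norm_minus_commute)
    also have "\<dots> \<le> L16 * norm (t *\<^sub>R z)" by (rule order_trans[OF norm_snd_le' step[OF t O]])
    also have "\<dots> \<le> L16 * r16" using tz[OF t] z L16_pos by (intro mult_left_mono) auto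
    finally show ?thesis using r16_pos(3) by linarith
  qed
  have f0: "f 0 \<in> Od" using i(2) \<rho>0 by (auto simp: f_def Od_def y0_def watlas_simps mem_Times_iff)
  have all: "f t \<in> Od" if t: "t \<in> {0..1}" for t
  proof (rule ccontr)
    assume bad: "f t \<notin> Od"
    define Bd where "Bd = {0..1} \<inter> f -` (- Od)"
    have "compact Bd" unfolding Bd_def
      by (rule closed_Int_compact[of "{0..1} \<inter> f -` (- Od)" "{0..1}", simplified Int_assoc Int_commute Int_left_absorb Int_absorb])
         (use continuous_closed_preimage[OF fc, of "{0..1}" "- Od"] Od in \<open>auto simp: Int_commute\<close>)
    moreover have "Bd \<noteq> {}" using bad t by (auto simp: Bd_def)
    ultimately obtain t0 where t0: "t0 \<in> Bd" "\<And>s. s \<in> Bd \<Longrightarrow> t0 \<le> s" using compact_attains_inf by metis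
    have t01: "t0 \<in> {0..1}" "f t0 \<notin> Od" using t0(1) by (auto simp: Bd_def)
    then have t0p: "t0 > 0" using f0 by (cases "t0 = 0") auto
    have before: "f s \<in> Od" if "s \<in> {0..<t0}" for s
    proof (rule ccontr)
      assume "f s \<notin> Od"
      then have "s \<in> Bd" using that t01 by (auto simp: Bd_def)
      then show False using t0(2)[of s] that by simp
    qed
    \<comment> \<open>Up to the first exit time \<open>t0\<close> the path lies in the closed set
      \<open>N\<close>, hence so does its position at \<open>t0\<close>; but \<open>N\<close> is
      contained in \<open>Od\<close>.\<close>
    have "f ` {0..<t0} \<subseteq> N"
    proof (rule image_subsetI)
      fix s assume s: "s \<in> {0..<t0}"
      show "f s \<in> N" by (rule ON[OF before[OF s] half]) (use s t01 before in auto)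
    qed
    then have "f ` closure {0..<t0} \<subseteq> N" using image_closure_subset[OF fc Ncl] by blast
    moreover have "t0 \<in> closure {0..<t0}" using t0p by simp
    ultimately have "f t0 \<in> N" by blast
    then show False using NO t01 by blast
  qed
  have O1: "snd (v z) \<in> Od" using all[of 1] by (simp add: f_def)
  show ?thesis
    using inK[OF O1] step[of 1] all Dn[OF O1 z1, of 1] Dn[OF O1 z1, of \<i>] by (simp add: K_def y0_def)
qed

text \<open>The gradient estimate is applied in a chart, with J frozen at the value of v at 0. F(0)
  \<ge> 1 forces |vs(0)| \<ge> 1 / sqrt \<Lambda>, while the estimate allows only three quarters of
  that: one quarter each for freezing J, for the area of the disc and for the energy.\<close>

lemma eps_regularity:
  obtains \<epsilon> where "\<epsilon> > 0"
    "\<And>v. J_holomorphic I C J v \<Longrightarrow> (\<And>z. norm z \<le> 1 \<Longrightarrow> fden v z \<le> 16) \<Longrightarrow>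
      (\<integral>\<^sup>+z\<in>cball 0 1. ennreal (fden v z) \<partial>lborel) \<le> ennreal \<epsilon> \<Longrightarrow> fden v 0 < 1"
proof -
  define \<mu> where "\<mu> = integral UNIV (bmp 3) / 3"
  have \<mu>: "\<mu> > 0" using bmp_integral_pos[of 3] by (simp add: \<mu>_def)
  define q where "q = \<mu> / sqrt \<Lambda>"
  have sL: "sqrt \<Lambda> \<ge> 1" using \<Lambda>1 by simp
  have q: "q > 0" using \<mu> sL \<Lambda>1 by (simp add: q_def)
  \<comment> \<open>Freezing J costs its Lipschitz constant \<Lambda> times |\<partial>_t v| \<le>
    L16 times the distance L16 |z| travelled.\<close>
  define M where "M = \<Lambda> * L16 * L16"
  have M: "M > 0" using \<Lambda>1 L16_pos by (simp add: M_def)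
  define T where "T = min (r16 / 2) (q / (32 * (1 + \<Lambda>) * M))"
  have T: "0 < T" "T < r16" "T \<le> 1" using r16_pos q M \<Lambda>1 by (auto simp: T_def min_less_iff_disj)
  have TM: "8 * (1 + \<Lambda>) * M * T \<le> q / 4"
  proof -
    have "8 * (1 + \<Lambda>) * M * T \<le> 8 * (1 + \<Lambda>) * M * (q / (32 * (1 + \<Lambda>) * M))"
      using M \<Lambda>1 by (intro mult_left_mono) (auto simp: T_def)
    also have "\<dots> = q / 4"
    proof -
      have "8 * a * b * (q / (32 * a * b)) = q / 4" if "a > 0" "b > 0" for a b :: real using that by (simp add: field_simps)
      from this[of "1 + \<Lambda>" M] show ?thesis using M \<Lambda>1 by simp
    qed
    finally show ?thesis .
  qed
  \<comment> \<open>Makes |vs - J0 vt| at most c sqrt F.\<close>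
  define c where "c = (1 + \<Lambda> * \<Lambda>) * sqrt \<Lambda>"
  have c: "c > 0" unfolding c_def using \<Lambda>1 by (intro mult_pos_pos add_pos_nonneg) auto
  define \<nu> where "\<nu> = measure lborel (cball (0::complex) 1)"
  have \<nu>: "\<nu> \<ge> 0" "emeasure lborel (cball (0::complex) 1) = ennreal \<nu>"
    unfolding \<nu>_def using emeasure_lborel_cball_finite[of "0::complex" 1] by (auto simp: emeasure_eq_ennreal_measure)
  \<comment> \<open>The parameter in sqrt F \<le> \<kappa> + F / (4 \<kappa>), by which an integral
    of sqrt F is bounded through one of F; the \<kappa> part integrates to the area term.\<close>
  define \<kappa> where "\<kappa> = q / (4 * c * (\<nu> + 1))"
  have \<kappa>: "\<kappa> > 0" using q c \<nu> by (simp add: \<kappa>_def)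
  have \<kappa>\<nu>: "c * (\<kappa> * \<nu>) \<le> q / 4"
  proof -
    have "c * (q / (4 * c * b) * a) = q / 4 * (a / b)" if "b > 0" for a b :: real using that c by (simp add: field_simps)
    from this[of "\<nu> + 1" \<nu>] have "c * (\<kappa> * \<nu>) = q / 4 * (\<nu> / (\<nu> + 1))" using \<nu> by (simp add: \<kappa>_def)
    also have "\<dots> \<le> q / 4 * 1" using q \<nu> by (intro mult_left_mono) auto
    finally show ?thesis by simp
  qed
  \<comment> \<open>Exactly what makes c \<epsilon> / (4 \<kappa> T^2) equal to q / 4; T^2 comes
    from rescaling the disc of radius T to the unit disc.\<close>
  define \<epsilon> where "\<epsilon> = q * \<kappa> * T\<^sup>2 / c"
  have \<epsilon>: "\<epsilon> > 0" using q \<kappa> T c by (simp add: \<epsilon>_def)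
  show ?thesis
  proof (rule that[OF \<epsilon>], rule ccontr)
    fix v assume hol: "J_holomorphic I C J v" and F: "\<And>z. norm z \<le> 1 \<Longrightarrow> fden v z \<le> 16"
      and int: "(\<integral>\<^sup>+z\<in>cball 0 1. ennreal (fden v z) \<partial>lborel) \<le> ennreal \<epsilon>" and n: "\<not> fden v 0 < 1"
    obtain i where i: "i \<in> I" "0 \<in> Dom v i" "X v i 0 \<in> {0::real..} \<times> cball (snd (X v i 0)) \<rho>"
      "cball (snd (X v i 0)) \<rho> \<subseteq> R i" "chart_const \<Lambda> \<delta> i (cball (snd (X v i 0)) \<rho>)"
      by (rule good_chart[OF hol, of 0])
    have st: "norm z < r16 \<Longrightarrow> z \<in> Dom v i \<and> X v i z \<in> {0::real..} \<times> cball (snd (X v i 0)) \<rho> \<and> norm (X v i z - X v i 0) \<le> L16 * norm z \<and>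
      norm (Dm v i z 1) \<le> L16 \<and> norm (Dm v i z \<i>) \<le> L16" for z
      by (rule stay_in_chart[OF hol _ i(1,2,4,5)]) (rule F)
    define J0 where "J0 = J i (X v i 0)"
    define vs where "vs z = Dm v i z 1" for z
    define vt where "vt z = Dm v i z \<i>" for z
    interpret j: cplx_struct J0 unfolding J0_def by (rule J_struct[OF i(1) X_in_S[OF hol i(1,2)]])
    have C1: "C1_on (ball 0 r16) (X v i) vs vt" unfolding vs_def vt_def
      by (rule C1_on_subset[OF X_C1[OF hol i(1)]]) (use st in auto)
    have J0b: "norm (J0 x) \<le> \<Lambda> * norm x" for x unfolding J0_def by (rule chart_constD(1)[OF i(5,3)])
    have g: "norm (vs z + J0 (vt z)) \<le> M * norm z" if z: "norm z < r16" for z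
    proof -
      have zD: "z \<in> Dom v i" and zK: "X v i z \<in> {0::real..} \<times> cball (snd (X v i 0)) \<rho>" using st[OF z] by blast+
      interpret jz: cplx_struct "J i (X v i z)" by (rule J_struct[OF i(1) X_in_S[OF hol i(1) zD]])
      have "J i (X v i z) (vt z) = - vs z" unfolding vt_def vs_def Dm_J[OF hol i(1) zD] by (rule jz.sq)
      then have "norm (vs z + J0 (vt z)) = norm (J i (X v i 0) (vt z) - J i (X v i z) (vt z))" by (simp add: J0_def add.commute)
      also have "\<dots> \<le> \<Lambda> * norm (vt z) * norm (X v i 0 - X v i z)" by (rule chart_constD(2)[OF i(5,3) zK])
      also have "\<dots> \<le> \<Lambda> * L16 * (L16 * norm z)"
        using st[OF z] \<Lambda>1 L16_pos by (intro mult_mono) (auto simp: vt_def norm_minus_commute)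
      finally show ?thesis by (simp add: M_def mult_ac)
    qed
    have est: "norm (vs 0) * \<mu> \<le> integral UNIV (\<lambda>z. bmp 3 z / 6 * norm (vs (T *\<^sub>R z) - J0 (vt (T *\<^sub>R z)))) + 8 * (1 + \<Lambda>) * M * T"
      unfolding \<mu>_def
    proof (rule J_linear_gradient_estimate[OF C1 j.lin j.sq J0b _ g T(1,2)])
      show "vt 0 = J0 (vs 0)" unfolding vt_def vs_def J0_def by (rule Dm_J[OF hol i(1,2)])
    qed (use M \<Lambda>1 in auto)
    have Tz: "norm (T *\<^sub>R z) < r16" if "norm z \<le> 1" for z :: complex
    proof -
      have "norm (T *\<^sub>R z) \<le> T * 1" using that T(1) by (simp add: mult_left_le)
      then show ?thesis using T(2) by linarith
    qed
    define m where "m z = \<kappa> + fden v (T *\<^sub>R z) / (4 * \<kappa>)" for z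
    have "integral UNIV (\<lambda>z. bmp 3 z / 6 * norm (vs (T *\<^sub>R z) - J0 (vt (T *\<^sub>R z)))) \<le> c * (\<kappa> * \<nu> + \<epsilon> / (4 * \<kappa> * T\<^sup>2))"
    proof (rule integral_le_nn_integral_bound[where r = 1 and m = m and S = "cball 0 1"])
      have Jc: "continuous_on D J0" for D using j.lin linear_conv_bounded_linear linear_continuous_on by blast
      have vc: "continuous_on (ball 0 (r16 / T)) (\<lambda>z. norm (vs (T *\<^sub>R z) - J0 (vt (T *\<^sub>R z))) / 6)"
      proof -
        have s: "T *\<^sub>R z \<in> ball 0 r16" if "z \<in> ball 0 (r16 / T)" for z :: complex
          using that T(1) by (simp add: field_simps)
        show ?thesis
          by (intro continuous_intros continuous_on_compose2[OF C1_onD(1)[OF C1]] continuous_on_compose2[OF Jc[of UNIV]] continuous_on_compose2[OF C1_onD(2)[OF C1]]) (use s in auto)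
      qed
      have "continuous_on UNIV (\<lambda>z. bmp 3 z *\<^sub>R (norm (vs (T *\<^sub>R z) - J0 (vt (T *\<^sub>R z))) / 6))"
      proof (rule kernel_continuous(1)[OF _ _ open_ball _ vc])
        show "continuous_on UNIV (bmp 3)" using continuous_on_bmp[OF continuous_on_id, of UNIV 3] by (simp add: id_def)
        have "1 < r16 / T" using T by (simp add: field_simps)
        then show "cball (0::complex) 1 \<subseteq> ball 0 (r16 / T)" by auto
      qed (simp add: bmp_eq_0)
      then show "continuous_on UNIV (\<lambda>z. bmp 3 z / 6 * norm (vs (T *\<^sub>R z) - J0 (vt (T *\<^sub>R z))))" by simp
      fix z :: complex
      show "norm z > 1 \<Longrightarrow> bmp 3 z / 6 * norm (vs (T *\<^sub>R z) - J0 (vt (T *\<^sub>R z))) = 0" by (simp add: bmp_eq_0)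
      show "z \<notin> cball 0 1 \<Longrightarrow> bmp 3 z / 6 * norm (vs (T *\<^sub>R z) - J0 (vt (T *\<^sub>R z))) = 0" by (simp add: bmp_eq_0)
      show "0 \<le> bmp 3 z / 6 * norm (vs (T *\<^sub>R z) - J0 (vt (T *\<^sub>R z)))" by simp
      assume "z \<in> cball 0 1"
      then have z: "norm z \<le> 1" by simp
      note s = st[OF Tz[OF z]]
      define F0 where "F0 = fden v (T *\<^sub>R z)"
      have F0: "F0 \<ge> 0" unfolding F0_def by (rule fden_nonneg[OF hol])
      define a where "a = norm (vs (T *\<^sub>R z))"
      have "a\<^sup>2 \<le> \<Lambda> * F0" unfolding a_def vs_def F0_def by (rule Dm_bound[OF hol i(1) _ i(5)]) (use s in auto)
      then have a: "a \<le> sqrt \<Lambda> * sqrt F0" by (metis real_le_rsqrt real_sqrt_mult)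
      have amgm: "sqrt F0 \<le> \<kappa> + F0 / (4 * \<kappa>)"
      proof -
        have "0 \<le> (sqrt F0 - 2 * \<kappa>)\<^sup>2" by simp
        then have "4 * \<kappa> * sqrt F0 \<le> F0 + 4 * \<kappa> * \<kappa>" using F0 by (simp add: power2_diff power2_eq_square algebra_simps)
        then show ?thesis using \<kappa> by (simp add: field_simps)
      qed
      have vtb: "norm (vt (T *\<^sub>R z)) \<le> \<Lambda> * a" unfolding vt_def a_def vs_def using s
        by (subst Dm_J[OF hol i(1)]) (auto intro: chart_constD(1)[OF i(5)])
      have "norm (vs (T *\<^sub>R z) - J0 (vt (T *\<^sub>R z))) \<le> a + \<Lambda> * (\<Lambda> * a)"
      proof -
        have "norm (J0 (vt (T *\<^sub>R z))) \<le> \<Lambda> * (\<Lambda> * a)"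
          by (rule order_trans[OF J0b]) (use vtb \<Lambda>1 in \<open>auto intro: mult_left_mono\<close>)
        then show ?thesis using norm_triangle_ineq4[of "vs (T *\<^sub>R z)" "J0 (vt (T *\<^sub>R z))"] by (simp add: a_def)
      qed
      also have "\<dots> = (1 + \<Lambda> * \<Lambda>) * a" by (simp add: algebra_simps)
      also have "\<dots> \<le> (1 + \<Lambda> * \<Lambda>) * (sqrt \<Lambda> * sqrt F0)" using a \<Lambda>1 by (intro mult_left_mono) auto
      also have "\<dots> = c * sqrt F0" by (simp add: c_def)
      also have "\<dots> \<le> c * (\<kappa> + F0 / (4 * \<kappa>))" using amgm c by (intro mult_left_mono) auto
      finally have b: "norm (vs (T *\<^sub>R z) - J0 (vt (T *\<^sub>R z))) \<le> c * m z" by (simp add: m_def F0_def)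
      have "bmp 3 z / 6 * norm (vs (T *\<^sub>R z) - J0 (vt (T *\<^sub>R z))) \<le> 1 * norm (vs (T *\<^sub>R z) - J0 (vt (T *\<^sub>R z)))"
        using bmp_le_1[of 3 z] by (intro mult_right_mono) auto
      then show "bmp 3 z / 6 * norm (vs (T *\<^sub>R z) - J0 (vt (T *\<^sub>R z))) \<le> c * m z" using b by linarith
    next
      show "\<kappa> * \<nu> + \<epsilon> / (4 * \<kappa> * T\<^sup>2) \<ge> 0" using \<kappa> \<nu> \<epsilon> by simp
      have fm[measurable]: "fden v \<in> borel_measurable borel" using fden_continuous[OF hol] by (rule borel_measurable_continuous_onI)
      have [measurable]: "cball (0::complex) 1 \<in> sets borel" by simp
      have "(\<integral>\<^sup>+z\<in>cball 0 1. ennreal (m z) \<partial>lborel) = (\<integral>\<^sup>+z. ennreal \<kappa> * indicator (cball 0 1) z +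
          ennreal (1 / (4 * \<kappa> * T\<^sup>2)) * (ennreal (T\<^sup>2 * fden v (0 + T *\<^sub>R z)) * indicator (cball 0 1) z) \<partial>lborel)"
      proof (rule nn_integral_cong)
        fix z :: complex
        have "ennreal (m z) = ennreal \<kappa> + ennreal (1 / (4 * \<kappa> * T\<^sup>2)) * ennreal (T\<^sup>2 * fden v (0 + T *\<^sub>R z))"
          using \<kappa> T fden_nonneg[OF hol, of "T *\<^sub>R z"] by (simp add: m_def ennreal_mult'[symmetric] ennreal_plus[symmetric] del: ennreal_plus)
        then show "ennreal (m z) * indicator (cball 0 1) z = ennreal \<kappa> * indicator (cball 0 1) z +
          ennreal (1 / (4 * \<kappa> * T\<^sup>2)) * (ennreal (T\<^sup>2 * fden v (0 + T *\<^sub>R z)) * indicator (cball 0 1) z)"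
          by (simp add: distrib_right mult.assoc)
      qed
      also have "\<dots> = ennreal \<kappa> * emeasure lborel (cball (0::complex) 1) +
          ennreal (1 / (4 * \<kappa> * T\<^sup>2)) * (\<integral>\<^sup>+z\<in>cball 0 1. ennreal (T\<^sup>2 * fden v (0 + T *\<^sub>R z)) \<partial>lborel)"
        by (subst nn_integral_add) (simp_all add: nn_integral_cmult_indicator nn_integral_cmult)
      also have "(\<integral>\<^sup>+z\<in>cball 0 1. ennreal (T\<^sup>2 * fden v (0 + T *\<^sub>R z)) \<partial>lborel) = (\<integral>\<^sup>+z\<in>cball 0 (T * 1). ennreal (fden v z) \<partial>lborel)"
        by (rule nn_integral_affine_cball[OF fden_continuous[OF hol] T(1)])
      also have "ennreal \<kappa> * emeasure lborel (cball (0::complex) 1) + ennreal (1 / (4 * \<kappa> * T\<^sup>2)) * (\<integral>\<^sup>+z\<in>cball 0 (T * 1). ennreal (fden v z) \<partial>lborel)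
        \<le> ennreal \<kappa> * ennreal \<nu> + ennreal (1 / (4 * \<kappa> * T\<^sup>2)) * ennreal \<epsilon>"
      proof (intro add_mono mult_left_mono)
        show "emeasure lborel (cball (0::complex) 1) \<le> ennreal \<nu>" using \<nu> by simp
        have "(\<integral>\<^sup>+z\<in>cball 0 (T * 1). ennreal (fden v z) \<partial>lborel) \<le> (\<integral>\<^sup>+z\<in>cball 0 1. ennreal (fden v z) \<partial>lborel)"
          using T(3) by (intro nn_integral_mono) (auto simp: indicator_def)
        then show "(\<integral>\<^sup>+z\<in>cball 0 (T * 1). ennreal (fden v z) \<partial>lborel) \<le> ennreal \<epsilon>" using int by (rule order_trans)
      qed auto
      also have "\<dots> = ennreal (\<kappa> * \<nu> + \<epsilon> / (4 * \<kappa> * T\<^sup>2))"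
        using \<kappa> \<nu> \<epsilon> T by (simp add: ennreal_mult'[symmetric] ennreal_plus[symmetric] del: ennreal_plus)
      finally show "(\<integral>\<^sup>+z\<in>cball 0 1. ennreal (m z) \<partial>lborel) \<le> ennreal (\<kappa> * \<nu> + \<epsilon> / (4 * \<kappa> * T\<^sup>2))" .
    qed (rule c)
    also have "\<dots> \<le> q / 4 + q / 4"
    proof -
      have "c * (\<epsilon> / (4 * \<kappa> * T\<^sup>2)) = q / 4" using c \<kappa> T by (simp add: \<epsilon>_def field_simps)
      then show ?thesis using \<kappa>\<nu> unfolding distrib_left by linarith
    qed
    finally have "norm (vs 0) * \<mu> \<le> q / 4 + q / 4 + q / 4" using est TM by linarith
    moreover have "norm (vs 0) \<ge> 1 / sqrt \<Lambda>"
    proof -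
      have "1 \<le> fden v 0" using n by simp
      also have "\<dots> \<le> \<Lambda> * (norm (vs 0))\<^sup>2"
        unfolding chart_independent(1)[OF hol i(1,2)] vs_def by (rule chart_constD(4)[OF i(5,3)])
      finally have "1 / \<Lambda> \<le> (norm (vs 0))\<^sup>2" using \<Lambda>1 by (simp add: field_simps)
      then have "sqrt (1 / \<Lambda>) \<le> norm (vs 0)" by (simp add: real_le_lsqrt)
      then show ?thesis by (simp add: real_sqrt_divide)
    qed
    then have "1 / sqrt \<Lambda> * \<mu> \<le> norm (vs 0) * \<mu>" using \<mu> by (intro mult_right_mono) auto
    then have "q \<le> norm (vs 0) * \<mu>" by (simp add: q_def)
    ultimately show False using q by linarith
  qed
qed

end

section \<open>Point picking and the bound on the gradient\<close>

context cyl_good begin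

lemma fden_bounded:
  assumes hol: "J_holomorphic I C J u" and fin: "energy I C J winf u < \<infinity>"
  shows "\<exists>b. \<forall>z. fden u z \<le> b"
proof (rule ccontr)
  assume unb: "\<not> (\<exists>b. \<forall>z. fden u z \<le> b)"
  note F0 = fden_nonneg[OF hol] and Fc = fden_continuous[OF hol]
  obtain E where E: "E \<ge> 0" "(\<integral>\<^sup>+z. ennreal (ev u z) \<partial>lborel) \<le> ennreal E"
    "\<And>\<phi>. \<phi> \<in> energy_cutoffs \<Longrightarrow> (\<integral>\<^sup>+z. ennreal (\<phi> (av u z) * ((av1 u z)\<^sup>2 + (av2 u z)\<^sup>2)) \<partial>lborel) \<le> ennreal E"
    by (rule energy_bounds[OF hol fin]) (rule that; blast)
  obtain \<epsilon> where \<epsilon>: "\<epsilon> > 0" "\<And>v. J_holomorphic I C J v \<Longrightarrow> (\<And>z. norm z \<le> 1 \<Longrightarrow> fden v z \<le> 16) \<Longrightarrow>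
      (\<integral>\<^sup>+z\<in>cball 0 1. ennreal (fden v z) \<partial>lborel) \<le> ennreal \<epsilon> \<Longrightarrow> fden v 0 < 1"
    by (rule eps_regularity) (rule that; blast)
  have e2: "\<epsilon> / 2 > 0" using \<epsilon> by simp
  \<comment> \<open>K = 4 bounds the partials of \<open>a\<close> wherever |\<nabla>a|^2 \<le> F
    \<le> 16.\<close>
  have four: "(4::real) > 0" by simp
  obtain Rr \<eta> \<theta> :: real where nh: "Rr \<ge> 2" "\<eta> > 0" "\<theta> > 0"
    "\<And>a a1 a2 p ps pt q qs qt. near_harmonic Rr 4 \<theta> \<eta> a a1 a2 p ps pt q qs qt \<Longrightarrow>
      (\<And>\<phi>. \<phi> \<in> energy_cutoffs \<Longrightarrow>
        (\<integral>\<^sup>+z\<in>cball 0 Rr. ennreal (\<phi> (a z) * ((a1 z)\<^sup>2 + (a2 z)\<^sup>2)) \<partial>lborel) \<le> ennreal E) \<Longrightarrow>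
      (\<integral>\<^sup>+z\<in>cball 0 1. ennreal ((a1 z)\<^sup>2 + (a2 z)\<^sup>2) \<partial>lborel) \<le> ennreal (\<epsilon> / 2)"
    by (rule near_harmonic_gradient_small[OF four e2 E(1)]) (rule that; blast)
  define \<nu> where "\<nu> = measure lborel (cball (0::complex) Rr)"
  have \<nu>: "\<nu> \<ge> 0" "emeasure lborel (cball (0::complex) Rr) = ennreal \<nu>"
    unfolding \<nu>_def using emeasure_lborel_cball_finite[of "0::complex" Rr] by (auto simp: emeasure_eq_ennreal_measure)
  \<comment> \<open>Coefficients of exp(- \<delta> a) in the uniform error, to be compared with
    \<theta>, and in the curl integrated over the disc of radius \<open>Rr\<close>, to be compared
    with \<eta>.\<close>
  define k1 where "k1 = \<Lambda>\<^sup>2 * sqrt (\<Lambda> * 16)"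
  define k2 where "k2 = \<Lambda> * (\<Lambda> * 16) * (\<nu> + 1)"
  have k: "k1 > 0" "k2 > 0" using \<Lambda>1 \<nu> by (auto simp: k1_def k2_def intro!: mult_pos_pos add_nonneg_pos)
  define \<tau> where "\<tau> = min (\<theta> / k1) (\<eta> / (2 * k2))"
  have \<tau>: "\<tau> > 0" "k1 * \<tau> \<le> \<theta>" "k2 * \<tau> \<le> \<eta> / 2"
  proof -
    show "\<tau> > 0" using nh k by (simp add: \<tau>_def)
    have "k1 * \<tau> \<le> k1 * (\<theta> / k1)" using k by (intro mult_left_mono) (auto simp: \<tau>_def)
    then show "k1 * \<tau> \<le> \<theta>" using k by simp
    have "k2 * \<tau> \<le> k2 * (\<eta> / (2 * k2))" using k by (intro mult_left_mono) (auto simp: \<tau>_def)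
    also have "\<dots> = \<eta> / 2" using k by (simp add: field_simps)
    finally show "k2 * \<tau> \<le> \<eta> / 2" .
  qed
  define A0 where "A0 = - ln \<tau> / \<delta>"
  have A0: "exp (- \<delta> * r) \<le> \<tau>" if "r \<ge> A0" for r
  proof -
    have "\<delta> * A0 \<le> \<delta> * r" using that \<delta>0 by (intro mult_left_mono) auto
    then have "- \<delta> * r \<le> ln \<tau>" using \<delta>0 by (simp add: A0_def)
    then have "exp (- \<delta> * r) \<le> exp (ln \<tau>)" by (simp only: exp_le_cancel_iff)
    then show ?thesis using \<tau>(1) by simp
  qed
  \<comment> \<open>On the rescaled disc \<open>a\<close> has Lipschitz constant 8, so a start above
    \<open>A1\<close> keeps the whole disc of radius \<open>Rr\<close> above
    \<open>A0\<close>.\<close>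
  define A1 where "A1 = \<bar>A0\<bar> + 8 * Rr"
  have A1: "A1 > 0" using nh by (simp add: A1_def)
  obtain c where c: "c > 0" "\<And>a N. N \<ge> c \<Longrightarrow> \<exists>\<phi> \<Phi>. \<phi> \<in> energy_cutoffs \<and> continuous_on UNIV \<phi> \<and>
       (\<forall>x. (\<Phi> has_real_derivative \<phi> x) (at x)) \<and> (\<forall>x. 0 \<le> \<phi> x \<and> \<phi> x \<le> c / N) \<and>
       (\<forall>x\<in>{a<..<a + N}. \<phi> x > 0) \<and> (\<forall>x\<le>a. \<Phi> x = - 1 / 2) \<and> (\<forall>x\<ge>a + N. \<Phi> x = 1 / 2) \<and>
       (\<forall>x. \<bar>\<Phi> x\<bar> \<le> 1 / 2)" using energy_cutoff_exists by blast
  \<comment> \<open>The cutoff begins at -1 to be positive at height 0, and is long enough to be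
    positive on all heights up to A1 + 8, the extra 8 being the variation of \<open>a\<close> over
    the unit disc.\<close>
  have "c + A1 + 10 \<ge> c" using A1 by simp
  from c(2)[OF this, of "-1"] obtain \<phi>0 where \<phi>0: "\<phi>0 \<in> energy_cutoffs" "\<forall>x\<in>{-1<..<-1 + (c + A1 + 10)}. \<phi>0 x > 0"
    by (elim exE conjE) (rule that)
  have \<phi>c: "continuous_on D \<phi>0" for D by (rule continuous_on_subset[OF energy_cutoff_continuous[OF \<phi>0(1)]]) simp
  obtain x0 where x0: "x0 \<in> {0..A1 + 8}" "\<And>x. x \<in> {0..A1 + 8} \<Longrightarrow> \<phi>0 x0 \<le> \<phi>0 x"
    using continuous_attains_inf[OF compact_Icc _ \<phi>c, of 0 "A1 + 8"] A1 by auto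
  define m0 where "m0 = \<phi>0 x0"
  have m0: "m0 > 0" unfolding m0_def by (rule bspec[OF \<phi>0(2)]) (use x0(1) c(1) in auto)
  define h where "h z = \<phi>0 (av u z) * ((av1 u z)\<^sup>2 + (av2 u z)\<^sup>2)" for z
  have hc: "continuous_on UNIV h" unfolding h_def[abs_def]
    by (intro continuous_intros continuous_on_compose2[OF \<phi>c[of UNIV]] C1_onD[OF av_C1[OF hol]]) auto
  have hE: "(\<integral>\<^sup>+z. ennreal (h z) \<partial>lborel) \<le> ennreal E" unfolding h_def by (rule E(3)[OF \<phi>0(1)])
  \<comment> \<open>Allowed tail of the \<omega>-energy: one bound is half of the regularity
    threshold, the other leaves room for the factor \<Lambda> in the curl estimate.\<close>
  define \<eta>1 where "\<eta>1 = min (\<epsilon> / 2) (\<eta> / (2 * \<Lambda>))"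
  have \<eta>1: "\<eta>1 > 0" "\<eta>1 \<le> \<epsilon> / 2" "\<Lambda> * \<eta>1 \<le> \<eta> / 2"
  proof -
    show "\<eta>1 > 0" "\<eta>1 \<le> \<epsilon> / 2" using \<epsilon> nh \<Lambda>1 by (auto simp: \<eta>1_def)
    have "\<Lambda> * \<eta>1 \<le> \<Lambda> * (\<eta> / (2 * \<Lambda>))" using \<Lambda>1 by (intro mult_left_mono) (auto simp: \<eta>1_def)
    then show "\<Lambda> * \<eta>1 \<le> \<eta> / 2" using \<Lambda>1 by simp
  qed
  have \<eta>2: "m0 * (\<epsilon> / 2) > 0" using m0 \<epsilon> by simp
  obtain b1 where b1: "b1 \<ge> 0" "\<And>D. D \<in> sets borel \<Longrightarrow> D \<inter> cball 0 b1 = {} \<Longrightarrow> (\<integral>\<^sup>+z\<in>D. ennreal (ev u z) \<partial>lborel) \<le> ennreal \<eta>1"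
    by (rule nn_integral_tail[OF ev_continuous[OF hol] E(2) \<eta>1(1)]) (rule that; blast)
  obtain b2 where b2: "b2 \<ge> 0" "\<And>D. D \<in> sets borel \<Longrightarrow> D \<inter> cball 0 b2 = {} \<Longrightarrow> (\<integral>\<^sup>+z\<in>D. ennreal (h z) \<partial>lborel) \<le> ennreal (m0 * (\<epsilon> / 2))"
    by (rule nn_integral_tail[OF hc hE \<eta>2]) (rule that; blast)
  define b where "b = max b1 b2"
  \<comment> \<open>F is bounded on this ball, so a point with larger F lies outside it. The
    rescaled disc stays within distance 2 of that point, hence beyond radius b, where the tails are
    small.\<close>
  obtain Bm where Bm: "\<And>z. z \<in> cball 0 (b + 3) \<Longrightarrow> fden u z \<le> Bm"
  proof -
    have "compact (fden u ` cball 0 (b + 3))" by (rule compact_continuous_image[OF continuous_on_subset[OF Fc]]) auto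
    then have "bdd_above (fden u ` cball 0 (b + 3))" by (intro bounded_imp_bdd_above compact_imp_bounded)
    then obtain M where "\<forall>x\<in>fden u ` cball 0 (b + 3). x \<le> M" unfolding bdd_above_def by blast
    then show thesis by (intro that[of M]) blast
  qed
  \<comment> \<open>The second bound gives sqrt F > 2 Rr, so that after rescaling a disc of radius
    \<open>Rr\<close> fits where F is under control.\<close>
  obtain z0 where z0: "fden u z0 > max Bm (4 * Rr\<^sup>2)" using unb by (metis not_le)
  have z0n: "norm z0 > b + 3" using Bm[of z0] z0 by (cases "norm z0 \<le> b + 3") auto
  have z0R: "sqrt (fden u z0) > 2 * Rr"
    using z0 nh by (intro real_less_rsqrt) (auto simp: power_mult_distrib)
  \<comment> \<open>Hofer's weight. At a maximum z' the distance to the boundary circle is dd, and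
    on the disc of radius dd / 2 about z' the weight is at least dd / 2, so sqrt F is at most twice
    its value at z'.\<close>
  define G where "G z = (1 - dist z0 z) * sqrt (fden u z)" for z
  have Gc: "continuous_on D G" for D unfolding G_def
    by (intro continuous_intros continuous_on_subset[OF Fc]) auto
  obtain z' where z': "z' \<in> cball z0 1" "\<And>z. z \<in> cball z0 1 \<Longrightarrow> G z \<le> G z'"
    using continuous_attains_sup[OF compact_cball _ Gc, of z0 1] by auto
  define dd where "dd = 1 - dist z0 z'"
  define N where "N = sqrt (fden u z')"
  have dN: "dd * N > 2 * Rr"
    using z'(2)[of z0] z0R by (simp add: G_def dd_def N_def)
  have N0: "N \<ge> 0" by (simp add: N_def F0)
  have dd0: "dd \<ge> 0" "dd \<le> 1" using z'(1) by (auto simp: dd_def)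
  have "dd * N > 0" using dN nh by linarith
  then have dNp: "dd > 0" "N > 0" using dd0 N0 by (auto simp: zero_less_mult_iff)
  have NF: "N\<^sup>2 = fden u z'" using F0 by (simp add: N_def)
  \<comment> \<open>Normalises F at the picked point to 1.\<close>
  define s where "s = 1 / N"
  have s: "s > 0" "s\<^sup>2 * fden u z' = 1" "s * Rr \<le> dd / 2"
    using dNp dN by (auto simp: s_def NF[symmetric] power_divide field_simps)
  define v where "v = (\<lambda>z. u (z' + s *\<^sub>R z))"
  note rs = rescale[OF hol s(1), of z', folded v_def]
  note holv = rs(1)
  have near: "dist z0 (z' + s *\<^sub>R z) \<le> 1 - dd / 2" if "norm z \<le> Rr" for z
  proof -
    have "norm (s *\<^sub>R z) \<le> s * Rr" using that s(1) by simp
    then have "dist z' (z' + s *\<^sub>R z) \<le> dd / 2" using s(3) by (simp add: dist_norm)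
    moreover have "x \<le> 1 - e / 2" if "x \<le> p + q" "q \<le> e / 2" "e = 1 - p" for x p q e :: real using that by (simp add: field_simps)
    ultimately show ?thesis using dist_triangle[of z0 "z' + s *\<^sub>R z" z'] dd_def by blast
  qed
  \<comment> \<open>The factor 2 for sqrt F gives F \<le> 4, which is relaxed to the bound 16 of the
    regularity estimate.\<close>
  have F4: "fden v z \<le> 16" if z: "norm z \<le> Rr" for z
  proof -
    define f where "f = sqrt (fden u (z' + s *\<^sub>R z))"
    have f0: "f \<ge> 0" by (simp add: f_def F0)
    have "dd / 2 * f \<le> (1 - dist z0 (z' + s *\<^sub>R z)) * f" using near[OF z] f0 by (intro mult_right_mono) auto
    also have "\<dots> \<le> dd * N"
      using z'(2)[of "z' + s *\<^sub>R z"] near[OF z] dd0 by (simp add: G_def f_def dd_def N_def)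
    finally have "f \<le> 2 * N" using dNp by simp
    then have "s * f \<le> 2" using dNp by (simp add: s_def field_simps)
    then have "(s * f)\<^sup>2 \<le> 2\<^sup>2" using s f0 by (intro power_mono) auto
    moreover have "(s * f)\<^sup>2 = fden v z" using F0 by (simp add: rs(2) f_def power_mult_distrib)
    ultimately show ?thesis by simp
  qed
  have D: "cball z' (s * Rr) \<in> sets borel" "cball z' (s * Rr) \<inter> cball 0 b1 = {}" "cball z' (s * Rr) \<inter> cball 0 b2 = {}"
  proof -
    have "norm w > b" if "w \<in> cball z' (s * Rr)" for w
    proof -
      have "dist z' w \<le> 1" using that s(3) dd0 by simp
      moreover have "dist z0 z' \<le> 1" using z'(1) by simp
      ultimately have "dist z0 w \<le> 2" using dist_triangle[of z0 w z'] by linarith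
      then show ?thesis using z0n norm_triangle_ineq2[of z0 w] by (simp add: dist_norm)
    qed
    then show "cball z' (s * Rr) \<inter> cball 0 b1 = {}" "cball z' (s * Rr) \<inter> cball 0 b2 = {}"
      by (force simp: b_def)+
  qed simp
  have evv: "(\<integral>\<^sup>+z\<in>cball 0 Rr. ennreal (ev v z) \<partial>lborel) \<le> ennreal \<eta>1"
    unfolding rs(6) nn_integral_affine_cball[OF ev_continuous[OF hol] s(1)] by (rule b1(2)[OF D(1,2)])
  have sub1: "cball (0::complex) 1 \<subseteq> cball 0 Rr" using nh by auto
  have mono1: "(\<integral>\<^sup>+z\<in>cball 0 1. ennreal (f z) \<partial>lborel) \<le> (\<integral>\<^sup>+z\<in>cball 0 Rr. ennreal (f z) \<partial>lborel)" for f :: "complex \<Rightarrow> real"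
    using sub1 by (intro nn_integral_mono) (auto simp: indicator_def)
  have gr: "(av1 v z)\<^sup>2 + (av2 v z)\<^sup>2 \<le> 16" "\<bar>av1 v z\<bar> \<le> 4" "\<bar>av2 v z\<bar> \<le> 4" if z: "norm z \<le> Rr" for z
  proof -
    show 1: "(av1 v z)\<^sup>2 + (av2 v z)\<^sup>2 \<le> 16" using grad_le_fden[OF holv, of z] F4[OF z] by linarith
    have "(av1 v z)\<^sup>2 \<le> 16" "(av2 v z)\<^sup>2 \<le> 16"
      using 1 zero_le_power2[of "av1 v z"] zero_le_power2[of "av2 v z"] by linarith+
    then have "\<bar>av1 v z\<bar>\<^sup>2 \<le> 4\<^sup>2" "\<bar>av2 v z\<bar>\<^sup>2 \<le> 4\<^sup>2" by simp_all
    then show "\<bar>av1 v z\<bar> \<le> 4" "\<bar>av2 v z\<bar> \<le> 4" by (auto intro: power2_le_imp_le)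
  qed
  have avL: "\<bar>av v z - av v 0\<bar> \<le> 8 * norm z" if z: "norm z \<le> Rr" for z
  proof -
    have "norm (av v z - av v 0) \<le> 8 * norm (z - 0)"
    proof (rule differentiable_bound[of "cball 0 Rr" "av v" "\<lambda>z h. Re h *\<^sub>R av1 v z + Im h *\<^sub>R av2 v z"])
      fix w :: complex assume w: "w \<in> cball 0 Rr"
      show "(av v has_derivative (\<lambda>h. Re h *\<^sub>R av1 v w + Im h *\<^sub>R av2 v w)) (at w within cball 0 Rr)"
        by (rule has_derivative_at_withinI[OF C1_onD(4)[OF av_C1[OF holv] UNIV_I]])
      show "onorm (\<lambda>h. Re h *\<^sub>R av1 v w + Im h *\<^sub>R av2 v w) \<le> 8"
      proof (rule onorm_le)
        fix h :: complex
        have "norm (Re h *\<^sub>R av1 v w + Im h *\<^sub>R av2 v w) \<le> \<bar>Re h\<bar> * \<bar>av1 v w\<bar> + \<bar>Im h\<bar> * \<bar>av2 v w\<bar>"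
          using abs_triangle_ineq[of "Re h * av1 v w" "Im h * av2 v w"] by (simp add: abs_mult)
        also have "\<dots> \<le> norm h * 4 + norm h * 4"
          using gr(2,3)[of w] w abs_Re_le_cmod[of h] abs_Im_le_cmod[of h] by (intro add_mono mult_mono) auto
        finally show "norm (Re h *\<^sub>R av1 v w + Im h *\<^sub>R av2 v w) \<le> 8 * norm h" by simp
      qed
    qed (use z nh in auto)
    then show ?thesis by simp
  qed
  have small: "(\<integral>\<^sup>+z\<in>cball 0 1. ennreal ((av1 v z)\<^sup>2 + (av2 v z)\<^sup>2) \<partial>lborel) \<le> ennreal (\<epsilon> / 2)"
  proof (cases "av v 0 \<ge> A1")
    case True
    have far: "exp (- \<delta> * av v z) \<le> \<tau>" if z: "norm z \<le> Rr" for z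
      by (rule A0) (use True avL[OF z] z in \<open>simp add: A1_def\<close>)
    show ?thesis
    proof (rule nh(4)[of "av v" "av1 v" "av2 v" "\<lambda>z. lamp v z 1" "lps v 1" "lpt v 1" "\<lambda>z. lamp v z \<i>" "lps v \<i>" "lpt v \<i>"])
      have th: "\<Lambda>\<^sup>2 * exp (- \<delta> * av v z) * sqrt (\<Lambda> * fden v z) \<le> \<theta>" if z: "norm z \<le> Rr" for z
      proof -
        have "\<Lambda>\<^sup>2 * exp (- \<delta> * av v z) * sqrt (\<Lambda> * fden v z) \<le> \<Lambda>\<^sup>2 * \<tau> * sqrt (\<Lambda> * 16)"
          using far[OF z] F4[OF z] \<Lambda>1 \<tau>(1) fden_nonneg[OF holv, of z]
          by (intro mult_mono mult_left_mono real_sqrt_le_mono mult_nonneg_nonneg) auto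
        also have "\<dots> = k1 * \<tau>" by (simp add: k1_def)
        finally show ?thesis using \<tau>(2) by linarith
      qed
      have dbound: "(\<integral>\<^sup>+z\<in>cball 0 Rr. ennreal \<bar>lps v \<i> z - lpt v 1 z\<bar> \<partial>lborel) \<le> ennreal \<eta>"
      proof -
        have [measurable]: "ev v \<in> borel_measurable borel" using ev_continuous[OF holv] by (rule borel_measurable_continuous_onI)
        have [measurable]: "cball (0::complex) Rr \<in> sets borel" by simp
        have "(\<integral>\<^sup>+z\<in>cball 0 Rr. ennreal \<bar>lps v \<i> z - lpt v 1 z\<bar> \<partial>lborel)
          \<le> (\<integral>\<^sup>+z. ennreal \<Lambda> * (ennreal (ev v z) * indicator (cball 0 Rr) z) + ennreal (\<Lambda> * (\<Lambda> * 16) * \<tau>) * indicator (cball 0 Rr) z \<partial>lborel)"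
        proof (rule nn_integral_mono)
          fix z :: complex
          show "ennreal \<bar>lps v \<i> z - lpt v 1 z\<bar> * indicator (cball 0 Rr) z
            \<le> ennreal \<Lambda> * (ennreal (ev v z) * indicator (cball 0 Rr) z) + ennreal (\<Lambda> * (\<Lambda> * 16) * \<tau>) * indicator (cball 0 Rr) z"
          proof (cases "z \<in> cball 0 Rr")
            case True
            then have z: "norm z \<le> Rr" by simp
            have "exp (- \<delta> * av v z) * (\<Lambda> * fden v z) \<le> \<tau> * (\<Lambda> * 16)"
              using far[OF z] F4[OF z] \<Lambda>1 \<tau>(1) fden_nonneg[OF holv, of z] by (intro mult_mono) auto
            then have "\<Lambda> * (ev v z + exp (- \<delta> * av v z) * (\<Lambda> * fden v z)) \<le> \<Lambda> * (ev v z + \<tau> * (\<Lambda> * 16))"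
              using \<Lambda>1 by (intro mult_left_mono add_left_mono) auto
            then have "\<bar>lps v \<i> z - lpt v 1 z\<bar> \<le> \<Lambda> * ev v z + \<Lambda> * (\<Lambda> * 16) * \<tau>"
              using pointwise_estimates(3)[OF holv, of z] by (simp add: algebra_simps)
            then have "ennreal \<bar>lps v \<i> z - lpt v 1 z\<bar> \<le> ennreal (\<Lambda> * ev v z + \<Lambda> * (\<Lambda> * 16) * \<tau>)" by (rule ennreal_leI)
            also have "\<dots> = ennreal \<Lambda> * ennreal (ev v z) + ennreal (\<Lambda> * (\<Lambda> * 16) * \<tau>)"
              using \<Lambda>1 \<tau>(1) ev_nonneg[OF holv, of z] by (subst ennreal_plus) (auto simp: ennreal_mult')
            finally show ?thesis using True by simp
          qed simp
        qed
        also have "\<dots> = ennreal \<Lambda> * (\<integral>\<^sup>+z\<in>cball 0 Rr. ennreal (ev v z) \<partial>lborel) + ennreal (\<Lambda> * (\<Lambda> * 16) * \<tau>) * emeasure lborel (cball (0::complex) Rr)"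
          by (subst nn_integral_add) (simp_all add: nn_integral_cmult_indicator nn_integral_cmult)
        also have "\<dots> \<le> ennreal \<Lambda> * ennreal \<eta>1 + ennreal (\<Lambda> * (\<Lambda> * 16) * \<tau>) * ennreal \<nu>"
          using evv \<nu> by (intro add_mono mult_left_mono) auto
        also have "\<dots> = ennreal (\<Lambda> * \<eta>1 + \<Lambda> * (\<Lambda> * 16) * \<tau> * \<nu>)"
          using \<Lambda>1 \<tau>(1) \<eta>1(1) \<nu>(1) by (simp add: ennreal_mult'[symmetric] ennreal_plus[symmetric] del: ennreal_plus)
        also have "\<dots> \<le> ennreal \<eta>"
        proof (rule ennreal_leI)
          have "\<Lambda> * (\<Lambda> * 16) * \<tau> * \<nu> \<le> \<Lambda> * (\<Lambda> * 16) * \<tau> * (\<nu> + 1)" using \<Lambda>1 \<tau>(1) by (intro mult_left_mono) auto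
          also have "\<dots> = k2 * \<tau>" by (simp add: k2_def mult_ac)
          finally show "\<Lambda> * \<eta>1 + \<Lambda> * (\<Lambda> * 16) * \<tau> * \<nu> \<le> \<eta>" using \<tau>(3) \<eta>1(3) by linarith
        qed
        finally show ?thesis .
      qed
      show "near_harmonic Rr 4 \<theta> \<eta> (av v) (av1 v) (av2 v) (\<lambda>z. lamp v z 1) (lps v 1) (lpt v 1) (\<lambda>z. lamp v z \<i>) (lps v \<i>) (lpt v \<i>)"
      proof (rule near_harmonic.intro)
        show "C1_on UNIV (av v) (av1 v) (av2 v)" by (rule av_C1[OF holv])
        show "C1_on UNIV (\<lambda>z. lamp v z 1) (lps v 1) (lpt v 1)" "C1_on UNIV (\<lambda>z. lamp v z \<i>) (lps v \<i>) (lpt v \<i>)"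
          by (rule lamp_C1[OF holv])+
        fix z :: complex assume z: "norm z \<le> Rr"
        show "\<bar>av1 v z\<bar> \<le> 4" "\<bar>av2 v z\<bar> \<le> 4" by (rule gr(2,3)[OF z])+
        show "\<bar>av1 v z - lamp v z \<i>\<bar> \<le> \<theta>" using pointwise_estimates(1)[OF holv, of z] th[OF z] by linarith
        show "\<bar>av2 v z + lamp v z 1\<bar> \<le> \<theta>" using pointwise_estimates(2)[OF holv, of z] th[OF z] by linarith
      next
        show "(\<integral>\<^sup>+z\<in>cball 0 Rr. ennreal \<bar>lps v \<i> z - lpt v 1 z\<bar> \<partial>lborel) \<le> ennreal \<eta>" by (rule dbound)
      qed (use nh in auto)
      fix \<phi> assume \<phi>: "\<phi> \<in> energy_cutoffs"
      have c1: "continuous_on UNIV (\<lambda>z. \<phi> (av u z) * ((av1 u z)\<^sup>2 + (av2 u z)\<^sup>2))"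
        by (intro continuous_intros continuous_on_compose2[OF energy_cutoff_continuous[OF \<phi>]] C1_onD[OF av_C1[OF hol]]) auto
      have "(\<integral>\<^sup>+z\<in>cball 0 Rr. ennreal (\<phi> (av v z) * ((av1 v z)\<^sup>2 + (av2 v z)\<^sup>2)) \<partial>lborel)
        = (\<integral>\<^sup>+z\<in>cball 0 Rr. ennreal (s\<^sup>2 * (\<phi> (av u (z' + s *\<^sub>R z)) * ((av1 u (z' + s *\<^sub>R z))\<^sup>2 + (av2 u (z' + s *\<^sub>R z))\<^sup>2))) \<partial>lborel)"
        by (simp add: rs(3,4,5) power_mult_distrib algebra_simps)
      also have "\<dots> = (\<integral>\<^sup>+z\<in>cball z' (s * Rr). ennreal (\<phi> (av u z) * ((av1 u z)\<^sup>2 + (av2 u z)\<^sup>2)) \<partial>lborel)"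
        by (rule nn_integral_affine_cball[OF c1 s(1)])
      also have "\<dots> \<le> (\<integral>\<^sup>+z. ennreal (\<phi> (av u z) * ((av1 u z)\<^sup>2 + (av2 u z)\<^sup>2)) \<partial>lborel)"
        by (intro nn_integral_mono) (auto simp: indicator_def)
      also have "\<dots> \<le> ennreal E" by (rule E(3)[OF \<phi>])
      finally show "(\<integral>\<^sup>+z\<in>cball 0 Rr. ennreal (\<phi> (av v z) * ((av1 v z)\<^sup>2 + (av2 v z)\<^sup>2)) \<partial>lborel) \<le> ennreal E" .
    qed
  next
    case False
    have low: "m0 * ((av1 v z)\<^sup>2 + (av2 v z)\<^sup>2) \<le> s\<^sup>2 * h (z' + s *\<^sub>R z)" if z: "norm z \<le> 1" for z
    proof -
      have zR: "norm z \<le> Rr" using z nh by simp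
      have "av v z \<ge> 0" using fst_nonneg[OF holv] by (simp add: av_def[OF holv])
      moreover have "av v z \<le> A1 + 8" using avL[OF zR] z False by linarith
      ultimately have "m0 \<le> \<phi>0 (av v z)" unfolding m0_def by (intro x0(2)) simp
      then have "m0 * ((av1 v z)\<^sup>2 + (av2 v z)\<^sup>2) \<le> \<phi>0 (av v z) * ((av1 v z)\<^sup>2 + (av2 v z)\<^sup>2)" by (rule mult_right_mono) simp
      also have "\<dots> = s\<^sup>2 * h (z' + s *\<^sub>R z)" by (simp add: rs(3,4,5) h_def power_mult_distrib algebra_simps)
      finally show ?thesis .
    qed
    have [measurable]: "h \<in> borel_measurable borel" using hc by (rule borel_measurable_continuous_onI)
    have [measurable]: "cball (0::complex) 1 \<in> sets borel" by simp
    have "(\<integral>\<^sup>+z\<in>cball 0 1. ennreal ((av1 v z)\<^sup>2 + (av2 v z)\<^sup>2) \<partial>lborel)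
      \<le> (\<integral>\<^sup>+z. ennreal (1 / m0) * (ennreal (s\<^sup>2 * h (z' + s *\<^sub>R z)) * indicator (cball 0 1) z) \<partial>lborel)"
    proof (rule nn_integral_mono)
      fix z :: complex
      show "ennreal ((av1 v z)\<^sup>2 + (av2 v z)\<^sup>2) * indicator (cball 0 1) z \<le> ennreal (1 / m0) * (ennreal (s\<^sup>2 * h (z' + s *\<^sub>R z)) * indicator (cball 0 1) z)"
      proof (cases "norm z \<le> 1")
        case True
        have "(av1 v z)\<^sup>2 + (av2 v z)\<^sup>2 \<le> 1 / m0 * (s\<^sup>2 * h (z' + s *\<^sub>R z))"
          using low[OF True] m0 by (simp add: pos_le_divide_eq mult.commute)
        then have "ennreal ((av1 v z)\<^sup>2 + (av2 v z)\<^sup>2) \<le> ennreal (1 / m0 * (s\<^sup>2 * h (z' + s *\<^sub>R z)))" by (rule ennreal_leI)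
        also have "\<dots> = ennreal (1 / m0) * ennreal (s\<^sup>2 * h (z' + s *\<^sub>R z))" by (rule ennreal_mult') (use m0 in simp)
        finally show ?thesis using True by simp
      qed simp
    qed
    also have "\<dots> = ennreal (1 / m0) * (\<integral>\<^sup>+z\<in>cball 0 1. ennreal (s\<^sup>2 * h (z' + s *\<^sub>R z)) \<partial>lborel)"
      by (rule nn_integral_cmult) measurable
    also have "\<dots> \<le> ennreal (1 / m0) * ennreal (m0 * (\<epsilon> / 2))"
    proof (rule mult_left_mono)
      have "(\<integral>\<^sup>+z\<in>cball 0 1. ennreal (s\<^sup>2 * h (z' + s *\<^sub>R z)) \<partial>lborel) \<le> (\<integral>\<^sup>+z\<in>cball 0 Rr. ennreal (s\<^sup>2 * h (z' + s *\<^sub>R z)) \<partial>lborel)"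
        by (rule mono1)
      also have "\<dots> \<le> ennreal (m0 * (\<epsilon> / 2))"
        unfolding nn_integral_affine_cball[OF hc s(1)] by (rule b2(2)[OF D(1,3)])
      finally show "(\<integral>\<^sup>+z\<in>cball 0 1. ennreal (s\<^sup>2 * h (z' + s *\<^sub>R z)) \<partial>lborel) \<le> ennreal (m0 * (\<epsilon> / 2))" .
    qed simp
    also have "\<dots> = ennreal (1 / m0 * (m0 * (\<epsilon> / 2)))" by (rule ennreal_mult'[symmetric]) (use m0 in simp)
    also have "\<dots> = ennreal (\<epsilon> / 2)" using m0 by simp
    finally show ?thesis .
  qed
  have [measurable]: "ev v \<in> borel_measurable borel" "av1 v \<in> borel_measurable borel" "av2 v \<in> borel_measurable borel"
    using ev_continuous[OF holv] C1_onD(1,2)[OF av_C1[OF holv]] by (auto intro: borel_measurable_continuous_onI)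
  have [measurable]: "cball (0::complex) 1 \<in> sets borel" by simp
  have "(\<integral>\<^sup>+z\<in>cball 0 1. ennreal (fden v z) \<partial>lborel)
    = (\<integral>\<^sup>+z. ennreal (ev v z) * indicator (cball 0 1) z + ennreal ((av1 v z)\<^sup>2 + (av2 v z)\<^sup>2) * indicator (cball 0 1) z \<partial>lborel)"
  proof (rule nn_integral_cong)
    fix z :: complex
    have "ennreal (fden v z) = ennreal (ev v z) + ennreal ((av1 v z)\<^sup>2 + (av2 v z)\<^sup>2)"
      unfolding fden_ev[OF holv] by (rule ennreal_plus) (simp_all add: ev_nonneg[OF holv])
    then show "ennreal (fden v z) * indicator (cball 0 1) z = ennreal (ev v z) * indicator (cball 0 1) z + ennreal ((av1 v z)\<^sup>2 + (av2 v z)\<^sup>2) * indicator (cball 0 1) z"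
      by (simp only: distrib_right)
  qed
  also have "\<dots> = (\<integral>\<^sup>+z\<in>cball 0 1. ennreal (ev v z) \<partial>lborel) + (\<integral>\<^sup>+z\<in>cball 0 1. ennreal ((av1 v z)\<^sup>2 + (av2 v z)\<^sup>2) \<partial>lborel)"
    by (rule nn_integral_add) measurable
  also have "\<dots> \<le> ennreal (\<epsilon> / 2) + ennreal (\<epsilon> / 2)"
  proof (rule add_mono[OF _ small])
    show "(\<integral>\<^sup>+z\<in>cball 0 1. ennreal (ev v z) \<partial>lborel) \<le> ennreal (\<epsilon> / 2)"
      by (rule order_trans[OF mono1 order_trans[OF evv ennreal_leI[OF \<eta>1(2)]]])
  qed
  also have "\<dots> = ennreal (\<epsilon> / 2 + \<epsilon> / 2)" by (rule ennreal_plus[symmetric]) (use \<epsilon> in auto)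
  finally have int: "(\<integral>\<^sup>+z\<in>cball 0 1. ennreal (fden v z) \<partial>lborel) \<le> ennreal \<epsilon>" by simp
  have F1: "fden v z \<le> 16" if "norm z \<le> 1" for z by (rule F4) (use that nh in simp)
  have "fden v 0 < 1" by (rule \<epsilon>(2)[OF holv _ int]) (rule F1)
  moreover have "fden v 0 = 1" using s(2) by (simp add: rs(2))
  ultimately show False by simp
qed

text \<open>The gradient norm is at most a constant times sqrt F.\<close>

lemma gradient_norm_bounded:
  assumes hol: "J_holomorphic I C J u" and fin: "energy I C J winf u < \<infinity>"
  shows "(SUP z. ereal (gradient_norm I C gW u z)) < \<infinity>"
proof -
  obtain b where b: "\<And>z. fden u z \<le> b" using fden_bounded[OF hol fin] by blast
  have "gradient_norm I C gW u z \<le> sqrt (\<Lambda> * ((1 + \<Lambda>)\<^sup>2 * (\<Lambda> * b)))" for z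
    by (rule order_trans[OF pointwise_estimates(4)[OF hol]])
       (use b[of z] \<Lambda>1 in \<open>auto intro!: mult_left_mono\<close>)
  then have "(SUP z. ereal (gradient_norm I C gW u z)) \<le> ereal (sqrt (\<Lambda> * ((1 + \<Lambda>)\<^sup>2 * (\<Lambda> * b))))"
    by (intro SUP_least) simp
  then show ?thesis by (rule le_less_trans) simp
qed

end

theorem proposition2:
  fixes n :: nat
    and B :: "'e::euclidean_space list"
    and I :: "'i set"
    and C :: "'i \<Rightarrow> ('v::t2_space, 'e) chart"
    and g gW :: "'i \<Rightarrow> real \<times> 'e \<Rightarrow> real \<times> 'e \<Rightarrow> real \<times> 'e \<Rightarrow> real"
    and J Jinf :: "'i \<Rightarrow> real \<times> 'e \<Rightarrow> real \<times> 'e \<Rightarrow> real \<times> 'e"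
    and winf :: "'i \<Rightarrow> 'e \<Rightarrow> 'e \<Rightarrow> 'e \<Rightarrow> real"
    and u :: "complex \<Rightarrow> real \<times> 'v"
  assumes "closed_oriented_manifold (2 * n + 1) B I C"
    and "almost_complex_structure I (watlas C) J"
    and "induces_product_orientation n B I C J"
    and "riemannian_metric I (watlas C) g" and "translation_invariant I C g"
    and "asymptotically_cylindrical I C g J Jinf winf"
    and "morse_bott I C J winf"
    and "J_holomorphic I C J u"
    and "energy I C J winf u < \<infinity>"
    and "riemannian_metric I (watlas C) gW" and "translation_invariant I C gW"
  shows "(SUP z. ereal (gradient_norm I C gW u z)) < \<infinity>"
proof -
  interpret cyl_metric "2 * n + 1" B I C g J Jinf winf gW
    by (intro cyl_metric.intro asymp_cyl.intro cyl_metric_axioms.intro) fact+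
  \<comment> \<open>One set of constants for all base points, from compactness of V.\<close>
  obtain \<Lambda> \<delta> \<rho> where c: "\<Lambda> \<ge> 1" "\<delta> > 0" "\<rho> > 0" "\<And>p. good \<Lambda> \<delta> \<rho> p"
    by (rule good_uniform) (rule that; blast)
  interpret cyl_good "2 * n + 1" B I C g J Jinf winf gW \<Lambda> \<delta> \<rho>
    by (intro cyl_good.intro cyl_good_axioms.intro cyl_metric_axioms) (fact c)+
  show ?thesis by (rule gradient_norm_bounded) fact+
qed

end
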